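(* Let $k$ be a field, $Q$ a finite quiver without sinks, $A=kQ/J^2$ and $B=L_k(Q)^{\rm op}$. Then the dg $A$-$B$-bimodule $\mathcal{I}^{\bullet}$ (the injective Leavitt complex of $Q$) is right quasi-balanced. In particular, the dg endomorphism algebra $\mathrm{End}_A(\mathcal{I}^{\bullet})$ is quasi-isomorphic to the Leavitt path algebra $L_k(Q)$, where $L_k(Q)$ is naturally $\mathbb{Z}$-graded and viewed as a dg algebra with trivial differential.
   Context: Quivers and $A$. $k$ is a field and $Q=(Q_0,Q_1;s,t)$ is a finite quiver without sinks: $Q_0$ is a finite set of vertices, $Q_1$ a finite set of arrows, $s,t:Q_1\to Q_0$ give starting and terminating vertices, and every vertex is the start of at least one arrow. A path of length $n\geq 1$ is a sequence $p=\alpha_n\cdots\alpha_1$ of arrows with $t(\alpha_j)=s(\alpha_{j+1})$ for $1\le j\le n-1$; $l(p)=n$, $s(p)=s(\alpha_1)$, $t(p)=t(\alpha_n)$. Each vertex $i$ has a trivial path $e_i$ of length $0$ with $s(e_i)=t(e_i)=i$. In the path algebra $kQ$ the product $pq$ of paths is the concatenation (first $q$, then $p$) if $s(p)=t(q)$, and $0$ otherwise. $J$ is the two-sided ideal of $kQ$ generated by arrows; $A=kQ/J^2$ has $k$-basis $\{e_i\}_{i\in Q_0}\cup Q_1$ and is viewed as a dg algebra concentrated in degree zero. Special arrows and admissible pairs. For each vertex $i$ fix one arrow starting at $i$, called the special arrow starting at $i$. For a special arrow $\alpha$ put $S(\alpha)=\{\beta\in Q_1\mid s(\beta)=s(\alpha),\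 \beta\ne\alpha\}$. A pair $(p,q)$ of paths $p=\alpha_m\cdots\alpha_1$, $q=\beta_n\cdots\beta_1$ with $m,n\ge 1$ is admissible if $t(p)=t(q)$ and either $\alpha_m\ne\beta_n$, or $\alpha_m=\beta_n$ is not special; moreover for every path $r$ the pairs $(r,e_{t(r)})$ and $(e_{t(r)},r)$ are admissible. For $i\in Q_0$, $l\in\mathbb{Z}$ let $\mathbf{B}^l_i$ be the set of admissible pairs $(p,q)$ with $l(q)-l(p)=l$ and $s(q)=i$. Injective modules. $I_i=\mathrm{Hom}_k(e_iA,k)$ (a left $A$-module), with basis $\{e_i^{\sharp}\}\cup\{\alpha^{\sharp}\mid \alpha\in Q_1,\ t(\alpha)=i\}$ dual to the basis $\{e_i\}\cup\{\alpha\mid t(\alpha)=i\}$ of $e_iA$. For a set $X$ and module $M$, $M^{(X)}=\bigoplus_{x\in X}M\zeta_x$ is the coproduct of copies of $M$, $m\zeta_x$ being the element $m$ in the copy indexed by $x$. Truncations. For $p=\alpha_n\cdots\alpha_1$ with $n\ge2$: $\widehat{p}=\alpha_{n-1}\cdots\alpha_1$ and $\widetilde{p}=\alpha_n\cdots\alpha_2$; for an arrow $\alpha$: $\widehat{\alpha}=e_{s(\alpha)}$, $\widetilde{\alpha}=e_{t(\alpha)}$. Injective Leavitt complex. $\mathcal{I}^{\bullet}=(\mathcal{I}^l,\partial^l)_{l\in\mathbb{Z}}$ has $\mathcal{I}^l=\bigoplus_{i\in Q_0}I_i^{(\mathbf{B}^l_i)}$ and, for $i\in Q_0$, $(p,q)\in\mathbf{B}^l_i$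 and $\alpha\in Q_1$ with $t(\alpha)=i$: $\partial^l(e_i^{\sharp}\zeta_{(p,q)})=0$; $\partial^l(\alpha^{\sharp}\zeta_{(p,q)})=e_{s(\alpha)}^{\sharp}\zeta_{(\widehat{p},e_{s(\alpha)})}-\sum_{\beta\in S(\alpha)}e_{s(\alpha)}^{\sharp}\zeta_{(\beta\widehat{p},\beta)}$ if $q=e_i$, $p=\alpha\widehat{p}$ and $\alpha$ is special; and $\partial^l(\alpha^{\sharp}\zeta_{(p,q)})=e_{s(\alpha)}^{\sharp}\zeta_{(p,q\alpha)}$ otherwise. Leavitt path algebra. $L_k(Q)$ is the $k$-algebra generated by $\{e_i\mid i\in Q_0\}\cup\{\alpha\mid\alpha\in Q_1\}\cup\{\alpha^*\mid\alpha\in Q_1\}$ subject to: $e_ie_j=\delta_{i,j}e_i$; $e_{t(\alpha)}\alpha=\alpha e_{s(\alpha)}=\alpha$; $e_{s(\alpha)}\alpha^*=\alpha^*e_{t(\alpha)}=\alpha^*$; $\alpha\beta^*=\delta_{\alpha,\beta}e_{t(\alpha)}$; $\sum_{\{\alpha\in Q_1\mid s(\alpha)=i\}}\alpha^*\alpha=e_i$ for each $i\in Q_0$. Grading: $|e_i|=0$, $|\alpha|=1$, $|\alpha^*|=-1$. $B=L_k(Q)^{\rm op}$ is the usual opposite algebra, with product $a\circ b=ba$, graded by $B^n=L_k(Q)^n$, a dg algebra with trivial differential. Right $B$-action on $\mathcal{I}^{\bullet}$. For $x\zeta_{(p,q)}\in I_i\zeta_{(p,q)}$, $(p,q)\in\mathbf{B}^l_i$,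 $j\in Q_0$, $\alpha\in Q_1$: $x\zeta_{(p,q)}\cdot e_j=\delta_{j,s(p)}x\zeta_{(p,q)}$; $x\zeta_{(p,q)}\cdot\alpha=\delta_{\alpha,\alpha_1}x\zeta_{(\widetilde{p},q)}$ if $p=\widetilde{p}\alpha_1$ (with $\alpha_1\in Q_1$), and $=\delta_{s(\alpha),t(q)}x\zeta_{(e_{t(\alpha)},\alpha q)}$ if $l(p)=0$; $x\zeta_{(p,q)}\cdot\alpha^*=x\zeta_{(e_{s(\alpha)},\widehat{q})}-\sum_{\beta\in S(\alpha)}x\zeta_{(\beta,\beta\widehat{q})}$ if $l(p)=0$, $q=\alpha\widehat{q}$ and $\alpha$ is special, and $=\delta_{s(p),t(\alpha)}x\zeta_{(p\alpha,q)}$ otherwise. With this action $\mathcal{I}^{\bullet}$ is a dg $A$-$B$-bimodule (left dg $A$-module, right dg $B$-module, with commuting actions). Dg conventions. For a left dg $A$-module $M$, $\mathrm{End}_A(M)=\bigoplus_n\mathrm{End}_A(M)^n$, where degree-$n$ elements are $k$-linear maps $f$ with $f(M^i)\subseteq M^{i+n}$ and $f(a\cdot m)=(-1)^{n|a|}a\cdot f(m)$; differential $f\mapsto d_M\circ f-(-1)^nf\circ d_M$; multiplication is composition. For a dg algebra $R$, $R^{\rm opp}$ is the dg algebra with the same graded space and differential and product $a\circ b=(-1)^{|a||b|}ba$. A dg $A$-$B$-bimodule $M$ is right quasi-balanced if the canonical homomorphism of dg algebras $B\to\mathrm{End}_A(M)^{\rm opp}$, $b\mapsto r_b$, $r_b(m)=(-1)^{|b||m|}m\cdot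 b$ (homogeneous $b,m$), is a quasi-isomorphism. *)

theory Defs
  imports
    "HOL-Algebra.Ideal_Product"
    "HOL-Algebra.QuotRing"
    "HOL-Algebra.Module"
    "HOL-Library.Poly_Mapping"
    "HOL-Library.Function_Algebras"
    "Graph_Theory.Arc_Walk"
begin

section \<open>Dg algebras and dg bimodules over a field\<close>

text \<open>
  The ground field is a type of class \<^class>\<open>field\<close>; everything else is carrier based, in the style
  of \<open>HOL-Algebra\<close>. The fields \<open>mult\<close> and \<open>one\<close>, which the record of modules inherits from that of
  rings, are meaningful for algebras only.
\<close>

definition field_ring :: "'k::field ring" where
  "field_ring = \<lparr>carrier = UNIV, mult = (*), one = 1, zero = 0, add = (+)\<rparr>"

record ('k, 'm) graded_space = "('k, 'm) module" +
  hcomp :: "int \<Rightarrow> 'm set"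

record ('k, 'm) dg_space = "('k, 'm) graded_space" +
  diff :: "'m \<Rightarrow> 'm"

record ('k, 'a, 'b, 'm) dg_bimod = "('k, 'm) dg_space" +
  lact :: "'a \<Rightarrow> 'm \<Rightarrow> 'm"
  ract :: "'m \<Rightarrow> 'b \<Rightarrow> 'm"

definition klinear ::
  "('k::field, 'm, 'x) module_scheme \<Rightarrow> ('k, 'n, 'y) module_scheme \<Rightarrow> ('m \<Rightarrow> 'n) \<Rightarrow> bool" where
  "klinear V W f \<longleftrightarrow> f \<in> carrier V \<rightarrow> carrier W \<and>
     (\<forall>x\<in>carrier V. \<forall>y\<in>carrier V. f (x \<oplus>\<^bsub>V\<^esub> y) = f x \<oplus>\<^bsub>W\<^esub> f y) \<and>
     (\<forall>c. \<forall>x\<in>carrier V. f (c \<odot>\<^bsub>V\<^esub> x) = c \<odot>\<^bsub>W\<^esub> f x)"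

definition hdecomp :: "('k, 'm, 'x) graded_space_scheme \<Rightarrow> 'm \<Rightarrow> (int \<Rightarrow> 'm) \<Rightarrow> bool" where
  "hdecomp V x f \<longleftrightarrow> (\<forall>n. f n \<in> hcomp V n) \<and> finite {n. f n \<noteq> \<zero>\<^bsub>V\<^esub>} \<and>
     x = (\<Oplus>\<^bsub>V\<^esub>n\<in>{n. f n \<noteq> \<zero>\<^bsub>V\<^esub>}. f n)"

definition hpart :: "('k, 'm, 'x) graded_space_scheme \<Rightarrow> 'm \<Rightarrow> int \<Rightarrow> 'm" where
  "hpart V x = (THE f. hdecomp V x f)"

definition hsupp :: "('k, 'm, 'x) graded_space_scheme \<Rightarrow> 'm \<Rightarrow> int set" where
  "hsupp V x = {n. hpart V x n \<noteq> \<zero>\<^bsub>V\<^esub>}"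

definition is_graded :: "('k::field, 'm, 'x) graded_space_scheme \<Rightarrow> bool" where
  "is_graded V \<longleftrightarrow> Module.module field_ring V \<and>
     (\<forall>n. submodule (hcomp V n) field_ring V) \<and>
     (\<forall>x\<in>carrier V. \<exists>!f. hdecomp V x f)"

definition is_complex :: "('k::field, 'm, 'x) dg_space_scheme \<Rightarrow> bool" where
  "is_complex V \<longleftrightarrow> is_graded V \<and> klinear V V (diff V) \<and>
     (\<forall>n. diff V ` hcomp V n \<subseteq> hcomp V (n + 1)) \<and>
     (\<forall>x\<in>carrier V. diff V (diff V x) = \<zero>\<^bsub>V\<^esub>)"

definition dg_algebra :: "('k::field, 'a, 'x) dg_space_scheme \<Rightarrow> bool" where
  "dg_algebra R \<longleftrightarrow> is_complex R \<and> ring R \<and>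
     (\<forall>c. \<forall>x\<in>carrier R. \<forall>y\<in>carrier R.
        c \<odot>\<^bsub>R\<^esub> (x \<otimes>\<^bsub>R\<^esub> y) = (c \<odot>\<^bsub>R\<^esub> x) \<otimes>\<^bsub>R\<^esub> y \<and> c \<odot>\<^bsub>R\<^esub> (x \<otimes>\<^bsub>R\<^esub> y) = x \<otimes>\<^bsub>R\<^esub> (c \<odot>\<^bsub>R\<^esub> y)) \<and>
     \<one>\<^bsub>R\<^esub> \<in> hcomp R 0 \<and>
     (\<forall>m n. \<forall>x\<in>hcomp R m. \<forall>y\<in>hcomp R n. x \<otimes>\<^bsub>R\<^esub> y \<in> hcomp R (m + n)) \<and>
     (\<forall>n. \<forall>x\<in>hcomp R n. \<forall>y\<in>carrier R.
        diff R (x \<otimes>\<^bsub>R\<^esub> y) = (diff R x \<otimes>\<^bsub>R\<^esub> y) \<oplus>\<^bsub>R\<^esub> ((- 1) powi n \<odot>\<^bsub>R\<^esub> (x \<otimes>\<^bsub>R\<^esub> diff R y)))"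

definition left_dg_module ::
  "('k::field, 'a, 'x) dg_space_scheme \<Rightarrow> ('k, 'm, 'y) dg_space_scheme \<Rightarrow> ('a \<Rightarrow> 'm \<Rightarrow> 'm) \<Rightarrow> bool" where
  "left_dg_module A M act \<longleftrightarrow> dg_algebra A \<and> is_complex M \<and>
     (\<forall>a\<in>carrier A. klinear M M (act a)) \<and>
     (\<forall>m\<in>carrier M. klinear A M (\<lambda>a. act a m)) \<and>
     (\<forall>m\<in>carrier M. act \<one>\<^bsub>A\<^esub> m = m) \<and>
     (\<forall>a\<in>carrier A. \<forall>b\<in>carrier A. \<forall>m\<in>carrier M. act (a \<otimes>\<^bsub>A\<^esub> b) m = act a (act b m)) \<and>
     (\<forall>i j. \<forall>a\<in>hcomp A i. \<forall>m\<in>hcomp M j. act a m \<in> hcomp M (i + j)) \<and>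
     (\<forall>i. \<forall>a\<in>hcomp A i. \<forall>m\<in>carrier M.
        diff M (act a m) = act (diff A a) m \<oplus>\<^bsub>M\<^esub> ((- 1) powi i \<odot>\<^bsub>M\<^esub> act a (diff M m)))"

definition right_dg_module ::
  "('k::field, 'b, 'x) dg_space_scheme \<Rightarrow> ('k, 'm, 'y) dg_space_scheme \<Rightarrow> ('m \<Rightarrow> 'b \<Rightarrow> 'm) \<Rightarrow> bool" where
  "right_dg_module B M act \<longleftrightarrow> dg_algebra B \<and> is_complex M \<and>
     (\<forall>b\<in>carrier B. klinear M M (\<lambda>m. act m b)) \<and>
     (\<forall>m\<in>carrier M. klinear B M (act m)) \<and>
     (\<forall>m\<in>carrier M. act m \<one>\<^bsub>B\<^esub> = m) \<and>
     (\<forall>a\<in>carrier B. \<forall>b\<in>carrier B. \<forall>m\<in>carrier M. act m (a \<otimes>\<^bsub>B\<^esub> b) = act (act m a) b) \<and>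
     (\<forall>i j. \<forall>m\<in>hcomp M i. \<forall>b\<in>hcomp B j. act m b \<in> hcomp M (i + j)) \<and>
     (\<forall>i. \<forall>m\<in>hcomp M i. \<forall>b\<in>carrier B.
        diff M (act m b) = act (diff M m) b \<oplus>\<^bsub>M\<^esub> ((- 1) powi i \<odot>\<^bsub>M\<^esub> act m (diff B b)))"

definition dg_bimodule ::
  "('k::field, 'a, 'x) dg_space_scheme \<Rightarrow> ('k, 'b, 'y) dg_space_scheme \<Rightarrow>
   ('k, 'a, 'b, 'm) dg_bimod \<Rightarrow> bool" where
  "dg_bimodule A B M \<longleftrightarrow> left_dg_module A M (lact M) \<and> right_dg_module B M (ract M) \<and>
     (\<forall>a\<in>carrier A. \<forall>m\<in>carrier M. \<forall>b\<in>carrier B.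
        ract M (lact M a m) b = lact M a (ract M m b))"


subsection \<open>Quasi-isomorphisms\<close>

definition cocycles :: "('k, 'm, 'x) dg_space_scheme \<Rightarrow> int \<Rightarrow> 'm set" where
  "cocycles V n = {x \<in> hcomp V n. diff V x = \<zero>\<^bsub>V\<^esub>}"

definition coboundaries :: "('k, 'm, 'x) dg_space_scheme \<Rightarrow> int \<Rightarrow> 'm set" where
  "coboundaries V n = diff V ` hcomp V (n - 1)"

definition cohomology :: "('k, 'm, 'x) dg_space_scheme \<Rightarrow> int \<Rightarrow> 'm set set" where
  "cohomology V n = (\<lambda>x. coboundaries V n +>\<^bsub>V\<^esub> x) ` cocycles V n"

definition cohomology_map ::
  "('k, 'n, 'y) dg_space_scheme \<Rightarrow> ('m \<Rightarrow> 'n) \<Rightarrow> int \<Rightarrow> 'm set \<Rightarrow> 'n set" where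
  "cohomology_map W f n X = (\<Union>x\<in>X. coboundaries W n +>\<^bsub>W\<^esub> f x)"

definition dg_algebra_hom ::
  "('k::field, 'a, 'x) dg_space_scheme \<Rightarrow> ('k, 'b, 'y) dg_space_scheme \<Rightarrow> ('a \<Rightarrow> 'b) \<Rightarrow> bool" where
  "dg_algebra_hom R S f \<longleftrightarrow> dg_algebra R \<and> dg_algebra S \<and> f \<in> ring_hom R S \<and> klinear R S f \<and>
     (\<forall>n. f ` hcomp R n \<subseteq> hcomp S n) \<and> (\<forall>x\<in>carrier R. f (diff R x) = diff S (f x))"

definition quasi_isomorphism ::
  "('k::field, 'a, 'x) dg_space_scheme \<Rightarrow> ('k, 'b, 'y) dg_space_scheme \<Rightarrow> ('a \<Rightarrow> 'b) \<Rightarrow> bool" where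
  "quasi_isomorphism R S f \<longleftrightarrow> dg_algebra_hom R S f \<and>
     (\<forall>n. bij_betw (cohomology_map S f n) (cohomology R n) (cohomology S n))"

definition qiso_step ::
  "('k::field, 'a, 'x) dg_space_scheme \<Rightarrow> ('k, 'b, 'y) dg_space_scheme \<Rightarrow> bool" where
  "qiso_step R S \<longleftrightarrow> (\<exists>f. quasi_isomorphism R S f)"

text \<open>
  Two dg algebras are quasi-isomorphic if a zigzag of quasi-isomorphisms joins them. As HOL does not
  quantify over types, the intermediate algebras of the zigzag have the element type of one of its
  two ends.
\<close>

definition quasi_isomorphic ::
  "('k::field, 'a) dg_space \<Rightarrow> ('k, 'b) dg_space \<Rightarrow> bool" where
  "quasi_isomorphic R S \<longleftrightarrow> (\<exists>R' S'. equivclp qiso_step R R' \<and>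
     (qiso_step R' S' \<or> qiso_step S' R') \<and> equivclp qiso_step S' S)"


subsection \<open>Opposite algebras and endomorphism algebras\<close>

definition op_algebra :: "('k, 'a, 'x) dg_space_scheme \<Rightarrow> ('k, 'a, 'x) dg_space_scheme" where
  "op_algebra R = R\<lparr>mult := \<lambda>a b. b \<otimes>\<^bsub>R\<^esub> a\<rparr>"

text \<open>
  Rules with signs, which are given for homogeneous elements, are extended by splitting an element
  into its homogeneous parts.
\<close>

definition opp_dg_algebra ::
  "('k::field, 'a, 'x) dg_space_scheme \<Rightarrow> ('k, 'a, 'x) dg_space_scheme" where
  "opp_dg_algebra R = R\<lparr>mult := \<lambda>a b. \<Oplus>\<^bsub>R\<^esub>i\<in>hsupp R a. \<Oplus>\<^bsub>R\<^esub>j\<in>hsupp R b.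
     (- 1) powi (i * j) \<odot>\<^bsub>R\<^esub> (hpart R b j \<otimes>\<^bsub>R\<^esub> hpart R a i)\<rparr>"

definition End_deg ::
  "('k::field, 'a, 'x) dg_space_scheme \<Rightarrow> ('k, 'a, 'b, 'm) dg_bimod \<Rightarrow> int \<Rightarrow> ('m \<Rightarrow> 'm) set" where
  "End_deg A M n = {f \<in> extensional (carrier M). klinear M M f \<and>
     (\<forall>i. f ` hcomp M i \<subseteq> hcomp M (i + n)) \<and>
     (\<forall>i. \<forall>a\<in>hcomp A i. \<forall>m\<in>carrier M. f (lact M a m) = (- 1) powi (n * i) \<odot>\<^bsub>M\<^esub> lact M a (f m))}"

text \<open>
  The direct sum of the spaces \<^const>\<open>End_deg\<close> is formed inside the space of all linear
  endomorphisms.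
\<close>

definition End_graded ::
  "('k::field, 'a, 'x) dg_space_scheme \<Rightarrow> ('k, 'a, 'b, 'm) dg_bimod \<Rightarrow> ('k, 'm \<Rightarrow> 'm) graded_space" where
  "End_graded A M = \<lparr>
     carrier = {\<lambda>m\<in>carrier M. \<Oplus>\<^bsub>M\<^esub>n\<in>N. F n m | N F. finite N \<and> (\<forall>n\<in>N. F n \<in> End_deg A M n)},
     mult = compose (carrier M),
     one = \<lambda>m\<in>carrier M. m,
     zero = \<lambda>m\<in>carrier M. \<zero>\<^bsub>M\<^esub>,
     add = \<lambda>f g. \<lambda>m\<in>carrier M. f m \<oplus>\<^bsub>M\<^esub> g m,
     smult = \<lambda>c f. \<lambda>m\<in>carrier M. c \<odot>\<^bsub>M\<^esub> f m,
     hcomp = End_deg A M\<rparr>"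

definition dg_End ::
  "('k::field, 'a, 'x) dg_space_scheme \<Rightarrow> ('k, 'a, 'b, 'm) dg_bimod \<Rightarrow> ('k, 'm \<Rightarrow> 'm) dg_space" where
  "dg_End A M = graded_space.extend (End_graded A M) (dg_space.fields
     (\<lambda>f. \<lambda>m\<in>carrier M. diff M (f m) \<ominus>\<^bsub>M\<^esub>
        (\<Oplus>\<^bsub>M\<^esub>n\<in>hsupp (End_graded A M) f. (- 1) powi n \<odot>\<^bsub>M\<^esub> hpart (End_graded A M) f n (diff M m))))"

definition right_mult ::
  "('k::field, 'b, 'y) dg_space_scheme \<Rightarrow> ('k, 'a, 'b, 'm) dg_bimod \<Rightarrow> 'b \<Rightarrow> 'm \<Rightarrow> 'm" where
  "right_mult B M b = (\<lambda>m\<in>carrier M. \<Oplus>\<^bsub>M\<^esub>i\<in>hsupp B b. \<Oplus>\<^bsub>M\<^esub>j\<in>hsupp M m.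
     (- 1) powi (i * j) \<odot>\<^bsub>M\<^esub> ract M (hpart M m j) (hpart B b i))"

definition right_quasi_balanced ::
  "('k::field, 'a, 'x) dg_space_scheme \<Rightarrow> ('k, 'b, 'y) dg_space_scheme \<Rightarrow>
   ('k, 'a, 'b, 'm) dg_bimod \<Rightarrow> bool" where
  "right_quasi_balanced A B M \<longleftrightarrow> dg_bimodule A B M \<and>
     quasi_isomorphism B (opp_dg_algebra (dg_End A M)) (right_mult B M)"


section \<open>Algebras with a basis, and quotients\<close>

text \<open>The basis elements are multiplied by \<open>m\<close>; \<^const>\<open>None\<close> stands for the product zero.\<close>

definition basis_algebra ::
  "'b set \<Rightarrow> ('b \<Rightarrow> 'b \<Rightarrow> 'b option) \<Rightarrow> 'b set \<Rightarrow> ('k::field, 'b \<Rightarrow>\<^sub>0 'k) module" where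
  "basis_algebra X m U = \<lparr>
     carrier = {f. Poly_Mapping.keys f \<subseteq> X},
     mult = \<lambda>f g. \<Sum>u\<in>Poly_Mapping.keys f. \<Sum>v\<in>Poly_Mapping.keys g. case m u v of
        None \<Rightarrow> 0 | Some w \<Rightarrow> Poly_Mapping.single w (Poly_Mapping.lookup f u * Poly_Mapping.lookup g v),
     one = \<Sum>u\<in>U. Poly_Mapping.single u 1,
     zero = 0,
     add = (+),
     smult = \<lambda>c. Poly_Mapping.map ((*) c)\<rparr>"

definition quot_algebra :: "('k::field, 'a) module \<Rightarrow> 'a set \<Rightarrow> ('k, 'a set) module" where
  "quot_algebra R I = ring.extend (R Quot I) (module.fields (\<lambda>c X. \<Union>x\<in>X. I +>\<^bsub>R\<^esub> (c \<odot>\<^bsub>R\<^esub> x)))"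

definition trivial_dg :: "('k, 'a) module \<Rightarrow> (int \<Rightarrow> 'a set) \<Rightarrow> ('k, 'a) dg_space" where
  "trivial_dg R C = module.extend R \<lparr>hcomp = C, diff = (\<lambda>_. \<zero>\<^bsub>R\<^esub>)\<rparr>"


section \<open>Quivers\<close>

text \<open>
  A quiver is a \<^typ>\<open>('v, 'e) pre_digraph\<close>: \<open>tail\<close> and \<open>head\<close> are the maps \<open>s\<close> and \<open>t\<close>. The path
  \<open>\<alpha>\<^sub>n \<cdots> \<alpha>\<^sub>1\<close> is its starting vertex together with the list \<open>[\<alpha>\<^sub>1, \<dots>, \<alpha>\<^sub>n]\<close>, so lists are in the
  order of traversal and hence in the reverse of the order of multiplication.
\<close>

type_synonym ('v, 'e) path = "'v \<times> 'e list"

context pre_digraph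
begin

definition src :: "('a, 'b) path \<Rightarrow> 'a" where
  "src p = fst p"

definition tgt :: "('a, 'b) path \<Rightarrow> 'a" where
  "tgt p = awlast (fst p) (snd p)"

definition plen :: "('a, 'b) path \<Rightarrow> nat" where
  "plen p = length (snd p)"

definition paths :: "('a, 'b) path set" where
  "paths = {p. awalk (src p) (snd p) (tgt p)}"

definition triv :: "'a \<Rightarrow> ('a, 'b) path" where
  "triv i = (i, [])"

definition arr :: "'b \<Rightarrow> ('a, 'b) path" where
  "arr \<alpha> = (tail G \<alpha>, [\<alpha>])"

text \<open>The path \<open>pq\<close>: first \<open>q\<close>, then \<open>p\<close>.\<close>

definition pcat :: "('a, 'b) path \<Rightarrow> ('a, 'b) path \<Rightarrow> ('a, 'b) path" where
  "pcat p q = (src q, snd q @ snd p)"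

definition last_arrow :: "('a, 'b) path \<Rightarrow> 'b" where
  "last_arrow p = last (snd p)"

definition first_arrow :: "('a, 'b) path \<Rightarrow> 'b" where
  "first_arrow p = hd (snd p)"

text \<open>\<open>phat\<close> removes the last arrow \<open>\<alpha>\<^sub>n\<close> of a path, \<open>ptilde\<close> its first arrow \<open>\<alpha>\<^sub>1\<close>.\<close>

definition phat :: "('a, 'b) path \<Rightarrow> ('a, 'b) path" where
  "phat p = (src p, butlast (snd p))"

definition ptilde :: "('a, 'b) path \<Rightarrow> ('a, 'b) path" where
  "ptilde p = (head G (first_arrow p), tl (snd p))"


subsection \<open>The algebra \<open>kQ/J\<^sup>2\<close> and its injective modules\<close>

definition path_algebra :: "('k::field, ('a, 'b) path \<Rightarrow>\<^sub>0 'k) module" where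
  "path_algebra = basis_algebra paths
     (\<lambda>p q. if src p = tgt q then Some (pcat p q) else None) (triv ` verts G)"

definition arrow_ideal :: "(('a, 'b) path \<Rightarrow>\<^sub>0 'k::field) set" where
  "arrow_ideal = Idl\<^bsub>path_algebra\<^esub> ((\<lambda>\<alpha>. Poly_Mapping.single (arr \<alpha>) 1) ` arcs G)"

definition arrow_ideal_sq :: "(('a, 'b) path \<Rightarrow>\<^sub>0 'k::field) set" where
  "arrow_ideal_sq = arrow_ideal \<cdot>\<^bsub>path_algebra\<^esub> arrow_ideal"

definition rad_sq_zero_algebra :: "('k::field, (('a, 'b) path \<Rightarrow>\<^sub>0 'k) set) dg_space" where
  "rad_sq_zero_algebra = (let A = quot_algebra path_algebra arrow_ideal_sq in
     trivial_dg A (\<lambda>n. if n = 0 then carrier A else {\<zero>\<^bsub>A\<^esub>}))"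

definition path_class :: "('a, 'b) path \<Rightarrow> (('a, 'b) path \<Rightarrow>\<^sub>0 'k::field) set" where
  "path_class p = arrow_ideal_sq +>\<^bsub>path_algebra\<^esub> Poly_Mapping.single p 1"

definition eA :: "'a \<Rightarrow> (('a, 'b) path \<Rightarrow>\<^sub>0 'k::field) set set" where
  "eA i = (\<lambda>x. path_class (triv i) \<otimes>\<^bsub>rad_sq_zero_algebra\<^esub> x) ` carrier rad_sq_zero_algebra"

text \<open>\<open>Hom\<^sub>k(e\<^sub>iA, k)\<close>; its elements are extended by zero outside \<open>e\<^sub>iA\<close>.\<close>

definition inj_module :: "'a \<Rightarrow> ((('a, 'b) path \<Rightarrow>\<^sub>0 'k::field) set \<Rightarrow> 'k) set" where
  "inj_module i = {\<phi>. (\<forall>x. x \<notin> eA i \<longrightarrow> \<phi> x = 0) \<and>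
     (\<forall>x\<in>eA i. \<forall>y\<in>eA i. \<phi> (x \<oplus>\<^bsub>rad_sq_zero_algebra\<^esub> y) = \<phi> x + \<phi> y) \<and>
     (\<forall>c. \<forall>x\<in>eA i. \<phi> (c \<odot>\<^bsub>rad_sq_zero_algebra\<^esub> x) = c * \<phi> x)}"

text \<open>The element \<open>e\<^sub>i\<^sup>\<sharp>\<close> of the basis dual to \<open>e\<^sub>i\<close> and the arrows ending at \<open>i\<close>.\<close>

definition vertex_sharp :: "'a \<Rightarrow> (('a, 'b) path \<Rightarrow>\<^sub>0 'k::field) set \<Rightarrow> 'k" where
  "vertex_sharp i = (THE \<phi>. \<phi> \<in> inj_module i \<and> \<phi> (path_class (triv i)) = 1 \<and>
     (\<forall>\<alpha>\<in>in_arcs G i. \<phi> (path_class (arr \<alpha>)) = 0))"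

end


subsection \<open>The Leavitt path algebra\<close>

datatype ('v, 'e) leavitt_gen = Vtx 'v | Arr 'e | Ghost 'e

primrec gen_degree :: "('v, 'e) leavitt_gen \<Rightarrow> int" where
  "gen_degree (Vtx i) = 0"
| "gen_degree (Arr \<alpha>) = 1"
| "gen_degree (Ghost \<alpha>) = - 1"

abbreviation mono_word :: "'b list \<Rightarrow> 'b list \<Rightarrow>\<^sub>0 'k::field" where
  "mono_word w \<equiv> Poly_Mapping.single w 1"

context pre_digraph
begin

definition leavitt_gens :: "('a, 'b) leavitt_gen set" where
  "leavitt_gens = Vtx ` verts G \<union> Arr ` arcs G \<union> Ghost ` arcs G"

definition leavitt_free_algebra :: "('k::field, ('a, 'b) leavitt_gen list \<Rightarrow>\<^sub>0 'k) module" where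
  "leavitt_free_algebra = basis_algebra (lists leavitt_gens) (\<lambda>u v. Some (u @ v)) {[]}"

text \<open>
  The unit of the Leavitt path algebra is the sum of the \<open>e\<^sub>i\<close>: its presentation by generators and
  relations is one of non-unital algebras. The free algebra here is unital, hence the last relation.
\<close>

definition leavitt_relations :: "(('a, 'b) leavitt_gen list \<Rightarrow>\<^sub>0 'k::field) set" where
  "leavitt_relations =
     {mono_word [Vtx i, Vtx j] - (if i = j then mono_word [Vtx i] else 0) | i j. i \<in> verts G \<and> j \<in> verts G}
   \<union> {mono_word [Vtx (head G \<alpha>), Arr \<alpha>] - mono_word [Arr \<alpha>] | \<alpha>. \<alpha> \<in> arcs G}
   \<union> {mono_word [Arr \<alpha>, Vtx (tail G \<alpha>)] - mono_word [Arr \<alpha>] | \<alpha>. \<alpha> \<in> arcs G}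
   \<union> {mono_word [Vtx (tail G \<alpha>), Ghost \<alpha>] - mono_word [Ghost \<alpha>] | \<alpha>. \<alpha> \<in> arcs G}
   \<union> {mono_word [Ghost \<alpha>, Vtx (head G \<alpha>)] - mono_word [Ghost \<alpha>] | \<alpha>. \<alpha> \<in> arcs G}
   \<union> {mono_word [Arr \<alpha>, Ghost \<beta>] - (if \<alpha> = \<beta> then mono_word [Vtx (head G \<alpha>)] else 0) | \<alpha> \<beta>.
        \<alpha> \<in> arcs G \<and> \<beta> \<in> arcs G}
   \<union> {(\<Sum>\<alpha>\<in>out_arcs G i. mono_word [Ghost \<alpha>, Arr \<alpha>]) - mono_word [Vtx i] | i. i \<in> verts G}
   \<union> {(\<Sum>i\<in>verts G. mono_word [Vtx i]) - mono_word []}"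

definition leavitt_ideal :: "(('a, 'b) leavitt_gen list \<Rightarrow>\<^sub>0 'k::field) set" where
  "leavitt_ideal = Idl\<^bsub>leavitt_free_algebra\<^esub> leavitt_relations"

definition leavitt_path_algebra ::
  "('k::field, (('a, 'b) leavitt_gen list \<Rightarrow>\<^sub>0 'k) set) dg_space" where
  "leavitt_path_algebra = trivial_dg (quot_algebra leavitt_free_algebra leavitt_ideal)
     (\<lambda>n. {leavitt_ideal +>\<^bsub>leavitt_free_algebra\<^esub> f | f. f \<in> carrier leavitt_free_algebra \<and>
        (\<forall>w\<in>Poly_Mapping.keys f. sum_list (map gen_degree w) = n)})"

end


section \<open>The injective Leavitt complex\<close>

text \<open>
  An element of the total space assigns to finitely many pairs \<open>(p, q)\<close> an element of \<open>I\<^sub>s\<^sub>(\<^sub>q\<^sub>)\<close>;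
  the summand \<open>x\<zeta>\<close> at \<open>(p, q)\<close> is \<open>zeta x p q\<close>. The argument \<open>sp\<close> below chooses for each vertex
  the special arrow starting at it.
\<close>

type_synonym ('v, 'e, 'k) inj_leavitt =
  "(('v, 'e) path \<times> ('v, 'e) path) \<Rightarrow>\<^sub>0 ((('v, 'e) path \<Rightarrow>\<^sub>0 'k) set \<Rightarrow> 'k)"

definition zeta :: "((('v, 'e) path \<Rightarrow>\<^sub>0 'k) set \<Rightarrow> 'k) \<Rightarrow> ('v, 'e) path \<Rightarrow> ('v, 'e) path \<Rightarrow>
    ('v, 'e, 'k::field) inj_leavitt" where
  "zeta x p q = Poly_Mapping.single (p, q) x"

definition inj_scale :: "'k \<Rightarrow> ('v, 'e, 'k::field) inj_leavitt \<Rightarrow> ('v, 'e, 'k) inj_leavitt" where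
  "inj_scale c = Poly_Mapping.map (\<lambda>x y. c * x y)"

context pre_digraph
begin

definition special :: "('a \<Rightarrow> 'b) \<Rightarrow> 'b \<Rightarrow> bool" where
  "special sp \<alpha> \<longleftrightarrow> \<alpha> = sp (tail G \<alpha>)"

definition siblings :: "'b \<Rightarrow> 'b set" where
  "siblings \<alpha> = {\<beta> \<in> arcs G. tail G \<beta> = tail G \<alpha> \<and> \<beta> \<noteq> \<alpha>}"

definition admissible :: "('a \<Rightarrow> 'b) \<Rightarrow> ('a, 'b) path \<Rightarrow> ('a, 'b) path \<Rightarrow> bool" where
  "admissible sp p q \<longleftrightarrow> p \<in> paths \<and> q \<in> paths \<and>
     (plen p \<ge> 1 \<and> plen q \<ge> 1 \<and> tgt p = tgt q \<and>
        (last_arrow p \<noteq> last_arrow q \<or> last_arrow p = last_arrow q \<and> \<not> special sp (last_arrow p)) \<or>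
      q = triv (tgt p) \<or> p = triv (tgt q))"

definition inj_leavitt_total :: "('a \<Rightarrow> 'b) \<Rightarrow> ('a, 'b, 'k::field) inj_leavitt set" where
  "inj_leavitt_total sp =
     {m. \<forall>(p, q)\<in>Poly_Mapping.keys m. admissible sp p q \<and> Poly_Mapping.lookup m (p, q) \<in> inj_module (src q)}"

definition inj_leavitt_deg :: "('a \<Rightarrow> 'b) \<Rightarrow> int \<Rightarrow> ('a, 'b, 'k::field) inj_leavitt set" where
  "inj_leavitt_deg sp l =
     {m \<in> inj_leavitt_total sp. \<forall>(p, q)\<in>Poly_Mapping.keys m. int (plen q) - int (plen p) = l}"

text \<open>\<open>diff_arrow sp \<alpha> p q\<close> is the value of the differential at \<open>\<alpha>\<^sup>\<sharp>\<zeta>\<close>, the index being \<open>(p, q)\<close>.\<close>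

definition diff_arrow ::
  "('a \<Rightarrow> 'b) \<Rightarrow> 'b \<Rightarrow> ('a, 'b) path \<Rightarrow> ('a, 'b) path \<Rightarrow> ('a, 'b, 'k::field) inj_leavitt" where
  "diff_arrow sp \<alpha> p q = (let e = vertex_sharp (tail G \<alpha>) in
     if plen q = 0 \<and> plen p \<ge> 1 \<and> last_arrow p = \<alpha> \<and> special sp \<alpha>
     then zeta e (phat p) (triv (tail G \<alpha>)) - (\<Sum>\<beta>\<in>siblings \<alpha>. zeta e (pcat (arr \<beta>) (phat p)) (arr \<beta>))
     else zeta e p (pcat q (arr \<alpha>)))"

text \<open>
  The coordinates of \<open>x\<close> in the dual basis are its values at \<open>e\<^sub>i\<close> and the arrows ending at \<open>i\<close>. The
  coordinate at \<open>e\<^sub>i\<close> does not occur, as the differential vanishes at \<open>e\<^sub>i\<^sup>\<sharp>\<zeta>\<close>.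
\<close>

definition inj_leavitt_diff ::
  "('a \<Rightarrow> 'b) \<Rightarrow> ('a, 'b, 'k::field) inj_leavitt \<Rightarrow> ('a, 'b, 'k) inj_leavitt" where
  "inj_leavitt_diff sp m = (\<Sum>(p, q)\<in>Poly_Mapping.keys m. \<Sum>\<alpha>\<in>in_arcs G (src q).
     inj_scale (Poly_Mapping.lookup m (p, q) (path_class (arr \<alpha>))) (diff_arrow sp \<alpha> p q))"

text \<open>An element \<open>a\<close> of \<open>A\<close> sends \<open>x\<close> in \<open>Hom\<^sub>k(e\<^sub>iA, k)\<close> to the map taking \<open>y\<close> to \<open>x(ya)\<close>.\<close>

definition inj_leavitt_lact ::
  "(('a, 'b) path \<Rightarrow>\<^sub>0 'k::field) set \<Rightarrow> ('a, 'b, 'k) inj_leavitt \<Rightarrow> ('a, 'b, 'k) inj_leavitt" where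
  "inj_leavitt_lact a m = (\<Sum>(p, q)\<in>Poly_Mapping.keys m.
     zeta (\<lambda>y. if y \<in> eA (src q) then Poly_Mapping.lookup m (p, q) (y \<otimes>\<^bsub>rad_sq_zero_algebra\<^esub> a) else 0) p q)"

fun gen_ract :: "('a \<Rightarrow> 'b) \<Rightarrow> ('a, 'b) leavitt_gen \<Rightarrow> ((('a, 'b) path \<Rightarrow>\<^sub>0 'k) set \<Rightarrow> 'k) \<Rightarrow>
    ('a, 'b) path \<Rightarrow> ('a, 'b) path \<Rightarrow> ('a, 'b, 'k::field) inj_leavitt" where
  "gen_ract sp (Vtx j) x p q = (if j = src p then zeta x p q else 0)"
| "gen_ract sp (Arr \<alpha>) x p q =
    (if plen p \<ge> 1
     then (if \<alpha> = first_arrow p then zeta x (ptilde p) q else 0)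
     else (if tail G \<alpha> = tgt q then zeta x (triv (head G \<alpha>)) (pcat (arr \<alpha>) q) else 0))"
| "gen_ract sp (Ghost \<alpha>) x p q =
    (if plen p = 0 \<and> plen q \<ge> 1 \<and> last_arrow q = \<alpha> \<and> special sp \<alpha>
     then zeta x (triv (tail G \<alpha>)) (phat q) - (\<Sum>\<beta>\<in>siblings \<alpha>. zeta x (arr \<beta>) (pcat (arr \<beta>) (phat q)))
     else (if src p = head G \<alpha> then zeta x (pcat p (arr \<alpha>)) q else 0))"

definition gen_act ::
  "('a \<Rightarrow> 'b) \<Rightarrow> ('a, 'b) leavitt_gen \<Rightarrow> ('a, 'b, 'k::field) inj_leavitt \<Rightarrow> ('a, 'b, 'k) inj_leavitt" where
  "gen_act sp g m = (\<Sum>(p, q)\<in>Poly_Mapping.keys m. gen_ract sp g (Poly_Mapping.lookup m (p, q)) p q)"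

text \<open>
  For the opposite algebra the product \<open>g\<^sub>1 \<cdots> g\<^sub>n\<close> in the Leavitt path algebra acts from the right by
  \<open>g\<^sub>n\<close> first and by \<open>g\<^sub>1\<close> last. A residue class acts as any of its representatives.
\<close>

definition free_ract :: "('a \<Rightarrow> 'b) \<Rightarrow> ('a, 'b, 'k::field) inj_leavitt \<Rightarrow>
    (('a, 'b) leavitt_gen list \<Rightarrow>\<^sub>0 'k) \<Rightarrow> ('a, 'b, 'k) inj_leavitt" where
  "free_ract sp m f = (\<Sum>w\<in>Poly_Mapping.keys f. inj_scale (Poly_Mapping.lookup f w) (foldr (gen_act sp) w m))"

definition inj_leavitt_ract :: "('a \<Rightarrow> 'b) \<Rightarrow> ('a, 'b, 'k::field) inj_leavitt \<Rightarrow>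
    (('a, 'b) leavitt_gen list \<Rightarrow>\<^sub>0 'k) set \<Rightarrow> ('a, 'b, 'k) inj_leavitt" where
  "inj_leavitt_ract sp m b = free_ract sp m (SOME f. f \<in> b)"

definition injective_leavitt_complex :: "('a \<Rightarrow> 'b) \<Rightarrow>
    ('k::field, (('a, 'b) path \<Rightarrow>\<^sub>0 'k) set, (('a, 'b) leavitt_gen list \<Rightarrow>\<^sub>0 'k) set,
     ('a, 'b, 'k) inj_leavitt) dg_bimod" where
  "injective_leavitt_complex sp = \<lparr>
     carrier = inj_leavitt_total sp, mult = undefined, one = undefined, zero = 0, add = (+),
     smult = inj_scale, hcomp = inj_leavitt_deg sp, diff = inj_leavitt_diff sp,
     lact = inj_leavitt_lact, ract = inj_leavitt_ract sp\<rparr>"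

end

end

theory Submission
  imports Defs
begin

text \<open>
  The Leavitt path algebra has a basis of elements \<open>p\<^sup>*q\<close>, \<open>(p, q)\<close> ranging over the admissible pairs,
  so that every coordinate of \<open>\<I>\<close> is a copy of a piece of that algebra: the right action of the
  opposite algebra is left multiplication, and the differential carries the \<open>\<alpha>\<^sup>\<sharp>\<close>-coordinate to the
  \<open>e\<^sup>\<sharp>\<close>-coordinate by right multiplication with \<open>\<alpha>\<close>. As \<open>A\<close> lives in degree zero, an endomorphism
  amounts to one map \<open>\<phi>\<close> acting diagonally on the coordinates, and maps \<open>\<psi>\<^sub>\<alpha>\<close> from the
  \<open>\<alpha>\<^sup>\<sharp>\<close>-coordinate to the \<open>e\<^sup>\<sharp>\<close>-coordinate. It is a cocycle iff \<open>\<phi>\<close> commutes up to sign with the right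
  multiplications by arrows. Then it also commutes with those by ghost arrows, because
  \<open>x = \<Sum>x\<alpha>\<^sup>*\<alpha>\<close>, and so it is determined by its values at the vertices, that is, it is a left
  multiplication. The maps \<open>\<psi>\<^sub>\<alpha>\<close> can be removed by a coboundary, for which a recursion on the
  admissible pairs is solved. Finally, coboundaries vanish on the \<open>e\<^sup>\<sharp>\<close>-coordinate, where the Leavitt
  path algebra acts faithfully.
\<close>

section \<open>Linear maps between spaces of finitely supported functions\<close>

text \<open>That the admissible pairs give a basis is not shown by rewriting words. The generators
  act on the vector space over \<open>Adm\<close> by the rules that left multiplication should obey;
  the defining relations hold for these operators, and the word of a pair applied to the unit
  \<open>onev\<close> returns the pair. So two elements of the free algebra are congruent iff they
  move \<open>onev\<close> to the same vector, and the rest happens in coordinates. Right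
  multiplication is got from the left one by exchanging the two paths; associativity becomes the
  commutation of the two families of operators, a finite check on basis vectors. The obstacle is the
  special arrow: \<open>\<alpha>\<^sup>*\<alpha>\<close> is no basis element for special
  \<open>\<alpha>\<close>, so some equations for the homotopy are not part of its recursive
  definition and have to follow from the others. The second claim needs a change of signs: the two
  opposite algebras reverse products by different sign rules. The discrepancy is removed by
  rescaling each degree, which gives one quasi-isomorphism from the Leavitt path algebra to the
  endomorphism algebra.\<close>

abbreviation keys where "keys \<equiv> Poly_Mapping.keys"
abbreviation lookup where "lookup \<equiv> Poly_Mapping.lookup"
abbreviation single where "single \<equiv> Poly_Mapping.single"

abbreviation scl :: "'k::field \<Rightarrow> ('b \<Rightarrow>\<^sub>0 'k) \<Rightarrow> ('b \<Rightarrow>\<^sub>0 'k)" where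
  "scl c \<equiv> Poly_Mapping.map ((*) c)"

lemma lookup_map_zero: "f 0 = 0 \<Longrightarrow> lookup (Poly_Mapping.map f p) k = f (lookup p k)"
  by (auto simp: Poly_Mapping.map.rep_eq when_def)

lemma lookup_scl [simp]: "lookup (scl c v) b = c * lookup v b"
  by (simp add: lookup_map_zero)

lemma lookup_inj_scale [simp]: "lookup (inj_scale c m) b = (\<lambda>y. c * lookup m b y)"
  unfolding inj_scale_def by (subst lookup_map_zero) (auto simp: zero_fun_def)

lemma module_scl: "Modules.module (scl :: 'k::field \<Rightarrow> ('b \<Rightarrow>\<^sub>0 'k) \<Rightarrow> _)"
  by unfold_locales (auto intro!: poly_mapping_eqI simp: lookup_add algebra_simps)

lemma module_inj_scale: "Modules.module (inj_scale :: 'k::field \<Rightarrow> ('v, 'e, 'k) inj_leavitt \<Rightarrow> _)"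
  by unfold_locales (auto intro!: poly_mapping_eqI simp: lookup_add algebra_simps)

interpretation scl: Modules.module "scl :: 'k::field \<Rightarrow> ('b \<Rightarrow>\<^sub>0 'k) \<Rightarrow> _"
  by (rule module_scl)

interpretation inj_scale: Modules.module "inj_scale :: 'k::field \<Rightarrow> ('v, 'e, 'k) inj_leavitt \<Rightarrow> _"
  by (rule module_inj_scale)

lemma keys_scl: "keys (scl c v) \<subseteq> keys v"
  by (auto simp: in_keys_iff)

lemma keys_inj_scale: "keys (inj_scale c m) \<subseteq> keys m"
  by (auto simp: in_keys_iff zero_fun_def)

lemma scl_single [simp]: "scl c (single b x) = single b (c * x)"
  by (auto intro!: poly_mapping_eqI simp: lookup_single when_def)

lemma poly_mapping_sum_single: "v = (\<Sum>b\<in>keys v. single b (lookup v b))"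
  by (rule poly_mapping_eqI)
    (auto simp: lookup_sum lookup_single when_def in_keys_iff)

text \<open>The summand at a basis element may depend on the coefficient in any additive way:
  \<open>lext\<close> takes scalar multiples, and \<open>bmul\<close> nests two such sums to form a
  product.\<close>

definition pext :: "('b \<Rightarrow> 'c::zero \<Rightarrow> 'm::comm_monoid_add) \<Rightarrow> ('b \<Rightarrow>\<^sub>0 'c) \<Rightarrow> 'm" where
  "pext F f = (\<Sum>b\<in>keys f. F b (lookup f b))"

lemma pext_superset:
  assumes "finite S" "keys f \<subseteq> S" "\<And>b. F b 0 = 0"
  shows "pext F f = (\<Sum>b\<in>S. F b (lookup f b))"
  unfolding pext_def using assms
  by (intro sum.mono_neutral_left) (auto simp: in_keys_iff)

lemma pext_zero [simp]: "pext F 0 = 0"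
  by (simp add: pext_def)

lemma pext_single:
  assumes "F b 0 = 0"
  shows "pext F (single b x) = F b x"
  using assms by (auto simp: pext_def)

context
  fixes F :: "'b \<Rightarrow> 'c::ab_group_add \<Rightarrow> 'm::ab_group_add"
  assumes F_add: "\<And>b x y. F b (x + y) = F b x + F b y"
begin

lemma F_zero: "F b 0 = 0"
  using F_add[of b 0 0] by simp

lemma pext_add: "pext F (f + g) = pext F f + pext F g"
  using pext_superset[of "keys f \<union> keys g" "f + g" F] pext_superset[of "keys f \<union> keys g" f F]
    pext_superset[of "keys f \<union> keys g" g F] keys_add[of f g]
  by (simp add: F_zero lookup_add F_add sum.distrib)

end

definition lext :: "('k::field \<Rightarrow> 'm::ab_group_add \<Rightarrow> 'm) \<Rightarrow> ('b \<Rightarrow> 'm) \<Rightarrow> ('b \<Rightarrow>\<^sub>0 'k) \<Rightarrow> 'm" where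
  "lext s F = pext (\<lambda>b c. s c (F b))"

lemma module_hom_lext:
  assumes "Modules.module s"
  shows "module_hom scl s (lext s F)"
proof -
  interpret s: Modules.module s by fact
  have "lext s F (scl c v) = s c (lext s F v)" for c v
    using pext_superset[of "keys v" "scl c v" "\<lambda>b c. s c (F b)"] keys_scl[of c v]
    by (simp add: lext_def pext_def s.scale_sum_right)
  then show ?thesis
    by (intro module_hom.intro module_scl assms module_hom_axioms.intro)
      (auto simp: lext_def pext_add s.scale_left_distrib)
qed

lemma lext_single:
  assumes "Modules.module s"
  shows "lext s F (single b c) = s c (F b)"
  unfolding lext_def using assms by (simp add: pext_single module.scale_zero_left)

lemma keys_lext:
  assumes "\<And>b. b \<in> keys v \<Longrightarrow> keys (F b) \<subseteq> S"
  shows "keys (lext scl F v) \<subseteq> S"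
proof -
  have "keys (lext scl F v) \<subseteq> (\<Union>b\<in>keys v. keys (scl (lookup v b) (F b)))"
    unfolding lext_def pext_def by (rule keys_sum)
  also have "\<dots> \<subseteq> S"
    using assms keys_scl by fastforce
  finally show ?thesis .
qed

lemma module_hom_scl_expand:
  assumes "module_hom scl s T"
  shows "T v = (\<Sum>b\<in>keys v. s (lookup v b) (T (single b 1)))"
proof -
  interpret T: module_hom scl s T by fact
  have "T v = T (\<Sum>b\<in>keys v. scl (lookup v b) (single b 1))"
    using poly_mapping_sum_single[of v] by simp
  then show ?thesis
    by (simp only: T.sum T.scale)
qed

lemma module_hom_scl_eqI:
  assumes "module_hom scl s T" "module_hom scl s T'"
    and "\<And>b. b \<in> keys v \<Longrightarrow> T (single b 1) = T' (single b 1)"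
  shows "T v = T' v"
  using module_hom_scl_expand[OF assms(1), of v] module_hom_scl_expand[OF assms(2), of v] assms(3)
  by simp

lemma keys_plus_subset: "keys f \<subseteq> S \<Longrightarrow> keys g \<subseteq> S \<Longrightarrow> keys (f + g) \<subseteq> S"
  using keys_add[of f g] by (meson Un_least order_trans)

lemma keys_sum_subset: "(\<And>i. i \<in> I \<Longrightarrow> keys (f i) \<subseteq> S) \<Longrightarrow> keys (\<Sum>i\<in>I. f i) \<subseteq> S"
  by (rule order_trans[OF keys_sum]) blast

lemma keys_uminus': "keys (- f) = keys (f :: 'b \<Rightarrow>\<^sub>0 'c::ab_group_add)"
  by (auto simp: in_keys_iff)

lemma keys_minus_subset:
  "keys f \<subseteq> S \<Longrightarrow> keys g \<subseteq> S \<Longrightarrow> keys (f - g :: 'b \<Rightarrow>\<^sub>0 'c::ab_group_add) \<subseteq> S"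
  using keys_plus_subset[of f S "- g"] by (simp add: keys_uminus')

text \<open>Stands in for linear combinations: an additive claim about the span of \<open>S\<close>
  has to be checked on multiples of elements of \<open>S\<close> only.\<close>

lemma poly_mapping_add_induct [consumes 1, case_names zero single add]:
  fixes f :: "'b \<Rightarrow>\<^sub>0 'c::comm_monoid_add"
  assumes "keys f \<subseteq> S" "P 0" "\<And>b c. b \<in> S \<Longrightarrow> P (single b c)"
    "\<And>f g. keys f \<subseteq> S \<Longrightarrow> keys g \<subseteq> S \<Longrightarrow> P f \<Longrightarrow> P g \<Longrightarrow> P (f + g)"
  shows "P f"
proof -
  have "keys (\<Sum>b\<in>B. single b (lookup f b)) \<subseteq> S \<and> P (\<Sum>b\<in>B. single b (lookup f b))"
    if "finite B" "B \<subseteq> S" for B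
    using that
  proof (induct B rule: finite_induct)
    case (insert b B)
    let ?f = "\<Sum>b\<in>B. single b (lookup f b)"
    have "keys (single b (lookup f b)) \<subseteq> S"
      using insert.prems by simp
    then show ?case
      using insert assms(3)[of b] assms(4)[of "single b (lookup f b)" ?f]
        keys_plus_subset[of "single b (lookup f b)" S ?f] by simp
  qed (simp add: assms)
  from this[of "keys f"] show ?thesis
    using assms(1) poly_mapping_sum_single[of f] by simp
qed


section \<open>Graded spaces\<close>

lemma field_ring_simps [simp]:
  "carrier field_ring = UNIV" "mult field_ring = (*)" "one field_ring = 1"
  "zero field_ring = 0" "add field_ring = (+)"
  by (simp_all add: field_ring_def)

lemma cring_field_ring: "cring (field_ring :: 'k::field ring)"
proof (rule cringI)
  show "abelian_group (field_ring :: 'k ring)"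
    by (rule abelian_groupI) (auto simp: algebra_simps intro: exI[of _ "- x" for x])
  show "comm_monoid (field_ring :: 'k ring)"
    by (rule comm_monoidI) (auto simp: algebra_simps)
qed (auto simp: algebra_simps)

lemma module_fieldI:
  assumes "abelian_group V"
    and "\<And>c x. x \<in> carrier V \<Longrightarrow> c \<odot>\<^bsub>V\<^esub> x \<in> carrier V"
    and "\<And>c d x. x \<in> carrier V \<Longrightarrow> (c + d) \<odot>\<^bsub>V\<^esub> x = c \<odot>\<^bsub>V\<^esub> x \<oplus>\<^bsub>V\<^esub> d \<odot>\<^bsub>V\<^esub> x"
    and "\<And>c x y. x \<in> carrier V \<Longrightarrow> y \<in> carrier V \<Longrightarrow> c \<odot>\<^bsub>V\<^esub> (x \<oplus>\<^bsub>V\<^esub> y) = c \<odot>\<^bsub>V\<^esub> x \<oplus>\<^bsub>V\<^esub> c \<odot>\<^bsub>V\<^esub> y"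
    and "\<And>c d x. x \<in> carrier V \<Longrightarrow> (c * d) \<odot>\<^bsub>V\<^esub> x = c \<odot>\<^bsub>V\<^esub> (d \<odot>\<^bsub>V\<^esub> x)"
    and "\<And>x. x \<in> carrier V \<Longrightarrow> 1 \<odot>\<^bsub>V\<^esub> x = x"
  shows "Module.module (field_ring :: 'k::field ring) V"
  by (rule moduleI) (auto intro: assms cring_field_ring)

locale vspace =
  fixes V :: "('k::field, 'v, 'x) module_scheme" (structure)
  assumes vspace: "Module.module field_ring V"
begin

sublocale M: Module.module field_ring V
  by (rule vspace)

lemma smult_cl [simp, intro]: "x \<in> carrier V \<Longrightarrow> c \<odot> x \<in> carrier V"
  by (rule M.smult_closed) simp_all

lemma smult_add: "x \<in> carrier V \<Longrightarrow> y \<in> carrier V \<Longrightarrow> c \<odot> (x \<oplus> y) = c \<odot> x \<oplus> c \<odot> y"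
  by (rule M.smult_r_distr) simp_all

lemma smult_add_left: "x \<in> carrier V \<Longrightarrow> (c + d) \<odot> x = c \<odot> x \<oplus> d \<odot> x"
  using M.smult_l_distr[of c d x] by simp

lemma smult_smult: "x \<in> carrier V \<Longrightarrow> c \<odot> (d \<odot> x) = (c * d) \<odot> x"
  using M.smult_assoc1[of c d x] by simp

lemma smult_1 [simp]: "x \<in> carrier V \<Longrightarrow> 1 \<odot> x = x"
  using M.smult_one[of x] by simp

lemma smult_0_left [simp]: "x \<in> carrier V \<Longrightarrow> 0 \<odot> x = \<zero>"
  using M.smult_l_null[of x] by simp

lemma smult_zero [simp]: "c \<odot> \<zero> = \<zero>"
  by (rule M.smult_r_null) simp

lemma smult_minus1: "x \<in> carrier V \<Longrightarrow> (- 1) \<odot> x = \<ominus> x"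
  using smult_add_left[of x "- 1" 1] by (intro M.minus_equality[symmetric]) simp_all

lemma finsum_smult:
  assumes "f \<in> A \<rightarrow> carrier V"
  shows "c \<odot> (\<Oplus>i\<in>A. f i) = (\<Oplus>i\<in>A. c \<odot> f i)"
proof (cases "finite A")
  case True
  then show ?thesis
    using M.finsum_smult_ldistr[of A c f] assms by simp
qed simp

lemma submodule_fieldI:
  assumes "H \<subseteq> carrier V" "\<zero> \<in> H" "\<And>x y. x \<in> H \<Longrightarrow> y \<in> H \<Longrightarrow> x \<oplus> y \<in> H"
    "\<And>c x. x \<in> H \<Longrightarrow> c \<odot> x \<in> H"
  shows "submodule H field_ring V"
proof (rule M.submoduleI)
  show "\<ominus> x \<in> H" if "x \<in> H" for x
    using assms(1) assms(4)[OF that, of "- 1"] that by (metis smult_minus1 subsetD)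
qed (use assms in auto)

end

lemma klinearD:
  assumes "klinear V W f"
  shows "x \<in> carrier V \<Longrightarrow> f x \<in> carrier W"
    and "x \<in> carrier V \<Longrightarrow> y \<in> carrier V \<Longrightarrow> f (x \<oplus>\<^bsub>V\<^esub> y) = f x \<oplus>\<^bsub>W\<^esub> f y"
    and "x \<in> carrier V \<Longrightarrow> f (c \<odot>\<^bsub>V\<^esub> x) = c \<odot>\<^bsub>W\<^esub> f x"
  using assms by (auto simp: klinear_def)

lemma klinear_zero:
  assumes "klinear V W f" "Module.module field_ring V" "Module.module field_ring W"
  shows "f \<zero>\<^bsub>V\<^esub> = \<zero>\<^bsub>W\<^esub>"
proof -
  interpret V: vspace V by (rule vspace.intro) fact
  interpret W: vspace W by (rule vspace.intro) fact
  have "f (0 \<odot>\<^bsub>V\<^esub> \<zero>\<^bsub>V\<^esub>) = 0 \<odot>\<^bsub>W\<^esub> f \<zero>\<^bsub>V\<^esub>"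
    using klinearD(3)[OF assms(1)] by blast
  then show ?thesis
    using klinearD(1)[OF assms(1)] by simp
qed

locale graded = vspace V for V :: "('k::field, 'v, 'x) graded_space_scheme" (structure) +
  assumes graded: "is_graded V"
begin

lemma submodule_hcomp: "submodule (hcomp V n) field_ring V"
  using graded by (simp add: is_graded_def)

lemma hcomp_closed: "x \<in> hcomp V n \<Longrightarrow> x \<in> carrier V"
  using M.submoduleE(1)[OF submodule_hcomp] by blast

lemma hcomp_zero [simp, intro]: "\<zero> \<in> hcomp V n"
  using submodule_hcomp[of n] by (simp add: submodule_def subgroup_def)

lemma hcomp_add: "x \<in> hcomp V n \<Longrightarrow> y \<in> hcomp V n \<Longrightarrow> x \<oplus> y \<in> hcomp V n"
  using M.submoduleE(5)[OF submodule_hcomp] by blast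

lemma hcomp_smult: "x \<in> hcomp V n \<Longrightarrow> c \<odot> x \<in> hcomp V n"
  using M.submoduleE(4)[OF submodule_hcomp] by simp

lemma ex1_hdecomp: "x \<in> carrier V \<Longrightarrow> \<exists>!f. hdecomp V x f"
  using graded unfolding is_graded_def by blast

lemma hdecomp_hpart: "x \<in> carrier V \<Longrightarrow> hdecomp V x (hpart V x)"
  unfolding hpart_def by (rule theI'[OF ex1_hdecomp])

lemma hpart_mem [simp, intro]: "x \<in> carrier V \<Longrightarrow> hpart V x n \<in> hcomp V n"
  using hdecomp_hpart by (auto simp: hdecomp_def)

lemma hpart_closed [simp, intro]: "x \<in> carrier V \<Longrightarrow> hpart V x n \<in> carrier V"
  using hpart_mem hcomp_closed by blast

lemma finite_hsupp [simp, intro]: "x \<in> carrier V \<Longrightarrow> finite (hsupp V x)"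
  using hdecomp_hpart by (auto simp: hdecomp_def hsupp_def)

lemma finsum_hpart: "x \<in> carrier V \<Longrightarrow> x = (\<Oplus>n\<in>hsupp V x. hpart V x n)"
  using hdecomp_hpart by (auto simp: hdecomp_def hsupp_def)

lemma hpart_finsum:
  assumes "finite N" "\<And>n. n \<in> N \<Longrightarrow> f n \<in> hcomp V n"
  shows "hpart V (\<Oplus>n\<in>N. f n) = (\<lambda>n. if n \<in> N then f n else \<zero>)"
proof -
  let ?g = "\<lambda>n. if n \<in> N then f n else \<zero>"
  have cl: "f n \<in> carrier V" if "n \<in> N" for n
    using assms(2)[OF that] hcomp_closed by blast
  have "(\<Oplus>n\<in>N. f n) = (\<Oplus>n\<in>{n. ?g n \<noteq> \<zero>}. ?g n)"
    using assms cl by (intro M.add.finprod_mono_neutral_cong_right) (auto split: if_splits)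
  then have "hdecomp V (\<Oplus>n\<in>N. f n) ?g"
    using assms by (auto simp: hdecomp_def intro: finite_subset[of _ N])
  moreover have "(\<Oplus>n\<in>N. f n) \<in> carrier V"
    using cl by (simp add: Pi_def)
  ultimately show ?thesis
    unfolding hpart_def by (intro the1_equality ex1_hdecomp)
qed

lemma hpart_homog:
  assumes "x \<in> hcomp V n"
  shows "hpart V x = (\<lambda>m. if m = n then x else \<zero>)"
  using hpart_finsum[of "{n}" "\<lambda>_. x"] assms hcomp_closed[OF assms] by auto

lemma finsum_hpart_superset:
  assumes "x \<in> carrier V" "finite N" "hsupp V x \<subseteq> N"
  shows "x = (\<Oplus>n\<in>N. hpart V x n)"
  apply (subst (1) finsum_hpart[OF assms(1)])
  using assms by (intro M.add.finprod_mono_neutral_cong_left) (auto simp: hsupp_def)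

lemma hpart_add:
  assumes "x \<in> carrier V" "y \<in> carrier V"
  shows "hpart V (x \<oplus> y) n = hpart V x n \<oplus> hpart V y n"
proof -
  let ?N = "hsupp V x \<union> hsupp V y"
  have "x \<oplus> y = (\<Oplus>n\<in>?N. hpart V x n \<oplus> hpart V y n)"
    using finsum_hpart_superset[of x ?N] finsum_hpart_superset[of y ?N] assms by (simp add: Pi_def)
  then have "hpart V (x \<oplus> y) = (\<lambda>n. if n \<in> ?N then hpart V x n \<oplus> hpart V y n else \<zero>)"
    using hpart_finsum[of ?N "\<lambda>n. hpart V x n \<oplus> hpart V y n"] assms by (simp add: hcomp_add)
  then show ?thesis
    using assms by (auto simp: hsupp_def)
qed

text \<open>Holds because an element is the finite sum of its homogeneous parts. Identities additive
  in each argument, such as associativity with signs, are proved by nesting this rule.\<close>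

lemma graded_induct [consumes 1, case_names homog add]:
  assumes "x \<in> carrier V" "\<And>n y. y \<in> hcomp V n \<Longrightarrow> P y"
    "\<And>y z. y \<in> carrier V \<Longrightarrow> z \<in> carrier V \<Longrightarrow> P y \<Longrightarrow> P z \<Longrightarrow> P (y \<oplus> z)"
  shows "P x"
proof -
  have "(\<Oplus>n\<in>N. hpart V x n) \<in> carrier V \<and> P (\<Oplus>n\<in>N. hpart V x n)" if "finite N" for N
    using that
  proof (induct N rule: finite_induct)
    case empty
    then show ?case using assms(2)[OF hcomp_zero] by simp
  next
    case (insert n N)
    then have "(\<Oplus>m\<in>insert n N. hpart V x m) = hpart V x n \<oplus> (\<Oplus>m\<in>N. hpart V x m)"
      using assms(1) by (intro M.finsum_insert) auto
    then show ?case
      using insert assms(1) assms(2)[OF hpart_mem[OF assms(1)]] by (auto intro!: assms(3))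
  qed
  then show ?thesis
    using finsum_hpart[OF assms(1)] finite_hsupp[OF assms(1)] by metis
qed

text \<open>
  Rules given for homogeneous elements are extended by sums of this shape: they are additive and
  give back the rule on homogeneous elements.
\<close>

context
  fixes W :: "('w, 'y) ring_scheme" and g :: "int \<Rightarrow> 'v \<Rightarrow> 'w"
  assumes W: "abelian_group W"
    and g_closed: "\<And>n x. x \<in> hcomp V n \<Longrightarrow> g n x \<in> carrier W"
    and g_add: "\<And>n x y. x \<in> hcomp V n \<Longrightarrow> y \<in> hcomp V n \<Longrightarrow> g n (x \<oplus> y) = g n x \<oplus>\<^bsub>W\<^esub> g n y"
begin

interpretation W: abelian_group W by (rule W)

lemma g_zero: "g n \<zero> = \<zero>\<^bsub>W\<^esub>"
proof -
  have "g n \<zero> \<oplus>\<^bsub>W\<^esub> g n \<zero> = g n \<zero>"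
    using g_add[of \<zero> n \<zero>] by simp
  then show ?thesis
    using g_closed[of \<zero> n] by simp
qed

lemma hsum_superset:
  assumes "x \<in> carrier V" "finite N" "hsupp V x \<subseteq> N"
  shows "(\<Oplus>\<^bsub>W\<^esub>i\<in>hsupp V x. g i (hpart V x i)) = (\<Oplus>\<^bsub>W\<^esub>i\<in>N. g i (hpart V x i))"
  using assms g_closed
  by (intro W.add.finprod_mono_neutral_cong_left) (auto simp: hsupp_def g_zero)

lemma hsum_closed: "x \<in> carrier V \<Longrightarrow> (\<Oplus>\<^bsub>W\<^esub>i\<in>hsupp V x. g i (hpart V x i)) \<in> carrier W"
  using g_closed by (intro W.finsum_closed) auto

lemma hsum_homog:
  assumes "x \<in> hcomp V n"
  shows "(\<Oplus>\<^bsub>W\<^esub>i\<in>hsupp V x. g i (hpart V x i)) = g n x"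
proof -
  have "hsupp V x \<subseteq> {n}"
    by (auto simp: hsupp_def hpart_homog[OF assms])
  from hsum_superset[OF hcomp_closed[OF assms] _ this] show ?thesis
    using g_closed[OF assms] by (simp add: hpart_homog[OF assms] Pi_def)
qed

lemma hsum_add:
  assumes "x \<in> carrier V" "y \<in> carrier V"
  shows "(\<Oplus>\<^bsub>W\<^esub>i\<in>hsupp V (x \<oplus> y). g i (hpart V (x \<oplus> y) i)) =
    (\<Oplus>\<^bsub>W\<^esub>i\<in>hsupp V x. g i (hpart V x i)) \<oplus>\<^bsub>W\<^esub> (\<Oplus>\<^bsub>W\<^esub>i\<in>hsupp V y. g i (hpart V y i))"
proof -
  let ?N = "hsupp V x \<union> hsupp V y"
  have "hsupp V (x \<oplus> y) \<subseteq> ?N"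
    using assms by (auto simp: hsupp_def hpart_add)
  then show ?thesis
    using assms hsum_superset[of x ?N] hsum_superset[of y ?N] hsum_superset[of "x \<oplus> y" ?N] g_closed
    by (simp add: hpart_add g_add W.finsum_addf Pi_def)
qed

end

end

text \<open>\<open>gen\<close> expresses as an induction principle that the homogeneous elements
  generate; decompositions then exist because they can be added. Uniqueness is \<open>indep\<close>
  for the difference of two decompositions.\<close>

lemma is_gradedI:
  fixes V :: "('k::field, 'v, 'x) graded_space_scheme" (structure)
  assumes vs: "Module.module field_ring V"
    and sub: "\<And>n. submodule (hcomp V n) field_ring V"
    and gen: "\<And>x P. x \<in> carrier V \<Longrightarrow> (\<And>n y. y \<in> hcomp V n \<Longrightarrow> P y) \<Longrightarrow>
      (\<And>y z. y \<in> carrier V \<Longrightarrow> z \<in> carrier V \<Longrightarrow> P y \<Longrightarrow> P z \<Longrightarrow> P (y \<oplus> z)) \<Longrightarrow> P x"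
    and indep: "\<And>f N n. finite N \<Longrightarrow> (\<And>n. f n \<in> hcomp V n) \<Longrightarrow> (\<Oplus>n\<in>N. f n) = \<zero> \<Longrightarrow> n \<in> N \<Longrightarrow> f n = \<zero>"
  shows "is_graded V"
proof -
  interpret vspace V by (rule vspace.intro) fact
  have cl: "x \<in> carrier V" if "x \<in> hcomp V n" for x n
    using M.submoduleE(1)[OF sub] that by blast
  have zero: "\<zero> \<in> hcomp V n" for n
    using sub[of n] by (simp add: submodule_def subgroup_def)
  note addc = M.submoduleE(5)[OF sub] and negc = M.submoduleE(3)[OF sub]
  have sup: "(\<Oplus>n\<in>{n. f n \<noteq> \<zero>}. f n) = (\<Oplus>n\<in>N. f n)"
    if "finite N" "{n. f n \<noteq> \<zero>} \<subseteq> N" "\<And>n. f n \<in> hcomp V n" for f N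
    using that cl by (intro M.add.finprod_mono_neutral_cong_left) auto
  have ex: "\<exists>f. hdecomp V x f" if "x \<in> carrier V" for x
    using that
  proof (rule gen)
    fix n y assume y: "y \<in> hcomp V n"
    have s: "{m. (if m = n then y else \<zero>) \<noteq> \<zero>} \<subseteq> {n}" by auto
    have "y = (\<Oplus>m\<in>{n}. if m = n then y else \<zero>)"
      using cl[OF y] by (simp add: Pi_def)
    then have "hdecomp V y (\<lambda>m. if m = n then y else \<zero>)"
      using y zero sup[OF _ s] by (auto simp: hdecomp_def intro: finite_subset[OF s])
    then show "\<exists>f. hdecomp V y f" by blast
  next
    fix y z assume "\<exists>f. hdecomp V y f" "\<exists>f. hdecomp V z f"
    then obtain f g where f: "hdecomp V y f" and g: "hdecomp V z g" by blast
    let ?N = "{n. f n \<noteq> \<zero>} \<union> {n. g n \<noteq> \<zero>}"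
    have fin: "finite ?N" and fc: "f n \<in> hcomp V n" and gc: "g n \<in> hcomp V n" for n
      using f g by (auto simp: hdecomp_def)
    have s: "{n. f n \<oplus> g n \<noteq> \<zero>} \<subseteq> ?N"
      by auto
    have "y \<oplus> z = (\<Oplus>n\<in>?N. f n) \<oplus> (\<Oplus>n\<in>?N. g n)"
      using f g sup[OF fin, of f] sup[OF fin, of g] by (auto simp: hdecomp_def)
    also have "\<dots> = (\<Oplus>n\<in>?N. f n \<oplus> g n)"
      using fc gc cl by (intro M.finsum_addf[symmetric]) auto
    also have "\<dots> = (\<Oplus>n\<in>{n. f n \<oplus> g n \<noteq> \<zero>}. f n \<oplus> g n)"
      using sup[OF fin s] addc[OF fc gc] by simp
    finally have "hdecomp V (y \<oplus> z) (\<lambda>n. f n \<oplus> g n)"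
      using addc[OF fc gc] finite_subset[OF s fin] by (simp add: hdecomp_def)
    then show "\<exists>f. hdecomp V (y \<oplus> z) f" by blast
  qed
  have uniq: "f = g" if f: "hdecomp V x f" and g: "hdecomp V x g" for x f g
  proof
    fix m
    \<comment> \<open>\<open>m\<close> itself joins the index set, since \<open>indep\<close> speaks
      only of indices that occur in the sum.\<close>
    let ?N = "insert m ({n. f n \<noteq> \<zero>} \<union> {n. g n \<noteq> \<zero>})"
    have fin: "finite ?N" and fc: "f n \<in> hcomp V n" and gc: "g n \<in> hcomp V n" for n
      using f g by (auto simp: hdecomp_def)
    have fC: "f n \<in> carrier V" and gC: "g n \<in> carrier V" for n
      using cl[OF fc] cl[OF gc] by blast+
    have eq: "(\<Oplus>n\<in>?N. f n) = (\<Oplus>n\<in>?N. g n)"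
      using f g sup[OF fin, of f] sup[OF fin, of g] by (fastforce simp: hdecomp_def)
    have "(\<Oplus>n\<in>?N. f n \<oplus> (- 1) \<odot> g n) = (\<Oplus>n\<in>?N. f n) \<oplus> (- 1) \<odot> (\<Oplus>n\<in>?N. g n)"
      using fC gC by (subst finsum_smult) (auto intro!: M.finsum_addf)
    also have "\<dots> = \<zero>"
      unfolding eq using gc cl
      by (subst smult_minus1) (auto intro!: M.finsum_closed M.r_neg)
    finally have "f m \<oplus> (- 1) \<odot> g m = \<zero>"
      using indep[OF fin, of "\<lambda>n. f n \<oplus> (- 1) \<odot> g n" m] addc[OF fc negc[OF gc]] smult_minus1[OF cl[OF gc]]
      by simp
    then show "f m = g m"
      using fc[of m] gc[of m] cl smult_minus1 by (metis M.add.inv_closed M.minus_equality M.minus_minus)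
  qed
  show ?thesis
    unfolding is_graded_def using vs sub ex uniq by blast
qed

lemma gradedI: "is_graded V \<Longrightarrow> graded V"
  by (intro graded.intro vspace.intro graded_axioms.intro) (simp_all add: is_graded_def)


section \<open>Differential graded algebras\<close>

lemma finsum_cong_structure:
  assumes "carrier V = carrier W" "add V = add W" "zero V = zero W"
  shows "finsum V = finsum W"
  by (intro ext) (simp add: finsum_def finprod_def assms)

lemma module_cong:
  assumes "Module.module field_ring V"
    and "carrier V = carrier W" "add V = add W" "zero V = zero W" "smult V = smult W"
  shows "Module.module field_ring W"
proof -
  interpret V: vspace V by (rule vspace.intro) fact
  note eqs = assms(2-5)[symmetric]
  show ?thesis
  proof (rule module_fieldI)
    show "abelian_group W"
      unfolding eqs
      by (rule abelian_groupI)
        (auto simp: eqs V.M.a_ac intro: V.M.l_neg bexI[of _ "\<ominus>\<^bsub>V\<^esub> x" for x])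
  qed (auto simp: eqs V.smult_add V.smult_add_left V.smult_smult)
qed

lemma is_graded_cong:
  assumes "is_graded V"
    and "carrier V = carrier W" "add V = add W" "zero V = zero W" "smult V = smult W" "hcomp V = hcomp W"
  shows "is_graded W"
proof -
  have W: "Module.module field_ring W"
    by (rule module_cong[OF _ assms(2-5)]) (use assms(1) in \<open>simp add: is_graded_def\<close>)
  interpret V: graded V by (rule gradedI) fact
  interpret W: vspace W by (rule vspace.intro) fact
  have "submodule (hcomp W n) field_ring W" for n
    using V.hcomp_closed V.hcomp_zero V.hcomp_add V.hcomp_smult
    by (intro W.submodule_fieldI) (auto simp: assms(2-6)[symmetric])
  moreover have "hdecomp V = hdecomp W"
    by (intro ext) (simp add: hdecomp_def assms(2-6) finsum_cong_structure[OF assms(2-4)])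
  ultimately show ?thesis
    using assms W by (simp add: is_graded_def)
qed

text \<open>Being a complex does not involve \<open>mult\<close> and \<open>one\<close>, so it
  passes to both kinds of opposite algebra, whatever the product.\<close>

lemma is_complex_cong:
  assumes "is_complex V"
    and "carrier V = carrier W" "add V = add W" "zero V = zero W" "smult V = smult W"
      "hcomp V = hcomp W" "diff V = diff W"
  shows "is_complex W"
  using assms is_graded_cong[of V W] by (simp add: is_complex_def klinear_def)

lemma hpart_cong_structure:
  assumes "carrier V = carrier W" "add V = add W" "zero V = zero W" "hcomp V = hcomp W"
  shows "hpart V = hpart W" "hsupp V = hsupp W"
proof -
  have "hdecomp V = hdecomp W"
    by (intro ext) (simp add: hdecomp_def assms finsum_cong_structure[OF assms(1-3)])
  then show "hpart V = hpart W" "hsupp V = hsupp W"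
    by (auto simp: hpart_def hsupp_def assms fun_eq_iff)
qed

locale dg_alg = graded R for R :: "('k::field, 'a, 'x) dg_space_scheme" (structure) +
  assumes dg: "dg_algebra R"
begin

sublocale A: ring R
  using dg by (simp add: dg_algebra_def)

lemma complex: "is_complex R"
  using dg by (simp add: dg_algebra_def)

lemma smult_mult:
  assumes "x \<in> carrier R" "y \<in> carrier R"
  shows "(c \<odot> x) \<otimes> y = c \<odot> (x \<otimes> y)" "x \<otimes> (c \<odot> y) = c \<odot> (x \<otimes> y)"
  using dg assms unfolding dg_algebra_def by metis+

lemma one_hcomp: "\<one> \<in> hcomp R 0"
  using dg by (simp add: dg_algebra_def)

lemma mult_hcomp: "x \<in> hcomp R m \<Longrightarrow> y \<in> hcomp R n \<Longrightarrow> x \<otimes> y \<in> hcomp R (m + n)"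
  using dg by (simp add: dg_algebra_def)

lemma klinear_diff: "klinear R R (diff R)"
  using complex by (simp add: is_complex_def)

lemmas diff_closed = klinearD(1)[OF klinear_diff]
  and diff_add = klinearD(2)[OF klinear_diff]
  and diff_smult = klinearD(3)[OF klinear_diff]

lemma diff_hcomp: "x \<in> hcomp R n \<Longrightarrow> diff R x \<in> hcomp R (n + 1)"
  using complex by (auto simp: is_complex_def)

lemma leibniz:
  "x \<in> hcomp R n \<Longrightarrow> y \<in> carrier R \<Longrightarrow>
    diff R (x \<otimes> y) = (diff R x \<otimes> y) \<oplus> ((- 1) powi n \<odot> (x \<otimes> diff R y))"
  using dg by (simp add: dg_algebra_def)

end

lemma dg_algI:
  assumes "dg_algebra R"
  shows "dg_alg R"
proof -
  have "is_graded R"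
    using assms by (simp add: dg_algebra_def is_complex_def)
  then show ?thesis
    by (intro dg_alg.intro gradedI dg_alg_axioms.intro assms)
qed

definition kalgebra :: "('k::field, 'a, 'x) module_scheme \<Rightarrow> bool" where
  "kalgebra R \<longleftrightarrow> Module.module field_ring R \<and> ring R \<and>
     (\<forall>c. \<forall>x\<in>carrier R. \<forall>y\<in>carrier R.
        c \<odot>\<^bsub>R\<^esub> (x \<otimes>\<^bsub>R\<^esub> y) = (c \<odot>\<^bsub>R\<^esub> x) \<otimes>\<^bsub>R\<^esub> y \<and> c \<odot>\<^bsub>R\<^esub> (x \<otimes>\<^bsub>R\<^esub> y) = x \<otimes>\<^bsub>R\<^esub> (c \<odot>\<^bsub>R\<^esub> y))"

lemma trivial_dg_simps [simp]:
  "carrier (trivial_dg R C) = carrier R" "mult (trivial_dg R C) = mult R"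
  "one (trivial_dg R C) = one R" "zero (trivial_dg R C) = zero R"
  "add (trivial_dg R C) = add R" "smult (trivial_dg R C) = smult R"
  "hcomp (trivial_dg R C) = C" "diff (trivial_dg R C) = (\<lambda>_. \<zero>\<^bsub>R\<^esub>)"
  by (simp_all add: trivial_dg_def module.defs)

lemma ring_cong:
  assumes "ring R" "carrier R = carrier S" "mult R = mult S" "one R = one S" "zero R = zero S" "add R = add S"
  shows "ring S"
proof -
  interpret R: ring R by fact
  note eqs = assms(2-6)[symmetric]
  show ?thesis
  proof (rule ringI)
    show "abelian_group S"
      by (rule abelian_groupI)
        (auto simp: eqs R.a_ac intro: R.l_neg bexI[of _ "\<ominus>\<^bsub>R\<^esub> x" for x])
    show "Group.monoid S"
      by (rule monoidI) (auto simp: eqs R.m_assoc)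
  qed (auto simp: eqs R.l_distr R.r_distr)
qed

lemma dg_algebra_trivial_dg:
  fixes R :: "('k::field, 'a) module"
  assumes alg: "kalgebra R" and gr: "is_graded (trivial_dg R C)"
    and "one R \<in> C 0" "\<And>m n x y. x \<in> C m \<Longrightarrow> y \<in> C n \<Longrightarrow> x \<otimes>\<^bsub>R\<^esub> y \<in> C (m + n)"
  shows "dg_algebra (trivial_dg R C)"
proof -
  interpret T: graded "trivial_dg R C" by (rule gradedI[OF gr])
  interpret R: ring R using alg by (simp add: kalgebra_def)
  have "ring (trivial_dg R C)"
    by (rule ring_cong[OF R.ring_axioms]) simp_all
  moreover have "\<zero>\<^bsub>R\<^esub> \<in> C n" for n
    using T.hcomp_zero by simp
  moreover have "x \<in> C n \<Longrightarrow> x \<in> carrier R" for x n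
    using T.hcomp_closed[of x n] by simp
  moreover have "c \<odot>\<^bsub>R\<^esub> \<zero>\<^bsub>R\<^esub> = \<zero>\<^bsub>R\<^esub>" for c
    using T.smult_zero[of c] by simp
  moreover have "\<forall>c. \<forall>x\<in>carrier R. \<forall>y\<in>carrier R.
      c \<odot>\<^bsub>R\<^esub> (x \<otimes>\<^bsub>R\<^esub> y) = (c \<odot>\<^bsub>R\<^esub> x) \<otimes>\<^bsub>R\<^esub> y \<and> c \<odot>\<^bsub>R\<^esub> (x \<otimes>\<^bsub>R\<^esub> y) = x \<otimes>\<^bsub>R\<^esub> (c \<odot>\<^bsub>R\<^esub> y)"
    using alg unfolding kalgebra_def by blast
  ultimately show ?thesis
    using gr assms(3,4) unfolding dg_algebra_def is_complex_def klinear_def trivial_dg_simps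
    by (intro conjI; (assumption | auto))
qed

lemma op_algebra_simps [simp]:
  "carrier (op_algebra R) = carrier R" "mult (op_algebra R) = (\<lambda>a b. b \<otimes>\<^bsub>R\<^esub> a)"
  "one (op_algebra R) = one R" "zero (op_algebra R) = zero R"
  "add (op_algebra R) = add R" "smult (op_algebra R) = smult R"
  "hcomp (op_algebra R) = hcomp R" "diff (op_algebra R) = diff R"
  by (simp_all add: op_algebra_def)

text \<open>Reversal without signs respects the Leibniz rule here because every term of that rule
  contains a differential and so vanishes.\<close>

lemma dg_algebra_op_algebra:
  assumes dg: "dg_algebra R" and diff0: "\<And>x. x \<in> carrier R \<Longrightarrow> diff R x = \<zero>\<^bsub>R\<^esub>"
  shows "dg_algebra (op_algebra R)"
proof -
  interpret dg_alg R by (rule dg_algI[OF dg])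
  have "is_complex (op_algebra R)"
    by (rule is_complex_cong[OF complex]) simp_all
  moreover have "ring (op_algebra R)"
  proof (rule ringI)
    show "abelian_group (op_algebra R)"
      by (rule abelian_groupI)
        (auto simp: M.a_ac intro: M.l_neg bexI[of _ "\<ominus>\<^bsub>R\<^esub> x" for x])
    show "Group.monoid (op_algebra R)"
      by (rule monoidI) (auto simp: A.m_assoc)
  qed (auto simp: A.l_distr A.r_distr)
  moreover have "y \<otimes>\<^bsub>R\<^esub> x \<in> hcomp R (m + n)" if "x \<in> hcomp R m" "y \<in> hcomp R n" for x y m n
    using mult_hcomp[OF that(2,1)] by (simp add: add.commute)
  ultimately show ?thesis
    using one_hcomp hcomp_closed
    by (auto simp: dg_algebra_def smult_mult diff0)
qed

abbreviation sg :: "int \<Rightarrow> 'k::field" where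
  "sg n \<equiv> (- 1) powi n"

lemma sg_add: "sg (m + n) = sg m * (sg n :: 'k::field)"
  by (simp add: power_int_add)

lemma sg_sq [simp]: "sg n * sg n = (1 :: 'k::field)" "sg n * (sg n * c) = (c :: 'k)"
  by (simp_all flip: power_int_mult_distrib mult.assoc)

locale opp_alg = dg_alg
begin

abbreviation "Ropp \<equiv> opp_dg_algebra R"

lemma opp_simps [simp]:
  "carrier Ropp = carrier R" "one Ropp = one R" "zero Ropp = zero R"
  "add Ropp = add R" "smult Ropp = smult R"
  "hcomp Ropp = hcomp R" "diff Ropp = diff R"
  by (simp_all add: opp_dg_algebra_def)

text \<open>The inner sum of the signed product, with the degree \<open>i\<close> of the left factor
  as a parameter. The double sum is thus split into two single ones, to which the additivity of sums
  over homogeneous parts applies, first in \<open>b\<close> and then in \<open>a\<close>.\<close>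

definition opp_left :: "'a \<Rightarrow> int \<Rightarrow> 'a \<Rightarrow> 'a" where
  "opp_left b i x = (\<Oplus>j\<in>hsupp R b. sg (i * j) \<odot> (hpart R b j \<otimes> x))"

lemma opp_mult: "a \<otimes>\<^bsub>Ropp\<^esub> b = (\<Oplus>i\<in>hsupp R a. opp_left b i (hpart R a i))"
  by (simp add: opp_dg_algebra_def opp_left_def)

lemma opp_left_props:
  assumes "x \<in> carrier R"
  shows opp_left_closed: "b \<in> carrier R \<Longrightarrow> opp_left b i x \<in> carrier R"
    and opp_left_homog: "b \<in> hcomp R j \<Longrightarrow> opp_left b i x = sg (i * j) \<odot> (b \<otimes> x)"
    and opp_left_add1: "b \<in> carrier R \<Longrightarrow> c \<in> carrier R \<Longrightarrow>
      opp_left (b \<oplus> c) i x = opp_left b i x \<oplus> opp_left c i x"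
proof -
  have W: "abelian_group R" ..
  have 1: "sg (i * n) \<odot> (y \<otimes> x) \<in> carrier R" if "y \<in> hcomp R n" for n y
    using that assms hcomp_closed by blast
  have 2: "sg (i * n) \<odot> ((y \<oplus> z) \<otimes> x) = sg (i * n) \<odot> (y \<otimes> x) \<oplus> sg (i * n) \<odot> (z \<otimes> x)"
    if "y \<in> hcomp R n" "z \<in> hcomp R n" for n y z
    using that[THEN hcomp_closed] assms by (simp add: A.l_distr smult_add)
  note hs = hsum_closed[OF W, of "\<lambda>j y. sg (i * j) \<odot> (y \<otimes> x)", OF 1 2]
    hsum_homog[OF W, of "\<lambda>j y. sg (i * j) \<odot> (y \<otimes> x)", OF 1 2]
    hsum_add[OF W, of "\<lambda>j y. sg (i * j) \<odot> (y \<otimes> x)", OF 1 2]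
  show "b \<in> carrier R \<Longrightarrow> opp_left b i x \<in> carrier R"
    "b \<in> hcomp R j \<Longrightarrow> opp_left b i x = sg (i * j) \<odot> (b \<otimes> x)"
    "b \<in> carrier R \<Longrightarrow> c \<in> carrier R \<Longrightarrow> opp_left (b \<oplus> c) i x = opp_left b i x \<oplus> opp_left c i x"
    unfolding opp_left_def by (rule hs; assumption)+
qed

lemma opp_left_add2:
  assumes "b \<in> carrier R" "x \<in> carrier R" "y \<in> carrier R"
  shows "opp_left b i (x \<oplus> y) = opp_left b i x \<oplus> opp_left b i y"
  using assms(1)
proof (induct rule: graded_induct)
  case (homog n b)
  then show ?case
    using assms hcomp_closed[OF homog] by (simp add: opp_left_homog A.r_distr smult_add)
next
  case (add b c)
  then show ?case
    using assms by (simp add: opp_left_add1 opp_left_closed M.a_ac)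
qed

lemma opp_props:
  assumes "b \<in> carrier R"
  shows opp_closed: "a \<in> carrier R \<Longrightarrow> a \<otimes>\<^bsub>Ropp\<^esub> b \<in> carrier R"
    and opp_left_eq: "a \<in> hcomp R i \<Longrightarrow> a \<otimes>\<^bsub>Ropp\<^esub> b = opp_left b i a"
    and opp_add1: "a \<in> carrier R \<Longrightarrow> c \<in> carrier R \<Longrightarrow>
      (a \<oplus> c) \<otimes>\<^bsub>Ropp\<^esub> b = a \<otimes>\<^bsub>Ropp\<^esub> b \<oplus> c \<otimes>\<^bsub>Ropp\<^esub> b"
proof -
  have W: "abelian_group R" ..
  have 1: "opp_left b n x \<in> carrier R" if "x \<in> hcomp R n" for n x
    using opp_left_closed[OF hcomp_closed[OF that] assms] .
  have 2: "opp_left b n (x \<oplus> y) = opp_left b n x \<oplus> opp_left b n y"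
    if "x \<in> hcomp R n" "y \<in> hcomp R n" for n x y
    using opp_left_add2[OF assms that[THEN hcomp_closed]] .
  note hs = hsum_closed[OF W, of "opp_left b", OF 1 2]
    hsum_homog[OF W, of "opp_left b", OF 1 2] hsum_add[OF W, of "opp_left b", OF 1 2]
  show "a \<in> carrier R \<Longrightarrow> a \<otimes>\<^bsub>Ropp\<^esub> b \<in> carrier R"
    "a \<in> hcomp R i \<Longrightarrow> a \<otimes>\<^bsub>Ropp\<^esub> b = opp_left b i a"
    "a \<in> carrier R \<Longrightarrow> c \<in> carrier R \<Longrightarrow> (a \<oplus> c) \<otimes>\<^bsub>Ropp\<^esub> b = a \<otimes>\<^bsub>Ropp\<^esub> b \<oplus> c \<otimes>\<^bsub>Ropp\<^esub> b"
    unfolding opp_mult by (rule hs; assumption)+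
qed

lemma opp_homog:
  "a \<in> hcomp R i \<Longrightarrow> b \<in> hcomp R j \<Longrightarrow> a \<otimes>\<^bsub>Ropp\<^esub> b = sg (i * j) \<odot> (b \<otimes> a)"
  using opp_left_eq[OF hcomp_closed] opp_left_homog[OF hcomp_closed] by metis

lemma opp_add2:
  assumes "a \<in> carrier R" "b \<in> carrier R" "c \<in> carrier R"
  shows "a \<otimes>\<^bsub>Ropp\<^esub> (b \<oplus> c) = a \<otimes>\<^bsub>Ropp\<^esub> b \<oplus> a \<otimes>\<^bsub>Ropp\<^esub> c"
  using assms(1)
proof (induct rule: graded_induct)
  case (homog n a)
  then show ?case
    using assms hcomp_closed[OF homog] by (simp add: opp_left_eq opp_left_add1)
next
  case (add a d)
  then show ?case
    using assms by (simp add: opp_add1 opp_closed M.a_ac)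
qed

lemma opp_hcomp:
  assumes "a \<in> hcomp R i" "b \<in> hcomp R j"
  shows "a \<otimes>\<^bsub>Ropp\<^esub> b \<in> hcomp R (i + j)"
  using opp_homog[OF assms] hcomp_smult[OF mult_hcomp[OF assms(2,1)]] by (simp add: add.commute)

lemma opp_smult1:
  assumes "a \<in> carrier R" "b \<in> carrier R"
  shows "(c \<odot> a) \<otimes>\<^bsub>Ropp\<^esub> b = c \<odot> (a \<otimes>\<^bsub>Ropp\<^esub> b)"
  using assms(1)
proof (induct rule: graded_induct)
  case (homog i a)
  note a = homog
  show ?case
    using assms(2)
  proof (induct rule: graded_induct)
    case (homog j b)
    then show ?case
      using opp_homog[OF hcomp_smult[OF a] homog, of c] opp_homog[OF a homog] hcomp_closed[OF a] hcomp_closed[OF homog]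
      by (simp add: smult_mult smult_smult mult.commute)
  next
    case (add x y)
    then show ?case
      using hcomp_closed[OF a] by (simp add: opp_add2 smult_add opp_closed)
  qed
next
  case (add x y)
  then show ?case
    using assms by (simp add: opp_add1 smult_add opp_closed)
qed

lemma opp_smult2:
  assumes "a \<in> carrier R" "b \<in> carrier R"
  shows "a \<otimes>\<^bsub>Ropp\<^esub> (c \<odot> b) = c \<odot> (a \<otimes>\<^bsub>Ropp\<^esub> b)"
  using assms(1)
proof (induct rule: graded_induct)
  case (homog i a)
  note a = homog
  show ?case
    using assms(2)
  proof (induct rule: graded_induct)
    case (homog j b)
    then show ?case
      using opp_homog[OF a hcomp_smult[OF homog], of c] opp_homog[OF a homog] hcomp_closed[OF a] hcomp_closed[OF homog]
      by (simp add: smult_mult smult_smult mult.commute)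
  next
    case (add x y)
    then show ?case
      using hcomp_closed[OF a] by (simp add: opp_add2 smult_add opp_closed)
  qed
next
  case (add x y)
  then show ?case
    using assms by (simp add: opp_add1 smult_add opp_closed)
qed

text \<open>On homogeneous elements of degrees \<open>i\<close>, \<open>j\<close>, \<open>k\<close>
  both sides are the reversed product with the sign \<open>sg (i * j + i * k + j * k)\<close>;
  additivity in each factor does the rest.\<close>

lemma opp_assoc:
  assumes "a \<in> carrier R" "b \<in> carrier R" "c \<in> carrier R"
  shows "a \<otimes>\<^bsub>Ropp\<^esub> b \<otimes>\<^bsub>Ropp\<^esub> c = a \<otimes>\<^bsub>Ropp\<^esub> (b \<otimes>\<^bsub>Ropp\<^esub> c)"
  using assms(1)
proof (induct rule: graded_induct)
  case (homog i a)
  note a = homog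
  show ?case
    using assms(2)
  proof (induct rule: graded_induct)
    case (homog j b)
    note b = homog
    show ?case
      using assms(3)
    proof (induct rule: graded_induct)
      case (homog k c)
      note c = homog
      note cl = hcomp_closed[OF a] hcomp_closed[OF b] hcomp_closed[OF c]
      show ?case
        using opp_homog[OF opp_hcomp[OF a b] c] opp_homog[OF a opp_hcomp[OF b c]]
          opp_homog[OF a b] opp_homog[OF b c] cl
        by (simp add: smult_mult smult_smult A.m_assoc sg_add algebra_simps)
    next
      case (add x y)
      then show ?case
        using hcomp_closed[OF a] hcomp_closed[OF b] by (simp add: opp_add2 opp_closed)
    qed
  next
    case (add x y)
    then show ?case
      using hcomp_closed[OF a] assms by (simp add: opp_add1 opp_add2 opp_closed)
  qed
next
  case (add x y)
  then show ?case
    using assms by (simp add: opp_add1 opp_closed)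
qed

lemma opp_one:
  assumes "a \<in> carrier R"
  shows "\<one> \<otimes>\<^bsub>Ropp\<^esub> a = a" "a \<otimes>\<^bsub>Ropp\<^esub> \<one> = a"
proof -
  have "\<one> \<otimes>\<^bsub>Ropp\<^esub> a = a \<and> a \<otimes>\<^bsub>Ropp\<^esub> \<one> = a"
    using assms
  proof (induct rule: graded_induct)
    case (homog i a)
    then show ?case
      using opp_homog[OF one_hcomp homog] opp_homog[OF homog one_hcomp] hcomp_closed[OF homog] by simp
  qed (simp add: opp_add1 opp_add2)
  then show "\<one> \<otimes>\<^bsub>Ropp\<^esub> a = a" "a \<otimes>\<^bsub>Ropp\<^esub> \<one> = a" by auto
qed

text \<open>The rule of \<open>R\<close> is applied to the reversed product. For \<open>y\<close> of
  degree \<open>j\<close> the signs match because \<open>i * j + j\<close> is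
  \<open>(i + 1) * j\<close>, and because \<open>i + i * (j + 1)\<close> has the parity of
  \<open>i * j\<close>.\<close>

lemma opp_leibniz:
  assumes "x \<in> hcomp R i" "y \<in> carrier R"
  shows "diff R (x \<otimes>\<^bsub>Ropp\<^esub> y) = (diff R x \<otimes>\<^bsub>Ropp\<^esub> y) \<oplus> (sg i \<odot> (x \<otimes>\<^bsub>Ropp\<^esub> diff R y))"
  using assms(2)
proof (induct rule: graded_induct)
  case (homog j y)
  note cl = hcomp_closed[OF homog] hcomp_closed[OF assms(1)]
  note dcl = cl[THEN diff_closed]
  have e: "(j + 1) * i = i + i * j" for j
    by (simp add: algebra_simps)
  show ?case
    using opp_homog[OF assms(1) homog] opp_homog[OF diff_hcomp[OF assms(1)] homog]
      opp_homog[OF assms(1) diff_hcomp[OF homog]] cl dcl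
    by (simp add: diff_smult leibniz[OF homog cl(2)] smult_add smult_smult sg_add distrib_left distrib_right
        M.a_comm mult.commute mult.left_commute)
next
  case (add y z)
  then show ?case
    using hcomp_closed[OF assms(1)] diff_closed by (simp add: opp_add2 diff_add opp_closed smult_add M.a_ac)
qed

lemma dg_algebra_opp: "dg_algebra Ropp"
proof -
  have "is_complex Ropp"
    by (rule is_complex_cong[OF complex]) simp_all
  moreover have "ring Ropp"
  proof (rule ringI)
    show "abelian_group Ropp"
      by (rule abelian_groupI)
        (auto simp: M.a_ac intro: M.l_neg bexI[of _ "\<ominus>\<^bsub>R\<^esub> x" for x])
    show "Group.monoid Ropp"
      by (rule monoidI) (auto simp: opp_closed opp_one opp_assoc)
  qed (auto simp: opp_add1 opp_add2)
  ultimately show ?thesis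
    using one_hcomp opp_hcomp opp_leibniz by (auto simp: dg_algebra_def opp_smult1 opp_smult2)
qed

end


subsection \<open>A criterion for quasi-isomorphisms\<close>

text \<open>As the differential of \<open>R\<close> is zero, its cohomology classes are singletons.
  Injectivity on classes then is a statement about the kernel modulo coboundaries, tested on
  differences, and surjectivity is the splitting of each cocycle.\<close>

lemma quasi_isomorphismI:
  assumes hom: "dg_algebra_hom R S f"
    and diff0: "\<And>x. x \<in> carrier R \<Longrightarrow> diff R x = \<zero>\<^bsub>R\<^esub>"
    and inj: "\<And>n x. x \<in> hcomp R n \<Longrightarrow> f x \<in> coboundaries S n \<Longrightarrow> x = \<zero>\<^bsub>R\<^esub>"
    and surj: "\<And>n z. z \<in> cocycles S n \<Longrightarrow>
      \<exists>x\<in>hcomp R n. \<exists>h\<in>hcomp S (n - 1). z = f x \<oplus>\<^bsub>S\<^esub> diff S h"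
  shows "quasi_isomorphism R S f"
proof -
  interpret R: dg_alg R using hom by (intro dg_algI) (simp add: dg_algebra_hom_def)
  interpret S: dg_alg S using hom by (intro dg_algI) (simp add: dg_algebra_hom_def)
  have lin: "klinear R S f" and fh: "f x \<in> hcomp S n" if "x \<in> hcomp R n" for x n
    using hom that by (auto simp: dg_algebra_hom_def)
  have lin: "klinear R S f"
    using hom by (auto simp: dg_algebra_hom_def)
  let ?B = "coboundaries S"
  have subg: "subgroup (?B n) (add_monoid S)" for n
  proof (rule S.M.add.subgroupI)
    show "?B n \<subseteq> carrier S"
      using S.diff_closed S.hcomp_closed by (auto simp: coboundaries_def)
    show "?B n \<noteq> {}"
      using S.hcomp_zero by (auto simp: coboundaries_def)
    show "\<ominus>\<^bsub>S\<^esub> a \<in> ?B n" if a: "a \<in> ?B n" for a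
    proof -
      obtain h where h: "h \<in> hcomp S (n - 1)" "a = diff S h"
        using a by (auto simp: coboundaries_def)
      then have "\<ominus>\<^bsub>S\<^esub> a = diff S ((- 1) \<odot>\<^bsub>S\<^esub> h)"
        using S.smult_minus1 S.diff_smult S.diff_closed S.hcomp_closed by metis
      then show ?thesis
        using S.hcomp_smult[OF h(1)] by (auto simp: coboundaries_def)
    qed
    show "a \<oplus>\<^bsub>S\<^esub> b \<in> ?B n" if ab: "a \<in> ?B n" "b \<in> ?B n" for a b
    proof -
      obtain h k where h: "h \<in> hcomp S (n - 1)" "a = diff S h" "k \<in> hcomp S (n - 1)" "b = diff S k"
        using ab by (auto simp: coboundaries_def)
      then have "a \<oplus>\<^bsub>S\<^esub> b = diff S (h \<oplus>\<^bsub>S\<^esub> k)"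
        using S.diff_add S.hcomp_closed by metis
      then show ?thesis
        using S.hcomp_add[OF h(1,3)] by (auto simp: coboundaries_def)
    qed
  qed
  interpret B: additive_subgroup "?B n" S for n
    by (rule additive_subgroup.intro[OF subg])
  interpret B: abelian_subgroup "?B n" S for n
    by (rule abelian_subgroupI3) (unfold_locales)
  have cobR: "coboundaries R n = {\<zero>\<^bsub>R\<^esub>}" for n
    using R.hcomp_zero diff0 R.hcomp_closed by (auto simp: coboundaries_def image_def)
  have cR: "coboundaries R n +>\<^bsub>R\<^esub> x = {x}" if "x \<in> carrier R" for n x
    using that by (auto simp: cobR a_r_coset_def r_coset_def)
  have cohR: "cohomology R n = (\<lambda>x. {x}) ` hcomp R n" for n
    using cR R.hcomp_closed diff0 by (auto simp: cohomology_def cocycles_def image_def)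
  have map: "cohomology_map S f n {x} = ?B n +>\<^bsub>S\<^esub> f x" for n x
    by (simp add: cohomology_map_def)
  have "bij_betw (cohomology_map S f n) (cohomology R n) (cohomology S n)" for n
  proof (rule bij_betw_imageI)
    show "inj_on (cohomology_map S f n) (cohomology R n)"
    proof (rule inj_onI)
      fix X Y assume "X \<in> cohomology R n" "Y \<in> cohomology R n"
        and eq: "cohomology_map S f n X = cohomology_map S f n Y"
      then obtain x y where x: "x \<in> hcomp R n" "X = {x}" and y: "y \<in> hcomp R n" "Y = {y}"
        by (auto simp: cohR)
      note cl = x(1)[THEN R.hcomp_closed] y(1)[THEN R.hcomp_closed]
      note fcl = klinearD(1)[OF lin cl(1)] klinearD(1)[OF lin cl(2)]
      have "f x \<in> ?B n +>\<^bsub>S\<^esub> f y"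
        using eq B.a_rcos_self[OF fcl(1), of n] by (simp add: x y map)
      then obtain b where b: "b \<in> ?B n" "f x = b \<oplus>\<^bsub>S\<^esub> f y"
        by (auto simp: a_r_coset_def r_coset_def)
      have "f (x \<oplus>\<^bsub>R\<^esub> (- 1) \<odot>\<^bsub>R\<^esub> y) = f x \<oplus>\<^bsub>S\<^esub> (- 1) \<odot>\<^bsub>S\<^esub> f y"
        using klinearD[OF lin] cl by (simp add: R.smult_cl)
      also have "\<dots> = b"
        using b fcl B.a_Hcarr[OF b(1)] S.smult_minus1[OF fcl(2)] by (simp add: S.M.a_assoc S.M.r_neg)
      finally have "x \<oplus>\<^bsub>R\<^esub> (- 1) \<odot>\<^bsub>R\<^esub> y = \<zero>\<^bsub>R\<^esub>"
        using inj[of "x \<oplus>\<^bsub>R\<^esub> (- 1) \<odot>\<^bsub>R\<^esub> y" n] b x y by (simp add: R.hcomp_add R.hcomp_smult)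
      then have "x = y"
        using cl R.smult_minus1 by (metis R.M.add.inv_closed R.M.minus_equality R.M.minus_minus)
      then show "X = Y" by (simp add: x y)
    qed
    show "cohomology_map S f n ` cohomology R n = cohomology S n"
    proof (intro equalityI subsetI)
      fix Z assume "Z \<in> cohomology_map S f n ` cohomology R n"
      then obtain x where x: "x \<in> hcomp R n" "Z = ?B n +>\<^bsub>S\<^esub> f x"
        by (auto simp: cohR map)
      have "diff S (f x) = f (diff R x)"
        using hom R.hcomp_closed[OF x(1)] by (simp add: dg_algebra_hom_def)
      also have "\<dots> = \<zero>\<^bsub>S\<^esub>"
        using diff0[OF R.hcomp_closed[OF x(1)]] klinear_zero[OF lin R.vspace S.vspace] by simp
      finally show "Z \<in> cohomology S n"
        using x fh by (auto simp: cohomology_def cocycles_def)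
    next
      fix Z assume "Z \<in> cohomology S n"
      then obtain z where z: "z \<in> cocycles S n" "Z = ?B n +>\<^bsub>S\<^esub> z"
        by (auto simp: cohomology_def)
      obtain x h where x: "x \<in> hcomp R n" and h: "h \<in> hcomp S (n - 1)" "z = f x \<oplus>\<^bsub>S\<^esub> diff S h"
        using surj[OF z(1)] by auto
      have fx: "f x \<in> carrier S" and dh: "diff S h \<in> ?B n" "diff S h \<in> carrier S"
        using klinearD(1)[OF lin R.hcomp_closed[OF x]] h S.diff_closed S.hcomp_closed
        by (auto simp: coboundaries_def)
      have "z \<in> ?B n +>\<^bsub>S\<^esub> f x"
        using h dh(1) S.M.a_comm[OF fx dh(2)] by (auto simp: a_r_coset_def r_coset_def)
      then have "Z = ?B n +>\<^bsub>S\<^esub> f x"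
        using z(2) B.a_repr_independence'[OF _ fx] by metis
      then show "Z \<in> cohomology_map S f n ` cohomology R n"
        using x by (auto simp: cohR map intro!: image_eqI[of _ _ "{x}"])
    qed
  qed
  then show ?thesis
    using hom by (simp add: quasi_isomorphism_def)
qed


subsection \<open>The endomorphism algebra of a dg module\<close>

lemma sg_conj: "sg n * (c * sg n) = (c :: 'k::field)"
  by (simp add: mult.commute[of c])

text \<open>Addition and zero of the module are those of its type, so that \<open>finsum\<close>
  over the module becomes \<open>sum\<close> and the simplifier's rules for abelian groups
  apply.\<close>

locale dg_mod =
  fixes A :: "('k::field, 'a, 'x) dg_space_scheme" and M :: "('k, 'a, 'b, 'm::ab_group_add) dg_bimod"
  assumes left: "left_dg_module A M (lact M)"
    and add_M [simp]: "add M = (+)" and zero_M [simp]: "zero M = 0"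
begin

lemma complex_M: "is_complex M"
  using left by (simp add: left_dg_module_def)

sublocale A: dg_alg A
  using left by (intro dg_algI) (simp add: left_dg_module_def)

sublocale M: graded M
  using complex_M by (intro gradedI) (simp add: is_complex_def)

abbreviation "CM \<equiv> carrier M"

lemma uminus_M:
  assumes "x \<in> CM"
  shows "\<ominus>\<^bsub>M\<^esub> x = - x" "- x \<in> CM"
proof -
  have "x + \<ominus>\<^bsub>M\<^esub> x = 0"
    using M.M.r_neg[OF assms] by simp
  then show "\<ominus>\<^bsub>M\<^esub> x = - x"
    by (simp add: eq_neg_iff_add_eq_0 add.commute)
  then show "- x \<in> CM"
    using M.M.a_inv_closed[OF assms] by simp
qed

lemma CM_zero [simp, intro]: "0 \<in> CM"
  using M.M.zero_closed by simp

lemma CM_add [simp, intro]: "x \<in> CM \<Longrightarrow> y \<in> CM \<Longrightarrow> x + y \<in> CM"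
  using M.M.a_closed[of x y] by simp

lemma CM_diff [simp, intro]: "x \<in> CM \<Longrightarrow> y \<in> CM \<Longrightarrow> x - y \<in> CM"
  using CM_add[OF _ uminus_M(2), of x y] by simp

lemma minus_M: "x \<in> CM \<Longrightarrow> y \<in> CM \<Longrightarrow> x \<ominus>\<^bsub>M\<^esub> y = x - y"
  by (simp add: a_minus_def uminus_M)

lemma CM_sum [simp, intro]: "(\<And>n. n \<in> N \<Longrightarrow> F n \<in> CM) \<Longrightarrow> sum F N \<in> CM"
  by (induct N rule: infinite_finite_induct) auto

lemma finsum_M: "(\<And>n. n \<in> N \<Longrightarrow> F n \<in> CM) \<Longrightarrow> finsum M F N = sum F N"
  by (induct N rule: infinite_finite_induct) (auto simp: Pi_def)

lemma M_scale:
  assumes "x \<in> CM"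
  shows "y \<in> CM \<Longrightarrow> c \<odot>\<^bsub>M\<^esub> (x + y) = c \<odot>\<^bsub>M\<^esub> x + c \<odot>\<^bsub>M\<^esub> y"
    and "y \<in> CM \<Longrightarrow> c \<odot>\<^bsub>M\<^esub> (x - y) = c \<odot>\<^bsub>M\<^esub> x - c \<odot>\<^bsub>M\<^esub> y"
    and "(- c) \<odot>\<^bsub>M\<^esub> x = - (c \<odot>\<^bsub>M\<^esub> x)" "c \<odot>\<^bsub>M\<^esub> 0 = 0"
    and "c \<odot>\<^bsub>M\<^esub> (d \<odot>\<^bsub>M\<^esub> x) = (c * d) \<odot>\<^bsub>M\<^esub> x"
proof -
  have a: "c \<odot>\<^bsub>M\<^esub> (x + y) = c \<odot>\<^bsub>M\<^esub> x + c \<odot>\<^bsub>M\<^esub> y" if "x \<in> CM" "y \<in> CM" for x y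
    using M.smult_add[OF that] by simp
  show "c \<odot>\<^bsub>M\<^esub> (x + y) = c \<odot>\<^bsub>M\<^esub> x + c \<odot>\<^bsub>M\<^esub> y" if "y \<in> CM"
    using a[OF assms that] .
  show "c \<odot>\<^bsub>M\<^esub> (x - y) = c \<odot>\<^bsub>M\<^esub> x - c \<odot>\<^bsub>M\<^esub> y" if "y \<in> CM"
    using a[of "x - y" y] that assms by (simp add: algebra_simps)
  have "(- c) \<odot>\<^bsub>M\<^esub> x + c \<odot>\<^bsub>M\<^esub> x = 0"
    using M.smult_add_left[OF assms, of "- c" c] assms by simp
  then show "(- c) \<odot>\<^bsub>M\<^esub> x = - (c \<odot>\<^bsub>M\<^esub> x)"
    by (simp add: eq_neg_iff_add_eq_0)
  show "c \<odot>\<^bsub>M\<^esub> 0 = 0"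
    using M.smult_zero[of c] by simp
  show "c \<odot>\<^bsub>M\<^esub> (d \<odot>\<^bsub>M\<^esub> x) = (c * d) \<odot>\<^bsub>M\<^esub> x"
    by (rule M.smult_smult[OF assms])
qed

lemma klinear_d: "klinear M M (diff M)"
  using complex_M by (simp add: is_complex_def)

lemma d_props:
  assumes "x \<in> CM"
  shows d_closed: "diff M x \<in> CM" and d_smult: "diff M (c \<odot>\<^bsub>M\<^esub> x) = c \<odot>\<^bsub>M\<^esub> diff M x"
    and d_add: "y \<in> CM \<Longrightarrow> diff M (x + y) = diff M x + diff M y"
    and d_diff: "y \<in> CM \<Longrightarrow> diff M (x - y) = diff M x - diff M y"
    and dd: "diff M (diff M x) = 0"
proof -
  have a: "diff M (x + y) = diff M x + diff M y" if "x \<in> CM" "y \<in> CM" for x y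
    using klinearD(2)[OF klinear_d that] by simp
  show "diff M (x + y) = diff M x + diff M y" if "y \<in> CM"
    using a[OF assms that] .
  show "diff M (x - y) = diff M x - diff M y" if "y \<in> CM"
    using a[of "x - y" y] that assms by (simp add: algebra_simps)
qed (use klinearD[OF klinear_d, of x] complex_M assms in \<open>auto simp: is_complex_def\<close>)

lemma d_hcomp: "x \<in> hcomp M n \<Longrightarrow> diff M x \<in> hcomp M (n + 1)"
  using complex_M by (auto simp: is_complex_def)

lemma klinear_lact: "a \<in> carrier A \<Longrightarrow> klinear M M (lact M a)"
  using left by (simp add: left_dg_module_def)

lemma lact_props:
  assumes "a \<in> carrier A" "x \<in> CM"
  shows lact_closed: "lact M a x \<in> CM"
    and lact_smult: "lact M a (c \<odot>\<^bsub>M\<^esub> x) = c \<odot>\<^bsub>M\<^esub> lact M a x"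
    and lact_add: "y \<in> CM \<Longrightarrow> lact M a (x + y) = lact M a x + lact M a y"
    and lact_diff: "y \<in> CM \<Longrightarrow> lact M a (x - y) = lact M a x - lact M a y"
proof -
  have add: "lact M a (x + y) = lact M a x + lact M a y" if "x \<in> CM" "y \<in> CM" for x y
    using klinearD(2)[OF klinear_lact[OF assms(1)] that] by simp
  show "lact M a (x + y) = lact M a x + lact M a y" if "y \<in> CM"
    using add[OF assms(2) that] .
  show "lact M a (x - y) = lact M a x - lact M a y" if "y \<in> CM"
    using add[of "x - y" y] that assms by (simp add: algebra_simps)
qed (use klinearD[OF klinear_lact[OF assms(1)] assms(2)] assms in auto)

lemma lact_hcomp: "a \<in> hcomp A i \<Longrightarrow> x \<in> hcomp M j \<Longrightarrow> lact M a x \<in> hcomp M (i + j)"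
  using left by (simp add: left_dg_module_def)

lemma d_lact:
  "a \<in> hcomp A i \<Longrightarrow> x \<in> CM \<Longrightarrow> diff M (lact M a x) = lact M (diff A a) x + sg i \<odot>\<^bsub>M\<^esub> lact M a (diff M x)"
  using left by (simp add: left_dg_module_def)

abbreviation "E \<equiv> End_graded A M"

lemma E_simps [simp]:
  "mult E = compose CM" "one E = (\<lambda>m\<in>CM. m)" "zero E = (\<lambda>m\<in>CM. 0)"
  "add E = (\<lambda>f g. \<lambda>m\<in>CM. f m + g m)" "smult E = (\<lambda>c f. \<lambda>m\<in>CM. c \<odot>\<^bsub>M\<^esub> f m)" "hcomp E = End_deg A M"
  by (simp_all add: End_graded_def)

lemma End_degI:
  assumes "f \<in> extensional CM" "\<And>x. x \<in> CM \<Longrightarrow> f x \<in> CM"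
    "\<And>x y. x \<in> CM \<Longrightarrow> y \<in> CM \<Longrightarrow> f (x + y) = f x + f y"
    "\<And>c x. x \<in> CM \<Longrightarrow> f (c \<odot>\<^bsub>M\<^esub> x) = c \<odot>\<^bsub>M\<^esub> f x"
    "\<And>i x. x \<in> hcomp M i \<Longrightarrow> f x \<in> hcomp M (i + n)"
    "\<And>i a x. a \<in> hcomp A i \<Longrightarrow> x \<in> CM \<Longrightarrow> f (lact M a x) = sg (n * i) \<odot>\<^bsub>M\<^esub> lact M a (f x)"
  shows "f \<in> End_deg A M n"
  using assms by (auto simp: End_deg_def klinear_def)

lemma End_degD:
  assumes "f \<in> End_deg A M n"
  shows "f \<in> extensional CM" "x \<in> CM \<Longrightarrow> f x \<in> CM"
    "x \<in> CM \<Longrightarrow> y \<in> CM \<Longrightarrow> f (x + y) = f x + f y"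
    "x \<in> CM \<Longrightarrow> f (c \<odot>\<^bsub>M\<^esub> x) = c \<odot>\<^bsub>M\<^esub> f x"
    "x \<in> hcomp M i \<Longrightarrow> f x \<in> hcomp M (i + n)"
    "a \<in> hcomp A i \<Longrightarrow> x \<in> CM \<Longrightarrow> f (lact M a x) = sg (n * i) \<odot>\<^bsub>M\<^esub> lact M a (f x)"
  using assms by (auto simp: End_deg_def klinear_def image_subset_iff)

lemma End_degD_diff:
  assumes "f \<in> End_deg A M n" "x \<in> CM" "y \<in> CM"
  shows "f (x - y) = f x - f y"
  using End_degD(3)[OF assms(1), of "x - y" y] assms by simp

lemma End_deg_zero: "(\<lambda>m\<in>CM. 0) \<in> End_deg A M n"
proof (rule End_degI)
  show "(\<lambda>m\<in>CM. 0) x \<in> hcomp M (i + n)" if "x \<in> hcomp M i" for i x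
    using M.hcomp_zero[of "i + n"] M.hcomp_closed[OF that] by simp
  show "(\<lambda>m\<in>CM. 0) (lact M a x) = sg (n * i) \<odot>\<^bsub>M\<^esub> lact M a ((\<lambda>m\<in>CM. 0) x)"
    if "a \<in> hcomp A i" "x \<in> CM" for i a x
    using lact_diff[OF A.hcomp_closed[OF that(1)], of x x] lact_closed[OF A.hcomp_closed[OF that(1)]] that
    by (simp add: M_scale(4)[OF that(2)])
qed (auto simp: M_scale(4)[of 0])

lemma End_deg_add:
  assumes f: "f \<in> End_deg A M n" and g: "g \<in> End_deg A M n"
  shows "(\<lambda>m\<in>CM. f m + g m) \<in> End_deg A M n"
proof (rule End_degI)
  show "(\<lambda>m\<in>CM. f m + g m) x \<in> hcomp M (i + n)" if "x \<in> hcomp M i" for i x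
    using M.hcomp_add[OF End_degD(5)[OF f that] End_degD(5)[OF g that]] M.hcomp_closed[OF that] by simp
qed (use End_degD[OF f] End_degD[OF g] in
    \<open>auto simp: M_scale lact_add A.hcomp_closed lact_closed algebra_simps\<close>)

lemma End_deg_smult:
  assumes f: "f \<in> End_deg A M n"
  shows "(\<lambda>m\<in>CM. c \<odot>\<^bsub>M\<^esub> f m) \<in> End_deg A M n"
proof (rule End_degI)
  show "(\<lambda>m\<in>CM. c \<odot>\<^bsub>M\<^esub> f m) x \<in> hcomp M (i + n)" if "x \<in> hcomp M i" for i x
    using M.hcomp_smult[OF End_degD(5)[OF f that]] M.hcomp_closed[OF that] by simp
qed (use End_degD[OF f] in
    \<open>auto simp: M_scale lact_smult A.hcomp_closed lact_closed mult.commute\<close>)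

lemma End_deg_one: "(\<lambda>m\<in>CM. m) \<in> End_deg A M 0"
  by (rule End_degI) (auto simp: A.hcomp_closed lact_closed dest: M.hcomp_closed)

lemma End_deg_compose:
  assumes f: "f \<in> End_deg A M m" and g: "g \<in> End_deg A M n"
  shows "compose CM f g \<in> End_deg A M (m + n)"
proof (rule End_degI)
  show "compose CM f g x \<in> hcomp M (i + (m + n))" if "x \<in> hcomp M i" for i x
    using End_degD(5)[OF f End_degD(5)[OF g that]] M.hcomp_closed[OF that]
    by (simp add: compose_def algebra_simps)
  show "compose CM f g (lact M a x) = sg ((m + n) * i) \<odot>\<^bsub>M\<^esub> lact M a (compose CM f g x)"
    if "a \<in> hcomp A i" "x \<in> CM" for i a x
    using that End_degD[OF f] End_degD[OF g]
    by (simp add: compose_def M_scale A.hcomp_closed lact_closed sg_add distrib_right mult.commute[of "sg (n * i)"])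
qed (use End_degD[OF f] End_degD[OF g] in \<open>auto simp: compose_def\<close>)

lemma carrier_EI:
  assumes "finite N" "\<And>n. n \<in> N \<Longrightarrow> F n \<in> End_deg A M n"
  shows "(\<lambda>m\<in>CM. \<Sum>n\<in>N. F n m) \<in> carrier E"
proof -
  have "(\<lambda>m\<in>CM. \<Sum>n\<in>N. F n m) = (\<lambda>m\<in>CM. \<Oplus>\<^bsub>M\<^esub>n\<in>N. F n m)"
    using End_degD(2)[OF assms(2)] by (auto simp: fun_eq_iff finsum_M)
  then show ?thesis
    using assms by (auto simp: End_graded_def)
qed

lemma carrier_EE:
  assumes "f \<in> carrier E"
  obtains N F where "finite N" "\<And>n. F n \<in> End_deg A M n" "f = (\<lambda>m\<in>CM. \<Sum>n\<in>N. F n m)"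
proof -
  obtain N F where N: "finite N" "\<And>n. n \<in> N \<Longrightarrow> F n \<in> End_deg A M n" "f = (\<lambda>m\<in>CM. \<Oplus>\<^bsub>M\<^esub>n\<in>N. F n m)"
    using assms by (auto simp: End_graded_def)
  \<comment> \<open>Outside \<open>N\<close> the family is filled up with the zero map, which is
    homogeneous of every degree.\<close>
  let ?F = "\<lambda>n. if n \<in> N then F n else (\<lambda>m\<in>CM. 0)"
  have "f = (\<lambda>m\<in>CM. \<Sum>n\<in>N. ?F n m)"
    unfolding N(3) using End_degD(2)[OF N(2)] by (auto simp: fun_eq_iff finsum_M)
  then show ?thesis
    using that[of N ?F] N End_deg_zero by auto
qed

lemma carrier_E_homog: "f \<in> End_deg A M n \<Longrightarrow> f \<in> carrier E"
  using carrier_EI[of "{n}" "\<lambda>_. f"] End_degD(1)[of f n] by (simp add: extensional_restrict)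

lemma carrier_ED:
  assumes "f \<in> carrier E"
  shows "f \<in> extensional CM" "x \<in> CM \<Longrightarrow> f x \<in> CM"
    "x \<in> CM \<Longrightarrow> y \<in> CM \<Longrightarrow> f (x + y) = f x + f y"
    "x \<in> CM \<Longrightarrow> f (c \<odot>\<^bsub>M\<^esub> x) = c \<odot>\<^bsub>M\<^esub> f x"
proof -
  obtain N F where f: "\<And>n. F n \<in> End_deg A M n" "f = (\<lambda>m\<in>CM. \<Sum>n\<in>N. F n m)"
    using carrier_EE[OF assms] by metis
  note F = End_degD[OF f(1)]
  have "(\<Sum>n\<in>N. c \<odot>\<^bsub>M\<^esub> F n x) = c \<odot>\<^bsub>M\<^esub> (\<Sum>n\<in>N. F n x)" if "x \<in> CM" for c x
    using F(2) that by (induct N rule: infinite_finite_induct) (auto simp: M_scale)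
  then show "f \<in> extensional CM" "x \<in> CM \<Longrightarrow> f x \<in> CM"
    "x \<in> CM \<Longrightarrow> y \<in> CM \<Longrightarrow> f (x + y) = f x + f y"
    "x \<in> CM \<Longrightarrow> f (c \<odot>\<^bsub>M\<^esub> x) = c \<odot>\<^bsub>M\<^esub> f x"
    using F by (auto simp: f(2) sum.distrib)
qed

lemma carrier_ED_zero: "f \<in> carrier E \<Longrightarrow> f 0 = 0"
  using carrier_ED(3)[of f 0 0] by simp

lemma carrier_E_add:
  assumes "f \<in> carrier E" "g \<in> carrier E"
  shows "(\<lambda>m\<in>CM. f m + g m) \<in> carrier E"
proof -
  obtain N F where f: "finite N" "\<And>n. F n \<in> End_deg A M n" "f = (\<lambda>m\<in>CM. \<Sum>n\<in>N. F n m)"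
    using carrier_EE[OF assms(1)] by metis
  obtain N' G where g: "finite N'" "\<And>n. G n \<in> End_deg A M n" "g = (\<lambda>m\<in>CM. \<Sum>n\<in>N'. G n m)"
    using carrier_EE[OF assms(2)] by metis
  let ?z = "\<lambda>m\<in>CM. 0"
  let ?H = "\<lambda>n. \<lambda>m\<in>CM. (if n \<in> N then F n else ?z) m + (if n \<in> N' then G n else ?z) m"
  have "(\<Sum>n\<in>N. F n m) = (\<Sum>n\<in>N \<union> N'. (if n \<in> N then F n else ?z) m)"
    "(\<Sum>n\<in>N'. G n m) = (\<Sum>n\<in>N \<union> N'. (if n \<in> N' then G n else ?z) m)" if "m \<in> CM" for m
    using that f(1) g(1) by (auto intro!: sum.mono_neutral_cong_left)
  then have "(\<lambda>m\<in>CM. f m + g m) = (\<lambda>m\<in>CM. \<Sum>n\<in>N \<union> N'. ?H n m)"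
    by (auto simp: f(3) g(3) sum.distrib fun_eq_iff restrict_def)
  moreover have "?H n \<in> End_deg A M n" for n
    using f(2) g(2) End_deg_zero by (intro End_deg_add) auto
  ultimately show ?thesis
    using carrier_EI[of "N \<union> N'" ?H] f(1) g(1) by simp
qed

lemma carrier_E_smult:
  assumes "f \<in> carrier E"
  shows "(\<lambda>m\<in>CM. c \<odot>\<^bsub>M\<^esub> f m) \<in> carrier E"
proof -
  obtain N F where f: "finite N" "\<And>n. F n \<in> End_deg A M n" "f = (\<lambda>m\<in>CM. \<Sum>n\<in>N. F n m)"
    using carrier_EE[OF assms] by metis
  have "c \<odot>\<^bsub>M\<^esub> (\<Sum>n\<in>N. F n x) = (\<Sum>n\<in>N. c \<odot>\<^bsub>M\<^esub> F n x)" if "x \<in> CM" for x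
    using End_degD(2)[OF f(2)] that by (induct N rule: infinite_finite_induct) (auto simp: M_scale(1,4)[of x] M_scale)
  then have "(\<lambda>m\<in>CM. c \<odot>\<^bsub>M\<^esub> f m) = (\<lambda>m\<in>CM. \<Sum>n\<in>N. (\<lambda>m\<in>CM. c \<odot>\<^bsub>M\<^esub> F n m) m)"
    by (auto simp: f(3) fun_eq_iff)
  then show ?thesis
    using carrier_EI[OF f(1), of "\<lambda>n. \<lambda>m\<in>CM. c \<odot>\<^bsub>M\<^esub> F n m"] End_deg_smult[OF f(2)] by simp
qed

lemma module_E: "Module.module field_ring E"
proof (rule module_fieldI)
  show "abelian_group E"
  proof (rule abelian_groupI)
    show "\<exists>y\<in>carrier E. y \<oplus>\<^bsub>E\<^esub> x = \<zero>\<^bsub>E\<^esub>" if "x \<in> carrier E" for x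
      using carrier_E_smult[OF that, of "- 1"] carrier_ED[OF that]
      by (intro bexI[of _ "\<lambda>m\<in>CM. (- 1) \<odot>\<^bsub>M\<^esub> x m"]) (auto simp: fun_eq_iff M_scale)
    show "x \<oplus>\<^bsub>E\<^esub> y \<in> carrier E" if "x \<in> carrier E" "y \<in> carrier E" for x y
      using carrier_E_add[OF that] by simp
    show "\<zero>\<^bsub>E\<^esub> \<in> carrier E"
      using carrier_E_homog[OF End_deg_zero] by simp
    show "\<zero>\<^bsub>E\<^esub> \<oplus>\<^bsub>E\<^esub> x = x" if "x \<in> carrier E" for x
      using carrier_ED(1)[OF that] by (auto intro: extensionalityI)
  qed (simp_all add: add_ac cong: restrict_cong)
  show "c \<odot>\<^bsub>E\<^esub> x \<in> carrier E" if "x \<in> carrier E" for c x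
    using carrier_E_smult[OF that] by simp
  show "(c + d) \<odot>\<^bsub>E\<^esub> x = c \<odot>\<^bsub>E\<^esub> x \<oplus>\<^bsub>E\<^esub> d \<odot>\<^bsub>E\<^esub> x" if "x \<in> carrier E" for c d x
    using carrier_ED(2)[OF that] M.smult_add_left by (simp cong: restrict_cong)
  show "c \<odot>\<^bsub>E\<^esub> (x \<oplus>\<^bsub>E\<^esub> y) = c \<odot>\<^bsub>E\<^esub> x \<oplus>\<^bsub>E\<^esub> c \<odot>\<^bsub>E\<^esub> y" if "x \<in> carrier E" "y \<in> carrier E" for c x y
    using carrier_ED(2)[OF that(1)] carrier_ED(2)[OF that(2)] by (simp add: M_scale cong: restrict_cong)
  show "(c * d) \<odot>\<^bsub>E\<^esub> x = c \<odot>\<^bsub>E\<^esub> (d \<odot>\<^bsub>E\<^esub> x)" if "x \<in> carrier E" for c d x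
    using carrier_ED(2)[OF that] by (simp add: M_scale cong: restrict_cong)
  show "1 \<odot>\<^bsub>E\<^esub> x = x" if "x \<in> carrier E" for x
    using carrier_ED(1,2)[OF that] by (auto intro: extensionalityI)
qed

sublocale E: vspace E
  by (rule vspace.intro) (rule module_E)

lemma finsum_E:
  assumes "\<And>n. n \<in> N \<Longrightarrow> F n \<in> carrier E" "finite N"
  shows "finsum E F N = (\<lambda>m\<in>CM. \<Sum>n\<in>N. F n m)"
  using assms(2,1)
proof (induct N rule: finite_induct)
  case empty
  then show ?case
    using E.M.finsum_empty[of F] by (auto simp: fun_eq_iff)
next
  case (insert n N)
  then have "finsum E F (insert n N) = F n \<oplus>\<^bsub>E\<^esub> finsum E F N"
    by (intro E.M.finsum_insert) auto
  then show ?case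
    using insert by (auto simp: fun_eq_iff)
qed

text \<open>Evaluated at an element of degree \<open>i\<close>, the maps \<open>F n\<close> take
  values in the components \<open>i + n\<close>, which are different for different \<open>n\<close>;
  so each value vanishes by uniqueness of homogeneous parts in \<open>M\<close>.\<close>

lemma E_sum_homog_zero:
  assumes "finite N" "\<And>n. F n \<in> End_deg A M n" "(\<lambda>m\<in>CM. \<Sum>n\<in>N. F n m) = (\<lambda>m\<in>CM. 0)" "n \<in> N"
  shows "F n = (\<lambda>m\<in>CM. 0)"
proof (rule extensionalityI)
  fix m assume "m \<in> CM"
  then have "F n m = 0"
  proof (induct rule: M.graded_induct)
    case (homog i m)
    note m = M.hcomp_closed[OF homog]
    let ?N = "(\<lambda>n. i + n) ` N" and ?G = "\<lambda>k. F (k - i) m"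
    have G: "?G k \<in> hcomp M k" for k
      using End_degD(5)[OF assms(2) homog, of "k - i"] by simp
    have "finsum M ?G ?N = sum ?G ?N"
      using G M.hcomp_closed by (intro finsum_M) blast
    also have "\<dots> = (\<Sum>n\<in>N. F n m)"
      by (subst sum.reindex) (auto simp: inj_on_def)
    also have "\<dots> = 0"
      using fun_cong[OF assms(3), of m] m by simp
    finally have "hpart M 0 (i + n) = F n m"
      using M.hpart_finsum[of ?N ?G] G assms(1,4) by auto
    then show ?case
      using M.hpart_homog[OF M.hcomp_zero, of "i + n"] by (auto simp: fun_eq_iff split: if_splits)
  next
    case (add y z)
    then show ?case using End_degD(3)[OF assms(2)] by simp
  qed
  then show "F n m = (\<lambda>m\<in>CM. 0) m"
    using \<open>m \<in> CM\<close> by simp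
qed (use End_degD(1)[OF assms(2)] in auto)

lemma is_graded_E: "is_graded E"
proof (rule is_gradedI)
  show "submodule (hcomp E n) field_ring E" for n
    using carrier_E_homog End_deg_zero End_deg_add End_deg_smult
    by (intro E.submodule_fieldI) auto
next
  fix f P assume "f \<in> carrier E" and P: "\<And>n y. y \<in> hcomp E n \<Longrightarrow> P y"
    "\<And>y z. y \<in> carrier E \<Longrightarrow> z \<in> carrier E \<Longrightarrow> P y \<Longrightarrow> P z \<Longrightarrow> P (y \<oplus>\<^bsub>E\<^esub> z)"
  then obtain N F where f: "finite N" "\<And>n. F n \<in> End_deg A M n" "f = (\<lambda>m\<in>CM. \<Sum>n\<in>N. F n m)"
    using carrier_EE by metis
  from f(1) have "P (\<lambda>m\<in>CM. \<Sum>n\<in>N. F n m)"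
  proof (induct N rule: finite_induct)
    case empty
    have eq: "(\<lambda>m\<in>CM. \<Sum>n\<in>{}. F n m) = (\<lambda>m\<in>CM. 0)" by simp
    show ?case
      unfolding eq using P(1)[of "\<lambda>m\<in>CM. 0" 0] End_deg_zero unfolding E_simps by blast
  next
    case (insert n N)
    have "(\<lambda>m\<in>CM. \<Sum>n\<in>insert n N. F n m) = F n \<oplus>\<^bsub>E\<^esub> (\<lambda>m\<in>CM. \<Sum>n\<in>N. F n m)"
      using insert by (auto simp: fun_eq_iff)
    moreover have "P (F n)"
      using P(1)[of "F n" n] f(2) by simp
    ultimately show ?case
      using P(2)[OF carrier_E_homog[OF f(2)] carrier_EI[OF insert.hyps(1) f(2)] _ insert.hyps(3)] by (simp only:)
  qed
  then show "P f" by (simp add: f(3))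
next
  fix f N n assume N: "finite N" "\<And>n. f n \<in> hcomp E n" "finsum E f N = \<zero>\<^bsub>E\<^esub>" "n \<in> N"
  have "finsum E f N = (\<lambda>m\<in>CM. \<Sum>n\<in>N. f n m)"
    using N carrier_E_homog by (intro finsum_E) auto
  then show "f n = \<zero>\<^bsub>E\<^esub>"
    using E_sum_homog_zero[of N f n] N by simp
qed (rule module_E)

sublocale E: graded E
  by (rule gradedI) (rule is_graded_E)

lemma carrier_E_compose:
  assumes "f \<in> carrier E" "g \<in> carrier E"
  shows "compose CM f g \<in> carrier E"
  using assms(1)
proof (induct rule: E.graded_induct)
  case (homog i f)
  note f = homog
  show ?case
    using assms(2)
  proof (induct rule: E.graded_induct)
    case (homog j g)
    then show ?case
      using End_deg_compose[of f i g j] f carrier_E_homog by simp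
  next
    case (add g h)
    have "compose CM f (g \<oplus>\<^bsub>E\<^esub> h) = compose CM f g \<oplus>\<^bsub>E\<^esub> compose CM f h"
      using End_degD(3)[of f i] f carrier_ED(2)[OF add(1)] carrier_ED(2)[OF add(2)]
      by (auto simp: fun_eq_iff compose_def)
    then show ?case
      using E.M.a_closed[OF add(3,4)] by (simp only:)
  qed
next
  case (add f h)
  have "compose CM (f \<oplus>\<^bsub>E\<^esub> h) g = compose CM f g \<oplus>\<^bsub>E\<^esub> compose CM h g"
    using carrier_ED(2)[OF assms(2)] by (auto simp: fun_eq_iff compose_def)
  then show ?case
    using E.M.a_closed[OF add(3,4)] by (simp only:)
qed

lemma ring_E: "ring E"
proof (rule ringI)
  show "abelian_group E" ..
  show "Group.monoid E"
  proof (rule monoidI)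
    show "\<one>\<^bsub>E\<^esub> \<in> carrier E"
      using carrier_E_homog[OF End_deg_one] by simp
    show "x \<otimes>\<^bsub>E\<^esub> y \<in> carrier E" if "x \<in> carrier E" "y \<in> carrier E" for x y
      using carrier_E_compose[OF that] by simp
    show "x \<otimes>\<^bsub>E\<^esub> y \<otimes>\<^bsub>E\<^esub> z = x \<otimes>\<^bsub>E\<^esub> (y \<otimes>\<^bsub>E\<^esub> z)" if "z \<in> carrier E" for x y z
      using carrier_ED(2)[OF that] by (simp add: compose_def cong: restrict_cong)
    show "\<one>\<^bsub>E\<^esub> \<otimes>\<^bsub>E\<^esub> x = x" "x \<otimes>\<^bsub>E\<^esub> \<one>\<^bsub>E\<^esub> = x" if "x \<in> carrier E" for x
      using carrier_ED(1,2)[OF that] by (auto intro: extensionalityI simp: compose_def)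
  qed
  show "(x \<oplus>\<^bsub>E\<^esub> y) \<otimes>\<^bsub>E\<^esub> z = x \<otimes>\<^bsub>E\<^esub> z \<oplus>\<^bsub>E\<^esub> y \<otimes>\<^bsub>E\<^esub> z" if "z \<in> carrier E" for x y z
    using carrier_ED(2)[OF that] by (simp add: compose_def cong: restrict_cong)
  show "z \<otimes>\<^bsub>E\<^esub> (x \<oplus>\<^bsub>E\<^esub> y) = z \<otimes>\<^bsub>E\<^esub> x \<oplus>\<^bsub>E\<^esub> z \<otimes>\<^bsub>E\<^esub> y"
    if "x \<in> carrier E" "y \<in> carrier E" "z \<in> carrier E" for x y z
    using carrier_ED[OF that(3)] carrier_ED(2)[OF that(1)] carrier_ED(2)[OF that(2)]
    by (simp add: compose_def cong: restrict_cong)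
qed

abbreviation "dgE \<equiv> dg_End A M"

definition dE :: "('m \<Rightarrow> 'm) \<Rightarrow> 'm \<Rightarrow> 'm" where
  "dE f = (\<lambda>m\<in>CM. diff M (f m) \<ominus>\<^bsub>M\<^esub> (\<Oplus>\<^bsub>M\<^esub>n\<in>hsupp E f. sg n \<odot>\<^bsub>M\<^esub> hpart E f n (diff M m)))"

lemma dgE_simps [simp]:
  "carrier dgE = carrier E" "mult dgE = compose CM" "one dgE = (\<lambda>m\<in>CM. m)" "zero dgE = (\<lambda>m\<in>CM. 0)"
  "add dgE = (\<lambda>f g. \<lambda>m\<in>CM. f m + g m)" "smult dgE = (\<lambda>c f. \<lambda>m\<in>CM. c \<odot>\<^bsub>M\<^esub> f m)"
  "hcomp dgE = End_deg A M" "diff dgE = dE"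
  by (simp_all add: dg_End_def graded_space.defs dg_space.defs dE_def[abs_def] End_graded_def)

lemma
  assumes m: "m \<in> CM"
  shows dE_homog: "f \<in> End_deg A M n \<Longrightarrow> dE f m = diff M (f m) - sg n \<odot>\<^bsub>M\<^esub> f (diff M m)"
    and dE_closed': "f \<in> carrier E \<Longrightarrow> dE f m \<in> CM"
    and dE_add': "f \<in> carrier E \<Longrightarrow> g \<in> carrier E \<Longrightarrow> dE (f \<oplus>\<^bsub>E\<^esub> g) m = dE f m + dE g m"
proof -
  have W: "abelian_group M" ..
  have 1: "sg n \<odot>\<^bsub>M\<^esub> f (diff M m) \<in> carrier M" if "f \<in> hcomp E n" for n f
    using that m End_degD(2)[of f n] by (auto simp: d_closed)
  have 2: "sg n \<odot>\<^bsub>M\<^esub> (f \<oplus>\<^bsub>E\<^esub> g) (diff M m) = sg n \<odot>\<^bsub>M\<^esub> f (diff M m) \<oplus>\<^bsub>M\<^esub> sg n \<odot>\<^bsub>M\<^esub> g (diff M m)"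
    if "f \<in> hcomp E n" "g \<in> hcomp E n" for n f g
    using that m End_degD(2)[of f n] End_degD(2)[of g n] by (simp add: d_closed M_scale)
  have cl: "f \<in> carrier E \<Longrightarrow> (\<Oplus>\<^bsub>M\<^esub>n\<in>hsupp E f. sg n \<odot>\<^bsub>M\<^esub> hpart E f n (diff M m)) \<in> CM" for f
    by (rule E.hsum_closed[OF W, of "\<lambda>n f. sg n \<odot>\<^bsub>M\<^esub> f (diff M m)"]) (assumption | rule 1 2)+
  have hom: "f \<in> hcomp E n \<Longrightarrow> (\<Oplus>\<^bsub>M\<^esub>n\<in>hsupp E f. sg n \<odot>\<^bsub>M\<^esub> hpart E f n (diff M m)) = sg n \<odot>\<^bsub>M\<^esub> f (diff M m)" for f n
    by (rule E.hsum_homog[OF W, of "\<lambda>n f. sg n \<odot>\<^bsub>M\<^esub> f (diff M m)"]) (assumption | rule 1 2)+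
  have add: "f \<in> carrier E \<Longrightarrow> g \<in> carrier E \<Longrightarrow> (\<Oplus>\<^bsub>M\<^esub>n\<in>hsupp E (f \<oplus>\<^bsub>E\<^esub> g). sg n \<odot>\<^bsub>M\<^esub> hpart E (f \<oplus>\<^bsub>E\<^esub> g) n (diff M m)) =
      (\<Oplus>\<^bsub>M\<^esub>n\<in>hsupp E f. sg n \<odot>\<^bsub>M\<^esub> hpart E f n (diff M m)) \<oplus>\<^bsub>M\<^esub> (\<Oplus>\<^bsub>M\<^esub>n\<in>hsupp E g. sg n \<odot>\<^bsub>M\<^esub> hpart E g n (diff M m))" for f g
    by (rule E.hsum_add[OF W, of "\<lambda>n f. sg n \<odot>\<^bsub>M\<^esub> f (diff M m)"]) (assumption | rule 1 2)+
  show "dE f m = diff M (f m) - sg n \<odot>\<^bsub>M\<^esub> f (diff M m)" if "f \<in> End_deg A M n"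
    using hom[of f n] that m End_degD(2)[OF that] by (simp add: dE_def minus_M d_closed)
  show "dE f m \<in> CM" if "f \<in> carrier E"
    using cl[of f] that m carrier_ED(2)[OF that] by (simp add: dE_def minus_M d_closed)
  show "dE (f \<oplus>\<^bsub>E\<^esub> g) m = dE f m + dE g m" if fg: "f \<in> carrier E" "g \<in> carrier E"
  proof -
    have fgm: "(f \<oplus>\<^bsub>E\<^esub> g) m = f m + g m" using m by simp
    show ?thesis
      using add[of f g] cl[OF fg(1)] cl[OF fg(2)] fg m carrier_ED(2)[OF fg(1)] carrier_ED(2)[OF fg(2)]
      unfolding dE_def restrict_apply'[OF m] fgm
      by (simp del: E_simps add: minus_M d_closed d_add)
  qed
qed

lemma dE_hcomp:
  assumes f: "f \<in> End_deg A M n"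
  shows "dE f \<in> End_deg A M (n + 1)"
proof (rule End_degI)
  note F = End_degD[OF f] and hc = M.hcomp_closed and ac = A.hcomp_closed
  show "dE f \<in> extensional CM" by (simp add: dE_def)
  show "dE f x \<in> CM" if "x \<in> CM" for x
    using dE_closed'[OF that carrier_E_homog[OF f]] .
  show "dE f (x + y) = dE f x + dE f y" if "x \<in> CM" "y \<in> CM" for x y
    using that F by (simp add: dE_homog[OF _ f] d_add d_closed M_scale)
  show "dE f (c \<odot>\<^bsub>M\<^esub> x) = c \<odot>\<^bsub>M\<^esub> dE f x" if "x \<in> CM" for c x
    using that F by (simp add: dE_homog[OF _ f] d_smult d_closed M_scale mult.commute)
  show "dE f x \<in> hcomp M (i + (n + 1))" if "x \<in> hcomp M i" for i x
  proof -
    have "diff M (f x) \<in> hcomp M (i + (n + 1))"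
      using d_hcomp[OF F(5)[OF that]] by (simp add: algebra_simps)
    moreover have "(- sg n) \<odot>\<^bsub>M\<^esub> f (diff M x) \<in> hcomp M (i + (n + 1))"
      using M.hcomp_smult[OF F(5)[OF d_hcomp[OF that]]] by (simp add: algebra_simps)
    ultimately show ?thesis
      using M.hcomp_add[of "diff M (f x)" "i + (n + 1)" "(- sg n) \<odot>\<^bsub>M\<^esub> f (diff M x)"] hc[OF that] F(2)
      by (simp add: dE_homog[OF _ f] M_scale d_closed)
  qed
  show "dE f (lact M a x) = sg ((n + 1) * i) \<odot>\<^bsub>M\<^esub> lact M a (dE f x)"
    if a: "a \<in> hcomp A i" and x: "x \<in> CM" for i a x
  proof -
    note da = A.diff_hcomp[OF a]
    have 1: "diff M (f (lact M a x)) =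
      sg (n * i) \<odot>\<^bsub>M\<^esub> lact M (diff A a) (f x) + (sg (n * i) * sg i) \<odot>\<^bsub>M\<^esub> lact M a (diff M (f x))"
      using a x F da by (simp add: d_smult lact_closed ac d_lact M_scale d_closed)
    have 2: "sg n \<odot>\<^bsub>M\<^esub> f (diff M (lact M a x)) =
      sg (n * i) \<odot>\<^bsub>M\<^esub> lact M (diff A a) (f x) + (sg n * (sg i * sg (n * i))) \<odot>\<^bsub>M\<^esub> lact M a (f (diff M x))"
      using a x F da by (simp add: lact_closed ac d_lact M_scale d_closed sg_add distrib_left sg_conj)
    have "dE f (lact M a x) = diff M (f (lact M a x)) - sg n \<odot>\<^bsub>M\<^esub> f (diff M (lact M a x))"
      by (rule dE_homog[OF lact_closed[OF ac[OF a] x] f])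
    \<comment> \<open>The terms with \<open>diff A a\<close> occur in 1 and 2 with the same sign
      \<open>sg (n * i)\<close> and cancel.\<close>
    also have "\<dots> = (sg (n * i) * sg i) \<odot>\<^bsub>M\<^esub> lact M a (diff M (f x)) -
        (sg n * (sg i * sg (n * i))) \<odot>\<^bsub>M\<^esub> lact M a (f (diff M x))"
      unfolding 1 2 by simp
    also have "\<dots> = (sg (n * i) * sg i) \<odot>\<^bsub>M\<^esub> lact M a (dE f x)"
      using a x F
      by (simp add: dE_homog[OF _ f] lact_closed ac M_scale lact_diff lact_smult d_closed mult_ac)
    also have "sg (n * i) * sg i = (sg ((n + 1) * i) :: 'k)"
      by (simp add: distrib_right sg_add)
    finally show ?thesis .
  qed
qed

lemma dE_extensional [simp]: "dE f \<in> extensional CM"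
  by (simp add: dE_def)

lemma dE_add:
  assumes "f \<in> carrier E" "g \<in> carrier E"
  shows "dE (f \<oplus>\<^bsub>E\<^esub> g) = dE f \<oplus>\<^bsub>E\<^esub> dE g"
proof (rule extensionalityI)
  fix m assume "m \<in> CM"
  then show "dE (f \<oplus>\<^bsub>E\<^esub> g) m = (dE f \<oplus>\<^bsub>E\<^esub> dE g) m"
    using dE_add'[OF _ assms] by simp
qed auto

lemma dE_closed:
  assumes "f \<in> carrier E"
  shows "dE f \<in> carrier E"
  using assms
proof (induct rule: E.graded_induct)
  case (homog n f)
  then show ?case using carrier_E_homog[OF dE_hcomp] by simp
next
  case (add f g)
  then show ?case using dE_add[OF add(1,2)] E.M.a_closed[OF add(3,4)] by (simp only:)
qed

lemma restrict_apply_CM: "x \<in> CM \<Longrightarrow> restrict f CM x = f x"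
  by simp

lemma dE_smult:
  assumes "f \<in> carrier E"
  shows "dE (c \<odot>\<^bsub>E\<^esub> f) = c \<odot>\<^bsub>E\<^esub> dE f"
  using assms
proof (induct rule: E.graded_induct)
  case (homog n f)
  then have f: "f \<in> End_deg A M n" by simp
  show ?case
    using dE_homog[OF _ f] dE_homog[OF _ End_deg_smult[OF f]] End_degD[OF f]
    by (intro extensionalityI[of _ CM]) (auto simp: d_smult d_closed M_scale mult.commute restrict_apply_CM simp del: restrict_apply)
next
  case (add f g)
  have "dE (c \<odot>\<^bsub>E\<^esub> (f \<oplus>\<^bsub>E\<^esub> g)) = dE (c \<odot>\<^bsub>E\<^esub> f) \<oplus>\<^bsub>E\<^esub> dE (c \<odot>\<^bsub>E\<^esub> g)"
    unfolding E.smult_add[OF add(1,2)] by (rule dE_add) (use add in blast)+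
  also have "\<dots> = c \<odot>\<^bsub>E\<^esub> (dE f \<oplus>\<^bsub>E\<^esub> dE g)"
    unfolding add by (rule E.smult_add[symmetric]) (use add dE_closed in blast)+
  finally show ?case
    unfolding dE_add[OF add(1,2)] .
qed

text \<open>The two mixed terms carry the opposite signs \<open>sg n\<close> and
  \<open>sg (n + 1)\<close>; the remaining terms contain the square of the differential of
  \<open>M\<close>.\<close>

lemma dE_dE:
  assumes "f \<in> carrier E"
  shows "dE (dE f) = \<zero>\<^bsub>E\<^esub>"
  using assms
proof (induct rule: E.graded_induct)
  case (homog n f)
  then have f: "f \<in> End_deg A M n" by simp
  show ?case
    using dE_homog[OF _ f] dE_homog[OF _ dE_hcomp[OF f]] End_degD[OF f]
    by (intro extensionalityI[of _ CM])
      (auto simp: d_smult d_closed M_scale d_diff dd End_degD_diff[OF f] sg_add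
        carrier_ED_zero[OF carrier_E_homog[OF f]] restrict_apply_CM simp del: restrict_apply)
next
  case (add f g)
  then show ?case
    unfolding dE_add[OF add(1,2)] dE_add[OF dE_closed[OF add(1)] dE_closed[OF add(2)]]
    by (simp only: E.M.l_zero[OF E.M.zero_closed])
qed

lemma dE_leibniz:
  assumes x: "f \<in> End_deg A M n" and y: "g \<in> carrier E"
  shows "dE (compose CM f g) = compose CM (dE f) g \<oplus>\<^bsub>E\<^esub> (sg n \<odot>\<^bsub>E\<^esub> compose CM f (dE g))"
  using y
proof (induct rule: E.graded_induct)
  case (homog m g)
  then have g: "g \<in> End_deg A M m" by simp
  show ?case
    using dE_homog[OF _ x] dE_homog[OF _ g] dE_homog[OF _ End_deg_compose[OF x g]] End_degD[OF x] End_degD[OF g]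
    by (intro extensionalityI[of _ CM])
      (auto simp: compose_def d_smult d_closed M_scale d_diff dd End_degD_diff[OF x] sg_add restrict_apply_CM
        simp del: restrict_apply)
next
  case (add g h)
  note f = carrier_E_homog[OF x]
  have 1: "compose CM f (g \<oplus>\<^bsub>E\<^esub> h) = compose CM f g \<oplus>\<^bsub>E\<^esub> compose CM f h"
    if "g \<in> carrier E" "h \<in> carrier E" for g h
    using carrier_ED[OF f] carrier_ED[OF that(1)] carrier_ED[OF that(2)] by (auto simp: fun_eq_iff compose_def)
  have 2: "compose CM (dE f) (g \<oplus>\<^bsub>E\<^esub> h) = compose CM (dE f) g \<oplus>\<^bsub>E\<^esub> compose CM (dE f) h"
    using carrier_ED[OF dE_closed[OF f]] carrier_ED[OF add(1)] carrier_ED[OF add(2)] by (auto simp: fun_eq_iff compose_def)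
  note c = carrier_E_compose[OF f] carrier_E_compose[OF dE_closed[OF f]]
  note dc = dE_closed[OF add(1)] dE_closed[OF add(2)]
  show ?case
    unfolding 1[OF add(1,2)] 2 dE_add[OF c(1)[OF add(1)] c(1)[OF add(2)]] dE_add[OF add(1,2)] 1[OF dc] add(3,4)
      E.smult_add[OF c(1)[OF dc(1)] c(1)[OF dc(2)]]
    by (simp add: fun_eq_iff)
qed

lemma dg_algebra_dgE: "dg_algebra dgE"
proof -
  have "is_graded dgE"
    by (rule is_graded_cong[OF is_graded_E]) simp_all
  then have "is_complex dgE"
    using dE_add dE_closed dE_smult dE_hcomp dE_dE by (auto simp: is_complex_def klinear_def)
  moreover have "ring dgE"
    by (rule ring_cong[OF ring_E]) simp_all
  moreover have "\<one>\<^bsub>dgE\<^esub> \<in> hcomp dgE 0"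
    using End_deg_one by simp
  moreover have "c \<odot>\<^bsub>dgE\<^esub> (x \<otimes>\<^bsub>dgE\<^esub> y) = (c \<odot>\<^bsub>dgE\<^esub> x) \<otimes>\<^bsub>dgE\<^esub> y \<and> c \<odot>\<^bsub>dgE\<^esub> (x \<otimes>\<^bsub>dgE\<^esub> y) = x \<otimes>\<^bsub>dgE\<^esub> (c \<odot>\<^bsub>dgE\<^esub> y)"
    if "x \<in> carrier dgE" "y \<in> carrier dgE" for c x y
    using that carrier_ED[of x] carrier_ED[of y] by (auto simp: fun_eq_iff compose_def)
  moreover have "diff dgE (x \<otimes>\<^bsub>dgE\<^esub> y) = diff dgE x \<otimes>\<^bsub>dgE\<^esub> y \<oplus>\<^bsub>dgE\<^esub> (sg n \<odot>\<^bsub>dgE\<^esub> (x \<otimes>\<^bsub>dgE\<^esub> diff dgE y))"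
    if "x \<in> hcomp dgE n" "y \<in> carrier dgE" for n x y
    using that dE_leibniz[of x n y] by simp
  moreover have "x \<otimes>\<^bsub>dgE\<^esub> y \<in> hcomp dgE (m + n)" if "x \<in> hcomp dgE m" "y \<in> hcomp dgE n" for m n x y
    using that End_deg_compose[of x m y n] by simp
  ultimately show ?thesis
    unfolding dg_algebra_def by blast
qed

end


subsection \<open>Right multiplications\<close>

context dg_mod
begin

lemma End_eqI:
  assumes "f \<in> carrier E" "g \<in> carrier E" "\<And>n m. m \<in> hcomp M n \<Longrightarrow> f m = g m"
  shows "f = g"
proof (rule extensionalityI)
  fix m assume "m \<in> CM"
  then show "f m = g m"
  proof (induct rule: M.graded_induct)
    case (add y z)
    then show ?case using carrier_ED(3)[OF assms(1)] carrier_ED(3)[OF assms(2)] by simp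
  qed (rule assms(3))
qed (use carrier_ED(1)[OF assms(1)] carrier_ED(1)[OF assms(2)] in auto)

end

locale dg_bim = dg_mod A M for A :: "('k::field, 'a, 'x) dg_space_scheme"
    and M :: "('k, 'a, 'b, 'm::ab_group_add) dg_bimod" +
  fixes B :: "('k, 'b, 'y) dg_space_scheme"
  assumes bim: "dg_bimodule A B M"
begin

lemma right: "right_dg_module B M (ract M)"
  using bim by (simp add: dg_bimodule_def)

sublocale B: dg_alg B
  using right by (intro dg_algI) (simp add: right_dg_module_def)

lemma ract_props:
  assumes b: "b \<in> carrier B" and x: "x \<in> CM"
  shows ract_closed: "ract M x b \<in> CM"
    and ract_smult: "ract M (c \<odot>\<^bsub>M\<^esub> x) b = c \<odot>\<^bsub>M\<^esub> ract M x b"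
    and ract_smult2: "ract M x (c \<odot>\<^bsub>B\<^esub> b) = c \<odot>\<^bsub>M\<^esub> ract M x b"
    and ract_add: "y \<in> CM \<Longrightarrow> ract M (x + y) b = ract M x b + ract M y b"
    and ract_add2: "b' \<in> carrier B \<Longrightarrow> ract M x (b \<oplus>\<^bsub>B\<^esub> b') = ract M x b + ract M x b'"
    and ract_one: "ract M x \<one>\<^bsub>B\<^esub> = x"
    and ract_mult: "b' \<in> carrier B \<Longrightarrow> ract M x (b \<otimes>\<^bsub>B\<^esub> b') = ract M (ract M x b) b'"
    and ract_lact: "a \<in> carrier A \<Longrightarrow> ract M (lact M a x) b = lact M a (ract M x b)"
proof -
  have l1: "klinear M M (\<lambda>m. ract M m b)" and l2: "klinear B M (ract M x)"
    using right b x by (simp_all add: right_dg_module_def)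
  show "ract M x b \<in> CM" "ract M (c \<odot>\<^bsub>M\<^esub> x) b = c \<odot>\<^bsub>M\<^esub> ract M x b"
    "y \<in> CM \<Longrightarrow> ract M (x + y) b = ract M x b + ract M y b"
    using klinearD[OF l1] x by auto
  show "ract M x (c \<odot>\<^bsub>B\<^esub> b) = c \<odot>\<^bsub>M\<^esub> ract M x b"
    "b' \<in> carrier B \<Longrightarrow> ract M x (b \<oplus>\<^bsub>B\<^esub> b') = ract M x b + ract M x b'"
    using klinearD[OF l2] b by auto
  show "ract M x \<one>\<^bsub>B\<^esub> = x" "b' \<in> carrier B \<Longrightarrow> ract M x (b \<otimes>\<^bsub>B\<^esub> b') = ract M (ract M x b) b'"
    using right b x by (simp_all add: right_dg_module_def)
  show "a \<in> carrier A \<Longrightarrow> ract M (lact M a x) b = lact M a (ract M x b)"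
    using bim b x by (simp add: dg_bimodule_def)
qed

lemma ract_hcomp: "x \<in> hcomp M i \<Longrightarrow> b \<in> hcomp B j \<Longrightarrow> ract M x b \<in> hcomp M (i + j)"
  using right by (simp add: right_dg_module_def)

lemma d_ract:
  "x \<in> hcomp M i \<Longrightarrow> b \<in> carrier B \<Longrightarrow>
    diff M (ract M x b) = ract M (diff M x) b + sg i \<odot>\<^bsub>M\<^esub> ract M x (diff B b)"
  using right by (simp add: right_dg_module_def)

text \<open>The sign rule in the argument \<open>m\<close> alone, with the degree \<open>n\<close>
  of the algebra element as a parameter; the double sum in \<open>right_mult\<close> is split in the
  same way as the one in the opposite product.\<close>

definition rsign :: "int \<Rightarrow> 'b \<Rightarrow> 'm \<Rightarrow> 'm" where
  "rsign n b m = (\<Oplus>\<^bsub>M\<^esub>j\<in>hsupp M m. sg (n * j) \<odot>\<^bsub>M\<^esub> ract M (hpart M m j) b)"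

lemma
  assumes b: "b \<in> carrier B"
  shows rsign_closed: "m \<in> CM \<Longrightarrow> rsign n b m \<in> CM"
    and rsign_homog: "m \<in> hcomp M j \<Longrightarrow> rsign n b m = sg (n * j) \<odot>\<^bsub>M\<^esub> ract M m b"
    and rsign_add: "m \<in> CM \<Longrightarrow> m' \<in> CM \<Longrightarrow> rsign n b (m + m') = rsign n b m + rsign n b m'"
proof -
  have W: "abelian_group M" ..
  let ?g = "\<lambda>j m. sg (n * j) \<odot>\<^bsub>M\<^esub> ract M m b"
  have 1: "?g j x \<in> carrier M" if "x \<in> hcomp M j" for j x
    using ract_closed[OF b M.hcomp_closed[OF that]] by blast
  have 2: "?g j (x \<oplus>\<^bsub>M\<^esub> y) = ?g j x \<oplus>\<^bsub>M\<^esub> ?g j y" if "x \<in> hcomp M j" "y \<in> hcomp M j" for j x y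
    using that[THEN M.hcomp_closed] b by (simp add: ract_add ract_closed M_scale)
  show "m \<in> CM \<Longrightarrow> rsign n b m \<in> CM"
    unfolding rsign_def by (rule M.hsum_closed[OF W, of ?g]) (assumption | rule 1 2)+
  show "m \<in> hcomp M j \<Longrightarrow> rsign n b m = sg (n * j) \<odot>\<^bsub>M\<^esub> ract M m b"
    unfolding rsign_def by (rule M.hsum_homog[OF W, of ?g]) (assumption | rule 1 2)+
  have "m \<in> CM \<Longrightarrow> m' \<in> CM \<Longrightarrow> rsign n b (m \<oplus>\<^bsub>M\<^esub> m') = rsign n b m \<oplus>\<^bsub>M\<^esub> rsign n b m'"
    unfolding rsign_def by (rule M.hsum_add[OF W, of ?g]) (assumption | rule 1 2)+
  then show "m \<in> CM \<Longrightarrow> m' \<in> CM \<Longrightarrow> rsign n b (m + m') = rsign n b m + rsign n b m'"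
    by simp
qed

lemma rsign_add2:
  assumes "b \<in> carrier B" "b' \<in> carrier B" "m \<in> CM"
  shows "rsign n (b \<oplus>\<^bsub>B\<^esub> b') m = rsign n b m + rsign n b' m"
  using assms(3)
proof (induct rule: M.graded_induct)
  case (homog j m)
  then show ?case
    using assms M.hcomp_closed[OF homog] by (simp add: rsign_homog ract_add2 M_scale ract_closed)
next
  case (add y z)
  then show ?case using assms by (simp add: rsign_add)
qed

abbreviation "rm \<equiv> right_mult B M"

lemma rm_eq: "rm b = (\<lambda>m\<in>CM. \<Oplus>\<^bsub>M\<^esub>i\<in>hsupp B b. rsign i (hpart B b i) m)"
proof -
  have "(\<Oplus>\<^bsub>M\<^esub>j\<in>hsupp M m. sg (i * j) \<odot>\<^bsub>M\<^esub> ract M (hpart M m j) x) = rsign i x m" for i x m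
    by (simp add: rsign_def)
  then show ?thesis by (simp add: right_mult_def)
qed

lemma
  assumes m: "m \<in> CM"
  shows rm_closed: "b \<in> carrier B \<Longrightarrow> rm b m \<in> CM"
    and rm_rsign: "b \<in> hcomp B n \<Longrightarrow> rm b m = rsign n b m"
    and rm_add: "b \<in> carrier B \<Longrightarrow> b' \<in> carrier B \<Longrightarrow> rm (b \<oplus>\<^bsub>B\<^esub> b') m = rm b m + rm b' m"
proof -
  have W: "abelian_group M" ..
  let ?g = "\<lambda>i b. rsign i b m"
  have 1: "?g j x \<in> carrier M" if "x \<in> hcomp B j" for j x
    using rsign_closed[OF B.hcomp_closed[OF that] m] .
  have 2: "?g j (x \<oplus>\<^bsub>B\<^esub> y) = ?g j x \<oplus>\<^bsub>M\<^esub> ?g j y" if "x \<in> hcomp B j" "y \<in> hcomp B j" for j x y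
    using rsign_add2[OF that[THEN B.hcomp_closed] m] by simp
  show "b \<in> carrier B \<Longrightarrow> rm b m \<in> CM"
    unfolding rm_eq restrict_apply'[OF m]
    by (rule B.hsum_closed[OF W, of ?g]) (assumption | rule 1 2)+
  show "b \<in> hcomp B n \<Longrightarrow> rm b m = rsign n b m"
    unfolding rm_eq restrict_apply'[OF m]
    by (rule B.hsum_homog[OF W, of ?g]) (assumption | rule 1 2)+
  have "b \<in> carrier B \<Longrightarrow> b' \<in> carrier B \<Longrightarrow> rm (b \<oplus>\<^bsub>B\<^esub> b') m = rm b m \<oplus>\<^bsub>M\<^esub> rm b' m"
    unfolding rm_eq restrict_apply'[OF m]
    by (rule B.hsum_add[OF W, of ?g]) (assumption | rule 1 2)+
  then show "b \<in> carrier B \<Longrightarrow> b' \<in> carrier B \<Longrightarrow> rm (b \<oplus>\<^bsub>B\<^esub> b') m = rm b m + rm b' m"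
    by simp
qed

lemma rm_homog:
  assumes "b \<in> hcomp B n" "m \<in> hcomp M j"
  shows "rm b m = sg (n * j) \<odot>\<^bsub>M\<^esub> ract M m b"
  using rm_rsign[OF M.hcomp_closed[OF assms(2)] assms(1)] rsign_homog[OF B.hcomp_closed[OF assms(1)] assms(2)]
  by simp

lemma rm_End_deg:
  assumes b: "b \<in> hcomp B n"
  shows "rm b \<in> End_deg A M n"
proof (rule End_degI)
  note bc = B.hcomp_closed[OF b]
  show "rm b \<in> extensional CM" by (simp add: rm_eq)
  show "rm b x \<in> CM" if "x \<in> CM" for x
    using rm_closed[OF that bc] .
  show rm_b_add: "rm b (x + y) = rm b x + rm b y" if "x \<in> CM" "y \<in> CM" for x y
    using that by (simp add: rm_rsign[OF _ b] rsign_add[OF bc])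
  show sm: "rm b (c \<odot>\<^bsub>M\<^esub> x) = c \<odot>\<^bsub>M\<^esub> rm b x" if "x \<in> CM" for c x
    using that
  proof (induct rule: M.graded_induct)
    case (homog j x)
    then show ?case
      using rm_homog[OF b homog] rm_homog[OF b M.hcomp_smult[OF homog]] M.hcomp_closed[OF homog] bc
      by (simp add: ract_smult M_scale ract_closed mult.commute)
  next
    case (add y z)
    then show ?case using rm_closed bc by (simp add: M_scale rm_b_add)
  qed
  show "rm b x \<in> hcomp M (i + n)" if "x \<in> hcomp M i" for i x
    using rm_homog[OF b that] M.hcomp_smult[OF ract_hcomp[OF that b]] by simp
  show "rm b (lact M a x) = sg (n * i) \<odot>\<^bsub>M\<^esub> lact M a (rm b x)" if a: "a \<in> hcomp A i" and "x \<in> CM" for i a x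
    using that(2)
  proof (induct rule: M.graded_induct)
    case (homog j x)
    note ac = A.hcomp_closed[OF a]
    show ?case
      using rm_homog[OF b homog] rm_homog[OF b lact_hcomp[OF a homog]] M.hcomp_closed[OF homog] bc ac
      by (simp add: ract_lact M_scale ract_closed lact_closed lact_smult distrib_left sg_add)
  next
    case (add y z)
    note ac = A.hcomp_closed[OF a]
    show ?case using add ac rm_closed[OF _ bc]
      by (simp add: lact_add lact_closed M_scale rm_b_add)
  qed
qed

lemma rm_carrier:
  assumes "b \<in> carrier B"
  shows "rm b \<in> carrier E"
  using assms
proof (induct rule: B.graded_induct)
  case (homog n b)
  then show ?case using carrier_E_homog[OF rm_End_deg] by simp
next
  case (add x y)
  have "rm (x \<oplus>\<^bsub>B\<^esub> y) = (\<lambda>m\<in>CM. rm x m + rm y m)"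
    using rm_add[OF _ add(1,2)] by (intro extensionalityI[of _ CM]) (simp_all add: rm_eq)
  then show ?case using carrier_E_add[OF add(3,4)] by (simp only:)
qed

lemma rm_plus:
  assumes "x \<in> carrier B" "y \<in> carrier B"
  shows "rm (x \<oplus>\<^bsub>B\<^esub> y) = rm x \<oplus>\<^bsub>dgE\<^esub> rm y"
proof (rule End_eqI)
  show "rm x \<oplus>\<^bsub>dgE\<^esub> rm y \<in> carrier E"
    using carrier_E_add[OF rm_carrier rm_carrier, OF assms] by simp
  show "rm (x \<oplus>\<^bsub>B\<^esub> y) m = (rm x \<oplus>\<^bsub>dgE\<^esub> rm y) m" if "m \<in> hcomp M n" for m n
    using rm_add[OF M.hcomp_closed[OF that] assms] M.hcomp_closed[OF that] by simp
qed (use rm_carrier assms in blast)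

lemma klinear_rm: "klinear B dgE rm"
proof -
  have "rm (c \<odot>\<^bsub>B\<^esub> x) = c \<odot>\<^bsub>dgE\<^esub> rm x" if "x \<in> carrier B" for c x
  proof (rule End_eqI)
    show "c \<odot>\<^bsub>dgE\<^esub> rm x \<in> carrier E"
      using carrier_E_smult[OF rm_carrier[OF that]] by simp
    show "rm (c \<odot>\<^bsub>B\<^esub> x) m = (c \<odot>\<^bsub>dgE\<^esub> rm x) m" if m: "m \<in> hcomp M n" for m n
      using \<open>x \<in> carrier B\<close>
    proof (induct rule: B.graded_induct)
      case (homog i x)
      then show ?case
        using rm_homog[OF homog m] rm_homog[OF B.hcomp_smult[OF homog] m] B.hcomp_closed[OF homog] M.hcomp_closed[OF m]
        by (simp add: ract_smult2 M_scale ract_closed mult.commute)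
    next
      case (add x y)
      then show ?case
        using rm_add[OF M.hcomp_closed[OF m]] rm_closed[OF M.hcomp_closed[OF m]] M.hcomp_closed[OF m]
        by (simp add: B.smult_add M_scale)
    qed
  qed (use rm_carrier that in blast)
  then show ?thesis
    using rm_plus rm_carrier by (auto simp: klinear_def simp del: E_simps)
qed

sublocale Op: opp_alg dgE
  by (intro opp_alg.intro dg_algI dg_algebra_dgE)

text \<open>For \<open>a\<close>, \<open>b\<close>, \<open>m\<close> of degrees \<open>i\<close>,
  \<open>j\<close>, \<open>k\<close>, applying \<open>rm a\<close> and then \<open>rm b\<close>
  yields the sign exponents \<open>i * k\<close> and \<open>j * (k + i)\<close>. The sign
  \<open>sg (i * j)\<close> of the opposite product cancels the excess, and
  \<open>(i + j) * k\<close> is left.\<close>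

lemma rm_mult:
  assumes "a \<in> carrier B" "b \<in> carrier B"
  shows "rm (a \<otimes>\<^bsub>B\<^esub> b) = rm a \<otimes>\<^bsub>opp_dg_algebra dgE\<^esub> rm b"
  using assms(1)
proof (induct rule: B.graded_induct)
  case (homog i a)
  note a = homog
  note ac = B.hcomp_closed[OF a]
  show ?case
    using assms(2)
  proof (induct rule: B.graded_induct)
    case (homog j b)
    note b = homog
    note bc = B.hcomp_closed[OF b]
    have "rm a \<in> hcomp dgE i" "rm b \<in> hcomp dgE j"
      using rm_End_deg a b by auto
    note opp = Op.opp_homog[OF this]
    show ?case
    proof (rule End_eqI)
      show "rm a \<otimes>\<^bsub>opp_dg_algebra dgE\<^esub> rm b \<in> carrier E"
        using Op.opp_closed[of "rm b" "rm a"] rm_carrier[OF ac] rm_carrier[OF bc] by simp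
      fix m k assume m: "m \<in> hcomp M k"
      note mc = M.hcomp_closed[OF m]
      have "(rm a \<otimes>\<^bsub>opp_dg_algebra dgE\<^esub> rm b) m = sg (i * j) \<odot>\<^bsub>M\<^esub> rm b (rm a m)"
        unfolding opp using mc by (simp add: compose_def)
      also have "rm a m = sg (i * k) \<odot>\<^bsub>M\<^esub> ract M m a"
        by (rule rm_homog[OF a m])
      also have "rm b \<dots> = sg (i * k) \<odot>\<^bsub>M\<^esub> rm b (ract M m a)"
        by (rule End_degD(4)[OF rm_End_deg[OF b] ract_closed[OF ac mc]])
      also have "rm b (ract M m a) = sg (j * (k + i)) \<odot>\<^bsub>M\<^esub> ract M m (a \<otimes>\<^bsub>B\<^esub> b)"
        using rm_homog[OF b ract_hcomp[OF m a]] ract_mult[OF ac mc bc] by simp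
      also have "sg (i * j) \<odot>\<^bsub>M\<^esub> (sg (i * k) \<odot>\<^bsub>M\<^esub> \<dots>) = sg ((i + j) * k) \<odot>\<^bsub>M\<^esub> ract M m (a \<otimes>\<^bsub>B\<^esub> b)"
        using ract_closed[OF B.A.m_closed[OF ac bc] mc]
        by (simp add: M_scale distrib_left distrib_right sg_add mult_ac)
      also have "\<dots> = rm (a \<otimes>\<^bsub>B\<^esub> b) m"
        by (rule rm_homog[OF B.mult_hcomp[OF a b] m, symmetric])
      finally show "rm (a \<otimes>\<^bsub>B\<^esub> b) m = (rm a \<otimes>\<^bsub>opp_dg_algebra dgE\<^esub> rm b) m" ..
    qed (rule rm_carrier[OF B.A.m_closed[OF ac bc]])
  next
    case (add x y)
    have c: "rm a \<in> carrier dgE" "rm x \<in> carrier dgE" "rm y \<in> carrier dgE"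
      using rm_carrier ac add by auto
    show ?case
      using Op.opp_add2[OF c] add ac rm_plus[OF B.A.m_closed[OF ac add(1)] B.A.m_closed[OF ac add(2)]]
      by (simp add: B.A.r_distr rm_plus[OF add(1,2)] del: E_simps dgE_simps)
  qed
next
  case (add x y)
  have c: "rm b \<in> carrier dgE" "rm x \<in> carrier dgE" "rm y \<in> carrier dgE"
    using rm_carrier assms(2) add by auto
  show ?case
    using Op.opp_add1[OF c] add assms(2) rm_plus[OF B.A.m_closed[OF add(1) assms(2)] B.A.m_closed[OF add(2) assms(2)]]
    by (simp add: B.A.l_distr rm_plus[OF add(1,2)] del: E_simps dgE_simps)
qed

lemma dg_algebra_hom_rm: "dg_algebra_hom B (opp_dg_algebra dgE) rm"
proof -
  have one: "rm \<one>\<^bsub>B\<^esub> = \<one>\<^bsub>dgE\<^esub>"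
  proof (rule End_eqI)
    show "\<one>\<^bsub>dgE\<^esub> \<in> carrier E" using carrier_E_homog[OF End_deg_one] by simp
    show "rm \<one>\<^bsub>B\<^esub> m = \<one>\<^bsub>dgE\<^esub> m" if "m \<in> hcomp M n" for m n
      using rm_homog[OF B.one_hcomp that] M.hcomp_closed[OF that] by (simp add: ract_one[OF B.A.one_closed])
  qed (rule rm_carrier[OF B.A.one_closed])
  have d: "rm (diff B b) = dE (rm b)" if "b \<in> carrier B" for b
    using that
  proof (induct rule: B.graded_induct)
    case (homog n b)
    note b = homog
    note bc = B.hcomp_closed[OF b]
    show ?case
    proof (rule End_eqI)
      fix m k assume m: "m \<in> hcomp M k"
      note mc = M.hcomp_closed[OF m]
      have "dE (rm b) m = sg (n * k) \<odot>\<^bsub>M\<^esub> diff M (ract M m b) -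
          (sg n * sg (n * (k + 1))) \<odot>\<^bsub>M\<^esub> ract M (diff M m) b"
        using rm_homog[OF b m] rm_homog[OF b d_hcomp[OF m]] mc bc
        by (simp add: dE_homog[OF mc rm_End_deg[OF b]] d_smult ract_closed M_scale d_closed)
      \<comment> \<open>Both terms now have the same sign, so their difference is the summand of the
        Leibniz rule that contains \<open>diff B b\<close>.\<close>
      also have "sg n * sg (n * (k + 1)) = (sg (n * k) :: 'k)"
        by (simp add: distrib_left sg_add sg_conj)
      finally show "rm (diff B b) m = dE (rm b) m"
        using rm_homog[OF B.diff_hcomp[OF b] m] mc bc B.diff_closed[OF bc]
        by (simp add: d_ract[OF m bc] M_scale ract_closed d_closed distrib_right sg_add)
    qed (use rm_carrier B.diff_closed bc dE_closed in auto)
  next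
    case (add x y)
    note dc = B.diff_closed[OF add(1)] B.diff_closed[OF add(2)]
    have "add dgE = add E" by simp
    then show ?case
      unfolding B.diff_add[OF add(1,2)] rm_plus[OF add(1,2)] rm_plus[OF dc] add(3,4)
      using dE_add[OF rm_carrier[OF add(1)] rm_carrier[OF add(2)]] by metis
  qed
  have "rm \<in> ring_hom B (opp_dg_algebra dgE)"
    using rm_mult rm_plus rm_carrier one by (intro ring_hom_memI) (simp_all del: E_simps)
  moreover have "klinear B (opp_dg_algebra dgE) rm"
    using klinear_rm by (simp add: klinear_def)
  ultimately show ?thesis
    using Op.dg_algebra_opp B.dg rm_End_deg d by (auto simp: dg_algebra_hom_def)
qed

end


subsection \<open>Removing the signs of the opposite algebra\<close>

definition twist_sign :: "int \<Rightarrow> 'k::field" where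
  "twist_sign n = sg (n * (n - 1) div 2)"

text \<open>The bicharacter \<open>(m, n) \<mapsto> (-1)\<^sup>m\<^sup>n\<close> is the coboundary of \<open>twist_sign\<close>.\<close>

lemma twist_sign_add: "twist_sign (m + n) = twist_sign m * twist_sign n * sg (m * n)"
proof -
  have "(m + n) * (m + n - 1) div 2 = m * (m - 1) div 2 + n * (n - 1) div 2 + m * n"
  proof -
    have "even (m * (m - 1))" "even (n * (n - 1))" "even ((m + n) * (m + n - 1))" by auto
    then obtain a b c where "m * (m - 1) = 2 * a" "n * (n - 1) = 2 * b" "(m + n) * (m + n - 1) = 2 * c"
      unfolding dvd_def by blast
    then show ?thesis by (simp add: algebra_simps)
  qed
  then show ?thesis
    by (simp add: twist_sign_def sg_add)
qed

lemma twist_sign_sq [simp]: "twist_sign n * twist_sign n = 1" "twist_sign n * (twist_sign n * c) = c"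
  by (simp_all add: twist_sign_def)

text \<open>\<open>f\<close> respects two reversed products, of which only the second has signs;
  read between \<open>R\<close> and \<open>S\<close> it is therefore multiplicative up to
  \<open>sg (i * j)\<close>. Multiplying degree \<open>n\<close> by \<open>twist_sign n\<close>
  absorbs this sign. Scaling by units changes neither the kernel nor the image, so
  \<open>inj\<close> and \<open>surj\<close> carry over.\<close>

lemma twisted_quasi_isomorphism:
  fixes R :: "('k::field, 'a, 'x) dg_space_scheme" and S :: "('k, 'b, 'y) dg_space_scheme"
  assumes R: "dg_algebra R" and S: "dg_algebra S"
    and f: "dg_algebra_hom (op_algebra R) (opp_dg_algebra S) f"
    and diff0: "\<And>x. x \<in> carrier R \<Longrightarrow> diff R x = \<zero>\<^bsub>R\<^esub>"
    and inj: "\<And>n x. x \<in> hcomp R n \<Longrightarrow> f x \<in> coboundaries S n \<Longrightarrow> x = \<zero>\<^bsub>R\<^esub>"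
    and surj: "\<And>n z. z \<in> cocycles S n \<Longrightarrow>
      \<exists>x\<in>hcomp R n. \<exists>h\<in>hcomp S (n - 1). z = f x \<oplus>\<^bsub>S\<^esub> diff S h"
  shows "qiso_step R S"
proof -
  interpret R: dg_alg R by (rule dg_algI) fact
  interpret S: opp_alg S by (intro opp_alg.intro dg_algI) fact
  define tw where "tw x = (\<Oplus>\<^bsub>R\<^esub>i\<in>hsupp R x. twist_sign i \<odot>\<^bsub>R\<^esub> hpart R x i)" for x
  have W: "abelian_group R" ..
  let ?g = "\<lambda>i x. twist_sign i \<odot>\<^bsub>R\<^esub> x"
  have 1: "?g i x \<in> carrier R" if "x \<in> hcomp R i" for i x
    using R.hcomp_closed[OF that] by blast
  have 2: "?g i (x \<oplus>\<^bsub>R\<^esub> y) = ?g i x \<oplus>\<^bsub>R\<^esub> ?g i y" if "x \<in> hcomp R i" "y \<in> hcomp R i" for i x y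
    using that[THEN R.hcomp_closed] by (simp add: R.smult_add)
  have tw_closed: "tw x \<in> carrier R" if "x \<in> carrier R" for x
    unfolding tw_def by (rule R.hsum_closed[OF W, of ?g]) (assumption | rule 1 2 that)+
  have tw_homog: "tw x = twist_sign n \<odot>\<^bsub>R\<^esub> x" if "x \<in> hcomp R n" for x n
    unfolding tw_def by (rule R.hsum_homog[OF W, of ?g]) (assumption | rule 1 2 that)+
  have tw_add: "tw (x \<oplus>\<^bsub>R\<^esub> y) = tw x \<oplus>\<^bsub>R\<^esub> tw y" if "x \<in> carrier R" "y \<in> carrier R" for x y
    unfolding tw_def by (rule R.hsum_add[OF W, of ?g]) (assumption | rule 1 2 that)+
  have tw_smult: "tw (c \<odot>\<^bsub>R\<^esub> x) = c \<odot>\<^bsub>R\<^esub> tw x" if "x \<in> carrier R" for c x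
    using that
  proof (induct rule: R.graded_induct)
    case (homog n x)
    then show ?case
      using tw_homog[OF homog] tw_homog[OF R.hcomp_smult[OF homog]] R.hcomp_closed[OF homog]
      by (simp add: R.smult_smult mult.commute)
  next
    case (add x y)
    then show ?case by (simp add: R.smult_add tw_add tw_closed)
  qed
  have fl: "klinear R S f" and fh: "\<And>n x. x \<in> hcomp R n \<Longrightarrow> f x \<in> hcomp S n"
    and f1: "f \<one>\<^bsub>R\<^esub> = \<one>\<^bsub>S\<^esub>"
    and fm: "\<And>x y. x \<in> carrier R \<Longrightarrow> y \<in> carrier R \<Longrightarrow> f (y \<otimes>\<^bsub>R\<^esub> x) = f x \<otimes>\<^bsub>opp_dg_algebra S\<^esub> f y"
    and fd: "\<And>x. x \<in> carrier R \<Longrightarrow> f (diff R x) = diff S (f x)"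
    using f by (auto simp: dg_algebra_hom_def klinear_def ring_hom_def image_subset_iff)
  let ?h = "\<lambda>x. f (tw x)"
  note fc = klinearD(1)[OF fl] and fa = klinearD(2)[OF fl] and fs = klinearD(3)[OF fl]
  have hadd: "?h (x \<oplus>\<^bsub>R\<^esub> y) = ?h x \<oplus>\<^bsub>S\<^esub> ?h y" if "x \<in> carrier R" "y \<in> carrier R" for x y
    using that by (simp add: tw_add fa tw_closed)
  have hhom: "?h x = twist_sign n \<odot>\<^bsub>S\<^esub> f x" if "x \<in> hcomp R n" for x n
    using tw_homog[OF that] fs[OF R.hcomp_closed[OF that]] by simp
  have hmult: "?h (x \<otimes>\<^bsub>R\<^esub> y) = ?h x \<otimes>\<^bsub>S\<^esub> ?h y" if "x \<in> carrier R" "y \<in> carrier R" for x y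
    using that(1)
  proof (induct rule: R.graded_induct)
    case (homog i x)
    note x = homog
    note xc = R.hcomp_closed[OF x]
    show ?case
      using that(2)
    proof (induct rule: R.graded_induct)
      case (homog j y)
      note y = homog
      note yc = R.hcomp_closed[OF y]
      have "?h (x \<otimes>\<^bsub>R\<^esub> y) = twist_sign (i + j) \<odot>\<^bsub>S\<^esub> (sg (j * i) \<odot>\<^bsub>S\<^esub> (f x \<otimes>\<^bsub>S\<^esub> f y))"
        using hhom[OF R.mult_hcomp[OF x y]] fm[OF yc xc] S.opp_homog[OF fh[OF y] fh[OF x]] by simp
      also have "\<dots> = (twist_sign i * twist_sign j) \<odot>\<^bsub>S\<^esub> (f x \<otimes>\<^bsub>S\<^esub> f y)"
        using fc[OF xc] fc[OF yc] by (simp add: S.smult_smult twist_sign_add mult.assoc mult.commute[of j i])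
      also have "\<dots> = ?h x \<otimes>\<^bsub>S\<^esub> ?h y"
        using fc[OF xc] fc[OF yc] by (simp add: hhom[OF x] hhom[OF y] S.smult_mult S.smult_smult mult.commute)
      finally show ?case .
    next
      case (add y z)
      then show ?case
        using xc hadd[OF R.A.m_closed[OF xc add(1)] R.A.m_closed[OF xc add(2)]]
        by (simp add: R.A.r_distr hadd fc tw_closed S.A.r_distr)
    qed
  next
    case (add y z)
    then show ?case
      using that(2) hadd[OF R.A.m_closed[OF add(1) that(2)] R.A.m_closed[OF add(2) that(2)]]
      by (simp add: R.A.l_distr hadd fc tw_closed S.A.l_distr)
  qed
  have hd: "?h (diff R x) = diff S (?h x)" if "x \<in> carrier R" for x
  proof -
    have "tw \<zero>\<^bsub>R\<^esub> = \<zero>\<^bsub>R\<^esub>"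
      using tw_homog[OF R.hcomp_zero, of 0] by simp
    moreover have "f \<zero>\<^bsub>R\<^esub> = diff S (f (tw x))"
      using fd[OF tw_closed[OF that]] diff0[OF tw_closed[OF that]] by simp
    ultimately show ?thesis
      using diff0[OF that] by simp
  qed
  have h1: "?h \<one>\<^bsub>R\<^esub> = \<one>\<^bsub>S\<^esub>"
    using tw_homog[OF R.one_hcomp] f1 by (simp add: twist_sign_def)
  have hh: "?h x \<in> hcomp S n" if "x \<in> hcomp R n" for x n
    using hhom[OF that] S.hcomp_smult[OF fh[OF that]] by simp
  have "dg_algebra_hom R S ?h"
    unfolding dg_algebra_hom_def
  proof (intro conjI allI ballI R S)
    show "?h \<in> ring_hom R S"
      by (intro ring_hom_memI) (simp_all add: hadd hmult h1 fc tw_closed)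
    show "klinear R S ?h"
      unfolding klinear_def by (auto simp: hadd fc tw_closed tw_smult fs)
    show "?h ` hcomp R n \<subseteq> hcomp S n" for n
      using hh by auto
  qed (rule hd)
  then have "quasi_isomorphism R S ?h"
  proof (rule quasi_isomorphismI[OF _ diff0])
    fix n x assume x: "x \<in> hcomp R n" "?h x \<in> coboundaries S n"
    have "f (twist_sign n \<odot>\<^bsub>R\<^esub> x) \<in> coboundaries S n"
      using x(2) tw_homog[OF x(1)] by simp
    then have "twist_sign n \<odot>\<^bsub>R\<^esub> x = \<zero>\<^bsub>R\<^esub>"
      by (rule inj[OF R.hcomp_smult[OF x(1)]])
    then have "twist_sign n \<odot>\<^bsub>R\<^esub> (twist_sign n \<odot>\<^bsub>R\<^esub> x) = \<zero>\<^bsub>R\<^esub>"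
      by simp
    then show "x = \<zero>\<^bsub>R\<^esub>"
      using R.hcomp_closed[OF x(1)] by (simp add: R.smult_smult)
  next
    fix n z assume "z \<in> cocycles S n"
    from surj[OF this] obtain x h where x: "x \<in> hcomp R n" "h \<in> hcomp S (n - 1)" "z = f x \<oplus>\<^bsub>S\<^esub> diff S h"
      by blast
    \<comment> \<open>\<open>twist_sign n\<close> is its own inverse, so the rescaled preimage is
      sent to \<open>f x\<close> itself.\<close>
    have "?h (twist_sign n \<odot>\<^bsub>R\<^esub> x) = f x"
      using tw_homog[OF R.hcomp_smult[OF x(1)]] R.hcomp_closed[OF x(1)] by (simp add: R.smult_smult)
    then show "\<exists>x\<in>hcomp R n. \<exists>h\<in>hcomp S (n - 1). z = ?h x \<oplus>\<^bsub>S\<^esub> diff S h"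
      using x R.hcomp_smult[OF x(1)] by metis
  qed
  then show ?thesis
    unfolding qiso_step_def by blast
qed


section \<open>Algebras with a basis and their quotients\<close>

text \<open>Made for words and for paths alike. The unit is a sum of basis elements
  \<open>U\<close>: just the empty word, or all trivial paths. On either side exactly one member of
  \<open>U\<close> fixes a given basis element and the others annihilate it.\<close>

locale basis_alg =
  fixes X :: "'b set" and m :: "'b \<Rightarrow> 'b \<Rightarrow> 'b option" and U :: "'b set"
  assumes m_closed: "\<And>u v w. u \<in> X \<Longrightarrow> v \<in> X \<Longrightarrow> m u v = Some w \<Longrightarrow> w \<in> X"
    and m_assoc: "\<And>u v w. u \<in> X \<Longrightarrow> v \<in> X \<Longrightarrow> w \<in> X \<Longrightarrow>
      Option.bind (m u v) (\<lambda>x. m x w) = Option.bind (m v w) (m u)"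
    and U: "finite U" "U \<subseteq> X"
    and m_unit_left: "\<And>x. x \<in> X \<Longrightarrow> \<exists>u\<in>U. m u x = Some x \<and> (\<forall>v\<in>U. v \<noteq> u \<longrightarrow> m v x = None)"
    and m_unit_right: "\<And>x. x \<in> X \<Longrightarrow> \<exists>u\<in>U. m x u = Some x \<and> (\<forall>v\<in>U. v \<noteq> u \<longrightarrow> m x v = None)"
begin

abbreviation BA :: "('k::field, 'b \<Rightarrow>\<^sub>0 'k) module" where
  "BA \<equiv> basis_algebra X m U"

definition osingle :: "'b option \<Rightarrow> 'k::field \<Rightarrow> ('b \<Rightarrow>\<^sub>0 'k)" where
  "osingle o' c = (case o' of None \<Rightarrow> 0 | Some w \<Rightarrow> single w c)"

lemma osingle_simps [simp]: "osingle None c = 0" "osingle (Some w) c = single w c"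
  by (simp_all add: osingle_def)

lemma osingle_add: "osingle o' (c + d) = osingle o' c + osingle o' d"
  by (cases o') (simp_all add: single_add)

lemma BA_simps [simp]:
  "carrier BA = {f. keys f \<subseteq> X}" "zero BA = 0" "add BA = (+)" "smult BA = scl"
  by (simp_all add: basis_algebra_def)

definition bmul :: "('b \<Rightarrow>\<^sub>0 'k::field) \<Rightarrow> ('b \<Rightarrow>\<^sub>0 'k) \<Rightarrow> ('b \<Rightarrow>\<^sub>0 'k)" where
  "bmul f g = pext (\<lambda>u a. pext (\<lambda>v b. osingle (m u v) (a * b)) g) f"

lemma BA_mult: "mult BA = bmul"
  by (intro ext) (simp add: basis_algebra_def bmul_def pext_def osingle_def)

lemma BA_one: "one BA = (\<Sum>u\<in>U. single u 1)"
  by (simp add: basis_algebra_def)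

lemma bmul_add1: "bmul (f + g) h = bmul f h + bmul g h"
  unfolding bmul_def by (rule pext_add)
    (simp add: distrib_right osingle_add pext_def sum.distrib)

lemma bmul_add2: "bmul f (g + h) = bmul f g + bmul f h"
proof -
  have "pext (\<lambda>v b. osingle (m u v) (a * b)) (g + h) =
      pext (\<lambda>v b. osingle (m u v) (a * b)) g + pext (\<lambda>v b. osingle (m u v) (a * b)) h" for u a
    by (rule pext_add) (simp add: distrib_left osingle_add)
  then show ?thesis
    by (simp add: bmul_def pext_def[of "\<lambda>u a. _ u a"] sum.distrib)
qed

lemma osingle_zero [simp]: "osingle o' 0 = 0"
  by (cases o') simp_all

lemma bmul_single: "bmul (single u a) (single v b) = osingle (m u v) (a * b)"
  unfolding bmul_def by (subst pext_single) (auto simp: pext_single pext_def)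

lemma bmul_zero [simp]: "bmul 0 g = 0" "bmul f 0 = 0"
  using bmul_add1[of 0 0 g] bmul_add2[of f 0 0] by simp_all

lemma bmul_sum1: "bmul (\<Sum>i\<in>I. f i) g = (\<Sum>i\<in>I. bmul (f i) g)"
  by (induct I rule: infinite_finite_induct) (simp_all add: bmul_add1)

lemma bmul_sum2: "bmul g (\<Sum>i\<in>I. f i) = (\<Sum>i\<in>I. bmul g (f i))"
  by (induct I rule: infinite_finite_induct) (simp_all add: bmul_add2)

lemma keys_bmul:
  assumes "keys f \<subseteq> X" "keys g \<subseteq> X"
  shows "keys (bmul f g) \<subseteq> X"
  using assms(1)
proof (induct f rule: poly_mapping_add_induct)
  case (single u a)
  note u = this
  show ?case
    using assms(2)
  proof (induct g rule: poly_mapping_add_induct)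
    case (single v b)
    then show ?case
      using m_closed[OF u single] by (cases "m u v") (auto simp: bmul_single)
  qed (simp_all add: bmul_add2 keys_plus_subset)
qed (simp_all add: bmul_add1 keys_plus_subset)

lemma bmul_osingle:
  "bmul (osingle o' a) (single w b) = osingle (Option.bind o' (\<lambda>x. m x w)) (a * b)"
  "bmul (single w b) (osingle o' a) = osingle (Option.bind o' (m w)) (b * a)"
  by (cases o'; simp add: bmul_single)+

lemma bmul_assoc:
  assumes "keys f \<subseteq> X" "keys g \<subseteq> X" "keys h \<subseteq> X"
  shows "bmul (bmul f g) h = bmul f (bmul g h)"
  using assms(1)
proof (induct f rule: poly_mapping_add_induct)
  case (single u a)
  note u = this
  show ?case
    using assms(2)
  proof (induct g rule: poly_mapping_add_induct)
    case (single v b)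
    note v = this
    show ?case
      using assms(3)
    proof (induct h rule: poly_mapping_add_induct)
      case (single w c)
      then show ?case
        using m_assoc[OF u v single] by (simp add: bmul_single bmul_osingle mult.assoc)
    qed (simp_all add: bmul_add2)
  qed (simp_all add: bmul_add1 bmul_add2)
qed (simp_all add: bmul_add1)

lemma bmul_scl:
  "bmul (scl c f) g = scl c (bmul f g)" "bmul f (scl c g) = scl c (bmul f g)"
proof -
  have o: "osingle o' (c * a) = scl c (osingle o' a)" for o' a
    by (cases o') simp_all
  have "keys f \<subseteq> UNIV" "keys g \<subseteq> UNIV" by auto
  from this(1) have "bmul (scl c f) g = scl c (bmul f g) \<and> bmul f (scl c g) = scl c (bmul f g)"
  proof (induct f rule: poly_mapping_add_induct)
    case (single u a)
    show ?case
      using \<open>keys g \<subseteq> UNIV\<close>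
    proof (induct g rule: poly_mapping_add_induct)
      case (single v b)
      then show ?case
        using o by (simp add: bmul_single mult.assoc mult.left_commute[of a c])
    qed (simp_all add: bmul_add2 scl.scale_right_distrib del: scl_single)
  qed (simp_all add: bmul_add1 scl.scale_right_distrib)
  then show "bmul (scl c f) g = scl c (bmul f g)" "bmul f (scl c g) = scl c (bmul f g)"
    by auto
qed

lemma bmul_one:
  assumes "keys f \<subseteq> X"
  shows "bmul (\<Sum>u\<in>U. single u 1) f = f" "bmul f (\<Sum>u\<in>U. single u 1) = f"
proof -
  have "bmul (\<Sum>u\<in>U. single u 1) f = f \<and> bmul f (\<Sum>u\<in>U. single u 1) = f"
    using assms
  proof (induct f rule: poly_mapping_add_induct)
    case (single b c)
    obtain u where u: "u \<in> U" "m u b = Some b" "\<And>v. v \<in> U \<Longrightarrow> v \<noteq> u \<Longrightarrow> m v b = None"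
      using m_unit_left[OF single] by blast
    obtain w where w: "w \<in> U" "m b w = Some b" "\<And>v. v \<in> U \<Longrightarrow> v \<noteq> w \<Longrightarrow> m b v = None"
      using m_unit_right[OF single] by blast
    have "(\<Sum>v\<in>U. osingle (m v b) c) = (\<Sum>v\<in>U. if v = u then single b c else 0)"
      using u by (intro sum.cong) auto
    moreover have "(\<Sum>v\<in>U. osingle (m b v) c) = (\<Sum>v\<in>U. if v = w then single b c else 0)"
      using w by (intro sum.cong) auto
    ultimately show ?case
      using U(1) u(1) w(1) by (simp add: bmul_sum1 bmul_sum2 bmul_single)
  qed (simp_all add: bmul_add1 bmul_add2)
  then show "bmul (\<Sum>u\<in>U. single u 1) f = f" "bmul f (\<Sum>u\<in>U. single u 1) = f"
    by auto
qed

lemma kalgebra_BA: "kalgebra (BA :: ('k::field, 'b \<Rightarrow>\<^sub>0 'k) module)"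
proof -
  have ag: "abelian_group (BA :: ('k, 'b \<Rightarrow>\<^sub>0 'k) module)"
  proof (rule abelian_groupI)
    show "\<exists>y\<in>carrier BA. y \<oplus>\<^bsub>BA\<^esub> x = \<zero>\<^bsub>BA\<^esub>" if "x \<in> carrier BA" for x :: "'b \<Rightarrow>\<^sub>0 'k"
      using that by (intro bexI[of _ "- x"]) (simp_all add: keys_uminus')
  qed (simp_all add: add_ac keys_plus_subset)
  have "ring (BA :: ('k, 'b \<Rightarrow>\<^sub>0 'k) module)"
  proof (rule ringI[OF ag])
    show "Group.monoid (BA :: ('k, 'b \<Rightarrow>\<^sub>0 'k) module)"
    proof (rule monoidI)
      show "\<one>\<^bsub>BA\<^esub> \<in> carrier (BA :: ('k, 'b \<Rightarrow>\<^sub>0 'k) module)"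
        using U by (auto simp: BA_one intro!: keys_sum_subset)
    qed (use keys_bmul bmul_assoc bmul_one in \<open>simp_all add: BA_mult BA_one\<close>)
  qed (simp_all add: BA_mult bmul_add1 bmul_add2)
  moreover have "Module.module field_ring (BA :: ('k, 'b \<Rightarrow>\<^sub>0 'k) module)"
  proof (rule module_fieldI[OF ag])
    show "c \<odot>\<^bsub>BA\<^esub> x \<in> carrier BA" if "x \<in> carrier BA" for c and x :: "'b \<Rightarrow>\<^sub>0 'k"
      using that keys_scl[of c x] by auto
  qed (simp_all add: scl.scale_right_distrib scl.scale_left_distrib)
  ultimately show ?thesis
    by (simp add: kalgebra_def BA_mult bmul_scl)
qed

end

locale quot_alg = ideal I R for I and R :: "('k::field, 'a) module" (structure) +
  assumes kalg: "kalgebra R"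
begin

sublocale V: vspace R
  using kalg by (intro vspace.intro) (simp add: kalgebra_def)

abbreviation Q :: "('k, 'a set) module" where
  "Q \<equiv> quot_algebra R I"

abbreviation cls :: "'a \<Rightarrow> 'a set" where
  "cls x \<equiv> I +>\<^bsub>R\<^esub> x"

lemma Q_simps [simp]:
  "carrier Q = cls ` carrier R" "mult Q = rcoset_mult R I" "one Q = cls \<one>" "zero Q = I"
  "add Q = set_add R"
  by (auto simp: quot_algebra_def ring.defs module.defs FactRing_simps)

lemma Q_smult: "smult Q = (\<lambda>c X. \<Union>x\<in>X. cls (c \<odot> x))"
  by (simp add: quot_algebra_def ring.defs module.defs)

lemma cls_eq_iff: "x \<in> carrier R \<Longrightarrow> y \<in> carrier R \<Longrightarrow> cls x = cls y \<longleftrightarrow> x \<ominus> y \<in> I"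
  using quotient_eq_iff_same_a_r_cos[OF ideal_axioms] by auto

lemma cls_zero: "cls \<zero> = I"
  by (rule a_rcos_const[OF additive_subgroup.zero_closed[OF is_additive_subgroup]])

lemma cls_add: "x \<in> carrier R \<Longrightarrow> y \<in> carrier R \<Longrightarrow> cls x \<oplus>\<^bsub>Q\<^esub> cls y = cls (x \<oplus> y)"
  by (simp add: a_rcos_sum)

lemma cls_mult: "x \<in> carrier R \<Longrightarrow> y \<in> carrier R \<Longrightarrow> cls x \<otimes>\<^bsub>Q\<^esub> cls y = cls (x \<otimes> y)"
  by (simp add: rcoset_mult_add)

text \<open>A ring ideal is stable under scalars since scaling by \<open>c\<close> is multiplication
  by \<open>c \<odot> \<one>\<close>.\<close>

lemma smult_ideal:
  assumes "i \<in> I"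
  shows "c \<odot> i \<in> I"
proof -
  note iR = a_Hcarr[OF assms]
  have "c \<odot> (\<one> \<otimes> i) = (c \<odot> \<one>) \<otimes> i"
    using kalg iR one_closed unfolding kalgebra_def by blast
  then show ?thesis
    using I_l_closed[OF assms, of "c \<odot> \<one>"] iR by simp
qed

lemma cls_smult:
  assumes "x \<in> carrier R"
  shows "c \<odot>\<^bsub>Q\<^esub> cls x = cls (c \<odot> x)"
proof -
  have "cls (c \<odot> y) = cls (c \<odot> x)" if "y \<in> cls x" for y
  proof -
    obtain i where i: "i \<in> I" "y = i \<oplus> x"
      using \<open>y \<in> cls x\<close> by (auto simp: a_r_coset_def r_coset_def)
    have "c \<odot> y = c \<odot> i \<oplus> c \<odot> x"
      using i a_Hcarr[OF i(1)] assms by (simp add: V.smult_add)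
    then have "c \<odot> y \<in> cls (c \<odot> x)"
      using smult_ideal[OF i(1), of c] by (auto simp: a_r_coset_def r_coset_def)
    then show ?thesis
      using a_repr_independence'[of "c \<odot> y" "c \<odot> x"] assms by simp
  qed
  then have "c \<odot>\<^bsub>Q\<^esub> cls x = (\<Union>y\<in>cls x. cls (c \<odot> x))"
    unfolding Q_smult by (intro SUP_cong refl)
  moreover have "cls x \<noteq> {}"
    using a_rcos_self[OF assms] by blast
  ultimately show ?thesis
    by simp
qed

lemma kalgebra_Q: "kalgebra Q"
proof -
  have ring: "ring Q"
    by (rule ring_cong[OF quotient_is_ring]) (auto simp: quot_algebra_def ring.defs module.defs)
  interpret Q: ring Q by (rule ring)
  have "Module.module field_ring Q"
  proof (rule module_fieldI)
    show "abelian_group Q" ..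
    show "c \<odot>\<^bsub>Q\<^esub> x \<in> carrier Q" if "x \<in> carrier Q" for c x
      using that by (auto simp: cls_smult)
    show "(c + d) \<odot>\<^bsub>Q\<^esub> x = c \<odot>\<^bsub>Q\<^esub> x \<oplus>\<^bsub>Q\<^esub> d \<odot>\<^bsub>Q\<^esub> x" if "x \<in> carrier Q" for c d x
      using that by (auto simp: cls_smult cls_add V.smult_add_left simp del: Q_simps(5))
    show "c \<odot>\<^bsub>Q\<^esub> (x \<oplus>\<^bsub>Q\<^esub> y) = c \<odot>\<^bsub>Q\<^esub> x \<oplus>\<^bsub>Q\<^esub> c \<odot>\<^bsub>Q\<^esub> y" if "x \<in> carrier Q" "y \<in> carrier Q" for c x y
      using that by (auto simp: cls_smult cls_add V.smult_add simp del: Q_simps(5))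
    show "(c * d) \<odot>\<^bsub>Q\<^esub> x = c \<odot>\<^bsub>Q\<^esub> (d \<odot>\<^bsub>Q\<^esub> x)" if "x \<in> carrier Q" for c d x
      using that by (auto simp: cls_smult V.smult_smult)
    show "1 \<odot>\<^bsub>Q\<^esub> x = x" if "x \<in> carrier Q" for x
      using that by (auto simp: cls_smult)
  qed
  moreover have "c \<odot>\<^bsub>Q\<^esub> (x \<otimes>\<^bsub>Q\<^esub> y) = (c \<odot>\<^bsub>Q\<^esub> x) \<otimes>\<^bsub>Q\<^esub> y \<and> c \<odot>\<^bsub>Q\<^esub> (x \<otimes>\<^bsub>Q\<^esub> y) = x \<otimes>\<^bsub>Q\<^esub> (c \<odot>\<^bsub>Q\<^esub> y)"
    if xy: "x \<in> carrier Q" "y \<in> carrier Q" for c x y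
  proof -
    obtain x' y' where x: "x' \<in> carrier R" "x = cls x'" and y: "y' \<in> carrier R" "y = cls y'"
      using xy by auto
    have "c \<odot> (x' \<otimes> y') = (c \<odot> x') \<otimes> y'" "c \<odot> (x' \<otimes> y') = x' \<otimes> (c \<odot> y')"
      using kalg x(1) y(1) unfolding kalgebra_def by blast+
    then show ?thesis
      using x y by (simp add: cls_mult cls_smult V.smult_cl del: Q_simps(2))
  qed
  ultimately show ?thesis
    using ring unfolding kalgebra_def by blast
qed

end


section \<open>The space of admissible pairs\<close>

abbreviation lin :: "(('b \<Rightarrow>\<^sub>0 'k::field) \<Rightarrow> ('c \<Rightarrow>\<^sub>0 'k)) \<Rightarrow> bool" where
  "lin \<equiv> module_hom scl scl"

lemma lin_iff: "lin T \<longleftrightarrow> (\<forall>x y. T (x + y) = T x + T y) \<and> (\<forall>c x. T (scl c x) = scl c (T x))"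
  by (auto simp: module_hom_def module_hom_axioms_def module_scl)

lemma lin_zero [simp]: "lin T \<Longrightarrow> T 0 = 0"
  by (rule module_hom.zero)

lemma lin_add: "lin T \<Longrightarrow> T (x + y) = T x + T y"
  by (rule module_hom.add)

lemma lin_diff: "lin T \<Longrightarrow> T (x - y) = T x - T y"
  by (rule module_hom.diff)

lemma lin_sum: "lin T \<Longrightarrow> T (\<Sum>i\<in>I. f i) = (\<Sum>i\<in>I. T (f i))"
  by (rule module_hom.sum)

lemma lin_scale: "lin T \<Longrightarrow> T (scl c x) = scl c (T x)"
  by (rule module_hom.scale)

lemma lin_intros:
  "lin (\<lambda>v. v)" "lin (\<lambda>v. 0)"
  "lin f \<Longrightarrow> lin f' \<Longrightarrow> lin (\<lambda>v. f v + f' v)"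
  "lin f \<Longrightarrow> lin f' \<Longrightarrow> lin (\<lambda>v. f v - f' v)"
  "lin f \<Longrightarrow> lin (\<lambda>v. scl c (f v))"
  "(B \<Longrightarrow> lin f) \<Longrightarrow> (\<not> B \<Longrightarrow> lin f') \<Longrightarrow> lin (\<lambda>v. if B then f v else f' v)"
  unfolding lin_iff
  by (auto simp: scl.scale_right_distrib scl.scale_right_diff_distrib mult.commute)

lemma lin_comp: "lin f \<Longrightarrow> lin g \<Longrightarrow> lin (\<lambda>v. f (g v))"
  by (simp add: lin_iff)

lemma lin_sum_intro: "(\<And>i. i \<in> I \<Longrightarrow> lin (f i)) \<Longrightarrow> lin (\<lambda>v. \<Sum>i\<in>I. f i v)"
  unfolding lin_iff by (auto simp: sum.distrib scl.scale_sum_right)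

lemma lin_lext [simp, intro]: "lin (lext scl F)"
  by (rule module_hom_lext[OF module_scl])

lemma lin_eqI:
  assumes "lin S" "lin T" "keys v \<subseteq> B" "\<And>b. b \<in> B \<Longrightarrow> S (single b 1) = T (single b 1)"
  shows "S v = T v"
  by (rule module_hom_scl_eqI[OF assms(1,2)]) (use assms(3,4) in blast)

lemma lext_scl_single [simp]: "lext scl F (single b 1) = F b"
  by (simp add: lext_single[OF module_scl])

lemma keys_lin:
  assumes "lin T" "keys v \<subseteq> B" "\<And>b. b \<in> B \<Longrightarrow> keys (T (single b 1)) \<subseteq> S"
  shows "keys (T v) \<subseteq> S"
proof -
  have "T v = lext scl (\<lambda>b. T (single b 1)) v"
    by (rule lin_eqI[OF assms(1) lin_lext subset_UNIV]) simp
  then show ?thesis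
    using keys_lext[of v "\<lambda>b. T (single b 1)" S] assms(2,3) by auto
qed

section \<open>Exchange of the two paths of a pair\<close>

definition sw :: "(('p \<times> 'p) \<Rightarrow>\<^sub>0 'k::field) \<Rightarrow> (('p \<times> 'p) \<Rightarrow>\<^sub>0 'k)" where
  "sw = lext scl (\<lambda>b. single (prod.swap b) 1)"

lemma lin_sw [simp, intro]: "lin sw"
  by (simp add: sw_def)

lemma sw_single [simp]: "sw (single (p, q) c) = single (q, p) c"
  by (simp add: sw_def lext_single[OF module_scl])

lemma sw_sw [simp]: "sw (sw v) = v"
  by (rule lin_eqI[of "\<lambda>v. sw (sw v)" "\<lambda>v. v", OF lin_comp[OF lin_sw lin_sw] lin_intros(1) subset_UNIV])
    auto

lemma sw_simps [simp]:
  "sw 0 = 0" "sw (x + y) = sw x + sw y" "sw (x - y) = sw x - sw y" "sw (\<Sum>i\<in>I. f i) = (\<Sum>i\<in>I. sw (f i))"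
  by (simp_all add: lin_add lin_diff lin_sum)

lemma keys_sw: "keys (sw v) = prod.swap ` keys v"
proof -
  have *: "keys (sw v) \<subseteq> prod.swap ` keys v" for v :: "('p \<times> 'p) \<Rightarrow>\<^sub>0 'k::field"
    by (rule keys_lin[OF lin_sw order_refl]) auto
  have "prod.swap ` keys v \<subseteq> keys (sw v)"
    using *[of "sw v"] by force
  with * show ?thesis by auto
qed

locale special_quiver = fin_digraph G for G :: "('v, 'e) pre_digraph" (structure) +
  fixes sp :: "'v \<Rightarrow> 'e"
  assumes sp: "i \<in> verts G \<Longrightarrow> sp i \<in> out_arcs G i"
begin

lemmas path_defs = src_def tgt_def plen_def triv_def arr_def pcat_def last_arrow_def first_arrow_def
  phat_def ptilde_def

lemma awalk_awlast: "awalk u xs w \<Longrightarrow> awlast u xs = w"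
  by (rule awlast_if_cas) (simp add: awalk_def)

definition Adm :: "(('v, 'e) path \<times> ('v, 'e) path) set" where
  "Adm = {(p, q). admissible sp p q}"

text \<open>The pairs with a trivial path need no clause of their own: the condition on last arrows
  is vacuous for an empty list, and the common end \<open>w\<close> forces the trivial path to sit
  at the end of the other one.\<close>

lemma Adm_iff: "((u, as), (v, bs)) \<in> Adm \<longleftrightarrow>
    (\<exists>w. awalk u as w \<and> awalk v bs w \<and> (as \<noteq> [] \<longrightarrow> bs \<noteq> [] \<longrightarrow> last as = last bs \<longrightarrow> \<not> special sp (last as)))"
  (is "?L \<longleftrightarrow> ?R")
proof
  assume ?L
  then show ?R
    by (cases "as = []"; cases "bs = []")
      (auto simp: Adm_def admissible_def paths_def path_defs awalk_Nil_iff Suc_le_eq)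
next
  assume ?R
  then show ?L
    by (cases "as = []"; cases "bs = []")
      (auto simp: Adm_def admissible_def paths_def path_defs awalk_Nil_iff Suc_le_eq awalk_awlast)
qed

lemma Adm_swap: "(p, q) \<in> Adm \<longleftrightarrow> (q, p) \<in> Adm"
  by (cases p; cases q) (auto simp: Adm_iff)

lemma Adm_verts: "(p, q) \<in> Adm \<Longrightarrow> fst p \<in> verts G \<and> fst q \<in> verts G"
  by (cases p; cases q) (auto simp: Adm_iff dest: awalk_hd_in_verts)

text \<open>The cases of \<open>gen_ract\<close> without their coefficient. A product is rewritten
  only where the pair would cease to be admissible: when \<open>\<alpha>\<^sup>*\<close> meets a
  trivial \<open>p\<close> and a \<open>q\<close> ending in the special \<open>\<alpha>\<close>,
  then \<open>\<alpha>\<^sup>*\<alpha>\<close> is replaced by the vertex minus the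
  \<open>\<beta>\<^sup>*\<beta>\<close> of the siblings.\<close>

fun Lb :: "('v, 'e) leavitt_gen \<Rightarrow> ('v, 'e) path \<times> ('v, 'e) path \<Rightarrow>
    (('v, 'e) path \<times> ('v, 'e) path) \<Rightarrow>\<^sub>0 'k::field" where
  "Lb (Vtx j) (p, q) = (if j = src p then single (p, q) 1 else 0)"
| "Lb (Arr \<alpha>) (p, q) =
    (if plen p \<ge> 1
     then (if \<alpha> = first_arrow p then single (ptilde p, q) 1 else 0)
     else (if tail G \<alpha> = tgt q then single (triv (head G \<alpha>), pcat (arr \<alpha>) q) 1 else 0))"
| "Lb (Ghost \<alpha>) (p, q) =
    (if plen p = 0 \<and> plen q \<ge> 1 \<and> last_arrow q = \<alpha> \<and> special sp \<alpha>
     then single (triv (tail G \<alpha>), phat q) 1 - (\<Sum>\<beta>\<in>siblings \<alpha>. single (arr \<beta>, pcat (arr \<beta>) (phat q)) 1)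
     else (if src p = head G \<alpha> then single (pcat p (arr \<alpha>), q) 1 else 0))"

definition Lact :: "('v, 'e) leavitt_gen \<Rightarrow> ((('v, 'e) path \<times> ('v, 'e) path) \<Rightarrow>\<^sub>0 'k::field) \<Rightarrow> _" where
  "Lact g = lext scl (Lb g)"

text \<open>
  The pair \<open>(p, q)\<close> stands for the element \<open>p\<^sup>*q\<close> of the Leavitt path algebra. Then \<open>Lact\<close> is the
  left multiplication; the right multiplication is its conjugate under the involution which exchanges
  \<open>p\<^sup>*q\<close> and \<open>q\<^sup>*p\<close>, so that \<open>Ract (Ghost \<alpha>)\<close> is right multiplication by \<open>\<alpha>\<close>.
\<close>

definition Ract :: "('v, 'e) leavitt_gen \<Rightarrow> ((('v, 'e) path \<times> ('v, 'e) path) \<Rightarrow>\<^sub>0 'k::field) \<Rightarrow> _" where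
  "Ract g v = sw (Lact g (sw v))"

lemma lin_Lact [simp, intro]: "lin (Lact g)"
  by (simp add: Lact_def)

lemma lin_Ract [simp, intro]: "lin (Ract g)"
  unfolding Ract_def[abs_def] by (rule lin_comp[OF lin_sw lin_comp[OF lin_Lact lin_sw]])

lemma lin_Lact_Lact [simp, intro]: "lin (\<lambda>v. Lact g (Lact h v))"
  by (rule lin_comp[OF lin_Lact lin_Lact])

lemma Lact_single [simp]: "Lact g (single b 1) = Lb g b"
  by (simp add: Lact_def)

lemma Ract_single [simp]: "Ract g (single (p, q) 1) = sw (Lb g (q, p))"
  by (simp add: Ract_def)

lemmas Lact_simps = lin_zero[OF lin_Lact] lin_add[OF lin_Lact] lin_diff[OF lin_Lact] lin_sum[OF lin_Lact]
  lin_scale[OF lin_Lact]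
lemmas Ract_simps = lin_zero[OF lin_Ract] lin_add[OF lin_Ract] lin_diff[OF lin_Ract] lin_sum[OF lin_Ract]
  lin_scale[OF lin_Ract]

lemma finite_siblings [simp]: "finite (siblings a)"
  by (rule finite_subset[OF _ finite_arcs]) (auto simp: siblings_def)

lemma siblings_iff: "b \<in> siblings a \<longleftrightarrow> b \<in> arcs G \<and> tail G b = tail G a \<and> b \<noteq> a"
  by (auto simp: siblings_def)

lemma sibling_not_special: "b \<in> siblings a \<Longrightarrow> special sp a \<Longrightarrow> \<not> special sp b"
  by (auto simp: siblings_def special_def)

lemma leavitt_gens_iff [simp]:
  "Vtx j \<in> leavitt_gens \<longleftrightarrow> j \<in> verts G" "Arr a \<in> leavitt_gens \<longleftrightarrow> a \<in> arcs G"
  "Ghost a \<in> leavitt_gens \<longleftrightarrow> a \<in> arcs G"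
  by (auto simp: leavitt_gens_def)

text \<open>Exposes the arrows on which left multiplication depends: the first one of
  \<open>p\<close>, which an arrow may cancel, and the last one of \<open>q\<close>, which decides
  about rewriting when \<open>p\<close> is trivial.\<close>

lemma Adm_cases:
  assumes "b \<in> Adm"
  obtains (nil) u where "b = ((u, []), (u, []))" "u \<in> verts G"
  | (left) a as v where "b = ((tail G a, a # as), (v, []))" "a \<in> arcs G" "awalk (head G a) as v"
  | (right) u bs a where "b = ((head G a, []), (u, bs @ [a]))" "a \<in> arcs G" "awalk u bs (tail G a)"
  | (both) a as v bs c where "b = ((tail G a, a # as), (v, bs @ [c]))" "a \<in> arcs G" "c \<in> arcs G"
      "awalk (head G a) as (head G c)" "awalk v bs (tail G c)" "last (a # as) = c \<longrightarrow> \<not> special sp c"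
proof -
  obtain u as v bs where b: "b = ((u, as), (v, bs))" by (metis prod.collapse)
  with assms obtain w where w: "awalk u as w" "awalk v bs w"
    "as \<noteq> [] \<longrightarrow> bs \<noteq> [] \<longrightarrow> last as = last bs \<longrightarrow> \<not> special sp (last as)"
    by (auto simp: Adm_iff)
  show thesis
  proof (cases as)
    case Nil
    then show thesis
      using w b nil right by (cases bs rule: rev_cases) (auto simp: awalk_simps)
  next
    case (Cons a as')
    then show thesis
      using w b left both by (cases bs rule: rev_cases) (auto simp: awalk_simps)
  qed
qed

lemma keys_Lb:
  assumes "b \<in> Adm" "g \<in> leavitt_gens"
  shows "keys (Lb g b :: _ \<Rightarrow>\<^sub>0 'k::field) \<subseteq>
    {c \<in> Adm. int (plen (snd c)) - int (plen (fst c)) = int (plen (snd b)) - int (plen (fst b)) + gen_degree g \<and>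
      fst (snd c) = fst (snd b)}"
    (is "_ \<subseteq> ?S")
  using assms(1)
proof (cases rule: Adm_cases)
  case (nil u)
  then show ?thesis
    using assms(2) by (cases g) (auto simp: path_defs Adm_iff awalk_simps)
next
  case (left a as v)
  then show ?thesis
    using assms(2) by (cases g) (auto simp: path_defs Adm_iff awalk_simps)
next
  case (right u bs a)
  \<comment> \<open>Both paths of such a pair end in the same arrow \<open>\<beta>\<close>; it is
    admissible because a sibling of a special arrow is not special.\<close>
  have S: "keys (\<Sum>\<beta>\<in>siblings a. single ((tail G \<beta>, [\<beta>]), (u, bs @ [\<beta>])) (1::'k)) \<subseteq> ?S"
    if "g = Ghost a" "special sp a"
    using that right
    by (intro keys_sum_subset)
      (auto simp: path_defs Adm_iff awalk_simps siblings_iff special_def)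
  show ?thesis
  proof (cases g)
    case (Ghost c)
    show ?thesis
    proof (cases "c = a \<and> special sp a")
      case True
      then have "Lb g b = single ((tail G a, []), (u, bs)) (1::'k) -
          (\<Sum>\<beta>\<in>siblings a. single ((tail G \<beta>, [\<beta>]), (u, bs @ [\<beta>])) 1)"
        using right Ghost by (simp add: path_defs)
      moreover have "keys (single ((tail G a, []), (u, bs)) (1::'k)) \<subseteq> ?S"
        using right Ghost True by (auto simp: path_defs Adm_iff awalk_simps)
      from keys_minus_subset[OF this S] have
        "keys (single ((tail G a, []), (u, bs)) (1::'k) -
          (\<Sum>\<beta>\<in>siblings a. single ((tail G \<beta>, [\<beta>]), (u, bs @ [\<beta>])) 1)) \<subseteq> ?S"
        using Ghost True by blast
      ultimately show ?thesis
        by (simp only:)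
    next
      case False
      then show ?thesis
        using right Ghost assms(2) by (auto simp: path_defs Adm_iff awalk_simps)
    qed
  qed (use right assms(2) in \<open>auto simp: path_defs Adm_iff awalk_simps awalk_awlast\<close>)
next
  case (both a as v bs c)
  then show ?thesis
    using assms(2)
    by (cases g; cases as rule: rev_cases) (auto simp: path_defs Adm_iff awalk_simps)
qed

lemma keys_Lact: "g \<in> leavitt_gens \<Longrightarrow> keys v \<subseteq> Adm \<Longrightarrow> keys (Lact g v) \<subseteq> Adm"
  by (rule keys_lin[OF lin_Lact]) (use keys_Lb in fastforce)+

lemma keys_sw_Adm: "keys v \<subseteq> Adm \<Longrightarrow> keys (sw v) \<subseteq> Adm"
  using Adm_swap by (auto simp: keys_sw)

lemma keys_Ract: "g \<in> leavitt_gens \<Longrightarrow> keys v \<subseteq> Adm \<Longrightarrow> keys (Ract g v) \<subseteq> Adm"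
  by (simp add: Ract_def keys_sw_Adm keys_Lact)

text \<open>This lemma and the next three verify the relations of the Leavitt path algebra for the
  operators \<open>Lact g\<close>; by them the action of the free algebra factors through the
  quotient.\<close>

lemma Lact_vertex:
  "Lact (Vtx i) (Lact (Vtx j) v) = (if i = j then Lact (Vtx i) v else 0)"
  "keys v \<subseteq> Adm \<Longrightarrow> (\<Sum>i\<in>verts G. Lact (Vtx i) v) = v"
proof -
  show "Lact (Vtx i) (Lact (Vtx j) v) = (if i = j then Lact (Vtx i) v else 0)"
    by (rule lin_eqI[OF _ _ subset_UNIV]) (auto intro!: lin_intros)
  show "(\<Sum>i\<in>verts G. Lact (Vtx i) v) = v" if "keys v \<subseteq> Adm"
    by (rule lin_eqI[OF _ _ that]) (auto intro!: lin_intros lin_sum_intro simp: path_defs dest!: Adm_verts)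
qed

lemma Lact_arrow_vertex:
  assumes "keys v \<subseteq> Adm" "a \<in> arcs G"
  shows "Lact (Vtx (head G a)) (Lact (Arr a) v) = Lact (Arr a) v"
    and "Lact (Arr a) (Lact (Vtx (tail G a)) v) = Lact (Arr a) v"
    and "Lact (Vtx (tail G a)) (Lact (Ghost a) v) = Lact (Ghost a) v"
    and "Lact (Ghost a) (Lact (Vtx (head G a)) v) = Lact (Ghost a) v"
proof -
  have basis: "Lact (Vtx (head G a)) (Lact (Arr a) (single x 1)) = Lact (Arr a) (single x 1)"
    "Lact (Arr a) (Lact (Vtx (tail G a)) (single x 1)) = Lact (Arr a) (single x 1)"
    "Lact (Vtx (tail G a)) (Lact (Ghost a) (single x 1)) = Lact (Ghost a) (single x 1)"
    "Lact (Ghost a) (Lact (Vtx (head G a)) (single x 1)) = Lact (Ghost a) (single x 1)" if "x \<in> Adm" for x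
    using that assms(2)
    by (cases rule: Adm_cases;
        auto simp: path_defs awalk_awlast Lact_simps awalk_simps siblings_iff cong: sum.cong_simp)+
  show "Lact (Vtx (head G a)) (Lact (Arr a) v) = Lact (Arr a) v"
    "Lact (Arr a) (Lact (Vtx (tail G a)) v) = Lact (Arr a) v"
    "Lact (Vtx (tail G a)) (Lact (Ghost a) v) = Lact (Ghost a) v"
    "Lact (Ghost a) (Lact (Vtx (head G a)) v) = Lact (Ghost a) v"
    by (rule lin_eqI[OF lin_Lact_Lact lin_Lact assms(1)], erule basis)+
qed

lemma Lact_arrow_ghost:
  assumes "keys v \<subseteq> Adm" "a \<in> arcs G" "b \<in> arcs G"
  shows "Lact (Arr a) (Lact (Ghost b) v) = (if a = b then Lact (Vtx (head G a)) v else 0)"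
proof (rule lin_eqI[OF _ _ assms(1)])
  fix x assume "x \<in> Adm"
  then show "Lact (Arr a) (Lact (Ghost b) (single x 1)) =
      (if a = b then Lact (Vtx (head G a)) (single x 1) else 0)"
    by (cases rule: Adm_cases; insert assms(2,3))
      (auto simp: path_defs awalk_awlast Lact_simps awalk_simps siblings_iff)
qed (auto intro!: lin_intros)

text \<open>If \<open>p\<close> begins with an arrow \<open>c\<close>, only \<open>c\<close>
  contributes and restores the pair. If \<open>p\<close> is trivial, each sibling of the special
  arrow contributes a pair ending in itself on both sides, and the special arrow contributes the
  original pair minus exactly these.\<close>

lemma Lact_ghost_arrow:
  fixes v :: "(('v, 'e) path \<times> ('v, 'e) path) \<Rightarrow>\<^sub>0 'k::field"
  assumes "keys v \<subseteq> Adm" "i \<in> verts G"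
  shows "(\<Sum>a\<in>out_arcs G i. Lact (Ghost a) (Lact (Arr a) v)) = Lact (Vtx i) v"
proof (rule lin_eqI[OF _ _ assms(1)])
  fix x assume x: "x \<in> Adm"
  have fin: "finite (out_arcs G i)"
    by (rule finite_subset[OF _ finite_arcs]) auto
  have sib: "out_arcs G i = insert (sp i) (siblings (sp i))" "sp i \<notin> siblings (sp i)"
    using sp[OF assms(2)] by (auto simp: siblings_iff)
  have spi: "tail G (sp i) = i" "special sp (sp i)"
    using sp[OF assms(2)] by (auto simp: special_def)
  from x show "(\<Sum>a\<in>out_arcs G i. Lact (Ghost a) (Lact (Arr a) (single x (1::'k)))) = Lact (Vtx i) (single x (1::'k))"
  proof (cases "snd (fst x)")
    case Nil
    obtain w v bs where xe: "x = ((w, []), (v, bs))"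
      by (metis Nil prod.collapse)
    have "awalk v bs w"
      using x unfolding xe by (auto simp: Adm_iff awalk_Nil_iff)
    then have [simp]: "awlast v bs = w"
      by (rule awalk_awlast)
    show ?thesis
    proof (cases "i = w")
      case True
      have "Lact (Ghost a) (Lact (Arr a) (single x (1::'k))) = single ((i, [a]), (v, bs @ [a])) (1::'k)"
        if "a \<in> siblings (sp i)" for a
        using that True spi sibling_not_special[OF that] by (simp add: xe path_defs siblings_iff)
      then have "(\<Sum>a\<in>siblings (sp i). Lact (Ghost a) (Lact (Arr a) (single x (1::'k)))) =
          (\<Sum>a\<in>siblings (sp i). single ((i, [a]), (v, bs @ [a])) (1::'k))"
        by (rule sum.cong[OF refl])
      moreover have "Lact (Ghost (sp i)) (Lact (Arr (sp i)) (single x (1::'k))) =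
          single x (1::'k) - (\<Sum>a\<in>siblings (sp i). single ((tail G a, [a]), (v, bs @ [a])) (1::'k))"
        using True spi by (simp add: xe path_defs)
      moreover have "(\<Sum>a\<in>siblings (sp i). single ((tail G a, [a]), (v, bs @ [a])) (1::'k)) =
          (\<Sum>a\<in>siblings (sp i). single ((i, [a]), (v, bs @ [a])) (1::'k))"
        using spi by (intro sum.cong) (auto simp: siblings_iff)
      moreover have "(\<Sum>a\<in>out_arcs G i. Lact (Ghost a) (Lact (Arr a) (single x (1::'k)))) =
          Lact (Ghost (sp i)) (Lact (Arr (sp i)) (single x (1::'k))) +
          (\<Sum>a\<in>siblings (sp i). Lact (Ghost a) (Lact (Arr a) (single x (1::'k))))"
        unfolding sib(1) by (rule sum.insert) (use sib(2) in auto)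
      moreover have "Lact (Vtx i) (single x (1::'k)) = single x (1::'k)"
        using True by (simp add: xe path_defs)
      ultimately show ?thesis
        by (simp only: diff_add_cancel)
    next
      case False
      then show ?thesis by (auto simp: xe path_defs Lact_simps intro!: sum.neutral)
    qed
  next
    case (Cons c as)
    then obtain u v bs where xu: "x = ((u, c # as), (v, bs))"
      by (metis prod.collapse)
    have c: "c \<in> arcs G" "u = tail G c"
      and ns: "as = [] \<Longrightarrow> bs \<noteq> [] \<Longrightarrow> last bs = c \<Longrightarrow> \<not> special sp c"
      using x unfolding xu by (auto simp: Adm_iff awalk_Cons_iff)
    note xe = xu[unfolded c(2)]
    \<comment> \<open>When \<open>Ghost c\<close> puts \<open>c\<close> back, \<open>ns\<close>
      excludes the rewriting clause of \<open>Lb\<close>.\<close>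
    have "Lact (Ghost a) (Lact (Arr a) (single x (1::'k))) = (if a = c then single x (1::'k) else 0)" for a
      using ns by (cases "bs = []") (auto simp: xe path_defs Lact_simps)
    then show ?thesis
      using fin c(1) by (auto simp: xe path_defs)
  qed
qed (auto intro!: lin_intros lin_sum_intro)

section \<open>Commutation of left and right multiplications\<close>

lemma commute_VA:
  assumes "x \<in> Adm" "g \<in> leavitt_gens"
  shows "Lact g (Ract (Vtx i) (single x 1)) = Ract (Vtx i) (Lact g (single x 1))"
  using assms(1)
  by (cases rule: Adm_cases; cases g;
      auto simp: path_defs Ract_def Lact_simps awalk_awlast siblings_iff cong: sum.cong_simp)

lemma commute_AA:
  assumes "x \<in> Adm"
  shows "Lact (Arr a) (Ract (Arr b) (single x 1)) = Ract (Arr b) (Lact (Arr a) (single x 1))"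
  using assms
proof (cases rule: Adm_cases)
  case (left a as v)
  then show ?thesis
    by (cases as) (auto simp: path_defs Ract_def Lact_simps awalk_awlast awalk_simps)
next
  case (right u bs a)
  then show ?thesis
    by (cases bs) (auto simp: path_defs Ract_def Lact_simps awalk_awlast awalk_simps)
next
  case (both a as v bs c)
  then show ?thesis
    by (cases bs) (auto simp: path_defs Ract_def Lact_simps awalk_awlast awalk_simps)
qed (auto simp: path_defs Ract_def Lact_simps awalk_awlast awalk_simps)

lemma commute_AG:
  assumes "x \<in> Adm" "a \<in> arcs G" "b \<in> arcs G"
  shows "Lact (Arr a) (Ract (Ghost b) (single x 1)) = Ract (Ghost b) (Lact (Arr a) (single x 1))"
  using assms(1)
proof (cases rule: Adm_cases)
  case (left c as v)
  then show ?thesis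
    using assms(2,3)
    by (cases as rule: rev_cases)
      (auto simp: path_defs Ract_def Lact_simps awalk_awlast awalk_simps siblings_iff
        cong: sum.cong_simp)
next
  case (right u bs c)
  then show ?thesis
    using assms(2,3)
    by (cases bs) (auto simp: path_defs Ract_def Lact_simps awalk_awlast awalk_simps)
next
  case (both c as v bs d)
  then show ?thesis
    using assms(2,3)
    by (cases bs) (auto simp: path_defs Ract_def Lact_simps awalk_awlast awalk_simps)
qed (use assms(2,3) in \<open>auto simp: path_defs Ract_def Lact_simps awalk_awlast awalk_simps\<close>)

text \<open>The delicate pairs are those in which a product \<open>\<alpha>\<^sup>*\<alpha>\<close>
  with special \<open>\<alpha>\<close> is created: both orders must rewrite it in the same way. The
  splittings of the lists expose the end of the path whose last arrow is tested for this.\<close>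

lemma commute_GG:
  assumes "x \<in> Adm" "a \<in> arcs G" "b \<in> arcs G"
  shows "Lact (Ghost a) (Ract (Ghost b) (single x 1)) = Ract (Ghost b) (Lact (Ghost a) (single x 1))"
  using assms(1)
proof (cases rule: Adm_cases)
  case (left c as v)
  then show ?thesis
    using assms(2,3)
    by (cases as rule: rev_cases)
      (auto simp: path_defs Ract_def Lact_simps awalk_awlast awalk_simps siblings_iff
        special_def cong: sum.cong_simp)
next
  case (right u bs c)
  then show ?thesis
    using assms(2,3)
    by (cases bs)
      (auto simp: path_defs Ract_def Lact_simps awalk_awlast awalk_simps siblings_iff
        special_def cong: sum.cong_simp)
next
  case (both c as v bs d)
  then show ?thesis
    using assms(2,3)
    by (cases bs) (auto simp: path_defs Ract_def Lact_simps awalk_awlast awalk_simps)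
qed (use assms(2,3) in \<open>auto simp: path_defs Ract_def Lact_simps awalk_awlast awalk_simps special_def
   siblings_iff cong: sum.cong_simp\<close>)

end

context special_quiver
begin

text \<open>Commutation is associativity of the Leavitt path algebra on basis elements. As
  \<open>Ract\<close> is conjugate to \<open>Lact\<close> and \<open>Adm\<close> is symmetric, the
  pair of generators \<open>(g, h)\<close> follows from \<open>(h, g)\<close>; only the combinations
  treated above are left.\<close>

lemma commute:
  fixes v :: "(('v, 'e) path \<times> ('v, 'e) path) \<Rightarrow>\<^sub>0 'a::field"
  assumes "keys v \<subseteq> Adm" "g \<in> leavitt_gens" "h \<in> leavitt_gens"
  shows "Lact g (Ract h v) = Ract h (Lact g v)"
proof -
  let ?C = "\<lambda>g h. \<forall>x\<in>Adm. Lact g (Ract h (single x (1::'a))) = Ract h (Lact g (single x 1))"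
  \<comment> \<open>Applying \<open>sw\<close> to the identity at \<open>(q, p)\<close> turns it
    into the one at \<open>(p, q)\<close> with the roles of the generators exchanged.\<close>
  have swap: "?C h g" if C: "?C g h" for g h
  proof
    fix x assume "x \<in> Adm"
    then obtain p q where x: "x = (p, q)" "(q, p) \<in> Adm"
      using Adm_swap by (metis prod.collapse)
    have "Lact g (Ract h (single (q, p) (1::'a))) = Ract h (Lact g (single (q, p) 1))"
      using C x(2) by blast
    then have "sw (Lact g (sw (Lact h (single (p, q) (1::'a))))) = Lact h (sw (Lact g (single (q, p) 1)))"
      by (simp add: Ract_def del: Lact_single)
    then show "Lact h (Ract g (single x (1::'a))) = Ract g (Lact h (single x 1))"
      by (simp add: Ract_def x del: Lact_single)
  qed
  have "?C g h"
  proof (cases h)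
    case (Vtx i)
    show ?thesis
      unfolding Vtx by (intro ballI commute_VA assms(2))
  next
    case h: (Arr a)
    then have a: "a \<in> arcs G" using assms(3) by simp
    show ?thesis
    proof (cases g)
      case (Vtx i)
      show ?thesis
        unfolding Vtx by (rule swap) (intro ballI commute_VA assms(3))
    next
      case (Arr b)
      show ?thesis
        unfolding Arr h by (intro ballI commute_AA)
    next
      case (Ghost b)
      then have b: "b \<in> arcs G" using assms(2) by simp
      show ?thesis
        unfolding Ghost h by (rule swap) (intro ballI commute_AG a b)
    qed
  next
    case h: (Ghost a)
    then have a: "a \<in> arcs G" using assms(3) by simp
    show ?thesis
    proof (cases g)
      case (Vtx i)
      show ?thesis
        unfolding Vtx by (rule swap) (intro ballI commute_VA assms(3))
    next
      case (Arr b)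
      then have b: "b \<in> arcs G" using assms(2) by simp
      show ?thesis
        unfolding Arr h by (intro ballI commute_AG a b)
    next
      case (Ghost b)
      then have b: "b \<in> arcs G" using assms(2) by simp
      show ?thesis
        unfolding Ghost h by (intro ballI commute_GG a b)
    qed
  qed
  then show ?thesis
    by (intro lin_eqI[OF lin_comp[OF lin_Lact lin_Ract] lin_comp[OF lin_Ract lin_Lact] assms(1)]) (rule bspec)
qed

text \<open>Conjugation by \<open>sw\<close> transports the relations. As
  \<open>Ract (Arr a)\<close> is right multiplication by \<open>a\<^sup>*\<close> and
  \<open>Ract (Ghost a)\<close> the one by \<open>a\<close>, the last identity reads
  \<open>\<Sum>va\<^sup>*a = ve\<^sub>i\<close>.\<close>

lemma Ract_relations:
  assumes v: "keys v \<subseteq> Adm"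
  shows Ract_vertex: "Ract (Vtx i) (Ract (Vtx j) v) = (if i = j then Ract (Vtx i) v else 0)"
    and Ract_arrow_vertex: "a \<in> arcs G \<Longrightarrow> Ract (Vtx (head G a)) (Ract (Arr a) v) = Ract (Arr a) v"
      "a \<in> arcs G \<Longrightarrow> Ract (Arr a) (Ract (Vtx (tail G a)) v) = Ract (Arr a) v"
    and Ract_ghost_vertex: "a \<in> arcs G \<Longrightarrow> Ract (Vtx (tail G a)) (Ract (Ghost a) v) = Ract (Ghost a) v"
      "a \<in> arcs G \<Longrightarrow> Ract (Ghost a) (Ract (Vtx (head G a)) v) = Ract (Ghost a) v"
    and Ract_arrow_ghost: "a \<in> arcs G \<Longrightarrow> b \<in> arcs G \<Longrightarrow>
      Ract (Arr a) (Ract (Ghost b) v) = (if a = b then Ract (Vtx (head G a)) v else 0)"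
    and Ract_ghost_arrow: "i \<in> verts G \<Longrightarrow>
      (\<Sum>a\<in>out_arcs G i. Ract (Ghost a) (Ract (Arr a) v)) = Ract (Vtx i) v"
  using keys_sw_Adm[OF v]
  by (simp_all add: Ract_def Lact_vertex Lact_arrow_vertex Lact_arrow_ghost Lact_ghost_arrow
      flip: sw_simps(4))

section \<open>Degree and starting vertex of an admissible pair\<close>

definition pdeg :: "('v, 'e) path \<times> ('v, 'e) path \<Rightarrow> int" where
  "pdeg c = int (plen (snd c)) - int (plen (fst c))"

definition Admd :: "int \<Rightarrow> (('v, 'e) path \<times> ('v, 'e) path) set" where
  "Admd n = {c \<in> Adm. pdeg c = n}"

text \<open>Spans the left ideal of the Leavitt path algebra generated by the vertex
  \<open>i\<close>. Left multiplications preserve it, and right multiplication by an arrow leads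
  from the ideal at its head to the ideal at its tail.\<close>

definition Admv :: "'v \<Rightarrow> (('v, 'e) path \<times> ('v, 'e) path) set" where
  "Admv i = {c \<in> Adm. src (snd c) = i}"

lemma Admd_Adm: "Admd n \<subseteq> Adm" and Admv_Adm: "Admv i \<subseteq> Adm"
  by (auto simp: Admd_def Admv_def)

lemma keys_Lact_sub:
  assumes "g \<in> leavitt_gens"
  shows keys_Lact_Admd: "keys v \<subseteq> Admd n \<Longrightarrow> keys (Lact g v) \<subseteq> Admd (n + gen_degree g)"
    and keys_Lact_Admv: "keys v \<subseteq> Admv i \<Longrightarrow> keys (Lact g v) \<subseteq> Admv i"
proof -
  show "keys (Lact g v) \<subseteq> Admd (n + gen_degree g)" if "keys v \<subseteq> Admd n"
  proof (rule keys_lin[OF lin_Lact that])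
    fix b assume "b \<in> Admd n"
    then show "keys (Lact g (single b 1)) \<subseteq> Admd (n + gen_degree g)"
      using keys_Lb[of b g] assms by (auto simp: Admd_def pdeg_def)
  qed
  show "keys (Lact g v) \<subseteq> Admv i" if "keys v \<subseteq> Admv i"
  proof (rule keys_lin[OF lin_Lact that])
    fix b assume "b \<in> Admv i"
    then show "keys (Lact g (single b 1)) \<subseteq> Admv i"
      using keys_Lb[of b g] assms by (auto simp: Admv_def src_def)
  qed
qed

text \<open>Exchanging the paths negates the degree, whence the minus sign;
  \<open>Ract (Ghost a)\<close>, being right multiplication by \<open>a\<close>, raises the degree
  by one.\<close>

lemma keys_Ract_Admd:
  assumes "g \<in> leavitt_gens" "keys v \<subseteq> Admd n"
  shows "keys (Ract g v) \<subseteq> Admd (n - gen_degree g)"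
proof -
  have s: "keys (sw v) \<subseteq> Admd (- n)" if "keys v \<subseteq> Admd n" for n and v :: "_ \<Rightarrow>\<^sub>0 'k::field"
    using that Adm_swap by (fastforce simp: keys_sw Admd_def pdeg_def)
  show ?thesis
    using s[OF keys_Lact_Admd[OF assms(1) s[OF assms(2)]]] by (simp add: Ract_def algebra_simps)
qed

lemma Ract_Vtx_Admv: "keys v \<subseteq> Admv i \<Longrightarrow> Ract (Vtx i) v = v"
  by (rule lin_eqI[OF lin_Ract lin_intros(1)]) (auto simp: Admv_def)

lemma keys_Ract_Admv:
  assumes "keys v \<subseteq> Adm"
  shows "keys (Ract (Vtx i) v) \<subseteq> Admv i"
    and "a \<in> arcs G \<Longrightarrow> keys (Ract (Arr a) v) \<subseteq> Admv (head G a)"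
    and "a \<in> arcs G \<Longrightarrow> keys (Ract (Ghost a) v) \<subseteq> Admv (tail G a)"
proof -
  have V: "keys (Ract (Vtx i) v) \<subseteq> Admv i" if "keys v \<subseteq> Adm" for i and v :: "_ \<Rightarrow>\<^sub>0 'k::field"
    by (rule keys_lin[OF lin_Ract that]) (auto simp: Admv_def split: if_splits)
  show "keys (Ract (Vtx i) v) \<subseteq> Admv i"
    by (rule V[OF assms])
  show "a \<in> arcs G \<Longrightarrow> keys (Ract (Arr a) v) \<subseteq> Admv (head G a)"
    using V[OF keys_Ract[OF _ assms, of "Arr a"], of "head G a"] Ract_arrow_vertex(1)[OF assms] by simp
  show "a \<in> arcs G \<Longrightarrow> keys (Ract (Ghost a) v) \<subseteq> Admv (tail G a)"
    using V[OF keys_Ract[OF _ assms, of "Ghost a"], of "tail G a"] Ract_ghost_vertex(1)[OF assms] by simp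
qed

text \<open>Every pair arises from a vertex by right multiplications alone: first ghost arrows build
  up \<open>p\<^sup>*\<close> while \<open>q\<close> is trivial, then arrows build up
  \<open>q\<close>. Operators that commute with right multiplications are determined along this
  recursion, and the homotopy is defined along it.\<close>

lemma Adm_induct [consumes 1, case_names vertex ghost arrow]:
  assumes "b \<in> Adm"
    and vertex: "\<And>i. i \<in> verts G \<Longrightarrow> P (triv i, triv i)"
    and ghost: "\<And>u as a bs. a \<in> arcs G \<Longrightarrow> ((u, as), (head G a, bs)) \<in> Adm \<Longrightarrow>
      ((u, as), (tail G a, a # bs)) \<in> Adm \<Longrightarrow> P ((u, as), (head G a, bs)) \<Longrightarrow> P ((u, as), (tail G a, a # bs))"
    and arrow: "\<And>u as a. a \<in> arcs G \<Longrightarrow> ((u, as), triv (tail G a)) \<in> Adm \<Longrightarrow>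
      P ((u, as), triv (tail G a)) \<Longrightarrow> P ((u, as @ [a]), triv (head G a))"
  shows "P b"
proof -
  have nil: "P ((u, as), (v, []))" if "((u, as), (v, [])) \<in> Adm" for u as v
    using that
  proof (induct as arbitrary: v rule: rev_induct)
    case Nil
    then show ?case using vertex[of v] by (auto simp: Adm_iff awalk_Nil_iff triv_def)
  next
    case (snoc a as)
    then have "((u, as), (tail G a, [])) \<in> Adm" "a \<in> arcs G" "v = head G a"
      by (auto simp: Adm_iff awalk_simps)
    then show ?case using arrow[of a u as] snoc(1)[of "tail G a"] by (auto simp: triv_def)
  qed
  have "P ((u, as), (v, bs))" if "((u, as), (v, bs)) \<in> Adm" for u as v bs
    using that
  proof (induct bs arbitrary: v)
    case (Cons a bs)
    then have a: "a \<in> arcs G" "v = tail G a" and A: "((u, as), (head G a, bs)) \<in> Adm"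
      by (auto simp: Adm_iff awalk_simps split: if_splits)
    then show ?case using ghost[OF a(1) A] Cons by auto
  qed (rule nil)
  then show ?thesis
    using assms(1) by (metis prod.collapse)
qed

lemma single_ghost:
  assumes "((u, as), (tail G a, a # bs)) \<in> Adm"
  shows "single ((u, as), (tail G a, a # bs)) 1 = Ract (Ghost a) (single ((u, as), (head G a, bs)) 1)"
  using assms by (auto simp: path_defs Adm_iff awalk_simps)

lemma single_arrow:
  assumes "((u, as), triv (tail G a)) \<in> Adm"
  shows "single ((u, as @ [a]), triv (head G a)) 1 = Ract (Arr a) (single ((u, as), triv (tail G a)) 1)"
  using assms by (auto simp: path_defs Adm_iff awalk_simps awalk_awlast)


section \<open>The Leavitt path algebra\<close>

lemma basis_alg_F: "basis_alg (lists X) (\<lambda>u v. Some (u @ v)) {[]}"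
  by (rule basis_alg.intro) auto

interpretation F: basis_alg "lists leavitt_gens" "\<lambda>u v. Some (u @ v)" "{[]}"
  by (rule basis_alg_F)

abbreviation W :: "('v, 'e) leavitt_gen list \<Rightarrow> (('v, 'e) leavitt_gen list \<Rightarrow>\<^sub>0 'k::field)" where
  "W w \<equiv> mono_word w"

abbreviation CF :: "(('v, 'e) leavitt_gen list \<Rightarrow>\<^sub>0 'k::field) set" where
  "CF \<equiv> {f. keys f \<subseteq> lists leavitt_gens}"

lemma F_eq: "leavitt_free_algebra = F.BA"
  by (simp add: leavitt_free_algebra_def)

lemma F_simps [simp]:
  "carrier leavitt_free_algebra = CF" "mult leavitt_free_algebra = F.bmul"
  "one leavitt_free_algebra = W []" "zero leavitt_free_algebra = 0" "add leavitt_free_algebra = (+)"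
  "smult leavitt_free_algebra = scl"
  by (simp_all add: F_eq F.BA_mult F.BA_one)

lemma bmul_W [simp]: "F.bmul (W u) (W v) = W (u @ v)"
  by (simp add: F.bmul_single)

lemma relations_CF: "(leavitt_relations :: (_ \<Rightarrow>\<^sub>0 'k::field) set) \<subseteq> CF"
proof -
  have s: "keys (\<Sum>a\<in>out_arcs G i. W [Ghost a, Arr a] :: _ \<Rightarrow>\<^sub>0 'k) \<subseteq> lists leavitt_gens"
    "keys (\<Sum>i\<in>verts G. W [Vtx i] :: _ \<Rightarrow>\<^sub>0 'k) \<subseteq> lists leavitt_gens" for i
    by (rule keys_sum_subset; simp)+
  have "keys r \<subseteq> lists leavitt_gens" if "r \<in> leavitt_relations" for r :: "_ \<Rightarrow>\<^sub>0 'k"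
    using that unfolding leavitt_relations_def
    by (elim UnE CollectE exE conjE singletonE; hypsubst; intro keys_minus_subset s; simp)
  then show ?thesis by blast
qed

lemma ring_F: "ring (leavitt_free_algebra :: ('k::field, _) module)"
  using F.kalgebra_BA unfolding kalgebra_def F_eq by blast

lemma quot_alg_L: "quot_alg (leavitt_ideal :: (_ \<Rightarrow>\<^sub>0 'k::field) set) leavitt_free_algebra"
  unfolding leavitt_ideal_def using relations_CF
  by (intro quot_alg.intro quot_alg_axioms.intro ring.genideal_ideal[OF ring_F])
    (simp_all add: F_eq F.kalgebra_BA)

section \<open>Residue classes of words\<close>

abbreviation K :: "(('v, 'e) leavitt_gen list \<Rightarrow>\<^sub>0 'k::field) \<Rightarrow> _" where
  "K f \<equiv> leavitt_ideal +>\<^bsub>leavitt_free_algebra\<^esub> f"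

abbreviation LQ :: "('k::field, (('v, 'e) leavitt_gen list \<Rightarrow>\<^sub>0 'k) set) module" where
  "LQ \<equiv> quot_algebra leavitt_free_algebra leavitt_ideal"

lemma
  fixes f g :: "('v, 'e) leavitt_gen list \<Rightarrow>\<^sub>0 'k::field"
  assumes f: "f \<in> CF"
  shows K_scl: "K (scl c f) = c \<odot>\<^bsub>LQ\<^esub> K f"
    and K_add: "g \<in> CF \<Longrightarrow> K (f + g) = K f \<oplus>\<^bsub>LQ\<^esub> K g"
    and K_mult: "g \<in> CF \<Longrightarrow> K (F.bmul f g) = K f \<otimes>\<^bsub>LQ\<^esub> K g"
    and K_eq_iff: "g \<in> CF \<Longrightarrow> K f = K g \<longleftrightarrow> f - g \<in> leavitt_ideal"
proof -
  interpret L: quot_alg "leavitt_ideal :: (_ \<Rightarrow>\<^sub>0 'k) set" leavitt_free_algebra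
    by (rule quot_alg_L)
  show "K (scl c f) = c \<odot>\<^bsub>LQ\<^esub> K f"
    using L.cls_smult[of f c] f by simp
  assume g: "g \<in> CF"
  show "K (f + g) = K f \<oplus>\<^bsub>LQ\<^esub> K g" "K (F.bmul f g) = K f \<otimes>\<^bsub>LQ\<^esub> K g"
    using L.cls_add[of f g] L.cls_mult[of f g] f g by simp_all
  have "\<ominus>\<^bsub>leavitt_free_algebra\<^esub> g = - g"
    using g by (intro L.minus_equality) (simp_all add: keys_uminus')
  then show "K f = K g \<longleftrightarrow> f - g \<in> leavitt_ideal"
    using L.cls_eq_iff[of f g] f g by (simp add: a_minus_def)
qed

lemma K_relation:
  fixes f g :: "('v, 'e) leavitt_gen list \<Rightarrow>\<^sub>0 'k::field"
  assumes "f - g \<in> leavitt_relations" "f \<in> CF" "g \<in> CF"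
  shows "K f = K g"
proof -
  have "f - g \<in> leavitt_ideal"
    unfolding leavitt_ideal_def
    using assms(1) ring.genideal_self[OF ring_F, of "leavitt_relations :: (_ \<Rightarrow>\<^sub>0 'k) set"] relations_CF
    by auto
  then show ?thesis
    using K_eq_iff[OF assms(2,3)] by blast
qed

lemma bmul_CF: "f \<in> CF \<Longrightarrow> g \<in> CF \<Longrightarrow> F.bmul f g \<in> CF"
  using F.keys_bmul by blast

lemma lists_leavitt_gens [simp]: "w \<in> lists leavitt_gens \<longleftrightarrow> set w \<subseteq> leavitt_gens"
  by (auto simp: in_lists_conv_set)

lemma W_CF [simp]: "W w \<in> CF \<longleftrightarrow> set w \<subseteq> leavitt_gens"
  by (auto simp: in_lists_conv_set)

lemma K_word_left:
  assumes "K (W u) = K f" "f \<in> CF" "set u \<subseteq> leavitt_gens" "set w \<subseteq> leavitt_gens"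
  shows "K (W (u @ w)) = K (F.bmul f (W w))"
  using K_mult[of "W u" "W w"] K_mult[of f "W w"] assms W_CF by (metis bmul_W)

lemma K_word_right:
  assumes "K (W w) = K f" "f \<in> CF" "set u \<subseteq> leavitt_gens" "set w \<subseteq> leavitt_gens"
  shows "K (W (u @ w)) = K (F.bmul (W u) f)"
  using K_mult[of "W u" "W w"] K_mult[of "W u" f] assms W_CF by (metis bmul_W)

text \<open>The defining relations, multiplied on the right by an arbitrary word. This suffices,
  because reductions of \<open>g # wd b\<close> with more than two letters involved are done at the
  front of the word.\<close>

lemma
  assumes w: "set w \<subseteq> leavitt_gens"
  shows K_VV: "i \<in> verts G \<Longrightarrow> j \<in> verts G \<Longrightarrow>
      K (W (Vtx i # Vtx j # w)) = K (if i = j then W (Vtx i # w) else 0)"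
    and K_VA: "a \<in> arcs G \<Longrightarrow> K (W (Vtx (head G a) # Arr a # w)) = K (W (Arr a # w))"
    and K_AV: "a \<in> arcs G \<Longrightarrow> K (W (Arr a # Vtx (tail G a) # w)) = K (W (Arr a # w))"
    and K_VG: "a \<in> arcs G \<Longrightarrow> K (W (Vtx (tail G a) # Ghost a # w)) = K (W (Ghost a # w))"
    and K_GV: "a \<in> arcs G \<Longrightarrow> K (W (Ghost a # Vtx (head G a) # w)) = K (W (Ghost a # w))"
    and K_AG: "a \<in> arcs G \<Longrightarrow> b \<in> arcs G \<Longrightarrow>
      K (W (Arr a # Ghost b # w)) = K (if a = b then W (Vtx (head G a) # w) else 0)"
proof -
  have rel: "K (W ([g, h] @ w)) = K (F.bmul f (W w))"
    if "W [g, h] - f \<in> leavitt_relations" "f \<in> CF" "{g, h} \<subseteq> leavitt_gens" for g h f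
    using that w by (intro K_word_left K_relation) auto
  show "K (W (Vtx i # Vtx j # w)) = K (if i = j then W (Vtx i # w) else 0)"
    if "i \<in> verts G" "j \<in> verts G"
  proof -
    have "W [Vtx i, Vtx j] - (if i = j then W [Vtx i] else 0) \<in> leavitt_relations"
      unfolding leavitt_relations_def using that by blast
    then show ?thesis
      using rel[of "Vtx i" "Vtx j" "if i = j then W [Vtx i] else 0"] that by (auto split: if_splits)
  qed
  show "K (W (Arr a # Ghost b # w)) = K (if a = b then W (Vtx (head G a) # w) else 0)"
    if "a \<in> arcs G" "b \<in> arcs G"
  proof -
    have "W [Arr a, Ghost b] - (if a = b then W [Vtx (head G a)] else 0) \<in> leavitt_relations"
      unfolding leavitt_relations_def using that by blast
    then show ?thesis
      using rel[of "Arr a" "Ghost b" "if a = b then W [Vtx (head G a)] else 0"] that by (auto split: if_splits)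
  qed
  assume a: "a \<in> arcs G"
  have "W [Vtx (head G a), Arr a] - W [Arr a] \<in> leavitt_relations"
    "W [Arr a, Vtx (tail G a)] - W [Arr a] \<in> leavitt_relations"
    "W [Vtx (tail G a), Ghost a] - W [Ghost a] \<in> leavitt_relations"
    "W [Ghost a, Vtx (head G a)] - W [Ghost a] \<in> leavitt_relations"
    unfolding leavitt_relations_def using a by blast+
  note this[THEN rel]
  then show "K (W (Vtx (head G a) # Arr a # w)) = K (W (Arr a # w))"
    "K (W (Arr a # Vtx (tail G a) # w)) = K (W (Arr a # w))"
    "K (W (Vtx (tail G a) # Ghost a # w)) = K (W (Ghost a # w))"
    "K (W (Ghost a # Vtx (head G a) # w)) = K (W (Ghost a # w))"
    using a by simp_all
qed

lemma K_GA:
  assumes "set w \<subseteq> leavitt_gens" "i \<in> verts G"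
  shows "K (W (Vtx i # w)) = K (\<Sum>a\<in>out_arcs G i. W (Ghost a # Arr a # w))"
proof -
  let ?S = "\<Sum>a\<in>out_arcs G i. W [Ghost a, Arr a]"
  have S: "?S \<in> CF"
    using keys_sum_subset[of "out_arcs G i" "\<lambda>a. W [Ghost a, Arr a]" "lists leavitt_gens"] by simp
  have "?S - W [Vtx i] \<in> leavitt_relations"
    unfolding leavitt_relations_def using assms(2) by blast
  then have "K ?S = K (W [Vtx i])"
    using S assms(2) by (intro K_relation) auto
  then have "K (W ([Vtx i] @ w)) = K (F.bmul ?S (W w))"
    using S assms by (intro K_word_left) auto
  then show ?thesis
    by (simp add: F.bmul_sum1)
qed

text \<open>The word of \<open>p\<^sup>*q\<close>. Lists are in order of traversal: starring
  reverses a product, so the ghosts keep this order and only \<open>bs\<close> is reversed. The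
  final vertex keeps the word of a trivial pair from being empty.\<close>

fun wd :: "('v, 'e) path \<times> ('v, 'e) path \<Rightarrow> ('v, 'e) leavitt_gen list" where
  "wd ((u, as), (v, bs)) = map Ghost as @ map Arr (rev bs) @ [Vtx v]"

lemma set_wd: "b \<in> Adm \<Longrightarrow> set (wd b) \<subseteq> leavitt_gens"
  by (cases b rule: wd.cases) (auto simp: Adm_iff awalk_def)

definition Th :: "((('v, 'e) path \<times> ('v, 'e) path) \<Rightarrow>\<^sub>0 'k::field) \<Rightarrow> (('v, 'e) leavitt_gen list \<Rightarrow>\<^sub>0 'k)" where
  "Th = lext scl (\<lambda>b. W (wd b))"

lemma lin_Th [simp, intro]: "lin Th"
  by (simp add: Th_def)

lemma Th_single [simp]: "Th (single b 1) = W (wd b)"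
  by (simp add: Th_def)

lemmas Th_simps = lin_zero[OF lin_Th] lin_add[OF lin_Th] lin_diff[OF lin_Th] lin_sum[OF lin_Th]
  lin_scale[OF lin_Th]

lemma Th_CF: "keys v \<subseteq> Adm \<Longrightarrow> Th v \<in> CF"
  using keys_lin[OF lin_Th, of v Adm "lists leavitt_gens"] by (simp add: set_wd)

lemma K_wd_vertex:
  assumes "b \<in> Adm"
  shows "K (W (Vtx (src (fst b)) # wd b)) = K (W (wd b))"
  using assms set_wd[OF assms]
  by (cases rule: Adm_cases) (simp_all add: K_VV K_VA K_VG path_defs)

lemma K_Vtx:
  assumes b: "b \<in> Adm" and j: "j \<in> verts G"
  shows "K (W (Vtx j # wd b)) = K (if j = src (fst b) then W (wd b) else 0)"
proof -
  have i: "src (fst b) \<in> verts G"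
    using Adm_verts[of "fst b" "snd b"] b by (simp add: src_def)
  note w = set_wd[OF b]
  have "K (W ([Vtx j] @ wd b)) = K (F.bmul (W [Vtx j]) (W (Vtx (src (fst b)) # wd b)))"
    using w i j by (intro K_word_right) (simp_all add: K_wd_vertex[OF b])
  also have "\<dots> = K (if j = src (fst b) then W (Vtx j # wd b) else 0)"
    using K_VV[OF w j i] by simp
  finally show ?thesis
    using K_wd_vertex[OF b] by (auto split: if_splits)
qed

text \<open>The vertex \<open>i\<close> can be inserted behind \<open>g\<close> without changing the
  class, but it annihilates the word of \<open>b\<close>, which begins at another vertex.\<close>

lemma K_act_zero:
  assumes b: "b \<in> Adm" and g: "g \<in> leavitt_gens" and i: "i \<in> verts G" "i \<noteq> src (fst b)"
    and gi: "K (W (g # Vtx i # wd b)) = K (W (g # wd b) :: _ \<Rightarrow>\<^sub>0 'k::field)"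
  shows "K (W (g # wd b)) = K (0 :: _ \<Rightarrow>\<^sub>0 'k)"
proof -
  have "K (W ([g] @ Vtx i # wd b)) = K (F.bmul (W [g]) (0 :: _ \<Rightarrow>\<^sub>0 'k))"
    using K_Vtx[OF b i(1)] i set_wd[OF b] g by (intro K_word_right) auto
  then show ?thesis
    using gi by simp
qed

text \<open>Each clause of \<open>Lb\<close> is a reduction modulo the relations: an arrow cancels a
  leading ghost or gives zero, letters at different vertices give zero, and otherwise
  \<open>g # wd b\<close> is already the word of a pair. The exception is a product
  \<open>c\<^sup>*c\<close> with special \<open>c\<close>.\<close>

lemma K_act_basis:
  assumes b: "b \<in> Adm" and g: "g \<in> leavitt_gens"
  shows "K (W (g # wd b)) = K (Th (Lb g b) :: _ \<Rightarrow>\<^sub>0 'k::field)"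
proof (cases g)
  case (Vtx j)
  then show ?thesis
    using K_Vtx[OF b, of j, where 'a = 'k] g by (cases b) (simp add: Th_simps)
next
  case g: (Arr a)
  then have a: "a \<in> arcs G" using assms(2) by simp
  have zero: "K (W (g # wd b)) = K (0 :: _ \<Rightarrow>\<^sub>0 'k)" if "tail G a \<noteq> src (fst b)"
    using K_act_zero[OF b assms(2), of "tail G a"] K_AV[OF set_wd[OF b] a] a g that by simp
  have ghost: "K (W (g # wd b)) = K (Th (Lb g b) :: _ \<Rightarrow>\<^sub>0 'k)"
    if bd: "b = ((tail G c, c # as), q)" and c: "c \<in> arcs G" for c as q
  proof -
    obtain v bs where q: "q = (v, bs)" by (cases q)
    let ?b' = "((head G c, as), q)"
    have b': "?b' \<in> Adm"
      using b by (auto simp: bd q Adm_iff awalk_simps split: if_splits)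
    have w: "wd b = Ghost c # wd ?b'"
      by (simp add: bd q)
    show ?thesis
    proof (cases "a = c")
      case True
      have "K (W (g # wd b)) = K (W (Vtx (head G c) # wd ?b') :: _ \<Rightarrow>\<^sub>0 'k)"
        using K_AG[OF set_wd[OF b'] a c] True w g by simp
      also have "\<dots> = K (W (wd ?b'))"
        using K_Vtx[OF b', of "head G c"] c by (simp add: src_def)
      finally show ?thesis
        using True g by (simp add: bd q path_defs)
    next
      case False
      then show ?thesis
        using K_AG[OF set_wd[OF b'] a c] w g by (simp add: bd q path_defs Th_simps)
    qed
  qed
  show ?thesis
    using b
  proof (cases rule: Adm_cases)
    case (nil u)
    then show ?thesis
      using zero g by (cases "tail G a = u") (simp_all add: path_defs Th_simps)
  next
    case (right u bs d)
    then have "awlast u (bs @ [d]) = head G d"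
      by (intro awalk_awlast) (auto simp: awalk_simps)
    then show ?thesis
      using right zero g by (cases "tail G a = head G d") (simp_all add: path_defs Th_simps)
  next
    case (left c as v)
    show ?thesis by (rule ghost[OF left(1,2)])
  next
    case (both c as v bs d)
    show ?thesis by (rule ghost[OF both(1,2)])
  qed
next
  case g: (Ghost c)
  then have c: "c \<in> arcs G" using assms(2) by simp
  have zero: "K (W (g # wd b)) = K (0 :: _ \<Rightarrow>\<^sub>0 'k)" if "head G c \<noteq> src (fst b)"
    using K_act_zero[OF b assms(2), of "head G c"] K_GV[OF set_wd[OF b] c] c g that by simp
  obtain u as v bs where bd: "b = ((u, as), (v, bs))"
    by (cases b rule: wd.cases)
  show ?thesis
  proof (cases "as = [] \<and> bs \<noteq> [] \<and> last bs = c \<and> special sp c")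
    case True
    then obtain bs' where bs: "bs = bs' @ [c]"
      by (metis append_butlast_last_id)
    have w: "awalk v bs' (tail G c)" "u = head G c"
      using b True by (auto simp: bd bs Adm_iff awalk_simps)
    let ?b' = "((tail G c, []), (v, bs'))"
    have b': "?b' \<in> Adm"
      using w c by (auto simp: Adm_iff awalk_simps)
    let ?f = "\<lambda>a. W (Ghost a # Arr a # wd ?b') :: _ \<Rightarrow>\<^sub>0 'k"
    have out: "out_arcs G (tail G c) = insert c (siblings c)" "c \<notin> siblings c"
      using c by (auto simp: siblings_iff)
    have fCF: "?f a \<in> CF" if "a \<in> arcs G" for a
      using that set_wd[OF b'] by simp
    have sCF: "(\<Sum>a\<in>siblings c. ?f a) \<in> CF" "W (wd ?b') \<in> CF"
      using keys_sum_subset[of "siblings c" ?f "lists leavitt_gens"] fCF set_wd[OF b']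
      by (auto simp: siblings_iff)
    \<comment> \<open>The relation that the sum of all \<open>a\<^sup>*a\<close> is the vertex, read
      in front of the word of \<open>?b'\<close>; it is solved for the term of the special arrow
      \<open>c\<close>, which yields the rewriting clause of \<open>Lb\<close>.\<close>
    have "K (W (wd ?b')) = K (?f c + (\<Sum>a\<in>siblings c. ?f a))"
      using K_GA[OF set_wd[OF b'], of "tail G c", where 'a = 'k] K_Vtx[OF b', of "tail G c", where 'a = 'k] c out
      by (simp add: src_def)
    then have "W (wd ?b') - (?f c + (\<Sum>a\<in>siblings c. ?f a)) \<in> leavitt_ideal"
      using K_eq_iff[OF sCF(2), of "?f c + (\<Sum>a\<in>siblings c. ?f a)"] fCF[OF c] sCF(1)
        keys_plus_subset[of "?f c" "lists leavitt_gens" "\<Sum>a\<in>siblings c. ?f a"] by simp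
    then have "(W (wd ?b') - (\<Sum>a\<in>siblings c. ?f a)) - ?f c \<in> leavitt_ideal"
      by (simp add: algebra_simps)
    then have "K (?f c) = K (W (wd ?b') - (\<Sum>a\<in>siblings c. ?f a))"
      using K_eq_iff[OF _ fCF[OF c], of "W (wd ?b') - (\<Sum>a\<in>siblings c. ?f a)"] sCF
        keys_minus_subset[of "W (wd ?b')" "lists leavitt_gens" "\<Sum>a\<in>siblings c. ?f a"] by simp
    moreover have "W (g # wd b) = ?f c"
      using True by (simp add: bd bs g)
    moreover have "Th (Lb g b) = W (wd ?b') - (\<Sum>a\<in>siblings c. ?f a)"
      using True by (simp add: bd bs g path_defs Th_simps)
    ultimately show ?thesis by simp
  next
    case False
    then show ?thesis
      using zero g by (cases "u = head G c"; cases "as = []"; cases "bs = []"; cases "last bs = c"; cases "special sp c")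
        (simp_all add: bd path_defs Th_simps)
  qed
qed

lemma K_act:
  assumes g: "g \<in> leavitt_gens" and v: "keys v \<subseteq> Adm"
  shows "K (F.bmul (W [g]) (Th v)) = K (Th (Lact g v) :: _ \<Rightarrow>\<^sub>0 'k::field)"
  using v
proof (induct v rule: poly_mapping_add_induct)
  case (single b c)
  have s: "single b c = scl c (single b 1)" by simp
  note n = set_wd[OF single]
  have "keys (Lb g b :: _ \<Rightarrow>\<^sub>0 'k) \<subseteq> Adm"
    using keys_Lb[OF single g] by auto
  then have l: "Th (Lb g b) \<in> (CF :: (_ \<Rightarrow>\<^sub>0 'k) set)"
    by (rule Th_CF)
  have m: "W (g # wd b) \<in> (CF :: (_ \<Rightarrow>\<^sub>0 'k) set)"
    using n g by simp
  have "K (scl c (W (g # wd b))) = K (scl c (Th (Lb g b)) :: _ \<Rightarrow>\<^sub>0 'k)"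
    unfolding K_scl[OF l] K_scl[OF m] K_act_basis[OF single g] ..
  then show ?case
    unfolding s Th_simps Lact_simps F.bmul_scl Lact_single Th_single bmul_W by simp
next
  case (add f h)
  have W: "W [g] \<in> (CF :: (_ \<Rightarrow>\<^sub>0 'k) set)"
    using g by simp
  note cf = bmul_CF[OF W Th_CF[OF add(1)]] bmul_CF[OF W Th_CF[OF add(2)]]
    Th_CF[OF keys_Lact[OF g add(1)]] Th_CF[OF keys_Lact[OF g add(2)]]
  show ?case
    unfolding Th_simps Lact_simps F.bmul_add2
    unfolding K_add[OF cf(1,2)] K_add[OF cf(3,4)] add(3,4) ..
qed (simp add: Th_simps Lact_simps)

definition onev :: "(('v, 'e) path \<times> ('v, 'e) path) \<Rightarrow>\<^sub>0 'k::field" where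
  "onev = (\<Sum>i\<in>verts G. single (triv i, triv i) 1)"

lemma triv_Adm: "i \<in> verts G \<Longrightarrow> (triv i, triv i) \<in> Adm"
  by (simp add: triv_def Adm_iff awalk_simps)

lemma keys_onev: "keys onev \<subseteq> Adm" "keys onev \<subseteq> Admd 0"
  unfolding onev_def using triv_Adm
  by (auto intro!: keys_sum_subset simp: Admd_def pdeg_def plen_def triv_def)

section \<open>The action of the free algebra on the space of admissible pairs\<close>

definition wact :: "('v, 'e) leavitt_gen list \<Rightarrow> ((('v, 'e) path \<times> ('v, 'e) path) \<Rightarrow>\<^sub>0 'k::field) \<Rightarrow> _" where
  "wact w v = foldr Lact w v"

lemma wact_simps [simp]: "wact [] v = v" "wact (g # w) v = Lact g (wact w v)"
    "wact (u @ w) v = wact u (wact w v)"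
  by (simp_all add: wact_def)

lemma lin_wact [simp, intro]: "lin (wact w)"
  by (induct w) (simp_all add: lin_intros lin_comp[OF lin_Lact])

lemma keys_wact: "set w \<subseteq> leavitt_gens \<Longrightarrow> keys v \<subseteq> Adm \<Longrightarrow> keys (wact w v) \<subseteq> Adm"
  by (induct w) (simp_all add: keys_Lact)

lemma keys_wact_Admd:
  "set w \<subseteq> leavitt_gens \<Longrightarrow> keys v \<subseteq> Admd n \<Longrightarrow>
    keys (wact w v) \<subseteq> Admd (n + sum_list (map gen_degree w))"
proof (induct w)
  case (Cons g w)
  then show ?case
    using keys_Lact_Admd[of g "wact w v" "n + sum_list (map gen_degree w)"] by (simp add: algebra_simps)
qed simp

definition pact :: "(('v, 'e) leavitt_gen list \<Rightarrow>\<^sub>0 'k::field) \<Rightarrow>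
    ((('v, 'e) path \<times> ('v, 'e) path) \<Rightarrow>\<^sub>0 'k) \<Rightarrow> _" where
  "pact f v = lext scl (\<lambda>w. wact w v) f"

lemma lin_pact1: "lin (\<lambda>f. pact f v)"
  by (simp add: pact_def)

lemma lin_pact2: "lin (pact f)"
proof -
  have "pact f = (\<lambda>v. \<Sum>w\<in>keys f. scl (lookup f w) (wact w v))"
    by (intro ext) (simp add: pact_def lext_def pext_def)
  then show ?thesis
    by (simp only:) (intro lin_sum_intro lin_intros lin_wact)
qed

lemmas pact1_simps = lin_zero[OF lin_pact1] lin_add[OF lin_pact1] lin_diff[OF lin_pact1]
  lin_sum[OF lin_pact1] lin_scale[OF lin_pact1]
lemmas pact2_simps = lin_zero[OF lin_pact2] lin_add[OF lin_pact2] lin_diff[OF lin_pact2]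
  lin_sum[OF lin_pact2] lin_scale[OF lin_pact2]

lemma pact_W [simp]: "pact (W w) v = wact w v"
  by (simp add: pact_def)

lemma pact_single: "pact (single w c) v = scl c (wact w v)"
  by (simp add: pact_def lext_single[OF module_scl])

lemma keys_pact:
  assumes "f \<in> CF" "keys v \<subseteq> Adm"
  shows "keys (pact f v) \<subseteq> Adm"
  unfolding pact_def
proof (rule keys_lext)
  fix w assume "w \<in> keys f"
  then have "set w \<subseteq> leavitt_gens"
    using assms(1) lists_leavitt_gens by blast
  then show "keys (wact w v) \<subseteq> Adm"
    by (rule keys_wact[OF _ assms(2)])
qed

lemma pact_bmul: "pact (F.bmul f g) v = pact f (pact g v)"
  using subset_UNIV
proof (induct f rule: poly_mapping_add_induct)
  case (single u a)
  show ?case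
    using subset_UNIV
  proof (induct g rule: poly_mapping_add_induct)
    case (single w b)
    then show ?case
      by (simp add: F.bmul_single pact_single lin_scale[OF lin_wact])
  qed (simp_all add: F.bmul_add2 pact1_simps pact2_simps)
qed (simp_all add: F.bmul_add1 pact1_simps)

text \<open>The elements of the free algebra that annihilate the span of \<open>Adm\<close> form an
  ideal, for the action preserves this span; it contains the relations, hence also the ideal which
  they generate.\<close>

lemma pact_ideal:
  fixes f :: "('v, 'e) leavitt_gen list \<Rightarrow>\<^sub>0 'k::field"
  assumes f: "f \<in> leavitt_ideal" and v: "keys v \<subseteq> Adm"
  shows "pact f v = 0"
proof -
  let ?Z = "{f \<in> CF. \<forall>v. keys v \<subseteq> Adm \<longrightarrow> pact f v = (0 :: _ \<Rightarrow>\<^sub>0 'k)}"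
  interpret R: ring "leavitt_free_algebra :: ('k, ('v, 'e) leavitt_gen list \<Rightarrow>\<^sub>0 'k) module"
    by (rule ring_F)
  have "ideal ?Z leavitt_free_algebra"
  proof (rule idealI[OF ring_F])
    show "subgroup ?Z (add_monoid leavitt_free_algebra)"
    proof (rule R.add.subgroupI)
      show "?Z \<noteq> {}" by (intro ex_in_conv[THEN iffD1] exI[of _ 0]) (simp add: pact1_simps)
      show "\<ominus>\<^bsub>leavitt_free_algebra\<^esub> a \<in> ?Z" if "a \<in> ?Z" for a
      proof -
        have "\<ominus>\<^bsub>leavitt_free_algebra\<^esub> a = - a"
          using that by (intro R.minus_equality) (simp_all add: keys_uminus')
        then show ?thesis
          using that pact1_simps(3)[of 0 a] by (simp add: keys_uminus' pact1_simps(1))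
      qed
    qed (auto simp: pact1_simps keys_plus_subset)
    show "x \<otimes>\<^bsub>leavitt_free_algebra\<^esub> a \<in> ?Z" "a \<otimes>\<^bsub>leavitt_free_algebra\<^esub> x \<in> ?Z"
      if "a \<in> ?Z" "x \<in> carrier leavitt_free_algebra" for a x
      using that F.keys_bmul[of x a] F.keys_bmul[of a x] keys_pact[of x]
      by (simp_all add: pact_bmul pact2_simps(1))
  qed
  moreover have "leavitt_relations \<subseteq> ?Z"
  proof
    fix r :: "('v, 'e) leavitt_gen list \<Rightarrow>\<^sub>0 'k" assume r: "r \<in> leavitt_relations"
    have "pact r v = 0" if v: "keys v \<subseteq> Adm" for v
      using r unfolding leavitt_relations_def
      by (elim UnE CollectE exE conjE singletonE; hypsubst)
        (simp_all add: pact1_simps Lact_vertex Lact_arrow_vertex[OF v] Lact_arrow_ghost[OF v]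
          Lact_ghost_arrow[OF v] Lact_vertex(2)[OF v])
    then show "r \<in> ?Z"
      using r relations_CF by blast
  qed
  ultimately have "leavitt_ideal \<subseteq> ?Z"
    unfolding leavitt_ideal_def by (rule R.genideal_minimal)
  then show ?thesis
    using f v by blast
qed

lemma pact_K: "f \<in> CF \<Longrightarrow> g \<in> CF \<Longrightarrow> K f = K g \<Longrightarrow> keys v \<subseteq> Adm \<Longrightarrow> pact f v = pact g v"
  using pact_ideal[of "f - g" v] K_eq_iff[of f g] by (simp add: pact1_simps)

lemma K_word_Th:
  "set w \<subseteq> leavitt_gens \<Longrightarrow> K (W w) = K (Th (wact w onev) :: _ \<Rightarrow>\<^sub>0 'k::field)"
proof (induct w)
  case Nil
  have S: "(\<Sum>i\<in>verts G. W [Vtx i]) \<in> (CF :: (_ \<Rightarrow>\<^sub>0 'k) set)"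
    using keys_sum_subset[of "verts G" "\<lambda>i. W [Vtx i]" "lists leavitt_gens"] by simp
  have "(\<Sum>i\<in>verts G. W [Vtx i]) - W [] \<in> leavitt_relations"
    unfolding leavitt_relations_def by blast
  from K_relation[OF this S] show ?case
    by (simp add: onev_def Th_simps triv_def)
next
  case (Cons g w)
  then have g: "g \<in> leavitt_gens" and w: "set w \<subseteq> leavitt_gens" by auto
  have T: "Th (wact w onev) \<in> (CF :: (_ \<Rightarrow>\<^sub>0 'k) set)"
    by (intro Th_CF keys_wact w keys_onev)
  have "K (W ([g] @ w)) = K (F.bmul (W [g]) (Th (wact w onev)) :: _ \<Rightarrow>\<^sub>0 'k)"
    using Cons g w T by (intro K_word_right) auto
  also have "\<dots> = K (Th (Lact g (wact w onev)))"
    by (rule K_act[OF g keys_wact[OF w keys_onev(1)]])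
  finally show ?case by simp
qed

text \<open>A normal form: act on the unit and read the resulting vector as a combination of words
  of pairs.\<close>

lemma K_Th:
  assumes "f \<in> CF"
  shows "K f = K (Th (pact f onev) :: _ \<Rightarrow>\<^sub>0 'k::field)"
proof -
  have "keys f \<subseteq> lists leavitt_gens" using assms by simp
  then show ?thesis
  proof (induct f rule: poly_mapping_add_induct)
    case (single w c)
    then have w: "set w \<subseteq> leavitt_gens" by simp
    have s: "single w c = scl c (W w)" by simp
    have m: "W w \<in> (CF :: (_ \<Rightarrow>\<^sub>0 'k) set)" using w by simp
    have l: "Th (wact w onev) \<in> (CF :: (_ \<Rightarrow>\<^sub>0 'k) set)"
      by (intro Th_CF keys_wact w keys_onev)
    show ?case
      unfolding s pact1_simps Th_simps pact_W K_scl[OF m] K_scl[OF l] K_word_Th[OF w] ..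
  next
    case (add f g)
    then have c: "f \<in> CF" "g \<in> CF" by auto
    note t = Th_CF[OF keys_pact[OF c(1) keys_onev(1)]] Th_CF[OF keys_pact[OF c(2) keys_onev(1)]]
    show ?case
      unfolding pact1_simps Th_simps K_add[OF c] K_add[OF t]
      unfolding add(3,4)[symmetric] ..
  qed (simp add: pact1_simps Th_simps)
qed

text \<open>Read from its right end, the word lets the vertex select one summand of the unit, the
  arrows build up \<open>q\<close>, and the ghosts build up \<open>p\<close>; admissibility of
  \<open>b\<close> excludes rewriting on the way.\<close>

lemma wact_wd:
  assumes "b \<in> Adm"
  shows "wact (wd b) onev = single b (1 :: 'k::field)"
proof -
  obtain u as v bs where b: "b = ((u, as), (v, bs))" by (cases b rule: wd.cases)
  obtain w where w: "awalk u as w" "awalk v bs w"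
    using assms by (auto simp: b Adm_iff)
  have v: "v \<in> verts G" using w(2) by (rule awalk_hd_in_verts)
  have 0: "Lact (Vtx v) onev = single ((v, []), (v, [])) (1 :: 'k)"
    using v by (simp add: onev_def Lact_simps path_defs)
  have 1: "wact (map Arr (rev bs)) (single ((v, []), (v, [])) 1) = single ((w, []), (v, bs)) (1 :: 'k)"
    using w(2)
  proof (induct bs arbitrary: w rule: rev_induct)
    case (snoc a bs)
    then have a: "awalk v bs (tail G a)" "w = head G a"
      by (auto simp: awalk_simps)
    then show ?case
      using snoc(1)[OF a(1)] by (simp add: path_defs awalk_awlast)
  qed (simp add: awalk_Nil_iff)
  have "wact (map Ghost as) (single ((w, []), (v, bs)) 1) = single ((u, as), (v, bs)) (1 :: 'k)"
    using w(1) assms unfolding b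
  proof (induct as arbitrary: u)
    case (Cons a as)
    then have "awalk (head G a) as w" "u = tail G a" "((head G a, as), (v, bs)) \<in> Adm"
      by (auto simp: awalk_simps Adm_iff split: if_splits)
    moreover have "\<not> (as = [] \<and> bs \<noteq> [] \<and> last bs = a \<and> special sp a)"
      using Cons(3) by (auto simp: Adm_iff)
    ultimately show ?case
      using Cons(1)[of "head G a"] by (cases "bs = []"; cases "as = []"; cases "last bs = a") (simp_all add: path_defs)
  qed (simp add: awalk_Nil_iff)
  then show ?thesis
    by (simp add: b 0 1)
qed

lemma pact_Th:
  assumes "keys v \<subseteq> Adm"
  shows "pact (Th v) onev = v"
  by (rule lin_eqI[OF lin_comp[OF lin_pact1 lin_Th] lin_intros(1) assms]) (simp add: wact_wd)

text \<open>One direction is the normal form, the other that the ideal acts as zero. This is the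
  basis theorem in the form used below: classes are compared by vectors over
  \<open>Adm\<close>.\<close>

lemma K_injective: "f \<in> CF \<Longrightarrow> g \<in> CF \<Longrightarrow> K f = K g \<longleftrightarrow> pact f onev = pact g onev"
  using K_Th[of f] K_Th[of g] pact_K[OF _ _ _ keys_onev(1)] by metis

end

lemma sum_disjoint_degrees_zero:
  fixes x :: "int \<Rightarrow> ('b \<Rightarrow>\<^sub>0 'c::comm_monoid_add)"
  assumes "finite N" "\<And>n. keys (x n) \<subseteq> {k. d k = n}" "(\<Sum>n\<in>N. x n) = 0" "n \<in> N"
  shows "x n = 0"
proof (rule poly_mapping_eqI)
  fix k
  have other: "lookup (x m) k = 0" if "m \<noteq> d k" for m
    using assms(2)[of m] that by (auto simp: in_keys_iff)
  show "lookup (x n) k = lookup 0 k"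
  proof (cases "n = d k")
    case True
    have "0 = (\<Sum>m\<in>N. lookup (x m) k)"
      using assms(3) by (simp flip: lookup_sum)
    also have "\<dots> = (\<Sum>m\<in>{n}. lookup (x m) k)"
      using assms(1,4) other True by (intro sum.mono_neutral_right) auto
    finally show ?thesis by simp
  qed (simp add: other)
qed

lemma (in basis_alg) keys_bmul_subset:
  "keys (bmul f g) \<subseteq> {w. \<exists>u\<in>keys f. \<exists>v\<in>keys g. m u v = Some w}"
proof -
  have o: "keys (osingle o' c) \<subseteq> {w. o' = Some w}" for o' and c :: 'a
    by (cases o') auto
  show ?thesis
    unfolding bmul_def pext_def
    by (intro keys_sum_subset order_trans[OF o]) auto
qed

context special_quiver
begin

interpretation F: basis_alg "lists leavitt_gens" "\<lambda>u v. Some (u @ v)" "{[]}"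
  by (rule basis_alg_F)

section \<open>The grading of the Leavitt path algebra\<close>

definition homog :: "int \<Rightarrow> (('v, 'e) leavitt_gen list \<Rightarrow>\<^sub>0 'k::field) set" where
  "homog n = {f \<in> CF. \<forall>w\<in>keys f. sum_list (map gen_degree w) = n}"

abbreviation LA :: "('k::field, (('v, 'e) leavitt_gen list \<Rightarrow>\<^sub>0 'k) set) dg_space" where
  "LA \<equiv> leavitt_path_algebra"

lemma LA_eq: "(LA :: ('k::field, _) dg_space) = trivial_dg LQ (\<lambda>n. K ` homog n)"
proof -
  have "(\<lambda>n. K ` homog n) = (\<lambda>n. {K (f :: _ \<Rightarrow>\<^sub>0 'k) | f. f \<in> carrier leavitt_free_algebra \<and>
      (\<forall>w\<in>keys f. sum_list (map gen_degree w) = n)})"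
    by (intro ext) (auto simp: homog_def)
  then show ?thesis
    by (simp add: leavitt_path_algebra_def)
qed

lemma LQ_simps:
  "carrier (LQ :: ('k::field, _) module) = K ` CF" "zero (LQ :: ('k::field, _) module) = K 0"
  "one (LQ :: ('k::field, _) module) = K (W [])"
proof -
  interpret L: quot_alg "leavitt_ideal :: (_ \<Rightarrow>\<^sub>0 'k::field) set" leavitt_free_algebra
    by (rule quot_alg_L)
  show "carrier (LQ :: ('k::field, _) module) = K ` CF" "zero (LQ :: ('k::field, _) module) = K 0"
    "one (LQ :: ('k::field, _) module) = K (W [])"
    using L.cls_zero by simp_all
qed

lemma LA_simps [simp]:
  "carrier LA = K ` CF" "zero LA = K 0" "one LA = K (W [])" "mult LA = mult LQ" "add LA = add LQ"
  "smult LA = smult LQ" "hcomp LA = (\<lambda>n. K ` homog n)" "diff LA = (\<lambda>_. K 0)"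
  unfolding LA_eq by (simp_all add: LQ_simps)

lemma kalgebra_LQ: "kalgebra (LQ :: ('k::field, _) module)"
  using quot_alg.kalgebra_Q[OF quot_alg_L] .

lemma vspace_LQ: "vspace (LQ :: ('k::field, _) module)"
  using kalgebra_LQ unfolding kalgebra_def by (intro vspace.intro) blast

lemma homog_CF: "f \<in> homog n \<Longrightarrow> f \<in> CF"
  by (simp add: homog_def)

lemma keys_pact_Admd:
  assumes "f \<in> homog n" "keys v \<subseteq> Admd m"
  shows "keys (pact f v) \<subseteq> Admd (m + n)"
  unfolding pact_def
proof (rule keys_lext)
  fix w assume w: "w \<in> keys f"
  then have "set w \<subseteq> leavitt_gens"
    using assms(1) lists_leavitt_gens unfolding homog_def by blast
  from keys_wact_Admd[OF this assms(2)] show "keys (wact w v) \<subseteq> Admd (m + n)"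
    using assms(1) w by (simp add: homog_def)
qed

lemma sum_wd: "b \<in> Adm \<Longrightarrow> sum_list (map gen_degree (wd b)) = pdeg b"
proof -
  have g: "sum_list (map gen_degree (map Ghost as)) = - int (length as)"
    "sum_list (map gen_degree (map Arr as)) = int (length as)" for as :: "'e list"
    by (induct as) simp_all
  show ?thesis
    by (cases b rule: wd.cases) (simp add: g pdeg_def plen_def del: map_map)
qed

lemma Th_homog:
  assumes "keys v \<subseteq> Admd n"
  shows "Th v \<in> homog n"
proof -
  have "keys (Th v) \<subseteq> {w \<in> lists leavitt_gens. sum_list (map gen_degree w) = n}"
    by (rule keys_lin[OF lin_Th assms]) (auto simp: Admd_def set_wd sum_wd simp del: wd.simps)
  then show ?thesis
    by (auto simp: homog_def)
qed

lemma is_graded_LA: "is_graded (LA :: ('k::field, _) dg_space)"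
proof (rule is_gradedI)
  interpret Q: vspace "LQ :: ('k, _) module"
    by (rule vspace_LQ)
  show vs: "Module.module field_ring (LA :: ('k, _) dg_space)"
    by (rule module_cong[OF Q.vspace]) (simp_all add: LQ_simps)
  interpret V: vspace "LA :: ('k, _) dg_space"
    by (rule vspace.intro) (rule vs)
  show "submodule (hcomp LA n) field_ring (LA :: ('k, _) dg_space)" for n
  proof (rule V.submodule_fieldI)
    show "hcomp LA n \<subseteq> carrier (LA :: ('k, _) dg_space)"
      unfolding LA_simps by (rule image_mono) (use homog_CF in blast)
    show "\<zero>\<^bsub>LA\<^esub> \<in> hcomp (LA :: ('k, _) dg_space) n"
      by (auto simp: homog_def)
    show "x \<oplus>\<^bsub>LA\<^esub> y \<in> hcomp LA n" if xy: "x \<in> hcomp LA n" "y \<in> hcomp (LA :: ('k, _) dg_space) n" for x y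
    proof -
      obtain f g where f: "f \<in> homog n" "x = K f" and g: "g \<in> homog n" "y = K g"
        using xy by auto
      have "f + g \<in> homog n"
        using f(1) g(1) keys_add[of f g] unfolding homog_def by blast
      then show ?thesis
        using K_add[OF homog_CF[OF f(1)] homog_CF[OF g(1)]] f(2) g(2) by auto
    qed
    show "c \<odot>\<^bsub>LA\<^esub> x \<in> hcomp LA n" if x: "x \<in> hcomp (LA :: ('k, _) dg_space) n" for c x
    proof -
      obtain f where f: "f \<in> homog n" "x = K f"
        using x by auto
      have "scl c f \<in> homog n"
        using f(1) keys_scl[of c f] unfolding homog_def by blast
      then show ?thesis
        using K_scl[OF homog_CF[OF f(1)], of c] f(2) by auto
    qed
  qed
next
  fix x :: "(('v, 'e) leavitt_gen list \<Rightarrow>\<^sub>0 'k) set" and P :: "(('v, 'e) leavitt_gen list \<Rightarrow>\<^sub>0 'k) set \<Rightarrow> bool"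
  assume x: "x \<in> carrier LA" and P: "\<And>n y. y \<in> hcomp LA n \<Longrightarrow> P y"
    "\<And>y z. y \<in> carrier LA \<Longrightarrow> z \<in> carrier LA \<Longrightarrow> P y \<Longrightarrow> P z \<Longrightarrow> P (y \<oplus>\<^bsub>LA\<^esub> z)"
  obtain f where f: "keys f \<subseteq> lists leavitt_gens" "x = K f"
    using x by auto
  from f(1) have "P (K f)"
  proof (induct f rule: poly_mapping_add_induct)
    case zero
    then show ?case using P(1)[of "K 0" 0] by (simp add: homog_def)
  next
    case (single w c)
    then show ?case
      using P(1)[of "K (single w c)" "sum_list (map gen_degree w)"] by (simp add: homog_def)
  next
    case (add f g)
    then have c: "f \<in> CF" "g \<in> CF" by auto
    show ?case
      unfolding K_add[OF c] using P(2)[of "K f" "K g"] add(3,4) c by simp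
  qed
  then show "P x" by (simp add: f(2))
next
  fix f :: "int \<Rightarrow> (('v, 'e) leavitt_gen list \<Rightarrow>\<^sub>0 'k) set" and N n
  assume N: "finite N" "\<And>n. f n \<in> hcomp LA n" and sum: "(\<Oplus>\<^bsub>LA\<^esub>n\<in>N. f n) = \<zero>\<^bsub>LA\<^esub>" and n: "n \<in> N"
  have "\<forall>n. \<exists>r. r \<in> homog n \<and> f n = K r"
    using N(2) by auto
  then obtain r where r: "\<And>n. r n \<in> homog n" "\<And>n. f n = K (r n)"
    by metis
  interpret Q: vspace "LQ :: ('k, _) module"
    by (rule vspace_LQ)
  have vs: "Module.module field_ring (LA :: ('k, _) dg_space)"
    by (rule module_cong[OF Q.vspace]) (simp_all add: LQ_simps)
  interpret V: vspace "LA :: ('k, _) dg_space"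
    by (rule vspace.intro) (rule vs)
  have S: "(\<Sum>n\<in>N. r n) \<in> CF" for N
    using keys_sum_subset[of N r "lists leavitt_gens"] homog_CF[OF r(1)] by simp
  have "(\<Oplus>\<^bsub>LA\<^esub>n\<in>N. K (r n)) = K (\<Sum>n\<in>N. r n)"
    using N(1)
  proof (induct N rule: finite_induct)
    case (insert n N)
    have "(\<Oplus>\<^bsub>LA\<^esub>n\<in>insert n N. K (r n)) = K (r n) \<oplus>\<^bsub>LA\<^esub> (\<Oplus>\<^bsub>LA\<^esub>n\<in>N. K (r n))"
      using insert homog_CF[OF r(1)] by (intro V.M.finsum_insert) auto
    then show ?case
      using insert K_add[OF homog_CF[OF r(1)] S] by simp
  qed (use V.M.finsum_empty[of "\<lambda>n. K (r n)"] in simp)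
  \<comment> \<open>Independence of the components is moved to coordinates, where summands of
    different degrees have disjoint supports.\<close>
  then have "pact (\<Sum>n\<in>N. r n) onev = (0 :: _ \<Rightarrow>\<^sub>0 'k)"
    using sum K_injective[OF S, of 0 N] by (simp add: pact1_simps r(2))
  then have z: "(\<Sum>n\<in>N. pact (r n) onev) = 0"
    by (simp add: pact1_simps)
  have "pact (r n) onev = 0"
    using keys_pact_Admd[OF r(1) keys_onev(2)]
    by (intro sum_disjoint_degrees_zero[OF N(1) _ z n, of pdeg]) (auto simp: Admd_def)
  then show "f n = \<zero>\<^bsub>LA\<^esub>"
    using K_injective[OF homog_CF[OF r(1)], of 0 n] r(2) by (simp add: pact1_simps)
qed

lemma dg_algebra_LA: "dg_algebra (LA :: ('k::field, _) dg_space)"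
  unfolding LA_eq
proof (rule dg_algebra_trivial_dg[OF kalgebra_LQ])
  show "is_graded (trivial_dg (LQ :: ('k, _) module) (\<lambda>n. K ` homog n))"
    using is_graded_LA unfolding LA_eq .
  show "\<one>\<^bsub>LQ\<^esub> \<in> K ` (homog 0 :: (_ \<Rightarrow>\<^sub>0 'k) set)"
    by (simp add: LQ_simps homog_def)
  show "x \<otimes>\<^bsub>LQ\<^esub> y \<in> K ` homog (m + n)" if xy: "x \<in> K ` (homog m :: (_ \<Rightarrow>\<^sub>0 'k) set)" "y \<in> K ` (homog n :: (_ \<Rightarrow>\<^sub>0 'k) set)" for m n x y
  proof -
    obtain f g where f: "f \<in> homog m" "x = K f" and g: "g \<in> homog n" "y = K g"
      using xy by blast
    have "F.bmul f g \<in> homog (m + n)"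
      using F.keys_bmul_subset[of f g] bmul_CF[OF homog_CF[OF f(1)] homog_CF[OF g(1)]] f(1) g(1)
      by (fastforce simp: homog_def)
    then show ?thesis
      using K_mult[OF homog_CF[OF f(1)] homog_CF[OF g(1)]] f(2) g(2) by auto
  qed
qed


section \<open>The algebra of paths modulo paths of length two\<close>

lemma paths_iff: "(u, as) \<in> paths \<longleftrightarrow> (\<exists>w. awalk u as w)"
  unfolding paths_def src_def tgt_def using awalk_awlast by fastforce

lemma tgt_awalk: "awalk u as w \<Longrightarrow> tgt (u, as) = w"
  by (simp add: tgt_def awalk_awlast)

definition pmult :: "('v, 'e) path \<Rightarrow> ('v, 'e) path \<Rightarrow> ('v, 'e) path option" where
  "pmult p q = (if src p = tgt q then Some (pcat p q) else None)"

lemma pcat_props: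
  assumes "p \<in> paths" "q \<in> paths" "src p = tgt q"
  shows "pcat p q \<in> paths" "src (pcat p q) = src q" "tgt (pcat p q) = tgt p" "plen (pcat p q) = plen p + plen q"
proof -
  obtain u as v bs where p: "p = (u, as)" and q: "q = (v, bs)" by (metis prod.collapse)
  obtain w w' where w: "awalk u as w" "awalk v bs w'"
    using assms(1,2) by (auto simp: p q paths_iff)
  then have "w' = u" using assms(3) by (simp add: p q tgt_awalk src_def)
  with w have a: "awalk v (bs @ as) w" by (auto simp: awalk_append_iff)
  show "pcat p q \<in> paths" "src (pcat p q) = src q" "tgt (pcat p q) = tgt p" "plen (pcat p q) = plen p + plen q"
    using a w by (auto simp: p q pcat_def paths_iff src_def tgt_awalk plen_def)
qed

lemma triv_props [simp]: "src (triv i) = i" "tgt (triv i) = i" "plen (triv i) = 0"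
  "triv i \<in> paths \<longleftrightarrow> i \<in> verts G" "triv i = triv j \<longleftrightarrow> i = j"
  by (auto simp: src_def triv_def tgt_def plen_def paths_iff awalk_simps)

lemma arr_props [simp]: "src (arr a) = tail G a" "tgt (arr a) = head G a" "plen (arr a) = 1"
  "arr a \<in> paths \<longleftrightarrow> a \<in> arcs G" "arr a = arr b \<longleftrightarrow> a = b" "arr a \<noteq> triv i" "triv i \<noteq> arr a"
  by (auto simp: src_def arr_def tgt_def plen_def paths_iff awalk_simps triv_def)

lemma path_verts: "p \<in> paths \<Longrightarrow> src p \<in> verts G \<and> tgt p \<in> verts G"
  by (cases p) (auto simp: paths_iff src_def tgt_awalk dest: awalk_hd_in_verts awalk_last_in_verts)

lemma pcat_triv: "pcat p (triv (src p)) = p" "src p = src q \<Longrightarrow> pcat (triv i) p = p"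
  by (cases p; simp add: pcat_def src_def triv_def)+

lemma plen0: "p \<in> paths \<Longrightarrow> plen p = 0 \<longleftrightarrow> p = triv (src p)"
  by (cases p) (auto simp: plen_def triv_def src_def)

lemma plen1: "p \<in> paths \<Longrightarrow> plen p = 1 \<longleftrightarrow> (\<exists>a\<in>arcs G. p = arr a)"
  by (cases p) (auto simp: plen_def arr_def paths_iff length_Suc_conv awalk_simps)

lemma basis_alg_P: "basis_alg paths pmult (triv ` verts G)"
proof (rule basis_alg.intro)
  show "w \<in> paths" if "u \<in> paths" "v \<in> paths" "pmult u v = Some w" for u v w
    using that pcat_props(1)[of u v] by (auto simp: pmult_def split: if_splits)
  show "Option.bind (pmult u v) (\<lambda>x. pmult x w) = Option.bind (pmult v w) (pmult u)"
    if "u \<in> paths" "v \<in> paths" "w \<in> paths" for u v w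
    using that pcat_props[of u v] pcat_props[of v w]
    by (cases "src u = tgt v"; cases "src v = tgt w") (simp_all add: pmult_def pcat_def src_def)
  show "finite (triv ` verts G)" "triv ` verts G \<subseteq> paths"
    by auto
  show "\<exists>u\<in>triv ` verts G. pmult u x = Some x \<and> (\<forall>v\<in>triv ` verts G. v \<noteq> u \<longrightarrow> pmult v x = None)"
    "\<exists>u\<in>triv ` verts G. pmult x u = Some x \<and> (\<forall>v\<in>triv ` verts G. v \<noteq> u \<longrightarrow> pmult x v = None)"
    if "x \<in> paths" for x
    using path_verts[OF that] pcat_triv[of x] by (auto simp: pmult_def)
qed

interpretation P: basis_alg paths pmult "triv ` verts G"
  by (rule basis_alg_P)

abbreviation CP :: "(('v, 'e) path \<Rightarrow>\<^sub>0 'k::field) set" where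
  "CP \<equiv> {f. keys f \<subseteq> paths}"

lemma P_eq: "path_algebra = P.BA"
  by (simp add: path_algebra_def pmult_def[abs_def])

lemma P_simps [simp]:
  "carrier path_algebra = CP" "mult path_algebra = P.bmul"
  "one path_algebra = (\<Sum>i\<in>verts G. single (triv i) 1)" "zero path_algebra = 0" "add path_algebra = (+)"
  "smult path_algebra = scl"
  by (simp_all add: P_eq P.BA_mult P.BA_one sum.reindex inj_on_def)

lemma ring_P: "ring (path_algebra :: ('k::field, _) module)"
  using P.kalgebra_BA unfolding kalgebra_def P_eq by blast

text \<open>The power \<open>J\<^sup>n\<close> in explicit form; this is proved for
  \<open>n = 1\<close> and \<open>n = 2\<close>, which turns membership in the ideals into a
  condition on lengths.\<close>

definition longer :: "nat \<Rightarrow> (('v, 'e) path \<Rightarrow>\<^sub>0 'k::field) set" where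
  "longer n = {f. keys f \<subseteq> {p \<in> paths. n \<le> plen p}}"

lemma bmul_longer:
  assumes "f \<in> longer m" "g \<in> longer n"
  shows "P.bmul f g \<in> longer (m + n)"
proof -
  have "w \<in> paths \<and> m + n \<le> plen w" if uv: "u \<in> keys f" "v \<in> keys g" "pmult u v = Some w" for u v w
  proof -
    have "u \<in> paths" "m \<le> plen u" "v \<in> paths" "n \<le> plen v"
      using uv(1,2) assms by (auto simp: longer_def)
    then show ?thesis
      using uv(3) pcat_props(1,4)[of u v] by (simp add: pmult_def split: if_splits)
  qed
  then show ?thesis
    unfolding longer_def using P.keys_bmul_subset[of f g] by blast
qed

lemma longer_0: "CP = longer 0"
  by (simp add: longer_def)

text \<open>The whole algebra is \<open>longer 0\<close>, so absorption is the additivity of lengths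
  for \<open>0\<close> and \<open>n\<close>.\<close>

lemma ideal_longer: "ideal (longer n :: (_ \<Rightarrow>\<^sub>0 'k::field) set) path_algebra"
proof (rule idealI[OF ring_P])
  interpret R: ring "path_algebra :: ('k, _) module" by (rule ring_P)
  show "subgroup (longer n :: (_ \<Rightarrow>\<^sub>0 'k) set) (add_monoid path_algebra)"
  proof (rule R.add.subgroupI)
    show "longer n \<subseteq> carrier (path_algebra :: ('k, _) module)"
      by (auto simp: longer_def)
    show "(longer n :: (_ \<Rightarrow>\<^sub>0 'k) set) \<noteq> {}"
      by (auto simp: longer_def intro: exI[of _ 0])
    show "\<ominus>\<^bsub>path_algebra\<^esub> a \<in> longer n" if "a \<in> longer n" for a :: "_ \<Rightarrow>\<^sub>0 'k"
    proof -
      have "\<ominus>\<^bsub>path_algebra\<^esub> a = - a"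
        using that by (intro R.minus_equality) (auto simp: keys_uminus' longer_def)
      then show ?thesis using that by (simp add: longer_def keys_uminus')
    qed
    show "a \<oplus>\<^bsub>path_algebra\<^esub> b \<in> longer n" if "a \<in> longer n" "b \<in> longer n" for a b :: "_ \<Rightarrow>\<^sub>0 'k"
      using that unfolding longer_def by (simp add: keys_plus_subset)
  qed
  show "x \<otimes>\<^bsub>path_algebra\<^esub> a \<in> longer n" "a \<otimes>\<^bsub>path_algebra\<^esub> x \<in> longer n"
    if "a \<in> longer n" "x \<in> carrier path_algebra" for a x :: "_ \<Rightarrow>\<^sub>0 'k"
    using bmul_longer[of x 0 a n] bmul_longer[of a n x 0] that by (simp_all add: longer_0[symmetric])
qed

text \<open>Splits off the arrow traversed first, which is the right factor of the product. A path
  of positive length thus lies in the ideal of the arrows, and one of length at least two is a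
  product of two elements of that ideal.\<close>

lemma single_longer:
  assumes p: "p \<in> paths" "plen p = Suc n"
  obtains q a where "q \<in> paths" "plen q = n" "a \<in> arcs G"
    "\<And>c :: 'k::field. single p c = P.bmul (single q c) (single (arr a) 1)"
proof -
  obtain u a as where "p = (u, a # as)"
    using p(2) by (cases p) (auto simp: plen_def length_Suc_conv)
  then have a: "a \<in> arcs G" "u = tail G a" and q: "(head G a, as) \<in> paths" "p = (tail G a, a # as)"
    using p(1) by (auto simp: paths_iff awalk_simps)
  have "single p c = P.bmul (single (head G a, as) c) (single (arr a) (1 :: 'k))" for c
    by (simp add: P.bmul_single pmult_def q(2) src_def) (simp add: pcat_def arr_def src_def)
  then show thesis
    using that[of "(head G a, as)" a] q a p(2) by (simp add: plen_def)
qed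

lemma arrow_ideal_eq: "arrow_ideal = (longer 1 :: (('v, 'e) path \<Rightarrow>\<^sub>0 'k::field) set)"
proof (intro equalityI subsetI)
  interpret R: ring "path_algebra :: ('k, ('v, 'e) path \<Rightarrow>\<^sub>0 'k) module" by (rule ring_P)
  let ?S = "(\<lambda>a. single (arr a) (1 :: 'k)) ` arcs G"
  have S: "?S \<subseteq> longer 1" "?S \<subseteq> carrier path_algebra"
    by (auto simp: longer_def)
  show "f \<in> longer 1" if "f \<in> arrow_ideal" for f :: "_ \<Rightarrow>\<^sub>0 'k"
    using that R.genideal_minimal[OF ideal_longer S(1)] by (auto simp: arrow_ideal_def)
  interpret I: ideal "arrow_ideal :: (('v, 'e) path \<Rightarrow>\<^sub>0 'k) set" path_algebra
    unfolding arrow_ideal_def by (rule R.genideal_ideal[OF S(2)])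
  fix f :: "('v, 'e) path \<Rightarrow>\<^sub>0 'k" assume "f \<in> longer 1"
  then have "keys f \<subseteq> {p \<in> paths. 1 \<le> plen p}" by (simp add: longer_def)
  then show "f \<in> arrow_ideal"
  proof (induct f rule: poly_mapping_add_induct)
    case zero
    then show ?case using additive_subgroup.zero_closed[OF I.is_additive_subgroup] by simp
  next
    case (single p c)
    then obtain n where "plen p = Suc n" "p \<in> paths" by (cases "plen p") auto
    then obtain q a where q: "q \<in> paths" "a \<in> arcs G" "single p c = P.bmul (single q c) (single (arr a) 1)"
      using single_longer by metis
    have "single (arr a) (1 :: 'k) \<in> arrow_ideal"
      using R.genideal_self[OF S(2)] q(2) by (auto simp: arrow_ideal_def)
    then show ?case
      using I.I_l_closed[of "single (arr a) 1" "single q c"] q by simp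
  next
    case (add f g)
    then show ?case using I.a_closed[of f g] by simp
  qed
qed

lemma arrow_ideal_sq_eq: "arrow_ideal_sq = (longer 2 :: (('v, 'e) path \<Rightarrow>\<^sub>0 'k::field) set)"
proof (intro equalityI subsetI)
  interpret R: ring "path_algebra :: ('k, ('v, 'e) path \<Rightarrow>\<^sub>0 'k) module" by (rule ring_P)
  fix f :: "('v, 'e) path \<Rightarrow>\<^sub>0 'k"
  {
    assume "f \<in> arrow_ideal_sq"
    then show "f \<in> longer 2"
      unfolding arrow_ideal_sq_def arrow_ideal_eq
    proof (induct rule: ideal_prod.induct)
      case (prod i j)
      then show ?case
        using bmul_longer[of i 1 j 1] by (simp add: numeral_2_eq_2)
    next
      case (sum f g)
      then show ?case by (simp add: longer_def keys_plus_subset)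
    qed
  }
  assume "f \<in> longer 2"
  then have "keys f \<subseteq> {p \<in> paths. 2 \<le> plen p}" by (simp add: longer_def)
  then show "f \<in> arrow_ideal_sq"
    unfolding arrow_ideal_sq_def arrow_ideal_eq
  proof (induct f rule: poly_mapping_add_induct)
    case zero
    have "(0 :: _ \<Rightarrow>\<^sub>0 'k) \<in> longer 1" by (simp add: longer_def)
    from ideal_prod.prod[OF this this] show ?case by (metis P.bmul_zero(1) P_simps(2))
  next
    case (single p c)
    then obtain n where n: "plen p = Suc n" "1 \<le> n" "p \<in> paths" by (cases "plen p") auto
    then obtain q a where q: "q \<in> paths" "plen q = n" "a \<in> arcs G" "single p c = P.bmul (single q c) (single (arr a) 1)"
      using single_longer by metis
    have "single q c \<in> longer 1" "single (arr a) (1 :: 'k) \<in> longer 1"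
      using q n by (auto simp: longer_def)
    from ideal_prod.prod[OF this, of path_algebra] show ?case using q by simp
  next
    case (add f g)
    then show ?case using ideal_prod.sum[OF add(3,4)] by simp
  qed
qed

end

lemma is_graded_degree_zero:
  fixes R :: "('k::field, 'a) module"
  assumes "Module.module field_ring R"
  shows "is_graded (trivial_dg R (\<lambda>n. if n = 0 then carrier R else {\<zero>\<^bsub>R\<^esub>}))" (is "is_graded ?T")
proof (rule is_gradedI)
  show vs: "Module.module field_ring ?T"
    by (rule module_cong[OF assms]) simp_all
  interpret V: vspace ?T by (rule vspace.intro) (rule vs)
  show "submodule (hcomp ?T n) field_ring ?T" for n
    using V.M.a_closed V.M.zero_closed V.smult_cl V.smult_zero V.M.l_zero[OF V.M.zero_closed]
    by (intro V.submodule_fieldI) auto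
  show "P x" if "x \<in> carrier ?T" "\<And>n y. y \<in> hcomp ?T n \<Longrightarrow> P y" for x and P :: "'a \<Rightarrow> bool"
    using that(1) that(2)[of x 0] by simp
  fix f N n assume f: "finite N" "\<And>n. f n \<in> hcomp ?T n" "(\<Oplus>\<^bsub>?T\<^esub>n\<in>N. f n) = \<zero>\<^bsub>?T\<^esub>" "n \<in> N"
  have z: "f m = \<zero>\<^bsub>?T\<^esub>" if "m \<noteq> 0" for m
    using f(2)[of m] that by simp
  have c: "f m \<in> carrier ?T" for m
    using f(2)[of 0] z[of m] V.M.zero_closed by (cases "m = 0") auto
  show "f n = \<zero>\<^bsub>?T\<^esub>"
  proof (cases "n = 0")
    case True
    have "(\<Oplus>\<^bsub>?T\<^esub>n\<in>N. f n) = (\<Oplus>\<^bsub>?T\<^esub>n\<in>{0}. f n)"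
      using f(1,4) z c True by (intro V.M.add.finprod_mono_neutral_cong_right) (auto simp del: trivial_dg_simps)
    also have "\<dots> = f 0"
      using c V.M.finsum_insert[of "{}" 0 f] V.M.finsum_empty[of f] by (simp del: trivial_dg_simps)
    finally show ?thesis using f(3) True by simp
  qed (rule z)
qed

context special_quiver
begin

interpretation P: basis_alg paths pmult "triv ` verts G"
  by (rule basis_alg_P)

abbreviation AQ :: "('k::field, (('v, 'e) path \<Rightarrow>\<^sub>0 'k) set) module" where
  "AQ \<equiv> quot_algebra path_algebra arrow_ideal_sq"

abbreviation AA :: "('k::field, (('v, 'e) path \<Rightarrow>\<^sub>0 'k) set) dg_space" where
  "AA \<equiv> rad_sq_zero_algebra"

abbreviation Kp :: "(('v, 'e) path \<Rightarrow>\<^sub>0 'k::field) \<Rightarrow> _" where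
  "Kp f \<equiv> arrow_ideal_sq +>\<^bsub>path_algebra\<^esub> f"

lemma quot_alg_A: "quot_alg (arrow_ideal_sq :: (_ \<Rightarrow>\<^sub>0 'k::field) set) path_algebra"
proof (intro quot_alg.intro quot_alg_axioms.intro)
  show "ideal (arrow_ideal_sq :: (_ \<Rightarrow>\<^sub>0 'k) set) path_algebra"
    unfolding arrow_ideal_sq_eq by (rule ideal_longer)
  show "kalgebra (path_algebra :: ('k, _) module)"
    unfolding P_eq by (rule P.kalgebra_BA)
qed

lemma
  fixes f g :: "('v, 'e) path \<Rightarrow>\<^sub>0 'k::field"
  assumes f: "f \<in> CP"
  shows Kp_scl: "Kp (scl c f) = c \<odot>\<^bsub>AQ\<^esub> Kp f"
    and Kp_add: "g \<in> CP \<Longrightarrow> Kp (f + g) = Kp f \<oplus>\<^bsub>AQ\<^esub> Kp g"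
    and Kp_mult: "g \<in> CP \<Longrightarrow> Kp (P.bmul f g) = Kp f \<otimes>\<^bsub>AQ\<^esub> Kp g"
    and Kp_eq_iff: "g \<in> CP \<Longrightarrow> Kp f = Kp g \<longleftrightarrow> f - g \<in> longer 2"
    and Kp_some: "(SOME h. h \<in> Kp f) - f \<in> longer 2"
proof -
  interpret L: quot_alg "arrow_ideal_sq :: (_ \<Rightarrow>\<^sub>0 'k) set" path_algebra
    by (rule quot_alg_A)
  show "Kp (scl c f) = c \<odot>\<^bsub>AQ\<^esub> Kp f"
    using L.cls_smult[of f c] f by simp
  have "f \<in> Kp f"
    using L.a_rcos_self[of f] f by simp
  then have "(SOME h. h \<in> Kp f) \<in> Kp f"
    by (rule someI)
  then show "(SOME h. h \<in> Kp f) - f \<in> longer 2"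
    by (auto simp: a_r_coset_def r_coset_def arrow_ideal_sq_eq)
  assume g: "g \<in> CP"
  show "Kp (f + g) = Kp f \<oplus>\<^bsub>AQ\<^esub> Kp g" "Kp (P.bmul f g) = Kp f \<otimes>\<^bsub>AQ\<^esub> Kp g"
    using L.cls_add[of f g] L.cls_mult[of f g] f g by simp_all
  have "\<ominus>\<^bsub>path_algebra\<^esub> g = - g"
    using g by (intro L.minus_equality) (simp_all add: keys_uminus')
  then show "Kp f = Kp g \<longleftrightarrow> f - g \<in> longer 2"
    using L.cls_eq_iff[of f g] f g by (simp add: a_minus_def arrow_ideal_sq_eq)
qed

lemma AA_eq: "(AA :: ('k::field, _) dg_space) = trivial_dg AQ (\<lambda>n. if n = 0 then carrier AQ else {\<zero>\<^bsub>AQ\<^esub>})"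
  by (simp add: rad_sq_zero_algebra_def Let_def)

lemma AQ_simps:
  "carrier (AQ :: ('k::field, _) module) = Kp ` CP" "zero (AQ :: ('k::field, _) module) = Kp 0"
  "one (AQ :: ('k::field, _) module) = Kp (\<Sum>i\<in>verts G. single (triv i) 1)"
proof -
  interpret L: quot_alg "arrow_ideal_sq :: (_ \<Rightarrow>\<^sub>0 'k::field) set" path_algebra
    by (rule quot_alg_A)
  show "carrier (AQ :: ('k::field, _) module) = Kp ` CP" "zero (AQ :: ('k::field, _) module) = Kp 0"
    "one (AQ :: ('k::field, _) module) = Kp (\<Sum>i\<in>verts G. single (triv i) 1)"
    using L.cls_zero by simp_all
qed

lemma AA_simps [simp]:
  "carrier AA = Kp ` CP" "zero AA = Kp 0" "one AA = Kp (\<Sum>i\<in>verts G. single (triv i) 1)"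
  "mult AA = mult AQ" "add AA = add AQ" "smult AA = smult AQ"
  "hcomp AA = (\<lambda>n. if n = 0 then Kp ` CP else {Kp 0})" "diff AA = (\<lambda>_. Kp 0)"
  unfolding AA_eq by (simp_all add: AQ_simps cong: if_cong)

lemma kalgebra_AQ: "kalgebra (AQ :: ('k::field, _) module)"
  using quot_alg.kalgebra_Q[OF quot_alg_A] .

lemma dg_algebra_AA: "dg_algebra (AA :: ('k::field, _) dg_space)"
proof -
  have m: "Module.module field_ring (AQ :: ('k, _) module)" and r: "ring (AQ :: ('k, _) module)"
    using kalgebra_AQ unfolding kalgebra_def by blast+
  interpret R: ring "AQ :: ('k, _) module" by (rule r)
  show ?thesis
    unfolding AA_eq
  proof (rule dg_algebra_trivial_dg[OF kalgebra_AQ is_graded_degree_zero[OF m]])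
    show "x \<otimes>\<^bsub>AQ\<^esub> y \<in> (if m + n = 0 then carrier AQ else {\<zero>\<^bsub>AQ :: ('k, _) module\<^esub>})"
      if "x \<in> (if m = 0 then carrier AQ else {\<zero>\<^bsub>AQ\<^esub>})" "y \<in> (if n = 0 then carrier AQ else {\<zero>\<^bsub>AQ\<^esub>})"
      for m n :: int and x y
      using that by (cases "m = 0"; cases "n = 0") simp_all
  qed simp
qed

text \<open>The elements of the algebra are determined by their coefficients at the paths of length at most one.\<close>

definition Sh :: "('v, 'e) path set" where
  "Sh = {s \<in> paths. plen s \<le> 1}"

lemma Sh_eq: "Sh = triv ` verts G \<union> arr ` arcs G"
proof (intro equalityI subsetI)
  fix s assume "s \<in> Sh"
  then show "s \<in> triv ` verts G \<union> arr ` arcs G"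
    using plen0[of s] plen1[of s] path_verts[of s] by (cases "plen s") (auto simp: Sh_def)
qed (auto simp: Sh_def)

lemma Sh_simps [simp]: "finite Sh" "triv i \<in> Sh \<longleftrightarrow> i \<in> verts G" "arr a \<in> Sh \<longleftrightarrow> a \<in> arcs G"
  unfolding Sh_eq by auto

lemma Sh_cases:
  assumes "s \<in> Sh"
  obtains (vertex) i where "i \<in> verts G" "s = triv i" | (arrow) a where "a \<in> arcs G" "s = arr a"
  using assms unfolding Sh_eq by blast

lemma sum_Sh: "(\<Sum>s\<in>Sh. f s) = (\<Sum>i\<in>verts G. f (triv i)) + (\<Sum>a\<in>arcs G. f (arr a))"
  unfolding Sh_eq by (subst sum.union_disjoint) (auto simp: sum.reindex inj_on_def)

text \<open>The representative is arbitrary: two of them differ by paths of length at least two,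
  which do not touch the coefficients at \<open>Sh\<close>.\<close>

definition co :: "(('v, 'e) path \<Rightarrow>\<^sub>0 'k::field) set \<Rightarrow> ('v, 'e) path \<Rightarrow> 'k" where
  "co X s = lookup (SOME f. f \<in> X) s"

lemma longer_2_lookup: "f \<in> longer 2 \<Longrightarrow> s \<in> Sh \<Longrightarrow> lookup f s = 0"
  by (auto simp: longer_def Sh_def in_keys_iff)

lemma co_Kp: "f \<in> CP \<Longrightarrow> s \<in> Sh \<Longrightarrow> co (Kp f) s = lookup f s"
  using longer_2_lookup[OF Kp_some, of f s] by (simp add: co_def lookup_minus)

lemma A_ext:
  assumes "X \<in> carrier AA" "Y \<in> carrier AA" "\<And>s. s \<in> Sh \<Longrightarrow> co X s = co Y s"
  shows "X = Y"
proof -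
  obtain f g where f: "f \<in> CP" "X = Kp f" and g: "g \<in> CP" "Y = Kp g"
    using assms(1,2) by auto
  have "p \<in> paths \<and> 2 \<le> plen p" if p: "p \<in> keys (f - g)" for p
  proof -
    have "p \<in> paths"
      using p keys_minus_subset[of f paths g] f g by blast
    moreover have "p \<notin> Sh"
      using assms(3)[of p] f g p by (auto simp: co_Kp in_keys_iff lookup_minus)
    ultimately show ?thesis by (simp add: Sh_def)
  qed
  then have "f - g \<in> longer 2"
    by (auto simp: longer_def)
  then show ?thesis
    using Kp_eq_iff[of f g] f g by simp
qed

lemma lookup_bmul_triv:
  assumes "f \<in> CP" "g \<in> CP"
  shows "lookup (P.bmul f g) (triv i) = lookup f (triv i) * lookup g (triv i)"
proof -
  have "keys f \<subseteq> paths" "keys g \<subseteq> paths" using assms by auto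
  from this(1) show ?thesis
  proof (induct f rule: poly_mapping_add_induct)
    case (single p a)
    show ?case
      using \<open>keys g \<subseteq> paths\<close>
    proof (induct g rule: poly_mapping_add_induct)
      case (single q b)
      have "src p = tgt q \<and> pcat p q = triv i \<longleftrightarrow> p = triv i \<and> q = triv i"
        by (cases p; cases q) (auto simp: triv_def pcat_def src_def tgt_def)
      then show ?case
        unfolding P.bmul_single by (auto simp: pmult_def lookup_single when_def)
    qed (simp_all add: P.bmul_add2 lookup_add algebra_simps)
  qed (simp_all add: P.bmul_add1 lookup_add algebra_simps)
qed

lemma lookup_bmul_arr:
  assumes "f \<in> CP" "g \<in> CP"
  shows "lookup (P.bmul f g) (arr a) =
    lookup f (triv (head G a)) * lookup g (arr a) + lookup f (arr a) * lookup g (triv (tail G a))"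
proof -
  have "keys f \<subseteq> paths" "keys g \<subseteq> paths" using assms by auto
  from this(1) show ?thesis
  proof (induct f rule: poly_mapping_add_induct)
    case (single p c)
    show ?case
      using \<open>keys g \<subseteq> paths\<close>
    proof (induct g rule: poly_mapping_add_induct)
      case (single q b)
      \<comment> \<open>An arrow factors only trivially, through its head on the left or its tail on
        the right.\<close>
      have iff: "src p = tgt q \<and> pcat p q = arr a \<longleftrightarrow>
          p = triv (head G a) \<and> q = arr a \<or> p = arr a \<and> q = triv (tail G a)"
        using single \<open>p \<in> paths\<close>
        by (cases p; cases q)
          (auto simp: triv_def arr_def pcat_def src_def tgt_def append_eq_Cons_conv paths_iff awalk_simps)
      have "lookup (P.osingle (pmult p q) (c * b)) (arr a) =
          (if p = triv (head G a) \<and> q = arr a \<or> p = arr a \<and> q = triv (tail G a) then c * b else 0)"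
        unfolding iff[symmetric] by (simp add: pmult_def lookup_single when_def)
      then show ?case
        unfolding P.bmul_single
        by (cases "p = arr a"; cases "p = triv (head G a)"; cases "q = arr a"; cases "q = triv (tail G a)")
          (simp_all add: lookup_single when_def)
    qed (simp_all add: P.bmul_add2 lookup_add algebra_simps)
  qed (simp_all add: P.bmul_add1 lookup_add algebra_simps)
qed

lemma path_class_eq: "path_class p = Kp (single p 1)"
  by (simp add: path_class_def)

lemma single_CP: "s \<in> Sh \<Longrightarrow> single s c \<in> CP"
  by (auto simp: Sh_def)

lemma path_class_closed: "s \<in> Sh \<Longrightarrow> path_class s \<in> carrier AA"
  unfolding path_class_eq AA_simps by (rule imageI[OF single_CP])

lemma co_path_class: "s \<in> Sh \<Longrightarrow> t \<in> Sh \<Longrightarrow> co (path_class s) t = (if s = t then 1 else 0)"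
  unfolding path_class_eq by (subst co_Kp[OF single_CP]) (auto simp: lookup_single when_def)

lemma
  assumes "X \<in> carrier AA" "Y \<in> carrier AA"
  shows A_add_closed: "X \<oplus>\<^bsub>AA\<^esub> Y \<in> carrier AA" and A_mult_closed: "X \<otimes>\<^bsub>AA\<^esub> Y \<in> carrier AA"
    and A_smult_closed: "c \<odot>\<^bsub>AA\<^esub> X \<in> carrier AA"
    and co_add: "s \<in> Sh \<Longrightarrow> co (X \<oplus>\<^bsub>AA\<^esub> Y) s = co X s + co Y s"
    and co_smult: "s \<in> Sh \<Longrightarrow> co (c \<odot>\<^bsub>AA\<^esub> X) s = c * co X s"
    and co_mult_triv: "i \<in> verts G \<Longrightarrow> co (X \<otimes>\<^bsub>AA\<^esub> Y) (triv i) = co X (triv i) * co Y (triv i)"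
    and co_mult_arr: "a \<in> arcs G \<Longrightarrow> co (X \<otimes>\<^bsub>AA\<^esub> Y) (arr a) =
      co X (triv (head G a)) * co Y (arr a) + co X (arr a) * co Y (triv (tail G a))"
proof -
  obtain f g where f: "f \<in> CP" "X = Kp f" and g: "g \<in> CP" "Y = Kp g"
    using assms by auto
  have c: "f + g \<in> CP" "P.bmul f g \<in> CP" "scl c f \<in> CP"
    using f g keys_plus_subset[of f paths g] P.keys_bmul[of f g] keys_scl[of c f] by auto
  have e: "X \<oplus>\<^bsub>AA\<^esub> Y = Kp (f + g)" "X \<otimes>\<^bsub>AA\<^esub> Y = Kp (P.bmul f g)" "c \<odot>\<^bsub>AA\<^esub> X = Kp (scl c f)"
    using Kp_add[OF f(1) g(1)] Kp_mult[OF f(1) g(1)] Kp_scl[OF f(1)] f(2) g(2) by simp_all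
  show "X \<oplus>\<^bsub>AA\<^esub> Y \<in> carrier AA" "X \<otimes>\<^bsub>AA\<^esub> Y \<in> carrier AA" "c \<odot>\<^bsub>AA\<^esub> X \<in> carrier AA"
    unfolding e using c by simp_all
  show "s \<in> Sh \<Longrightarrow> co (X \<oplus>\<^bsub>AA\<^esub> Y) s = co X s + co Y s" "s \<in> Sh \<Longrightarrow> co (c \<odot>\<^bsub>AA\<^esub> X) s = c * co X s"
    "i \<in> verts G \<Longrightarrow> co (X \<otimes>\<^bsub>AA\<^esub> Y) (triv i) = co X (triv i) * co Y (triv i)"
    "a \<in> arcs G \<Longrightarrow> co (X \<otimes>\<^bsub>AA\<^esub> Y) (arr a) =
      co X (triv (head G a)) * co Y (arr a) + co X (arr a) * co Y (triv (tail G a))"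
    unfolding e using f g c
    by (simp_all add: co_Kp lookup_add lookup_bmul_triv lookup_bmul_arr)
qed

lemma co_zero: "s \<in> Sh \<Longrightarrow> co (Kp 0) s = 0"
  by (simp add: co_Kp)

text \<open>Left multiplication by a vertex is the projection onto the coefficients at paths ending
  there, so its image consists of the elements that it fixes.\<close>

lemma eA_iff:
  assumes "i \<in> verts G"
  shows "X \<in> eA i \<longleftrightarrow> X \<in> carrier AA \<and> (\<forall>s\<in>Sh. co X s \<noteq> 0 \<longrightarrow> tgt s = i)" (is "_ \<longleftrightarrow> ?R")
proof
  note e = path_class_closed[of "triv i", simplified assms Sh_simps, OF TrueI]
  assume "X \<in> eA i"
  then obtain Y where Y: "Y \<in> carrier AA" "X = path_class (triv i) \<otimes>\<^bsub>AA\<^esub> Y"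
    unfolding eA_def by blast
  have "co X s = 0" if "s \<in> Sh" "tgt s \<noteq> i" for s
    using that(1)
  proof (cases rule: Sh_cases)
    case (vertex j)
    then show ?thesis
      using that assms co_mult_triv[OF e Y(1) vertex(1)] by (simp add: Y(2) co_path_class del: AA_simps)
  next
    case (arrow a)
    then show ?thesis
      using that assms co_mult_arr[OF e Y(1) arrow(1)] by (auto simp add: Y(2) co_path_class simp del: AA_simps)
  qed
  then show ?R
    using A_mult_closed[OF e Y(1)] Y(2) by blast
next
  note e = path_class_closed[of "triv i", simplified assms Sh_simps, OF TrueI]
  assume R: ?R
  have "X = path_class (triv i) \<otimes>\<^bsub>AA\<^esub> X"
  proof (rule A_ext)
    fix s assume s: "s \<in> Sh"
    then show "co X s = co (path_class (triv i) \<otimes>\<^bsub>AA\<^esub> X) s"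
    proof (cases rule: Sh_cases)
      case (vertex j)
      then show ?thesis
        using R s assms co_mult_triv[OF e _ vertex(1), of X] by (auto simp add: co_path_class simp del: AA_simps)
    next
      case (arrow a)
      then show ?thesis
        using R s assms co_mult_arr[OF e _ arrow(1), of X] by (auto simp add: co_path_class simp del: AA_simps)
    qed
  qed (use R A_mult_closed[OF e] in blast)+
  then show "X \<in> eA i"
    unfolding eA_def using R by blast
qed

end

text \<open>For \<open>y\<close> the class of \<open>e\<^sub>i\<close> or of an arrow this extracts
  the coordinate belonging to the dual basis element; the map \<open>tens x\<close> goes back and
  sends \<open>v\<close> to the elementary tensor of \<open>x\<close> and \<open>v\<close>.\<close>

definition ev :: "'x \<Rightarrow> ('b \<Rightarrow>\<^sub>0 ('x \<Rightarrow> 'k::field)) \<Rightarrow> ('b \<Rightarrow>\<^sub>0 'k)" where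
  "ev y m = Poly_Mapping.map (\<lambda>x. x y) m"

definition tens :: "('x \<Rightarrow> 'k::field) \<Rightarrow> ('b \<Rightarrow>\<^sub>0 'k) \<Rightarrow> ('b \<Rightarrow>\<^sub>0 ('x \<Rightarrow> 'k))" where
  "tens x v = Poly_Mapping.map (\<lambda>c y. c * x y) v"

lemma lookup_ev [simp]: "lookup (ev y m) k = lookup m k y"
  unfolding ev_def by (simp add: lookup_map_zero)

lemma lookup_tens [simp]: "lookup (tens x v) k = (\<lambda>y. lookup v k * x y)"
  unfolding tens_def by (subst lookup_map_zero) (auto simp: zero_fun_def)

lemma tens_single: "tens x (single k c) = single k (\<lambda>y. c * x y)"
  by (rule poly_mapping_eqI) (auto simp: lookup_single when_def zero_fun_def)

lemma tens_props:
  "tens x 0 = 0" "tens x (v + w) = tens x v + tens x w" "tens x (v - w) = tens x v - tens x w"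
  "tens x (scl c v) = inj_scale c (tens x v)" "tens x (\<Sum>i\<in>I. f i) = (\<Sum>i\<in>I. tens x (f i))"
  "ev y (tens x v) = scl (x y) v" "keys (tens x v) \<subseteq> keys v"
proof -
  show a: "tens x (v + w) = tens x v + tens x w" for v w
    by (rule poly_mapping_eqI) (simp add: lookup_add algebra_simps fun_eq_iff)
  show z: "tens x 0 = 0"
    by (rule poly_mapping_eqI) (simp add: zero_fun_def)
  show "tens x (v - w) = tens x v - tens x w"
    by (rule poly_mapping_eqI) (simp add: lookup_minus algebra_simps fun_eq_iff)
  show "tens x (scl c v) = inj_scale c (tens x v)"
    by (rule poly_mapping_eqI) (simp add: algebra_simps fun_eq_iff)
  show "tens x (\<Sum>i\<in>I. f i) = (\<Sum>i\<in>I. tens x (f i))"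
    by (induct I rule: infinite_finite_induct) (simp_all add: a z)
  show "ev y (tens x v) = scl (x y) v"
    by (rule poly_mapping_eqI) (simp add: mult.commute)
  show "keys (tens x v) \<subseteq> keys v"
    by (auto simp: in_keys_iff zero_fun_def)
qed

lemma ev_props:
  fixes m m' :: "('v, 'e, 'k::field) inj_leavitt"
  shows ev_zero [simp]: "ev y (0 :: ('v, 'e, 'k) inj_leavitt) = 0"
    and ev_add: "ev y (m + m') = ev y m + ev y m'" and ev_diff: "ev y (m - m') = ev y m - ev y m'"
    and ev_scale: "ev y (inj_scale c m) = scl c (ev y m)"
    and ev_sum: "ev y (\<Sum>i\<in>I. f i :: ('v, 'e, 'k) inj_leavitt) = (\<Sum>i\<in>I. ev y (f i))"
proof -
  show a: "ev y (m + m') = ev y m + ev y m'" for m m' :: "('v, 'e, 'k) inj_leavitt"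
    by (rule poly_mapping_eqI) (simp add: lookup_add)
  show z: "ev y (0 :: ('v, 'e, 'k) inj_leavitt) = 0"
    by (rule poly_mapping_eqI) simp
  show "ev y (m - m') = ev y m - ev y m'"
    by (rule poly_mapping_eqI) (simp add: lookup_minus)
  show "ev y (inj_scale c m) = scl c (ev y m)"
    by (rule poly_mapping_eqI) simp
  show "ev y (\<Sum>i\<in>I. f i) = (\<Sum>i\<in>I. ev y (f i))"
    by (induct I rule: infinite_finite_induct) (simp_all add: a z)
qed

lemma ev_eq_sum: "ev y m = (\<Sum>k\<in>keys m. single k (lookup m k y))"
  by (rule poly_mapping_eqI)
    (auto simp: lookup_sum lookup_single when_def in_keys_iff)

context special_quiver
begin

section \<open>The injective modules\<close>

lemma eA_closed: "i \<in> verts G \<Longrightarrow> X \<in> eA i \<Longrightarrow> X \<in> carrier AA"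
  using eA_iff by blast

lemma inj_moduleD:
  assumes "\<phi> \<in> inj_module i"
  shows "X \<notin> eA i \<Longrightarrow> \<phi> X = 0"
    and "X \<in> eA i \<Longrightarrow> Y \<in> eA i \<Longrightarrow> \<phi> (X \<oplus>\<^bsub>AA\<^esub> Y) = \<phi> X + \<phi> Y"
    and "X \<in> eA i \<Longrightarrow> \<phi> (c \<odot>\<^bsub>AA\<^esub> X) = c * \<phi> X"
  using assms unfolding inj_module_def by blast+

lemma inj_moduleI:
  assumes "\<And>X. X \<notin> eA i \<Longrightarrow> \<phi> X = 0"
    "\<And>X Y. X \<in> eA i \<Longrightarrow> Y \<in> eA i \<Longrightarrow> \<phi> (X \<oplus>\<^bsub>AA\<^esub> Y) = \<phi> X + \<phi> Y"
    "\<And>c X. X \<in> eA i \<Longrightarrow> \<phi> (c \<odot>\<^bsub>AA\<^esub> X) = c * \<phi> X"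
  shows "\<phi> \<in> inj_module i"
  using assms unfolding inj_module_def by blast

lemma path_class_eA:
  assumes "s \<in> Sh" "i \<in> verts G"
  shows "(path_class s :: (_ \<Rightarrow>\<^sub>0 'k::field) set) \<in> eA i \<longleftrightarrow> tgt s = i"
proof -
  have "(\<forall>t\<in>Sh. co (path_class s :: (_ \<Rightarrow>\<^sub>0 'k) set) t \<noteq> 0 \<longrightarrow> tgt t = i) \<longleftrightarrow> tgt s = i"
    using assms(1) by (auto simp: co_path_class)
  then show ?thesis
    using eA_iff[OF assms(2), of "path_class s"] path_class_closed[OF assms(1)] by blast
qed

lemma eA_co: "i \<in> verts G \<Longrightarrow> X \<in> eA i \<Longrightarrow> s \<in> Sh \<Longrightarrow> tgt s \<noteq> i \<Longrightarrow> co X s = 0"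
  using eA_iff by blast

lemma eA_I: "i \<in> verts G \<Longrightarrow> X \<in> carrier AA \<Longrightarrow> (\<And>s. s \<in> Sh \<Longrightarrow> tgt s \<noteq> i \<Longrightarrow> co X s = 0) \<Longrightarrow> X \<in> eA i"
  using eA_iff by blast

lemma eA_add_smult:
  assumes "i \<in> verts G" "X \<in> eA i"
  shows "Y \<in> eA i \<Longrightarrow> X \<oplus>\<^bsub>AA\<^esub> Y \<in> eA i" "c \<odot>\<^bsub>AA\<^esub> X \<in> eA i"
proof -
  note c = eA_closed[OF assms]
  show "X \<oplus>\<^bsub>AA\<^esub> Y \<in> eA i" if Y: "Y \<in> eA i"
  proof (rule eA_I[OF assms(1)])
    note cY = eA_closed[OF assms(1) Y]
    show "X \<oplus>\<^bsub>AA\<^esub> Y \<in> carrier AA" by (rule A_add_closed[OF c cY])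
    show "co (X \<oplus>\<^bsub>AA\<^esub> Y) s = 0" if "s \<in> Sh" "tgt s \<noteq> i" for s
      unfolding co_add[OF c cY that(1)] eA_co[OF assms that] eA_co[OF assms(1) Y that] by simp
  qed
  show "c \<odot>\<^bsub>AA\<^esub> X \<in> eA i"
  proof (rule eA_I[OF assms(1) A_smult_closed[OF c c]])
    show "co (c \<odot>\<^bsub>AA\<^esub> X) s = 0" if "s \<in> Sh" "tgt s \<noteq> i" for s
      unfolding co_smult[OF c c that(1)] eA_co[OF assms that] by simp
  qed
qed

text \<open>\<open>X\<close> is the combination of the classes of short paths with its coefficients.
  Linearity of \<open>\<phi>\<close> holds on \<open>eA i\<close> only, so the expansion is made
  over the paths ending at \<open>i\<close>; at the others the coefficient of \<open>X\<close> is
  zero.\<close>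

lemma inj_expand:
  fixes X :: "(('v, 'e) path \<Rightarrow>\<^sub>0 'k::field) set"
  assumes \<phi>: "\<phi> \<in> inj_module i" and i: "i \<in> verts G" and X: "X \<in> eA i"
  shows "\<phi> X = (\<Sum>s\<in>Sh. co X s * \<phi> (path_class s))"
proof -
  let ?T = "{s \<in> Sh. tgt s = i}"
  let ?f = "\<lambda>S. \<Sum>s\<in>S. single s (co X s)"
  have z: "Kp 0 \<in> eA i"
    by (rule eA_I[OF i]) (auto simp: co_zero)
  have CP: "?f S \<in> CP" if "S \<subseteq> Sh" for S
    using that by (intro CollectI keys_sum_subset) (auto simp: Sh_def)
  have *: "Kp (?f S) \<in> eA i \<and> \<phi> (Kp (?f S)) = (\<Sum>s\<in>S. co X s * \<phi> (path_class s))"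
    if "finite S" "S \<subseteq> ?T" for S
    using that
  proof (induct S rule: finite_induct)
    case empty
    have "Kp (0 :: _ \<Rightarrow>\<^sub>0 'k) = 0 \<odot>\<^bsub>AA\<^esub> Kp 0"
      using Kp_scl[of "0 :: _ \<Rightarrow>\<^sub>0 'k" 0] by simp
    then show ?case
      using inj_moduleD(3)[OF \<phi> z, of 0] z by simp
  next
    case (insert s S)
    then have s: "s \<in> Sh" "tgt s = i" "S \<subseteq> Sh" by auto
    note sc = single_CP[OF s(1), of 1]
    have e: "Kp (single s (co X s)) = co X s \<odot>\<^bsub>AA\<^esub> path_class s"
      using Kp_scl[OF sc, of "co X s"] by (simp add: path_class_eq)
    have p: "path_class s \<in> eA i"
      using path_class_eA[OF s(1) i] s(2) by blast
    have "Kp (?f (insert s S)) = Kp (single s (co X s)) \<oplus>\<^bsub>AA\<^esub> Kp (?f S)"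
      using insert Kp_add[OF single_CP[OF s(1)] CP[OF s(3)]] by simp
    then have e': "Kp (?f (insert s S)) = (co X s \<odot>\<^bsub>AA\<^esub> path_class s) \<oplus>\<^bsub>AA\<^esub> Kp (?f S)"
      unfolding e .
    have IH: "Kp (?f S) \<in> eA i" "\<phi> (Kp (?f S)) = (\<Sum>s\<in>S. co X s * \<phi> (path_class s))"
      using insert by auto
    note q = eA_add_smult(2)[OF i p, of "co X s"]
    show ?case
      unfolding e' using eA_add_smult(1)[OF i q IH(1)] inj_moduleD(2)[OF \<phi> q IH(1)]
        inj_moduleD(3)[OF \<phi> p] IH(2) insert(1,2) by simp
  qed
  have "X = Kp (?f ?T)"
  proof (rule A_ext)
    show "X \<in> carrier AA" by (rule eA_closed[OF i X])
    show "Kp (?f ?T) \<in> carrier AA" using CP[of ?T] by auto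
    fix t assume t: "t \<in> Sh"
    have "co X t = 0" if "tgt t \<noteq> i"
      by (rule eA_co[OF i X t that])
    then show "co X t = co (Kp (?f ?T)) t"
      using CP[of ?T] t by (subst co_Kp) (auto simp: lookup_sum lookup_single when_def)
  qed
  then have "\<phi> X = (\<Sum>s\<in>?T. co X s * \<phi> (path_class s))"
    using *[of ?T] by simp
  also have "\<dots> = (\<Sum>s\<in>Sh. co X s * \<phi> (path_class s))"
    using eA_co[OF i X] by (intro sum.mono_neutral_left) auto
  finally show ?thesis .
qed

lemma inj_class_zero:
  assumes "\<phi> \<in> inj_module i" "i \<in> verts G" "s \<in> Sh" "tgt s \<noteq> i"
  shows "\<phi> (path_class s) = 0"
  using inj_moduleD(1)[OF assms(1)] path_class_eA[OF assms(3,2)] assms(4) by blast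

lemma inj_module_ext:
  assumes "\<phi> \<in> inj_module i" "\<psi> \<in> inj_module i" "i \<in> verts G"
    and "\<And>s. s \<in> Sh \<Longrightarrow> tgt s = i \<Longrightarrow> \<phi> (path_class s) = \<psi> (path_class s)"
  shows "\<phi> = \<psi>"
proof
  fix X
  have "\<phi> (path_class s) = \<psi> (path_class s)" if "s \<in> Sh" for s
    using assms(4)[OF that] inj_class_zero[OF assms(1,3) that] inj_class_zero[OF assms(2,3) that]
    by (cases "tgt s = i") simp_all
  then show "\<phi> X = \<psi> X"
    using inj_expand[OF assms(1,3)] inj_expand[OF assms(2,3)] inj_moduleD(1)[OF assms(1)] inj_moduleD(1)[OF assms(2)]
    by (cases "X \<in> eA i") simp_all
qed

lemma inj_module_closed:
  shows "0 \<in> inj_module i" "(\<lambda>_. 0) \<in> inj_module i" "\<phi> \<in> inj_module i \<Longrightarrow> (\<lambda>y. c * \<phi> y) \<in> inj_module i"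
    "\<phi> \<in> inj_module i \<Longrightarrow> \<psi> \<in> inj_module i \<Longrightarrow> \<phi> + \<psi> \<in> inj_module i"
  unfolding inj_module_def by (auto simp: algebra_simps zero_fun_def)

text \<open>The dual basis element of the class of \<open>s\<close>, extended by zero outside the
  space of its target as the encoding of injective modules demands.\<close>

definition sharp :: "('v, 'e) path \<Rightarrow> (('v, 'e) path \<Rightarrow>\<^sub>0 'k::field) set \<Rightarrow> 'k" where
  "sharp s X = (if X \<in> eA (tgt s) then co X s else 0)"

lemma tgt_Sh: "s \<in> Sh \<Longrightarrow> tgt s \<in> verts G"
  using path_verts by (auto simp: Sh_def)

lemma sharp_inj:
  assumes s: "s \<in> Sh"
  shows "(sharp s :: (_ \<Rightarrow>\<^sub>0 'k::field) set \<Rightarrow> 'k) \<in> inj_module (tgt s)"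
proof (rule inj_moduleI)
  note i = tgt_Sh[OF s]
  show "sharp s (X \<oplus>\<^bsub>AA\<^esub> Y) = sharp s X + sharp s Y" if "X \<in> eA (tgt s)" "Y \<in> eA (tgt s)" for X Y :: "(_ \<Rightarrow>\<^sub>0 'k) set"
    using that eA_add_smult(1)[OF i that] co_add[OF eA_closed[OF i that(1)] eA_closed[OF i that(2)] s]
    by (simp add: sharp_def del: AA_simps)
  show "sharp s (c \<odot>\<^bsub>AA\<^esub> X) = c * sharp s X" if "X \<in> eA (tgt s)" for c :: 'k and X
    using that eA_add_smult(2)[OF i that] co_smult[OF eA_closed[OF i that] eA_closed[OF i that] s]
    by (simp add: sharp_def del: AA_simps)
qed (simp add: sharp_def)

lemma sharp_class: "s \<in> Sh \<Longrightarrow> t \<in> Sh \<Longrightarrow> sharp s (path_class t) = (if s = t then 1 else 0)"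
  using path_class_eA[of t "tgt s"] tgt_Sh[of s] by (auto simp: sharp_def co_path_class)

lemma vertex_sharp_eq:
  assumes "i \<in> verts G"
  shows "vertex_sharp i = (sharp (triv i) :: (_ \<Rightarrow>\<^sub>0 'k::field) set \<Rightarrow> 'k)"
  unfolding vertex_sharp_def
proof (rule the_equality)
  show s: "sharp (triv i) \<in> inj_module i \<and> sharp (triv i) (path_class (triv i)) = (1 :: 'k) \<and>
      (\<forall>a\<in>in_arcs G i. sharp (triv i) (path_class (arr a)) = (0 :: 'k))"
    using sharp_inj[of "triv i"] assms by (auto simp: sharp_class)
  fix \<phi> :: "(_ \<Rightarrow>\<^sub>0 'k) set \<Rightarrow> 'k"
  assume \<phi>: "\<phi> \<in> inj_module i \<and> \<phi> (path_class (triv i)) = 1 \<and> (\<forall>a\<in>in_arcs G i. \<phi> (path_class (arr a)) = 0)"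
  show "\<phi> = sharp (triv i)"
  proof (rule inj_module_ext[of _ i])
    show "\<phi> (path_class s) = sharp (triv i) (path_class s)" if "s \<in> Sh" "tgt s = i" for s
      using that(1) by (cases rule: Sh_cases) (use \<phi> that assms in \<open>auto simp: sharp_class\<close>)
  qed (use \<phi> s assms in auto)
qed


section \<open>The injective Leavitt complex\<close>

abbreviation MT :: "('v, 'e, 'k::field) inj_leavitt set" where
  "MT \<equiv> inj_leavitt_total sp"

abbreviation evp :: "('v, 'e) path \<Rightarrow> ('v, 'e, 'k::field) inj_leavitt \<Rightarrow> (('v, 'e) path \<times> ('v, 'e) path) \<Rightarrow>\<^sub>0 'k" where
  "evp s \<equiv> ev (path_class s)"

abbreviation tsh :: "('v, 'e) path \<Rightarrow> ((('v, 'e) path \<times> ('v, 'e) path) \<Rightarrow>\<^sub>0 'k::field) \<Rightarrow> ('v, 'e, 'k) inj_leavitt" where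
  "tsh s \<equiv> tens (sharp s)"

lemma MT_iff: "m \<in> MT \<longleftrightarrow> (\<forall>k\<in>keys m. k \<in> Adm \<and> lookup m k \<in> inj_module (src (snd k)))"
  by (fastforce simp: inj_leavitt_total_def Adm_def)

lemma MT_lookup: "m \<in> MT \<Longrightarrow> lookup m k \<in> inj_module (src (snd k))"
  using inj_module_closed(1)[of "src (snd k)"] by (cases "k \<in> keys m") (auto simp: MT_iff in_keys_iff)

lemma Adm_src: "k \<in> Adm \<Longrightarrow> src (snd k) \<in> verts G"
  using Adm_verts[of "fst k" "snd k"] by (simp add: src_def)

lemma MT_add: "m \<in> MT \<Longrightarrow> m' \<in> MT \<Longrightarrow> m + m' \<in> MT"
  using keys_add[of m m'] inj_module_closed(4) MT_lookup[of m] MT_lookup[of m']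
  unfolding MT_iff lookup_add by blast

lemma MT_scale: "m \<in> MT \<Longrightarrow> inj_scale c m \<in> MT"
  using keys_inj_scale[of c m] inj_module_closed(3) unfolding MT_iff lookup_inj_scale by blast

lemma MT_zero: "0 \<in> MT"
  by (simp add: MT_iff)

lemma MT_sum: "(\<And>i. i \<in> I \<Longrightarrow> f i \<in> MT) \<Longrightarrow> (\<Sum>i\<in>I. f i) \<in> MT"
  by (induct I rule: infinite_finite_induct) (auto simp: MT_zero MT_add)

lemma MT_diff:
  assumes "m \<in> MT" "m' \<in> MT"
  shows "m - m' \<in> MT"
proof -
  have "m - m' = m + inj_scale (- 1) m'"
    by (rule poly_mapping_eqI) (simp add: lookup_add lookup_minus fun_eq_iff)
  then show ?thesis using MT_add[OF assms(1) MT_scale[OF assms(2)]] by (simp only:)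
qed

text \<open>At \<open>(p, q)\<close> the coefficient is a functional on the paths ending where
  \<open>q\<close> starts, and it vanishes at all others. So the coordinate at \<open>s\<close>
  lives in the left ideal of the target of \<open>s\<close>.\<close>

lemma keys_ev: "m \<in> MT \<Longrightarrow> s \<in> Sh \<Longrightarrow> keys (evp s m) \<subseteq> Admv (tgt s)"
proof
  fix k assume m: "m \<in> MT" "s \<in> Sh" and "k \<in> keys (evp s m)"
  then have nz: "lookup m k (path_class s) \<noteq> 0" by (simp add: in_keys_iff)
  then have k: "k \<in> Adm"
    using m(1) by (auto simp: MT_iff in_keys_iff zero_fun_def)
  then have "tgt s = src (snd k)"
    using nz inj_class_zero[OF MT_lookup[OF m(1)] Adm_src[OF k] m(2)] by metis
  then show "k \<in> Admv (tgt s)" using k by (simp add: Admv_def)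
qed

lemma keys_ev_Adm: "m \<in> MT \<Longrightarrow> s \<in> Sh \<Longrightarrow> keys (evp s m) \<subseteq> Adm"
  using keys_ev Admv_Adm by blast

lemma M_ext:
  assumes "m \<in> MT" "m' \<in> MT" "\<And>s. s \<in> Sh \<Longrightarrow> evp s m = evp s m'"
  shows "m = m'"
proof (rule poly_mapping_eqI)
  fix k
  show "lookup m k = lookup m' k"
  proof (cases "k \<in> Adm")
    case True
    have "lookup m k (path_class s) = lookup m' k (path_class s)" if "s \<in> Sh" for s
      using assms(3)[OF that] by (metis lookup_ev)
    then show ?thesis
      using inj_module_ext[OF MT_lookup[OF assms(1)] MT_lookup[OF assms(2)] Adm_src[OF True]] by blast
  next
    case False
    then have "k \<notin> keys m" "k \<notin> keys m'" using assms(1,2) by (auto simp: MT_iff)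
    then show ?thesis by (simp add: in_keys_iff)
  qed
qed

lemma tens_MT:
  assumes "x \<in> inj_module i" "keys v \<subseteq> Admv i"
  shows "tens x v \<in> MT"
  unfolding MT_iff
proof
  fix k assume "k \<in> keys (tens x v)"
  then have "k \<in> Admv i"
    using tens_props(7)[of x v] assms(2) by blast
  then have k: "k \<in> Adm" "src (snd k) = i"
    by (simp_all add: Admv_def)
  show "k \<in> Adm \<and> lookup (tens x v) k \<in> inj_module (src (snd k))"
    unfolding k(2) lookup_tens using k(1) inj_module_closed(3)[OF assms(1)] by blast
qed

lemma tsh_MT: "s \<in> Sh \<Longrightarrow> keys v \<subseteq> Admv (tgt s) \<Longrightarrow> tsh s v \<in> MT"
  by (rule tens_MT[OF sharp_inj])

lemma ev_tsh: "s \<in> Sh \<Longrightarrow> t \<in> Sh \<Longrightarrow> evp t (tsh s v) = (if s = t then v else 0)"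
  by (simp add: tens_props(6) sharp_class)

text \<open>A coefficient is nonzero iff one of its values at short paths is, so degrees can be read
  off coordinate by coordinate.\<close>

lemma MT_deg_iff: "m \<in> inj_leavitt_deg sp n \<longleftrightarrow> m \<in> MT \<and> (\<forall>s\<in>Sh. keys (evp s m) \<subseteq> Admd n)"
proof
  assume "m \<in> inj_leavitt_deg sp n"
  then have m: "m \<in> MT" "\<And>k. k \<in> keys m \<Longrightarrow> pdeg k = n"
    by (auto simp: inj_leavitt_deg_def pdeg_def)
  have "keys (evp s m) \<subseteq> Admd n" if "s \<in> Sh" for s
  proof
    fix k assume k: "k \<in> keys (evp s m)"
    then have "k \<in> keys m" by (auto simp: in_keys_iff zero_fun_def)
    then show "k \<in> Admd n" using m k keys_ev_Adm[OF m(1) that] by (auto simp: Admd_def)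
  qed
  then show "m \<in> MT \<and> (\<forall>s\<in>Sh. keys (evp s m) \<subseteq> Admd n)" using m by blast
next
  assume m: "m \<in> MT \<and> (\<forall>s\<in>Sh. keys (evp s m) \<subseteq> Admd n)"
  have "pdeg k = n" if k: "k \<in> keys m" for k
  proof (rule ccontr)
    assume "pdeg k \<noteq> n"
    then have "k \<notin> keys (evp s m)" if "s \<in> Sh" for s
      using m that unfolding Admd_def by blast
    then have "lookup m k (path_class s) = 0" if "s \<in> Sh" for s
      using that by (simp add: in_keys_iff)
    moreover have "k \<in> Adm" using m k by (auto simp: MT_iff)
    ultimately have "lookup m k = 0"
      using inj_module_ext[OF MT_lookup inj_module_closed(1) Adm_src, of m k] m by simp
    then show False using k by (simp add: in_keys_iff)
  qed
  then show "m \<in> inj_leavitt_deg sp n"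
    using m by (auto simp: inj_leavitt_deg_def pdeg_def)
qed

end

lemma lookup_sum_single:
  "lookup (\<Sum>k\<in>keys m. single k (F k)) k' = (if k' \<in> keys m then F k' else 0)"
  by (auto simp: lookup_sum lookup_single when_def)

context special_quiver
begin

abbreviation IM :: "('k::field, (('v, 'e) path \<Rightarrow>\<^sub>0 'k) set, (('v, 'e) leavitt_gen list \<Rightarrow>\<^sub>0 'k) set,
    ('v, 'e, 'k) inj_leavitt) dg_bimod" where
  "IM \<equiv> injective_leavitt_complex sp"

lemma IM_simps [simp]:
  "carrier IM = MT" "zero IM = 0" "add IM = (+)" "smult IM = inj_scale" "hcomp IM = inj_leavitt_deg sp"
  "diff IM = inj_leavitt_diff sp" "lact IM = inj_leavitt_lact" "ract IM = inj_leavitt_ract sp"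
  by (simp_all add: injective_leavitt_complex_def)

subsection \<open>The right action\<close>

lemma gen_ract_eq: "gen_ract sp g x p q = tens x (Lb g (p, q))"
  by (cases g) (simp_all add: zeta_def tens_props tens_single)

lemma gen_act_eq: "gen_act sp g m = (\<Sum>k\<in>keys m. tens (lookup m k) (Lb g k))"
  by (simp add: gen_act_def gen_ract_eq case_prod_beta)

text \<open>The action alters only the index of a summand and carries the coefficient along, so
  evaluating coefficients commutes with it; in every coordinate it is left multiplication.\<close>

lemma ev_gen_act: "ev y (gen_act sp g m) = Lact g (ev y m)"
proof -
  have "Lact g (ev y m) = (\<Sum>k\<in>keys m. scl (lookup m k y) (Lb g k))"
    unfolding ev_eq_sum[of y m] Lact_simps(4) by (simp add: Lact_def lext_single[OF module_scl])
  then show ?thesis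
    by (simp add: gen_act_eq ev_sum tens_props(6))
qed

lemma gen_act_MT:
  assumes "g \<in> leavitt_gens" "m \<in> MT"
  shows "gen_act sp g m \<in> MT"
  unfolding gen_act_eq
proof (rule MT_sum)
  fix k assume k: "k \<in> keys m"
  then have "k \<in> Adm" using assms(2) by (simp add: MT_iff)
  then have "k \<in> Admv (src (snd k))" by (simp add: Admv_def)
  then show "tens (lookup m k) (Lb g k) \<in> MT"
    using keys_Lact_Admv[OF assms(1), of "single k 1" "src (snd k)"]
    by (intro tens_MT[OF MT_lookup[OF assms(2)]]) simp
qed

lemma foldr_gen_act: "ev y (foldr (gen_act sp) w m) = wact w (ev y m)"
  "set w \<subseteq> leavitt_gens \<Longrightarrow> m \<in> MT \<Longrightarrow> foldr (gen_act sp) w m \<in> MT"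
  by (induct w) (simp_all add: ev_gen_act gen_act_MT)

lemma ev_free_ract: "ev y (free_ract sp m f) = pact f (ev y m)"
  by (simp add: free_ract_def ev_sum ev_scale foldr_gen_act pact_def lext_def pext_def)

lemma free_ract_MT: "f \<in> CF \<Longrightarrow> m \<in> MT \<Longrightarrow> free_ract sp m f \<in> MT"
  unfolding free_ract_def
proof (intro MT_sum MT_scale foldr_gen_act(2))
  fix w assume "f \<in> CF" "w \<in> keys f"
  then show "set w \<subseteq> leavitt_gens" using lists_leavitt_gens by blast
qed

lemma K_some:
  fixes f :: "('v, 'e) leavitt_gen list \<Rightarrow>\<^sub>0 'k::field"
  assumes f: "f \<in> CF"
  shows "(SOME h. h \<in> K f) \<in> CF" "(SOME h. h \<in> K f) - f \<in> leavitt_ideal"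
proof -
  interpret L: quot_alg "leavitt_ideal :: (_ \<Rightarrow>\<^sub>0 'k) set" leavitt_free_algebra
    by (rule quot_alg_L)
  have "f \<in> K f"
    using L.a_rcos_self[of f] f by simp
  then have "(SOME h. h \<in> K f) \<in> K f"
    by (rule someI)
  then obtain i where i: "i \<in> leavitt_ideal" "(SOME h. h \<in> K f) = i + f"
    by (auto simp: a_r_coset_def r_coset_def)
  show "(SOME h. h \<in> K f) - f \<in> leavitt_ideal"
    using i by simp
  have "i \<in> CF" using L.a_Hcarr[OF i(1)] by simp
  then show "(SOME h. h \<in> K f) \<in> CF"
    using i f by (simp add: keys_plus_subset)
qed

text \<open>The representative picked by \<open>SOME\<close> is immaterial, since the ideal
  annihilates each coordinate.\<close>

lemma
  assumes f: "f \<in> CF" and m: "m \<in> MT"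
  shows ract_K_MT: "inj_leavitt_ract sp m (K f) \<in> MT"
    and ev_ract_K: "s \<in> Sh \<Longrightarrow> evp s (inj_leavitt_ract sp m (K f)) = pact f (evp s m)"
proof -
  note h = K_some[OF f]
  show "inj_leavitt_ract sp m (K f) \<in> MT"
    unfolding inj_leavitt_ract_def by (rule free_ract_MT[OF h(1) m])
  assume s: "s \<in> Sh"
  show "evp s (inj_leavitt_ract sp m (K f)) = pact f (evp s m)"
    unfolding inj_leavitt_ract_def ev_free_ract
    using pact_ideal[OF h(2) keys_ev_Adm[OF m s]] by (simp add: pact1_simps)
qed

lemma wact_Ract:
  "set w \<subseteq> leavitt_gens \<Longrightarrow> keys v \<subseteq> Adm \<Longrightarrow> h \<in> leavitt_gens \<Longrightarrow> wact w (Ract h v) = Ract h (wact w v)"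
  by (induct w) (simp_all add: commute keys_wact)

lemma pact_Ract:
  assumes "f \<in> CF" "keys v \<subseteq> Adm" "h \<in> leavitt_gens"
  shows "pact f (Ract h v) = Ract h (pact f v)"
proof -
  have "pact f v = (\<Sum>w\<in>keys f. scl (lookup f w) (wact w v))" for v
    by (simp add: pact_def lext_def pext_def)
  moreover have "wact w (Ract h v) = Ract h (wact w v)" if "w \<in> keys f" for w
    using assms that lists_leavitt_gens by (intro wact_Ract) blast+
  ultimately show ?thesis
    by (simp add: Ract_simps)
qed


subsection \<open>The left action\<close>

lemma eA_mult:
  assumes i: "i \<in> verts G" and X: "X \<in> eA i" and a: "a \<in> carrier AA"
  shows "X \<otimes>\<^bsub>AA\<^esub> a \<in> eA i"
proof (rule eA_I[OF i])
  note c = eA_closed[OF i X]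
  show "X \<otimes>\<^bsub>AA\<^esub> a \<in> carrier AA" by (rule A_mult_closed[OF c a])
  show "co (X \<otimes>\<^bsub>AA\<^esub> a) s = 0" if s: "s \<in> Sh" "tgt s \<noteq> i" for s
    using s(1)
  proof (cases rule: Sh_cases)
    case (vertex j)
    then show ?thesis
      using eA_co[OF i X s] co_mult_triv[OF c a vertex(1)] by simp
  next
    case (arrow b)
    then show ?thesis
      using eA_co[OF i X s] eA_co[OF i X, of "triv (head G b)"] s(2) co_mult_arr[OF c a arrow(1)] by simp
  qed
qed

interpretation A: dg_alg AA
  by (rule dg_algI[OF dg_algebra_AA])

lemma lookup_lact:
  "lookup (inj_leavitt_lact a m) k = (\<lambda>y. if y \<in> eA (src (snd k)) then lookup m k (y \<otimes>\<^bsub>AA\<^esub> a) else 0)"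
proof -
  have "inj_leavitt_lact a m = (\<Sum>k\<in>keys m. single k
      (\<lambda>y. if y \<in> eA (src (snd k)) then lookup m k (y \<otimes>\<^bsub>AA\<^esub> a) else 0))"
    by (simp add: inj_leavitt_lact_def zeta_def case_prod_beta cong: if_cong)
  then show ?thesis
    by (auto simp: lookup_sum_single in_keys_iff fun_eq_iff)
qed

lemma lact_MT:
  fixes a :: "(('v, 'e) path \<Rightarrow>\<^sub>0 'k::field) set"
  assumes a: "a \<in> carrier AA" and m: "m \<in> MT"
  shows "inj_leavitt_lact a m \<in> MT"
  unfolding MT_iff
proof
  fix k assume "k \<in> keys (inj_leavitt_lact a m)"
  then have "k \<in> keys m"
    by (cases "lookup m k = 0") (simp_all add: in_keys_iff lookup_lact zero_fun_def cong: if_cong)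
  then have k: "k \<in> Adm" using m by (simp add: MT_iff)
  note i = Adm_src[OF k] and \<phi> = MT_lookup[OF m, of k]
  have "lookup (inj_leavitt_lact a m) k \<in> inj_module (src (snd k))"
    unfolding lookup_lact
  proof (rule inj_moduleI)
    fix X Y :: "(('v, 'e) path \<Rightarrow>\<^sub>0 'k) set" assume X: "X \<in> eA (src (snd k))" and Y: "Y \<in> eA (src (snd k))"
    show "(if X \<oplus>\<^bsub>AA\<^esub> Y \<in> eA (src (snd k)) then lookup m k ((X \<oplus>\<^bsub>AA\<^esub> Y) \<otimes>\<^bsub>AA\<^esub> a) else 0) =
        (if X \<in> eA (src (snd k)) then lookup m k (X \<otimes>\<^bsub>AA\<^esub> a) else 0) +
        (if Y \<in> eA (src (snd k)) then lookup m k (Y \<otimes>\<^bsub>AA\<^esub> a) else 0)"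
      using eA_add_smult(1)[OF i X Y] X Y inj_moduleD(2)[OF \<phi> eA_mult[OF i X a] eA_mult[OF i Y a]]
        A.A.l_distr[OF eA_closed[OF i X] eA_closed[OF i Y] a] by (simp del: AA_simps)
  next
    fix c and X :: "(('v, 'e) path \<Rightarrow>\<^sub>0 'k) set" assume X: "X \<in> eA (src (snd k))"
    show "(if c \<odot>\<^bsub>AA\<^esub> X \<in> eA (src (snd k)) then lookup m k (c \<odot>\<^bsub>AA\<^esub> X \<otimes>\<^bsub>AA\<^esub> a) else 0) =
        c * (if X \<in> eA (src (snd k)) then lookup m k (X \<otimes>\<^bsub>AA\<^esub> a) else 0)"
      using eA_add_smult(2)[OF i X, of c] X inj_moduleD(3)[OF \<phi> eA_mult[OF i X a], of c]
        A.smult_mult(1)[OF eA_closed[OF i X] a, of c] by (simp del: AA_simps)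
  qed simp
  then show "k \<in> Adm \<and> lookup (inj_leavitt_lact a m) k \<in> inj_module (src (snd k))"
    using k by blast
qed

lemma ev_lact:
  fixes a :: "(('v, 'e) path \<Rightarrow>\<^sub>0 'k::field) set"
  assumes a: "a \<in> carrier AA" and m: "m \<in> MT" and s: "s \<in> Sh"
  shows "evp s (inj_leavitt_lact a m) = (\<Sum>t\<in>Sh. scl (co (path_class s \<otimes>\<^bsub>AA\<^esub> a) t) (evp t m))"
proof (rule poly_mapping_eqI)
  fix k
  note cs = path_class_closed[OF s]
  have "lookup (evp s (inj_leavitt_lact a m)) k = (\<Sum>t\<in>Sh. co (path_class s \<otimes>\<^bsub>AA\<^esub> a) t * lookup m k (path_class t))"
  proof (cases "k \<in> Adm")
    case True
    note i = Adm_src[OF True] and \<phi> = MT_lookup[OF m, of k]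
    show ?thesis
    proof (cases "tgt s = src (snd k)")
      case True
      then have p: "(path_class s :: (_ \<Rightarrow>\<^sub>0 'k) set) \<in> eA (src (snd k))"
        using path_class_eA[OF s i] by blast
      then show ?thesis
        using inj_expand[OF \<phi> i eA_mult[OF i p a]] by (simp add: lookup_lact del: AA_simps)
    next
      case False
      then have p: "(path_class s :: (_ \<Rightarrow>\<^sub>0 'k) set) \<notin> eA (src (snd k))"
        using path_class_eA[OF s i] by blast
      have q: "path_class s \<otimes>\<^bsub>AA\<^esub> a \<in> eA (tgt s)"
        using path_class_eA[OF s tgt_Sh[OF s]] by (intro eA_mult[OF tgt_Sh[OF s] _ a]) blast
      have "co (path_class s \<otimes>\<^bsub>AA\<^esub> a) t * lookup m k (path_class t) = 0" if t: "t \<in> Sh" for t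
        using eA_co[OF tgt_Sh[OF s] q t] inj_class_zero[OF \<phi> i t] False by (cases "tgt t = tgt s") simp_all
      then have "(\<Sum>t\<in>Sh. co (path_class s \<otimes>\<^bsub>AA\<^esub> a) t * lookup m k (path_class t)) = 0"
        by (intro sum.neutral ballI)
      then show ?thesis
        using p by (simp add: lookup_lact del: AA_simps)
    qed
  next
    case False
    then have "lookup m k = 0"
      using m by (auto simp: MT_iff in_keys_iff)
    then show ?thesis by (simp add: lookup_lact)
  qed
  then show "lookup (evp s (inj_leavitt_lact a m)) k =
      lookup (\<Sum>t\<in>Sh. scl (co (path_class s \<otimes>\<^bsub>AA\<^esub> a) t) (evp t m)) k"
    by (simp add: lookup_sum)
qed

lemma ev_lact_arr:
  assumes a: "a \<in> carrier AA" and m: "m \<in> MT" and b: "b \<in> arcs G"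
  shows "evp (arr b) (inj_leavitt_lact a m) = scl (co a (triv (tail G b))) (evp (arr b) m)"
proof -
  have c: "path_class (arr b) \<in> carrier AA"
    using b by (intro path_class_closed) simp
  have 1: "co (path_class (arr b) \<otimes>\<^bsub>AA\<^esub> a) (triv i) = 0" if "i \<in> verts G" for i
    using co_mult_triv[OF c a that] b that by (simp add: co_path_class del: AA_simps)
  have 2: "co (path_class (arr b) \<otimes>\<^bsub>AA\<^esub> a) (arr d) = (if d = b then co a (triv (tail G b)) else 0)"
    if "d \<in> arcs G" for d
    using co_mult_arr[OF c a that] b that by (auto simp add: co_path_class simp del: AA_simps)
  have "(\<Sum>j\<in>verts G. scl (co (path_class (arr b) \<otimes>\<^bsub>AA\<^esub> a) (triv j)) (evp (triv j) m)) = 0"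
    using 1 by (intro sum.neutral) (auto simp del: AA_simps)
  moreover have "(\<Sum>d\<in>arcs G. scl (co (path_class (arr b) \<otimes>\<^bsub>AA\<^esub> a) (arr d)) (evp (arr d) m)) =
      (\<Sum>d\<in>arcs G. if d = b then scl (co a (triv (tail G b))) (evp (arr b) m) else 0)"
    using 2 by (intro sum.cong) (auto simp del: AA_simps)
  ultimately show ?thesis
    using ev_lact[OF a m, of "arr b"] b by (simp add: sum_Sh del: AA_simps)
qed

text \<open>The value of \<open>am\<close> at \<open>e\<^sub>i\<close> is the value of
  \<open>m\<close> at \<open>e\<^sub>ia\<close>, whose coefficients are those of \<open>a\<close> at
  the vertex and at the arrows ending there.\<close>

lemma ev_lact_triv:
  assumes a: "a \<in> carrier AA" and m: "m \<in> MT" and i: "i \<in> verts G"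
  shows "evp (triv i) (inj_leavitt_lact a m) = scl (co a (triv i)) (evp (triv i) m) +
    (\<Sum>b\<in>arcs G. if head G b = i then scl (co a (arr b)) (evp (arr b) m) else 0)"
proof -
  have c: "path_class (triv i) \<in> carrier AA"
    using i by (intro path_class_closed) simp
  have 1: "co (path_class (triv i) \<otimes>\<^bsub>AA\<^esub> a) (triv j) = (if j = i then co a (triv i) else 0)" if "j \<in> verts G" for j
    using co_mult_triv[OF c a that] i that by (auto simp add: co_path_class simp del: AA_simps)
  have 2: "co (path_class (triv i) \<otimes>\<^bsub>AA\<^esub> a) (arr d) = (if head G d = i then co a (arr d) else 0)"
    if "d \<in> arcs G" for d
    using co_mult_arr[OF c a that] i that by (auto simp add: co_path_class simp del: AA_simps)
  have "(\<Sum>j\<in>verts G. scl (co (path_class (triv i) \<otimes>\<^bsub>AA\<^esub> a) (triv j)) (evp (triv j) m)) =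
      (\<Sum>j\<in>verts G. if j = i then scl (co a (triv i)) (evp (triv i) m) else 0)"
    using 1 by (intro sum.cong) (auto simp del: AA_simps)
  moreover have "(\<Sum>b\<in>arcs G. scl (co (path_class (triv i) \<otimes>\<^bsub>AA\<^esub> a) (arr b)) (evp (arr b) m)) =
      (\<Sum>b\<in>arcs G. if head G b = i then scl (co a (arr b)) (evp (arr b) m) else 0)"
    using 2 by (intro sum.cong) (auto simp del: AA_simps)
  ultimately show ?thesis
    using ev_lact[OF a m, of "triv i"] i by (simp add: sum_Sh del: AA_simps)
qed


subsection \<open>The differential\<close>

text \<open>After the exchange of the paths, the exceptional clause of \<open>diff_arrow\<close>,
  with trivial \<open>q\<close> and \<open>p\<close> ending in the special arrow, is the rewriting
  clause of \<open>Lb\<close>. This identifies the differential with right multiplication by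
  arrows.\<close>

lemma diff_arrow_eq:
  assumes "a \<in> in_arcs G (src q)"
  shows "diff_arrow sp a p q = tsh (triv (tail G a)) (Ract (Ghost a) (single (p, q) 1))"
proof -
  have v: "vertex_sharp (tail G a) = sharp (triv (tail G a))"
    using assms by (intro vertex_sharp_eq) auto
  have "head G a = src q" using assms by simp
  then show ?thesis
    unfolding diff_arrow_def Let_def v
    by (auto simp: zeta_def tens_props tens_single)
qed

lemma diff_eq:
  assumes m: "m \<in> MT"
  shows "inj_leavitt_diff sp m = (\<Sum>a\<in>arcs G. tsh (triv (tail G a)) (Ract (Ghost a) (evp (arr a) m)))"
proof -
  let ?f = "\<lambda>k a. inj_scale (lookup m k (path_class (arr a))) (tsh (triv (tail G a)) (Ract (Ghost a) (single k 1)))"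
  have "(\<Sum>a\<in>in_arcs G (src (snd k)). inj_scale (lookup m k (path_class (arr a))) (diff_arrow sp a (fst k) (snd k))) =
      (\<Sum>a\<in>arcs G. ?f k a)" if k: "k \<in> keys m" for k
  proof -
    have "k \<in> Adm" using k m by (simp add: MT_iff)
    note i = Adm_src[OF this]
    have "?f k a = 0" if "a \<in> arcs G" "a \<notin> in_arcs G (src (snd k))" for a
      using inj_class_zero[OF MT_lookup[OF m] i, of "arr a"] that by simp
    then have "(\<Sum>a\<in>arcs G. ?f k a) = (\<Sum>a\<in>in_arcs G (src (snd k)). ?f k a)"
      by (intro sum.mono_neutral_right) auto
    also have "\<dots> = (\<Sum>a\<in>in_arcs G (src (snd k)).
        inj_scale (lookup m k (path_class (arr a))) (diff_arrow sp a (fst k) (snd k)))"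
      by (intro sum.cong refl) (simp add: diff_arrow_eq del: Ract_single)
    finally show ?thesis by simp
  qed
  then have "inj_leavitt_diff sp m = (\<Sum>k\<in>keys m. \<Sum>a\<in>arcs G. ?f k a)"
    unfolding inj_leavitt_diff_def by (simp add: case_prod_beta)
  also have "\<dots> = (\<Sum>a\<in>arcs G. \<Sum>k\<in>keys m. ?f k a)"
    by (rule sum.swap)
  also have "\<dots> = (\<Sum>a\<in>arcs G. tsh (triv (tail G a)) (Ract (Ghost a) (evp (arr a) m)))"
  proof (intro sum.cong refl)
    fix a
    have "evp (arr a) m = (\<Sum>k\<in>keys m. scl (lookup m k (path_class (arr a))) (single k 1))"
      using ev_eq_sum[of "path_class (arr a)" m] by simp
    then show "(\<Sum>k\<in>keys m. ?f k a) = tsh (triv (tail G a)) (Ract (Ghost a) (evp (arr a) m))"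
      by (simp only: Ract_simps tens_props)
  qed
  finally show ?thesis .
qed

lemma keys_ghost_ev:
  assumes "m \<in> MT" "a \<in> arcs G"
  shows "keys (Ract (Ghost a) (evp (arr a) m)) \<subseteq> Admv (tail G a)"
  using assms keys_ev_Adm[of m "arr a"] by (intro keys_Ract_Admv(3)) simp_all

text \<open>The differential reads only the coordinates at arrows and writes only those at vertices;
  in particular its square is zero.\<close>

lemma
  assumes m: "m \<in> MT"
  shows diff_MT: "inj_leavitt_diff sp m \<in> MT"
    and ev_diff_arr: "b \<in> arcs G \<Longrightarrow> evp (arr b) (inj_leavitt_diff sp m) = 0"
    and ev_diff_triv: "i \<in> verts G \<Longrightarrow> evp (triv i) (inj_leavitt_diff sp m) =
      (\<Sum>a\<in>out_arcs G i. Ract (Ghost a) (evp (arr a) m))"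
proof -
  show "inj_leavitt_diff sp m \<in> MT"
    unfolding diff_eq[OF m] using keys_ghost_ev[OF m] by (intro MT_sum tsh_MT) simp_all
  show "b \<in> arcs G \<Longrightarrow> evp (arr b) (inj_leavitt_diff sp m) = 0"
    unfolding diff_eq[OF m] ev_sum by (intro sum.neutral) (simp add: ev_tsh)
  assume i: "i \<in> verts G"
  have "evp (triv i) (inj_leavitt_diff sp m) =
      (\<Sum>a\<in>arcs G. if tail G a = i then Ract (Ghost a) (evp (arr a) m) else 0)"
    unfolding diff_eq[OF m] ev_sum using i by (intro sum.cong refl) (simp add: ev_tsh)
  also have "\<dots> = (\<Sum>a\<in>out_arcs G i. Ract (Ghost a) (evp (arr a) m))"
    by (intro sum.mono_neutral_cong_right) auto
  finally show "evp (triv i) (inj_leavitt_diff sp m) = (\<Sum>a\<in>out_arcs G i. Ract (Ghost a) (evp (arr a) m))" .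
qed


subsection \<open>The bimodule axioms\<close>

lemma module_IM: "Module.module field_ring (IM :: ('k::field, _, _, _) dg_bimod)"
proof (rule module_fieldI)
  show "abelian_group (IM :: ('k, _, _, _) dg_bimod)"
  proof (rule abelian_groupI)
    show "\<exists>y\<in>carrier IM. y \<oplus>\<^bsub>IM\<^esub> x = \<zero>\<^bsub>IM\<^esub>" if "x \<in> carrier IM" for x :: "('v, 'e, 'k) inj_leavitt"
      using that MT_diff[OF MT_zero, of x] by (intro bexI[of _ "0 - x"]) simp_all
  qed (simp_all add: MT_add MT_zero add_ac)
qed (simp_all add: MT_scale inj_scale.scale_left_distrib inj_scale.scale_right_distrib)

lemma MT_induct:
  assumes m: "m \<in> MT" and "P 0" "\<And>k x. k \<in> Adm \<Longrightarrow> single k x \<in> MT \<Longrightarrow> P (single k x)"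
    "\<And>x y. x \<in> MT \<Longrightarrow> y \<in> MT \<Longrightarrow> P x \<Longrightarrow> P y \<Longrightarrow> P (x + y)"
  shows "P m"
proof -
  have s: "single k (lookup m k) \<in> MT" "k \<in> keys m \<Longrightarrow> k \<in> Adm" for k
    using m by (cases "k \<in> keys m"; auto simp: MT_iff in_keys_iff)+
  have "(\<Sum>k\<in>B. single k (lookup m k)) \<in> MT \<and> P (\<Sum>k\<in>B. single k (lookup m k))"
    if "finite B" "B \<subseteq> keys m" for B
    using that
  proof (induct B rule: finite_induct)
    case (insert k B)
    then show ?case using assms(3)[OF s(2) s(1)] assms(4)[OF s(1)] MT_add[OF s(1)] by simp
  qed (simp add: assms(2) MT_zero)
  from this[of "keys m"] show ?thesis
    using poly_mapping_sum_single[of m] by simp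
qed

lemma is_graded_IM: "is_graded (IM :: ('k::field, _, _, _) dg_bimod)"
proof (rule is_gradedI)
  show "Module.module field_ring (IM :: ('k, _, _, _) dg_bimod)" by (rule module_IM)
  interpret V: vspace "IM :: ('k, _, _, _) dg_bimod" by (rule vspace.intro) (rule module_IM)
  have "x + y \<in> inj_leavitt_deg sp n" if "x \<in> inj_leavitt_deg sp n" "y \<in> inj_leavitt_deg sp n"
    for x y :: "('v, 'e, 'k) inj_leavitt" and n
    using that unfolding MT_deg_iff by (simp add: MT_add ev_add keys_plus_subset)
  moreover have "inj_scale c x \<in> inj_leavitt_deg sp n" if "x \<in> inj_leavitt_deg sp n"
    for x :: "('v, 'e, 'k) inj_leavitt" and n c
  proof -
    have "x \<in> MT" and d: "\<And>s. s \<in> Sh \<Longrightarrow> keys (evp s x) \<subseteq> Admd n"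
      using that unfolding MT_deg_iff by blast+
    then show ?thesis
      unfolding MT_deg_iff ev_scale by (intro conjI ballI MT_scale order_trans[OF keys_scl])
  qed
  ultimately show "submodule (hcomp IM n) field_ring (IM :: ('k, _, _, _) dg_bimod)" for n
    by (intro V.submodule_fieldI) (auto simp: MT_deg_iff MT_zero)
next
  fix x :: "('v, 'e, 'k) inj_leavitt" and P :: "('v, 'e, 'k) inj_leavitt \<Rightarrow> bool"
  assume x: "x \<in> carrier IM" and P: "\<And>n y. y \<in> hcomp IM n \<Longrightarrow> P y"
    "\<And>y z. y \<in> carrier IM \<Longrightarrow> z \<in> carrier IM \<Longrightarrow> P y \<Longrightarrow> P z \<Longrightarrow> P (y \<oplus>\<^bsub>IM\<^esub> z)"
  from x have "x \<in> MT" by simp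
  then show "P x"
  proof (rule MT_induct)
    show "P 0" using P(1)[of 0 0] by (simp add: MT_deg_iff MT_zero)
    show "P (single k x)" if "single k x \<in> MT" for k x
      using P(1)[of "single k x" "pdeg k"] that
      by (cases "x = 0") (auto simp: inj_leavitt_deg_def pdeg_def split_def)
  qed (use P(2) in simp)
next
  fix f :: "int \<Rightarrow> ('v, 'e, 'k) inj_leavitt" and N n
  assume N: "finite N" "\<And>n. f n \<in> hcomp IM n" "(\<Oplus>\<^bsub>IM\<^esub>n\<in>N. f n) = \<zero>\<^bsub>IM\<^esub>" "n \<in> N"
  interpret V: vspace "IM :: ('k, _, _, _) dg_bimod" by (rule vspace.intro) (rule module_IM)
  have f: "f n \<in> MT" for n using N(2)[of n] by (simp add: MT_deg_iff)
  have "(\<Oplus>\<^bsub>IM\<^esub>n\<in>N. f n) = (\<Sum>n\<in>N. f n)"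
    using N(1) f by (induct N rule: finite_induct) (simp_all add: Pi_def)
  moreover have "keys (f n) \<subseteq> {k. pdeg k = n}" for n
    using N(2)[of n] by (auto simp: inj_leavitt_deg_def pdeg_def)
  ultimately show "f n = \<zero>\<^bsub>IM\<^esub>"
    using sum_disjoint_degrees_zero[OF N(1), of f pdeg n] N(3,4) by simp
qed

lemma diff_linear:
  assumes "m \<in> MT" "m' \<in> MT"
  shows "inj_leavitt_diff sp (m + m') = inj_leavitt_diff sp m + inj_leavitt_diff sp m'"
    and "inj_leavitt_diff sp (inj_scale c m) = inj_scale c (inj_leavitt_diff sp m)"
  using assms
  by (simp_all add: diff_eq MT_add MT_scale ev_add ev_scale Ract_simps tens_props sum.distrib
      inj_scale.scale_sum_right)

lemma diff_deg:
  assumes "m \<in> inj_leavitt_deg sp n"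
  shows "inj_leavitt_diff sp m \<in> inj_leavitt_deg sp (n + 1)"
proof -
  from assms have m: "m \<in> MT" and d: "\<And>s. s \<in> Sh \<Longrightarrow> keys (evp s m) \<subseteq> Admd n"
    unfolding MT_deg_iff by blast+
  have "keys (evp s (inj_leavitt_diff sp m)) \<subseteq> Admd (n + 1)" if "s \<in> Sh" for s
    using that
  proof (cases rule: Sh_cases)
    case (vertex i)
    show ?thesis
      unfolding vertex ev_diff_triv[OF m vertex(1)]
    proof (rule keys_sum_subset)
      fix a assume "a \<in> out_arcs G i"
      then show "keys (Ract (Ghost a) (evp (arr a) m)) \<subseteq> Admd (n + 1)"
        using keys_Ract_Admd[of "Ghost a" "evp (arr a) m" n] d[of "arr a"] by simp
    qed
  next
    case (arrow a)
    then show ?thesis using ev_diff_arr[OF m] by simp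
  qed
  then show ?thesis
    using diff_MT[OF m] unfolding MT_deg_iff by blast
qed

lemma is_complex_IM: "is_complex (IM :: ('k::field, _, _, _) dg_bimod)"
proof -
  have "inj_leavitt_diff sp (inj_leavitt_diff sp m) = 0" if m: "m \<in> MT" for m :: "('v, 'e, 'k) inj_leavitt"
    unfolding diff_eq[OF diff_MT[OF m]]
    by (intro sum.neutral) (simp add: ev_diff_arr[OF m] Ract_simps tens_props)
  moreover have "klinear IM IM (diff (IM :: ('k, _, _, _) dg_bimod))"
    unfolding klinear_def by (simp add: diff_MT diff_linear)
  moreover have "diff IM ` hcomp IM n \<subseteq> hcomp (IM :: ('k, _, _, _) dg_bimod) (n + 1)" for n
    unfolding IM_simps by (rule image_subsetI) (rule diff_deg)
  ultimately show ?thesis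
    using is_graded_IM unfolding is_complex_def by simp
qed

lemma lact_linear:
  fixes a :: "(('v, 'e) path \<Rightarrow>\<^sub>0 'k::field) set"
  assumes a: "a \<in> carrier AA" and m: "m \<in> MT"
  shows "m' \<in> MT \<Longrightarrow> inj_leavitt_lact a (m + m') = inj_leavitt_lact a m + inj_leavitt_lact a m'"
    and "inj_leavitt_lact a (inj_scale c m) = inj_scale c (inj_leavitt_lact a m)"
    and "b \<in> carrier AA \<Longrightarrow> inj_leavitt_lact (a \<oplus>\<^bsub>AA\<^esub> b) m = inj_leavitt_lact a m + inj_leavitt_lact b m"
    and "inj_leavitt_lact (c \<odot>\<^bsub>AA\<^esub> a) m = inj_scale c (inj_leavitt_lact a m)"
proof -
  note cl = path_class_closed
  show "inj_leavitt_lact a (m + m') = inj_leavitt_lact a m + inj_leavitt_lact a m'" if m': "m' \<in> MT"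
    by (rule M_ext) (simp_all add: lact_MT[OF a] MT_add m m' ev_add ev_lact[OF a] scl.scale_right_distrib
        sum.distrib del: AA_simps)
  show "inj_leavitt_lact a (inj_scale c m) = inj_scale c (inj_leavitt_lact a m)"
    by (rule M_ext) (simp_all add: lact_MT[OF a] MT_scale m ev_scale ev_lact[OF a] scl.scale_sum_right
        mult.commute del: AA_simps)
  show "inj_leavitt_lact (a \<oplus>\<^bsub>AA\<^esub> b) m = inj_leavitt_lact a m + inj_leavitt_lact b m" if b: "b \<in> carrier AA"
  proof (rule M_ext)
    fix s assume s: "s \<in> Sh"
    have "co (path_class s \<otimes>\<^bsub>AA\<^esub> (a \<oplus>\<^bsub>AA\<^esub> b)) t = co (path_class s \<otimes>\<^bsub>AA\<^esub> a) t + co (path_class s \<otimes>\<^bsub>AA\<^esub> b) t"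
      if "t \<in> Sh" for t
      using co_add[OF A_mult_closed[OF cl[OF s] a] A_mult_closed[OF cl[OF s] b] that]
        A.A.r_distr[OF a b cl[OF s]] by (simp del: AA_simps)
    then show "evp s (inj_leavitt_lact (a \<oplus>\<^bsub>AA\<^esub> b) m) = evp s (inj_leavitt_lact a m + inj_leavitt_lact b m)"
      using A_add_closed[OF a b] a b m s
      by (simp add: ev_add ev_lact scl.scale_left_distrib sum.distrib del: AA_simps)
  qed (simp_all add: lact_MT a b m A_add_closed MT_add del: AA_simps)
  show "inj_leavitt_lact (c \<odot>\<^bsub>AA\<^esub> a) m = inj_scale c (inj_leavitt_lact a m)"
  proof (rule M_ext)
    fix s assume s: "s \<in> Sh"
    have "co (path_class s \<otimes>\<^bsub>AA\<^esub> (c \<odot>\<^bsub>AA\<^esub> a)) t = c * co (path_class s \<otimes>\<^bsub>AA\<^esub> a) t" if "t \<in> Sh" for t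
      using co_smult[OF A_mult_closed[OF cl[OF s] a] a that, of c]
        A.smult_mult(2)[OF cl[OF s] a, of c] by (simp del: AA_simps)
    then show "evp s (inj_leavitt_lact (c \<odot>\<^bsub>AA\<^esub> a) m) = evp s (inj_scale c (inj_leavitt_lact a m))"
      using A_smult_closed[OF a a, of c] a m s
      by (simp add: ev_scale ev_lact scl.scale_sum_right del: AA_simps)
  qed (simp_all add: lact_MT a m A_smult_closed[OF a a] MT_scale del: AA_simps)
qed

lemma lact_one:
  assumes m: "m \<in> (MT :: ('v, 'e, 'k::field) inj_leavitt set)"
  shows "inj_leavitt_lact \<one>\<^bsub>AA\<^esub> m = m"
proof (rule M_ext)
  have one: "\<one>\<^bsub>AA :: ('k, _) dg_space\<^esub> \<in> carrier AA" by (rule A.A.one_closed)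
  then show "inj_leavitt_lact \<one>\<^bsub>AA\<^esub> m \<in> MT" by (rule lact_MT[OF _ m])
  fix s assume s: "s \<in> Sh"
  have "evp s (inj_leavitt_lact \<one>\<^bsub>AA\<^esub> m) = (\<Sum>t\<in>Sh. scl (if s = t then 1 else 0) (evp t m))"
    unfolding ev_lact[OF one m s] A.A.r_one[OF path_class_closed[OF s]]
    using s by (intro sum.cong refl) (simp add: co_path_class)
  also have "\<dots> = (\<Sum>t\<in>Sh. if s = t then evp t m else 0)"
    by (intro sum.cong refl) simp
  finally show "evp s (inj_leavitt_lact \<one>\<^bsub>AA\<^esub> m) = evp s m"
    using s by simp
qed (rule m)

lemma lact_mult:
  fixes a b :: "(('v, 'e) path \<Rightarrow>\<^sub>0 'k::field) set"
  assumes a: "a \<in> carrier AA" and b: "b \<in> carrier AA" and m: "m \<in> MT"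
  shows "inj_leavitt_lact (a \<otimes>\<^bsub>AA\<^esub> b) m = inj_leavitt_lact a (inj_leavitt_lact b m)"
proof (rule poly_mapping_eqI)
  fix k
  show "lookup (inj_leavitt_lact (a \<otimes>\<^bsub>AA\<^esub> b) m) k = lookup (inj_leavitt_lact a (inj_leavitt_lact b m)) k"
  proof (cases "k \<in> Adm")
    case True
    note i = Adm_src[OF this]
    show ?thesis
      unfolding lookup_lact
      using eA_mult[OF i _ a] A.A.m_assoc[OF eA_closed[OF i] a b] by (auto simp del: AA_simps)
  next
    case False
    then have "lookup m k = 0" using m by (auto simp: MT_iff in_keys_iff)
    then show ?thesis by (simp add: lookup_lact cong: if_cong)
  qed
qed

lemma lact_zero:
  assumes m: "m \<in> MT"
  shows "inj_leavitt_lact (Kp 0 :: (_ \<Rightarrow>\<^sub>0 'k::field) set) m = 0"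
proof -
  have "Kp (0 :: _ \<Rightarrow>\<^sub>0 'k) \<in> carrier AA" by simp
  from lact_linear(4)[OF this m, of 0] show ?thesis
    using A.smult_zero[of "0::'k"] by simp
qed

lemma lact_deg:
  fixes a :: "(('v, 'e) path \<Rightarrow>\<^sub>0 'k::field) set"
  assumes a: "a \<in> carrier AA" and "m \<in> inj_leavitt_deg sp n"
  shows "inj_leavitt_lact a m \<in> inj_leavitt_deg sp n"
proof -
  have m: "m \<in> MT" and d: "\<And>s. s \<in> Sh \<Longrightarrow> keys (evp s m) \<subseteq> Admd n"
    using assms(2) unfolding MT_deg_iff by blast+
  have "keys (evp s (inj_leavitt_lact a m)) \<subseteq> Admd n" if "s \<in> Sh" for s
    unfolding ev_lact[OF a m that] by (intro keys_sum_subset order_trans[OF keys_scl d])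
  then show ?thesis
    unfolding MT_deg_iff using lact_MT[OF a m] by blast
qed

lemma diff_lact:
  fixes a :: "(('v, 'e) path \<Rightarrow>\<^sub>0 'k::field) set"
  assumes a: "a \<in> carrier AA" and m: "m \<in> MT"
  shows "inj_leavitt_diff sp (inj_leavitt_lact a m) = inj_leavitt_lact a (inj_leavitt_diff sp m)"
proof (rule M_ext)
  note am = lact_MT[OF a m] and dm = diff_MT[OF m]
  show "inj_leavitt_diff sp (inj_leavitt_lact a m) \<in> MT" "inj_leavitt_lact a (inj_leavitt_diff sp m) \<in> MT"
    by (rule diff_MT[OF am], rule lact_MT[OF a dm])
  fix s assume "s \<in> Sh"
  then show "evp s (inj_leavitt_diff sp (inj_leavitt_lact a m)) = evp s (inj_leavitt_lact a (inj_leavitt_diff sp m))"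
  proof (cases rule: Sh_cases)
    case (vertex i)
    have "(\<Sum>b\<in>arcs G. if head G b = i then scl (co a (arr b)) (evp (arr b) (inj_leavitt_diff sp m)) else 0) = 0"
      by (intro sum.neutral) (simp add: ev_diff_arr[OF m])
    then show ?thesis
      unfolding vertex ev_diff_triv[OF am vertex(1)] ev_lact_triv[OF a dm vertex(1)]
      by (simp add: ev_diff_triv[OF m vertex(1)] ev_lact_arr[OF a m] Ract_simps scl.scale_sum_right del: AA_simps)
  next
    case (arrow b)
    then show ?thesis
      by (simp add: ev_diff_arr[OF am] ev_lact_arr[OF a dm] ev_diff_arr[OF m])
  qed
qed

lemma left_dg_module_IM: "left_dg_module AA (IM :: ('k::field, _, _, _) dg_bimod) (lact IM)"
proof -
  have kl1: "klinear IM IM (lact (IM :: ('k, _, _, _) dg_bimod) a)" if "a \<in> carrier AA" for a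
    unfolding klinear_def using that by (simp add: lact_MT lact_linear del: AA_simps)
  have kl2: "klinear AA IM (\<lambda>a. lact (IM :: ('k, _, _, _) dg_bimod) a m)" if "m \<in> carrier IM" for m
    unfolding klinear_def using that by (simp add: lact_MT lact_linear del: AA_simps)
  have deg: "lact IM a m \<in> hcomp IM (i + j)" if a: "a \<in> hcomp (AA :: ('k, _) dg_space) i" "m \<in> hcomp IM j" for a m i j
  proof (cases "i = 0")
    case True
    then show ?thesis using lact_deg[of a m j] a by simp
  next
    case False
    then show ?thesis using lact_zero[of m] a by (simp add: MT_deg_iff MT_zero)
  qed
  have d: "diff IM (lact IM a m) = lact IM (diff AA a) m \<oplus>\<^bsub>IM\<^esub> (sg i \<odot>\<^bsub>IM\<^esub> lact IM a (diff IM m))"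
    if a: "a \<in> hcomp (AA :: ('k, _) dg_space) i" "m \<in> carrier IM" for a m i
  proof (cases "i = 0")
    case True
    then show ?thesis using diff_lact[of a m] lact_zero[of m] a by simp
  next
    case False
    then show ?thesis
      using lact_zero[of m] lact_zero[OF diff_MT, of m] diff_eq[OF MT_zero] a
      by (simp add: Ract_simps tens_props)
  qed
  have one': "\<forall>m\<in>carrier IM. lact (IM :: ('k, _, _, _) dg_bimod) \<one>\<^bsub>AA\<^esub> m = m"
    by (simp add: lact_one del: AA_simps)
  have mult': "\<forall>a\<in>carrier AA. \<forall>b\<in>carrier AA. \<forall>m\<in>carrier IM.
      lact (IM :: ('k, _, _, _) dg_bimod) (a \<otimes>\<^bsub>AA\<^esub> b) m = lact IM a (lact IM b m)"
    by (simp add: lact_mult del: AA_simps)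
  show ?thesis
    unfolding left_dg_module_def
    by (intro conjI allI ballI) (rule dg_algebra_AA is_complex_IM kl1 kl2 one'[rule_format]
        mult'[rule_format] deg d; assumption)+
qed

lemma pact_deg:
  assumes f: "f \<in> homog j" and "m \<in> inj_leavitt_deg sp i"
  shows "inj_leavitt_ract sp m (K f) \<in> inj_leavitt_deg sp (i + j)"
proof -
  have m: "m \<in> MT" and d: "\<And>s. s \<in> Sh \<Longrightarrow> keys (evp s m) \<subseteq> Admd i"
    using assms(2) unfolding MT_deg_iff by blast+
  have "keys (evp s (inj_leavitt_ract sp m (K f))) \<subseteq> Admd (i + j)" if "s \<in> Sh" for s
    unfolding ev_ract_K[OF homog_CF[OF f] m that] by (rule keys_pact_Admd[OF f d[OF that]])
  then show ?thesis
    unfolding MT_deg_iff using ract_K_MT[OF homog_CF[OF f] m] by blast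
qed

text \<open>In coordinates the action consists of left multiplications and the differential of right
  ones, so this is their commutation. No sign occurs, as the algebra acting has zero
  differential.\<close>

lemma ract_diff:
  assumes f: "f \<in> CF" and m: "m \<in> MT"
  shows "inj_leavitt_diff sp (inj_leavitt_ract sp m (K f)) = inj_leavitt_ract sp (inj_leavitt_diff sp m) (K f)"
proof (rule M_ext)
  note mf = ract_K_MT[OF f m] and dm = diff_MT[OF m]
  show "inj_leavitt_diff sp (inj_leavitt_ract sp m (K f)) \<in> MT" "inj_leavitt_ract sp (inj_leavitt_diff sp m) (K f) \<in> MT"
    by (rule diff_MT[OF mf], rule ract_K_MT[OF f dm])
  fix s assume s: "s \<in> Sh"
  show "evp s (inj_leavitt_diff sp (inj_leavitt_ract sp m (K f))) = evp s (inj_leavitt_ract sp (inj_leavitt_diff sp m) (K f))"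
    using s
  proof (cases rule: Sh_cases)
    case (vertex i)
    then show ?thesis
      by (simp add: ev_diff_triv[OF mf] ev_diff_triv[OF m] ev_ract_K[OF f m] ev_ract_K[OF f dm] pact2_simps
          pact_Ract[OF f keys_ev_Adm[OF m]])
  next
    case (arrow b)
    then show ?thesis
      by (simp add: ev_diff_arr[OF mf] ev_diff_arr[OF m] ev_ract_K[OF f dm] pact2_simps)
  qed
qed

interpretation F: basis_alg "lists leavitt_gens" "\<lambda>u v. Some (u @ v)" "{[]}"
  by (rule basis_alg_F)

lemma right_dg_module_IM:
  "right_dg_module (op_algebra LA) (IM :: ('k::field, _, _, _) dg_bimod) (ract IM)"
proof -
  have L: "dg_algebra (op_algebra LA :: ('k, _) dg_space)"
    by (rule dg_algebra_op_algebra[OF dg_algebra_LA]) simp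
  have kl1: "klinear IM IM (\<lambda>m. ract (IM :: ('k, _, _, _) dg_bimod) m (K f))" if f: "f \<in> CF" for f
    unfolding klinear_def
  proof (intro conjI ballI allI)
    fix x y :: "('v, 'e, 'k) inj_leavitt" and c assume "x \<in> carrier IM"
    then have x: "x \<in> MT" by simp
    show "ract IM (c \<odot>\<^bsub>IM\<^esub> x) (K f) = c \<odot>\<^bsub>IM\<^esub> ract IM x (K f)"
      using x by (intro M_ext) (simp_all add: ract_K_MT[OF f] MT_scale ev_ract_K[OF f] ev_scale pact2_simps)
    assume "y \<in> carrier IM"
    then show "ract IM (x \<oplus>\<^bsub>IM\<^esub> y) (K f) = ract IM x (K f) \<oplus>\<^bsub>IM\<^esub> ract IM y (K f)"
      using x by (intro M_ext) (simp_all add: ract_K_MT[OF f] MT_add ev_ract_K[OF f] ev_add pact2_simps)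
  qed (simp add: ract_K_MT[OF f])
  have kl2: "klinear (op_algebra LA) IM (ract (IM :: ('k, _, _, _) dg_bimod) m)" if "m \<in> carrier IM" for m
    unfolding klinear_def
  proof (intro conjI ballI allI)
    have m: "m \<in> MT" using that by simp
    show "ract IM m \<in> carrier (op_algebra LA) \<rightarrow> carrier IM"
      using ract_K_MT[OF _ m] by auto
    fix X Y :: "(('v, 'e) leavitt_gen list \<Rightarrow>\<^sub>0 'k) set" and c assume "X \<in> carrier (op_algebra LA)"
    then obtain f where f: "f \<in> CF" "X = K f" by auto
    have "scl c f \<in> CF" using f(1) keys_scl[of c f] by auto
    then show "ract IM m (c \<odot>\<^bsub>op_algebra LA\<^esub> X) = c \<odot>\<^bsub>IM\<^esub> ract IM m X"
      using f m by (intro M_ext) (simp_all flip: K_scl add: ract_K_MT MT_scale ev_ract_K ev_scale pact1_simps)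
    assume "Y \<in> carrier (op_algebra LA)"
    then obtain g where g: "g \<in> CF" "Y = K g" by auto
    have "f + g \<in> CF" using f(1) g(1) by (simp add: keys_plus_subset)
    then show "ract IM m (X \<oplus>\<^bsub>op_algebra LA\<^esub> Y) = ract IM m X \<oplus>\<^bsub>IM\<^esub> ract IM m Y"
      using f g m by (intro M_ext) (simp_all flip: K_add add: ract_K_MT MT_add ev_ract_K ev_add pact1_simps)
  qed
  have one: "ract IM m \<one>\<^bsub>op_algebra LA\<^esub> = m" if "m \<in> carrier (IM :: ('k, _, _, _) dg_bimod)" for m
    using that by (intro M_ext) (simp_all add: ract_K_MT ev_ract_K)
  have mult: "ract IM m (X \<otimes>\<^bsub>op_algebra LA\<^esub> Y) = ract IM (ract IM m X) Y"
    if XY: "X \<in> carrier (op_algebra LA)" "Y \<in> carrier (op_algebra LA)" "m \<in> carrier (IM :: ('k, _, _, _) dg_bimod)"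
    for X Y m
  proof -
    obtain f where f: "f \<in> CF" "X = K f" using XY(1) by auto
    obtain g where g: "g \<in> CF" "Y = K g" using XY(2) by auto
    note gf = bmul_CF[OF g(1) f(1)]
    have "X \<otimes>\<^bsub>op_algebra LA\<^esub> Y = K (F.bmul g f)"
      using K_mult[OF g(1) f(1)] f g by simp
    then show ?thesis
      using XY(3) f g ract_K_MT[OF gf] ev_ract_K[OF gf]
      by (intro M_ext) (simp_all add: ract_K_MT ev_ract_K pact_bmul)
  qed
  have deg: "ract IM m X \<in> hcomp IM (i + j)"
    if "m \<in> hcomp (IM :: ('k, _, _, _) dg_bimod) i" "X \<in> hcomp (op_algebra LA) j" for m X i j
    using that pact_deg by auto
  have d: "diff IM (ract IM m X) = ract IM (diff IM m) X \<oplus>\<^bsub>IM\<^esub> (sg i \<odot>\<^bsub>IM\<^esub> ract IM m (diff (op_algebra LA) X))"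
    if m: "m \<in> hcomp (IM :: ('k, _, _, _) dg_bimod) i" and X: "X \<in> carrier (op_algebra LA)" for m X i
  proof -
    have mM: "m \<in> MT" using m by (simp add: MT_deg_iff)
    obtain f where f: "f \<in> CF" "X = K f" using X by auto
    have "inj_leavitt_ract sp m (K 0) = 0"
      using mM by (intro M_ext) (simp_all add: ract_K_MT MT_zero ev_ract_K pact1_simps)
    then show ?thesis
      using ract_diff[OF f(1) mM] f by simp
  qed
  show ?thesis
    unfolding right_dg_module_def
    using L is_complex_IM kl1 kl2 one mult deg d by auto
qed

lemma dg_bimodule_IM: "dg_bimodule AA (op_algebra LA) (IM :: ('k::field, _, _, _) dg_bimod)"
proof -
  have "ract IM (lact IM a m) X = lact IM a (ract IM m X)"
    if a: "a \<in> carrier AA" and "m \<in> carrier (IM :: ('k, _, _, _) dg_bimod)" and X: "X \<in> carrier (op_algebra LA)" for a m X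
  proof -
    have m: "m \<in> MT" using that(2) by simp
    obtain f where f: "f \<in> CF" "X = K f" using X by auto
    show ?thesis
      using f lact_MT[OF a m] lact_MT[OF a ract_K_MT[OF f(1) m]] ract_K_MT[OF f(1)] m
      by (intro M_ext) (simp_all add: ev_ract_K ev_lact[OF a] pact2_simps del: AA_simps)
  qed
  then show ?thesis
    unfolding dg_bimodule_def using left_dg_module_IM right_dg_module_IM by blast
qed

end


section \<open>Linear operators commuting with the ghost arrows\<close>

context special_quiver
begin

abbreviation Admdv :: "int \<Rightarrow> 'v \<Rightarrow> (('v, 'e) path \<times> ('v, 'e) path) set" where
  "Admdv d i \<equiv> Admd d \<inter> Admv i"

lemma Admdv_self: "b \<in> Adm \<Longrightarrow> b \<in> Admdv (pdeg b) (src (snd b))"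
  by (simp add: Admd_def Admv_def)

lemma keys_Ract_Admdv:
  assumes "keys v \<subseteq> Admdv d i" "a \<in> arcs G"
  shows "keys (Ract (Arr a) v) \<subseteq> Admdv (d - 1) (head G a)"
    and "keys (Ract (Ghost a) v) \<subseteq> Admdv (d + 1) (tail G a)"
proof -
  have d: "keys v \<subseteq> Admd d" and A: "keys v \<subseteq> Adm"
    using assms(1) Admd_Adm by blast+
  show "keys (Ract (Arr a) v) \<subseteq> Admdv (d - 1) (head G a)"
    using keys_Ract_Admd[OF _ d, of "Arr a"] keys_Ract_Admv(2)[OF A assms(2)] assms(2) by simp
  show "keys (Ract (Ghost a) v) \<subseteq> Admdv (d + 1) (tail G a)"
    using keys_Ract_Admd[OF _ d, of "Ghost a"] keys_Ract_Admv(3)[OF A assms(2)] assms(2) by simp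
qed

lemma out_arcs_eq: "a \<in> arcs G \<Longrightarrow> out_arcs G (tail G a) = insert a (siblings a)"
  by (auto simp: siblings_iff)

lemma sum_ghost_arrow:
  "i \<in> verts G \<Longrightarrow> keys v \<subseteq> Admv i \<Longrightarrow> (\<Sum>a\<in>out_arcs G i. Ract (Ghost a) (Ract (Arr a) v)) = v"
  using Admv_Adm Ract_ghost_arrow[of v i] Ract_Vtx_Admv[of v i] by (metis subset_trans)

lemma ghost_commuting_zero:
  fixes T :: "((('v, 'e) path \<times> ('v, 'e) path) \<Rightarrow>\<^sub>0 'k::field) \<Rightarrow> (('v, 'e) path \<times> ('v, 'e) path) \<Rightarrow>\<^sub>0 'k"
  assumes T: "lin T" and s: "s * s = 1"
    and keys_T: "\<And>i v. keys v \<subseteq> Admv i \<Longrightarrow> keys (T v) \<subseteq> Admv i"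
    and comm: "\<And>a v. a \<in> arcs G \<Longrightarrow> keys v \<subseteq> Admv (head G a) \<Longrightarrow>
      Ract (Ghost a) (T v) = scl s (T (Ract (Ghost a) v))"
    and vertex: "\<And>i. i \<in> verts G \<Longrightarrow> T (single (triv i, triv i) 1) = 0"
    and v: "keys v \<subseteq> Adm"
  shows "T v = 0"
proof (rule lin_eqI[OF T lin_intros(2) v])
  have ss: "scl s (scl s x) = x" for x :: "(('v, 'e) path \<times> ('v, 'e) path) \<Rightarrow>\<^sub>0 'k"
    by (simp add: s)
  have comm': "T (Ract (Ghost a) v) = scl s (Ract (Ghost a) (T v))"
    if "a \<in> arcs G" "keys v \<subseteq> Admv (head G a)" for a v
    unfolding comm[OF that] ss ..
  fix b assume "b \<in> Adm"
  then show "T (single b 1) = 0"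
  proof (induct rule: Adm_induct)
    case (vertex i)
    then show ?case by (rule assms(5))
  next
    case (ghost u as a bs)
    have "keys (single ((u, as), (head G a, bs)) (1::'k)) \<subseteq> Admv (head G a)"
      using ghost(2) by (simp add: Admv_def src_def)
    from comm'[OF ghost(1) this] show ?case
      unfolding single_ghost[OF ghost(3)] ghost(4) by (simp add: Ract_simps)
  next
    case (arrow u as a)
    let ?v = "single ((u, as), triv (tail G a)) (1::'k)"
    have kv: "keys ?v \<subseteq> Admv (tail G a)"
      using arrow(2) by (simp add: Admv_def src_def triv_def)
    have kA: "keys ?v \<subseteq> Adm" using arrow(2) by simp
    have kE: "keys (Ract (Arr c) ?v) \<subseteq> Admv (head G c)" if "c \<in> arcs G" for c
      by (rule keys_Ract_Admv(2)[OF kA that])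
    note kT = keys_T[OF kE]
    have kTA: "keys (T (Ract (Arr c) ?v)) \<subseteq> Adm" if "c \<in> arcs G" for c
      using kT[OF that] Admv_Adm by (rule subset_trans)
    have "0 = T (\<Sum>c\<in>out_arcs G (tail G a). Ract (Ghost c) (Ract (Arr c) ?v))"
      using arrow(1) by (simp only: sum_ghost_arrow[OF tail_in_verts kv] arrow(3))
    also have "\<dots> = (\<Sum>c\<in>out_arcs G (tail G a). scl s (Ract (Ghost c) (T (Ract (Arr c) ?v))))"
      unfolding lin_sum[OF T] by (intro sum.cong refl comm' kE) auto
    \<comment> \<open>Right multiplication by \<open>a\<^sup>*\<close> isolates the summand at
      \<open>a\<close>, because \<open>ca\<^sup>*\<close> is zero for \<open>c\<close> different
      from \<open>a\<close>; \<open>keys_T\<close> ensures that the vertex left over acts as the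
      identity.\<close>
    finally have "Ract (Arr a) 0 =
        Ract (Arr a) (\<Sum>c\<in>out_arcs G (tail G a). scl s (Ract (Ghost c) (T (Ract (Arr c) ?v))))"
      by (rule arg_cong)
    then have "0 = (\<Sum>c\<in>out_arcs G (tail G a). scl s (Ract (Arr a) (Ract (Ghost c) (T (Ract (Arr c) ?v)))))"
      by (simp only: Ract_simps)
    also have "\<dots> = (\<Sum>c\<in>out_arcs G (tail G a). if c = a then scl s (T (Ract (Arr a) ?v)) else 0)"
    proof (intro sum.cong refl)
      fix c assume "c \<in> out_arcs G (tail G a)"
      then have c: "c \<in> arcs G" by simp
      show "scl s (Ract (Arr a) (Ract (Ghost c) (T (Ract (Arr c) ?v)))) =
          (if c = a then scl s (T (Ract (Arr a) ?v)) else 0)"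
        unfolding Ract_arrow_ghost[OF kTA[OF c] arrow(1) c] using Ract_Vtx_Admv[OF kT[OF c]]
        by (auto simp del: Ract_single)
    qed
    also have "\<dots> = scl s (T (Ract (Arr a) ?v))"
      using arrow(1) by (simp add: out_arcs_eq del: Ract_single)
    finally have "scl s (scl s (T (Ract (Arr a) ?v))) = 0"
      by (simp del: Ract_single)
    then show ?case
      unfolding single_arrow[OF arrow(2)] ss .
  qed
qed

text \<open>
  The map \<open>H = htpy s psi\<close> solves \<open>psi\<^sub>\<alpha>(v) = H(v)\<alpha> - s H(v\<alpha>)\<close>. For \<open>v = p\<^sup>*q\<close> this prescribes \<open>H\<close> at
  \<open>p\<^sup>*q\<alpha>\<close>. Summing over the equations for \<open>v = p\<^sup>*\<alpha>\<^sup>*\<close> yields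
  \<open>\<Sum>H(p\<^sup>*\<alpha>\<^sup>*)\<alpha> = s H(p\<^sup>*) + \<Sum>psi\<^sub>\<alpha>(p\<^sup>*\<alpha>\<^sup>*)\<close>, whence \<open>H\<close> at \<open>p\<^sup>*\<alpha>\<^sup>*\<close>. The value at a vertex is arbitrary.
\<close>

primrec htriv :: "'k::field \<Rightarrow> ('e \<Rightarrow> ((('v, 'e) path \<times> ('v, 'e) path) \<Rightarrow>\<^sub>0 'k) \<Rightarrow> _) \<Rightarrow> 'v \<Rightarrow> 'e list \<Rightarrow>
    (('v, 'e) path \<times> ('v, 'e) path) \<Rightarrow>\<^sub>0 'k" where
  "htriv s psi u [] = 0"
| "htriv s psi u (a # as) = Ract (Arr a) (scl s (htriv s psi u as) +
    (\<Sum>c\<in>out_arcs G (tail G a). psi c (Ract (Arr c) (single ((u, rev as), triv (tail G a)) 1))))"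

primrec hpair :: "'k::field \<Rightarrow> ('e \<Rightarrow> ((('v, 'e) path \<times> ('v, 'e) path) \<Rightarrow>\<^sub>0 'k) \<Rightarrow> _) \<Rightarrow> ('v, 'e) path \<Rightarrow> 'e list \<Rightarrow>
    (('v, 'e) path \<times> ('v, 'e) path) \<Rightarrow>\<^sub>0 'k" where
  "hpair s psi p [] = htriv s psi (fst p) (rev (snd p))"
| "hpair s psi p (a # bs) =
    scl s (Ract (Ghost a) (hpair s psi p bs) - psi a (single (p, (head G a, bs)) 1))"

definition htpy :: "'k::field \<Rightarrow> ('e \<Rightarrow> ((('v, 'e) path \<times> ('v, 'e) path) \<Rightarrow>\<^sub>0 'k) \<Rightarrow> _) \<Rightarrow>
    ((('v, 'e) path \<times> ('v, 'e) path) \<Rightarrow>\<^sub>0 'k) \<Rightarrow> (('v, 'e) path \<times> ('v, 'e) path) \<Rightarrow>\<^sub>0 'k" where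
  "htpy s psi = lext scl (\<lambda>(p, q). hpair s psi p (snd q))"

lemma lin_htpy: "lin (htpy s psi)"
  by (simp add: htpy_def)

lemma htpy_vertex: "htpy s psi (single (triv i, triv i) 1) = 0"
  by (simp add: htpy_def triv_def)

lemma htpy_ghost: "htpy s psi (single (p, (v, a # bs)) 1) =
    scl s (Ract (Ghost a) (htpy s psi (single (p, (head G a, bs)) 1)) - psi a (single (p, (head G a, bs)) 1))"
  by (simp add: htpy_def)

lemma htpy_arrow: "htpy s psi (single ((u, as @ [a]), triv (head G a)) 1) =
    Ract (Arr a) (scl s (htpy s psi (single ((u, as), triv (tail G a)) 1)) +
      (\<Sum>c\<in>out_arcs G (tail G a). psi c (Ract (Arr c) (single ((u, as), triv (tail G a)) 1))))"
  by (simp add: htpy_def triv_def)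

text \<open>In the equation for \<open>H\<close> an arrow of degree one stands beside
  \<open>H\<close>, against \<open>psi\<close> of degree \<open>n\<close>; so \<open>H\<close> has
  degree \<open>n - 1\<close>. It respects starting vertices because both sides of each recursive
  equation do.\<close>

lemma keys_htpy:
  fixes psi :: "'e \<Rightarrow> ((('v, 'e) path \<times> ('v, 'e) path) \<Rightarrow>\<^sub>0 'k::field) \<Rightarrow> _"
  assumes psi: "\<And>a d v. a \<in> arcs G \<Longrightarrow> keys v \<subseteq> Admdv d (head G a) \<Longrightarrow> keys (psi a v) \<subseteq> Admdv (d + n) (tail G a)"
    and v: "keys v \<subseteq> Admdv d i"
  shows "keys (htpy s psi v) \<subseteq> Admdv (d + n - 1) i"
proof (rule keys_lin[OF lin_htpy v])
  have *: "keys (htpy s psi (single b (1::'k))) \<subseteq> Admdv (pdeg b + n - 1) (src (snd b))" if "b \<in> Adm" for b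
    using that
  proof (induct rule: Adm_induct)
    case (vertex i)
    then show ?case by (simp add: htpy_vertex)
  next
    case (ghost u as a bs)
    let ?b = "((u, as), (head G a, bs))" and ?c = "((u, as), (tail G a, a # bs))"
    have p: "pdeg ?c = pdeg ?b + 1" "src (snd ?c) = tail G a" "src (snd ?b) = head G a"
      by (simp_all add: pdeg_def plen_def src_def)
    have "keys (single ?b (1::'k)) \<subseteq> Admdv (pdeg ?b) (head G a)"
      using Admdv_self[OF ghost(2)] p(3) by simp
    from psi[OF ghost(1) this] keys_Ract_Admdv(2)[OF ghost(4) ghost(1)] show ?case
      unfolding htpy_ghost p by (intro order_trans[OF keys_scl] keys_minus_subset) (simp_all add: algebra_simps)
  next
    case (arrow u as a)
    let ?b = "((u, as), triv (tail G a))" and ?c = "((u, as @ [a]), triv (head G a))"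
    have p: "pdeg ?c = pdeg ?b - 1" "src (snd ?c) = head G a" "src (snd ?b) = tail G a"
      by (simp_all add: pdeg_def plen_def src_def triv_def)
    have b: "keys (single ?b (1::'k)) \<subseteq> Admdv (pdeg ?b) (tail G a)"
      using Admdv_self[OF arrow(2)] p(3) by simp
    have "keys (psi c (Ract (Arr c) (single ?b 1))) \<subseteq> Admdv (pdeg ?b + n - 1) (tail G a)"
      if "c \<in> out_arcs G (tail G a)" for c
      using that psi[OF _ keys_Ract_Admdv(1)[OF b], of c] by (simp add: algebra_simps del: Ract_single)
    then have "keys (scl s (htpy s psi (single ?b 1)) +
        (\<Sum>c\<in>out_arcs G (tail G a). psi c (Ract (Arr c) (single ?b 1)))) \<subseteq> Admdv (pdeg ?b + n - 1) (tail G a)"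
      using arrow(3) unfolding p(3)
      by (intro keys_plus_subset order_trans[OF keys_scl] keys_sum_subset)
    from keys_Ract_Admdv(1)[OF this arrow(1)] show ?case
      unfolding htpy_arrow p by (simp add: algebra_simps del: Ract_single)
  qed
  fix b assume "b \<in> Admdv d i"
  then show "keys (htpy s psi (single b (1::'k))) \<subseteq> Admdv (d + n - 1) i"
    using *[of b] by (simp add: Admd_def Admv_def)
qed

lemma keys_Admv_split:
  assumes T: "lin T" and "\<And>d v. keys v \<subseteq> Admdv d i \<Longrightarrow> keys (T v) \<subseteq> Admdv (d + n) j" and v: "keys v \<subseteq> Admv i"
  shows "keys (T v) \<subseteq> Admv j"
proof (rule keys_lin[OF T v])
  fix b assume "b \<in> Admv i"
  then have "keys (single b 1) \<subseteq> Admdv (pdeg b) i" by (simp add: Admd_def Admv_def)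
  from assms(2)[OF this] show "keys (T (single b 1)) \<subseteq> Admv j" by simp
qed

text \<open>If \<open>va\<close> is again a basis element, the equation is the recursive definition.
  Otherwise \<open>v = p\<^sup>*a\<^sup>*\<close> with \<open>a\<close> special, and
  \<open>va\<close> is \<open>p\<^sup>*\<close> minus the \<open>p\<^sup>*c\<^sup>*c\<close> of the
  siblings \<open>c\<close>; then the equation follows from those of the siblings together with the
  summed equation by which \<open>H\<close> was defined at
  \<open>p\<^sup>*c\<^sup>*\<close>.\<close>

lemma htpy_eq:
  fixes psi :: "'e \<Rightarrow> ((('v, 'e) path \<times> ('v, 'e) path) \<Rightarrow>\<^sub>0 'k::field) \<Rightarrow> _"
  assumes keys_psi: "\<And>a d v. a \<in> arcs G \<Longrightarrow> keys v \<subseteq> Admdv d (head G a) \<Longrightarrow> keys (psi a v) \<subseteq> Admdv (d + n) (tail G a)"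
    and lin_psi: "\<And>a. a \<in> arcs G \<Longrightarrow> lin (psi a)"
    and s: "s * s = 1" and a: "a \<in> arcs G" and v: "keys v \<subseteq> Admv (head G a)"
  shows "psi a v = Ract (Ghost a) (htpy s psi v) - scl s (htpy s psi (Ract (Ghost a) v))"
proof (rule lin_eqI[OF lin_psi[OF a] _ v])
  let ?H = "htpy s psi"
  show "lin (\<lambda>v. Ract (Ghost a) (?H v) - scl s (?H (Ract (Ghost a) v)))"
    by (intro lin_intros lin_comp[OF lin_Ract lin_htpy] lin_comp[OF lin_htpy lin_Ract])
  have ss: "scl s (scl s x) = x" for x :: "(('v, 'e) path \<times> ('v, 'e) path) \<Rightarrow>\<^sub>0 'k"
    by (simp add: s)
  have gen: "scl s (?H (Ract (Ghost a) (single ((u, as), (head G a, bs)) 1))) =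
      Ract (Ghost a) (?H (single ((u, as), (head G a, bs)) 1)) - psi a (single ((u, as), (head G a, bs)) 1)"
    if "((u, as), (tail G a, a # bs)) \<in> Adm" for a u as bs
    unfolding single_ghost[OF that, symmetric] htpy_ghost ss ..
  fix b assume "b \<in> Admv (head G a)"
  then obtain u as bs where b: "b = ((u, as), (head G a, bs))" "((u, as), (head G a, bs)) \<in> Adm"
    by (cases b) (auto simp: Admv_def src_def)
  show "psi a (single b 1) = Ract (Ghost a) (?H (single b 1)) - scl s (?H (Ract (Ghost a) (single b 1)))"
  proof (cases "((u, as), (tail G a, a # bs)) \<in> Adm")
    case True
    show ?thesis unfolding b(1) gen[OF True] by simp
  next
    case False
    \<comment> \<open>As \<open>b\<close> is admissible, putting \<open>a\<close> at the start of
      its second path can only do harm if that path is trivial and the first path ends in the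
      special arrow \<open>a\<close>.\<close>
    obtain as' where as: "as = as' @ [a]" and bs: "bs = []" and sa: "special sp a"
      using False b(2) a by (cases as rule: rev_cases) (auto simp: Adm_iff awalk_simps split: if_splits)
    let ?v = "single ((u, as'), triv (tail G a)) (1::'k)"
    have A: "((u, as'), triv (tail G a)) \<in> Adm"
      using b(2) a unfolding as bs by (auto simp: Adm_iff triv_def awalk_simps)
    have kv: "keys ?v \<subseteq> Admdv (pdeg ((u, as'), triv (tail G a))) (tail G a)"
      using Admdv_self[OF A] by (simp add: triv_def src_def)
    then have kv': "keys ?v \<subseteq> Admv (tail G a)" by simp
    have single_b: "single b 1 = Ract (Arr a) ?v"
      unfolding b(1) as bs single_arrow[OF A, symmetric] by (simp add: triv_def)
    have ev: "Ract (Arr c) ?v = single ((u, as' @ [c]), triv (head G c)) 1" if "c \<in> out_arcs G (tail G a)" for c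
    proof -
      have t: "tail G c = tail G a" using that by simp
      show ?thesis
        unfolding t[symmetric] by (rule single_arrow[symmetric]) (simp add: t A)
    qed
    \<comment> \<open>With \<open>p\<close> the first path of \<open>?v\<close>, the recursion sets
      \<open>H\<close> at \<open>p\<^sup>*c\<^sup>*\<close> to \<open>Xc\<^sup>*\<close>, with one
      \<open>X\<close> for all \<open>c\<close>. Multiplying by \<open>c\<close> and summing
      therefore recovers \<open>X\<close>.\<close>
    define X where "X = scl s (?H ?v) + (\<Sum>c\<in>out_arcs G (tail G a). psi c (Ract (Arr c) ?v))"
    have HX: "?H (Ract (Arr c) ?v) = Ract (Arr c) X" if "c \<in> out_arcs G (tail G a)" for c
      unfolding ev[OF that] htpy_arrow X_def using that by (simp del: Ract_single)
    have kpsi: "keys (psi c (Ract (Arr c) ?v)) \<subseteq> Admv (tail G a)" if "c \<in> out_arcs G (tail G a)" for c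
      using keys_psi[OF _ keys_Ract_Admdv(1)[OF kv], of c] that by (simp del: Ract_single)
    have "keys X \<subseteq> Admv (tail G a)"
      unfolding X_def using keys_htpy[of psi n, OF keys_psi kv] kpsi
      by (intro keys_plus_subset order_trans[OF keys_scl] keys_sum_subset) auto
    note X = sum_ghost_arrow[OF tail_in_verts[OF a] this]
    note V = sum_ghost_arrow[OF tail_in_verts[OF a] kv']
    let ?D = "\<lambda>c. Ract (Ghost c)" and ?E = "\<lambda>c. Ract (Arr c) ?v"
    \<comment> \<open>A sibling is not special, so its pair stays admissible and the recursive
      equation \<open>gen\<close> applies to it.\<close>
    have sib: "scl s (?H (?D c (?E c))) = ?D c (?H (?E c)) - psi c (?E c)" if c: "c \<in> siblings a" for c
    proof -
      have "((u, as' @ [c]), (tail G c, [c])) \<in> Adm"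
        using A c sibling_not_special[OF c sa]
        by (auto simp: Adm_iff siblings_iff triv_def awalk_simps)
      then show ?thesis
        using gen[of u "as' @ [c]" c "[]"] ev[of c] c a by (simp add: triv_def out_arcs_eq del: Ract_single)
    qed
    have split: "(\<Sum>c\<in>out_arcs G (tail G a). f c) = f a + (\<Sum>c\<in>siblings a. f c)"
      for f :: "'e \<Rightarrow> (('v, 'e) path \<times> ('v, 'e) path) \<Rightarrow>\<^sub>0 'k"
      unfolding out_arcs_eq[OF a] by (rule sum.insert) (auto simp: siblings_iff)
    \<comment> \<open>The rewriting of \<open>p\<^sup>*a\<^sup>*a\<close>: what is left are the
      value at \<open>p\<^sup>*\<close> and the terms governed by \<open>sib\<close>.\<close>
    have "scl s (?H (?D a (?E a))) = scl s (?H ?v) - (\<Sum>c\<in>siblings a. scl s (?H (?D c (?E c))))"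
    proof -
      have "scl s (?H ?v) = (\<Sum>c\<in>out_arcs G (tail G a). scl s (?H (?D c (?E c))))"
        using arg_cong[OF V, of "\<lambda>v. scl s (?H v)"] by (simp only: lin_sum[OF lin_htpy] scl.scale_sum_right)
      then show ?thesis unfolding split by simp
    qed
    also have "\<dots> = scl s (?H ?v) - (\<Sum>c\<in>siblings a. ?D c (?H (?E c))) + (\<Sum>c\<in>siblings a. psi c (?E c))"
      using sib by (simp add: sum_subtractf del: Ract_single)
    also have "(\<Sum>c\<in>siblings a. ?D c (?H (?E c))) = X - ?D a (?H (?E a))"
    proof -
      have "(\<Sum>c\<in>out_arcs G (tail G a). ?D c (?H (?E c))) = X"
        using HX X by (simp del: Ract_single)
      then show ?thesis unfolding split by (simp add: algebra_simps)
    qed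
    also have "(\<Sum>c\<in>siblings a. psi c (?E c)) = X - scl s (?H ?v) - psi a (?E a)"
      unfolding X_def split by simp
    finally show ?thesis
      unfolding single_b by simp
  qed
qed

end


section \<open>Endomorphisms of the injective Leavitt complex\<close>

text \<open>\<open>T\<close> is linear on the span of \<open>S\<close> only; its values at basis
  elements define a map that is linear everywhere and agrees with it there. Components of
  endomorphisms are turned into operators on the whole space in this way.\<close>

lemma lext_on:
  assumes add: "\<And>v w. keys v \<subseteq> S \<Longrightarrow> keys w \<subseteq> S \<Longrightarrow> T (v + w) = T v + T w"
    and scale: "\<And>c v. keys v \<subseteq> S \<Longrightarrow> T (scl c v) = scl c (T v)" and v: "keys v \<subseteq> S"
  shows "lext scl (\<lambda>b. T (single b 1)) v = T v"
  using v
proof (induct v rule: poly_mapping_add_induct)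
  case (single b c)
  then show ?case
    using scale[of "single b 1" c] by (simp add: lext_single[OF module_scl])
next
  case (add f g)
  then show ?case by (simp add: lin_add[OF lin_lext] assms(1))
next
  case zero
  show ?case using scale[of 0 0] by (simp add: lin_zero[OF lin_lext])
qed

context special_quiver
begin

interpretation B: dg_bim AA "IM :: ('k::field, _, _, _) dg_bimod" "op_algebra LA"
  by (intro dg_bim.intro dg_mod.intro dg_bim_axioms.intro left_dg_module_IM dg_bimodule_IM IM_simps)

lemma End_degD:
  fixes g :: "('v, 'e, 'k::field) inj_leavitt \<Rightarrow> _"
  assumes "g \<in> End_deg AA IM n"
  shows End_ext: "g \<in> extensional MT" and End_MT: "m \<in> MT \<Longrightarrow> g m \<in> MT"
    and End_add: "m \<in> MT \<Longrightarrow> m' \<in> MT \<Longrightarrow> g (m + m') = g m + g m'"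
    and End_scale: "m \<in> MT \<Longrightarrow> g (inj_scale c m) = inj_scale c (g m)"
    and End_deg: "m \<in> inj_leavitt_deg sp d \<Longrightarrow> g m \<in> inj_leavitt_deg sp (d + n)"
    and End_lact: "a \<in> carrier AA \<Longrightarrow> m \<in> MT \<Longrightarrow> g (inj_leavitt_lact a m) = inj_leavitt_lact a (g m)"
proof -
  show "g (inj_leavitt_lact a m) = inj_leavitt_lact a (g m)" if "a \<in> carrier AA" "m \<in> MT"
    using B.End_degD(6)[OF assms, of a 0 m] that by simp
qed (use B.End_degD(1-5)[OF assms] in simp_all)

lemma
  assumes m: "m \<in> MT"
  shows keys_ev_triv: "i \<in> verts G \<Longrightarrow> keys (evp (triv i) m) \<subseteq> Admv i"
    and keys_ev_arr: "a \<in> arcs G \<Longrightarrow> keys (evp (arr a) m) \<subseteq> Admv (head G a)"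
  using keys_ev[OF m, of "triv i"] keys_ev[OF m, of "arr a"] by simp_all

text \<open>The only short path whose product with the arrow on its right is nonzero at a coordinate
  is the vertex at its head; so the arrow moves its own coordinate to that vertex and annihilates
  all others.\<close>

lemma lact_arr_class:
  fixes m :: "('v, 'e, 'k::field) inj_leavitt"
  assumes a: "a \<in> arcs G" and m: "m \<in> MT"
  shows "inj_leavitt_lact (path_class (arr a)) m = tsh (triv (head G a)) (evp (arr a) m)"
proof (rule M_ext)
  have c: "path_class (arr a) \<in> carrier (AA :: ('k, _) dg_space)"
    using a by (intro path_class_closed) simp
  show "inj_leavitt_lact (path_class (arr a)) m \<in> MT" by (rule lact_MT[OF c m])
  show "tsh (triv (head G a)) (evp (arr a) m) \<in> MT"
    using keys_ev_arr[OF m] a by (intro tsh_MT) simp_all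
  fix s assume "s \<in> Sh"
  then show "evp s (inj_leavitt_lact (path_class (arr a)) m) = evp s (tsh (triv (head G a)) (evp (arr a) m))"
  proof (cases rule: Sh_cases)
    case (vertex i)
    have "(\<Sum>b\<in>arcs G. if head G b = i then scl (co (path_class (arr a)) (arr b)) (evp (arr b) m) else 0) =
        (\<Sum>b\<in>arcs G. if b = a then (if head G a = i then evp (arr a) m else 0) else 0)"
      using a by (intro sum.cong) (auto simp: co_path_class)
    then show ?thesis
      using vertex a by (simp add: ev_lact_triv[OF c m] co_path_class ev_tsh)
  next
    case (arrow b)
    then show ?thesis
      using a by (simp add: ev_lact_arr[OF c m] co_path_class ev_tsh)
  qed
qed

text \<open>Multiplying a short path by \<open>e\<^sub>i\<close> on its right keeps it iff it starts
  at \<open>i\<close>; so this is the projection onto the coordinates of the vertex and of the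
  arrows leaving it.\<close>

lemma lact_triv_class:
  fixes m :: "('v, 'e, 'k::field) inj_leavitt"
  assumes i: "i \<in> verts G" and m: "m \<in> MT"
  shows "inj_leavitt_lact (path_class (triv i)) m =
    tsh (triv i) (evp (triv i) m) + (\<Sum>a\<in>out_arcs G i. tsh (arr a) (evp (arr a) m))"
proof (rule M_ext)
  have c: "path_class (triv i) \<in> carrier (AA :: ('k, _) dg_space)"
    using i by (intro path_class_closed) simp
  show "inj_leavitt_lact (path_class (triv i)) m \<in> MT" by (rule lact_MT[OF c m])
  show "tsh (triv i) (evp (triv i) m) + (\<Sum>a\<in>out_arcs G i. tsh (arr a) (evp (arr a) m)) \<in> MT"
    using keys_ev_triv[OF m] keys_ev_arr[OF m] i by (intro MT_add MT_sum tsh_MT) simp_all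
  fix s assume "s \<in> Sh"
  then show "evp s (inj_leavitt_lact (path_class (triv i)) m) =
      evp s (tsh (triv i) (evp (triv i) m) + (\<Sum>a\<in>out_arcs G i. tsh (arr a) (evp (arr a) m)))"
  proof (cases rule: Sh_cases)
    case (vertex j)
    have "(\<Sum>b\<in>arcs G. if head G b = j then scl (co (path_class (triv i)) (arr b)) (evp (arr b) m) else 0) = 0"
      using i by (intro sum.neutral) (auto simp: co_path_class)
    moreover have "(\<Sum>a\<in>out_arcs G i. evp (triv j) (tsh (arr a) (evp (arr a) m))) = 0"
      using vertex by (intro sum.neutral) (auto simp: ev_tsh)
    ultimately show ?thesis
      using vertex i by (simp add: ev_lact_triv[OF c m] co_path_class ev_tsh ev_add ev_sum)
  next
    case (arrow b)
    have "(\<Sum>a\<in>out_arcs G i. evp (arr b) (tsh (arr a) (evp (arr a) m))) =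
        (\<Sum>a\<in>out_arcs G i. if a = b then evp (arr b) m else 0)"
      using arrow by (intro sum.cong) (auto simp: ev_tsh)
    also have "\<dots> = (if b \<in> out_arcs G i then evp (arr b) m else 0)"
      by (rule sum.delta) (rule finite_subset[OF _ finite_arcs], auto)
    finally show ?thesis
      using arrow i by (auto simp: ev_lact_arr[OF c m] co_path_class ev_tsh ev_add ev_sum)
  qed
qed

text \<open>
  An endomorphism is determined by the linear maps \<open>vcomp\<close> and \<open>acomp\<close>: since it commutes with the
  action of the degree zero algebra, the map which it induces on the \<open>\<alpha>\<^sup>\<sharp>\<close>-coordinate equals the one
  on the coordinate of \<open>e\<^sub>i\<^sup>\<sharp>\<close>, \<open>i\<close> being the head of \<open>\<alpha>\<close>.
\<close>

definition vcomp :: "(('v, 'e, 'k::field) inj_leavitt \<Rightarrow> ('v, 'e, 'k) inj_leavitt) \<Rightarrow>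
    ((('v, 'e) path \<times> ('v, 'e) path) \<Rightarrow>\<^sub>0 'k) \<Rightarrow> (('v, 'e) path \<times> ('v, 'e) path) \<Rightarrow>\<^sub>0 'k" where
  "vcomp g = lext scl (\<lambda>b. evp (triv (src (snd b))) (g (tsh (triv (src (snd b))) (single b 1))))"

definition acomp :: "(('v, 'e, 'k::field) inj_leavitt \<Rightarrow> ('v, 'e, 'k) inj_leavitt) \<Rightarrow> 'e \<Rightarrow>
    ((('v, 'e) path \<times> ('v, 'e) path) \<Rightarrow>\<^sub>0 'k) \<Rightarrow> (('v, 'e) path \<times> ('v, 'e) path) \<Rightarrow>\<^sub>0 'k" where
  "acomp g a = lext scl (\<lambda>b. evp (triv (tail G a)) (g (tsh (arr a) (single b 1))))"

lemma lin_vcomp: "lin (vcomp g)" and lin_acomp: "lin (acomp g a)"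
  by (simp_all add: vcomp_def acomp_def)

lemma End_tsh_lext:
  fixes g :: "('v, 'e, 'k::field) inj_leavitt \<Rightarrow> _"
  assumes g: "g \<in> End_deg AA IM n" and s: "s \<in> Sh" and v: "keys v \<subseteq> Admv (tgt s)"
  shows "lext scl (\<lambda>b. evp t (g (tsh s (single b 1)))) v = evp t (g (tsh s v))"
  by (rule lext_on[OF _ _ v])
    (simp_all add: tens_props End_add[OF g] End_scale[OF g] tsh_MT[OF s] ev_add ev_scale)

lemma vcomp_eq:
  fixes g :: "('v, 'e, 'k::field) inj_leavitt \<Rightarrow> _"
  assumes g: "g \<in> End_deg AA IM n" and i: "i \<in> verts G" and v: "keys v \<subseteq> Admv i"
  shows "vcomp g v = evp (triv i) (g (tsh (triv i) v))"
proof -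
  have "vcomp g v = lext scl (\<lambda>b. evp (triv i) (g (tsh (triv i) (single b 1)))) v"
    unfolding vcomp_def by (rule lin_eqI[OF lin_lext lin_lext v]) (simp add: Admv_def)
  then show ?thesis
    using End_tsh_lext[OF g, of "triv i" v "triv i"] i v by simp
qed

lemma acomp_eq:
  fixes g :: "('v, 'e, 'k::field) inj_leavitt \<Rightarrow> _"
  assumes g: "g \<in> End_deg AA IM n" and a: "a \<in> arcs G" and v: "keys v \<subseteq> Admv (head G a)"
  shows "acomp g a v = evp (triv (tail G a)) (g (tsh (arr a) v))"
  unfolding acomp_def using End_tsh_lext[OF g, of "arr a" v] a v by simp

lemma tsh_deg: "s \<in> Sh \<Longrightarrow> keys v \<subseteq> Admdv d (tgt s) \<Longrightarrow> tsh s v \<in> inj_leavitt_deg sp d"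
  unfolding MT_deg_iff by (simp add: tsh_MT ev_tsh)

lemma keys_vcomp:
  fixes g :: "('v, 'e, 'k::field) inj_leavitt \<Rightarrow> _"
  assumes g: "g \<in> End_deg AA IM n" and v: "keys v \<subseteq> Admdv d i"
  shows "keys (vcomp g v) \<subseteq> Admdv (d + n) i"
proof (cases "i \<in> verts G")
  case True
  then have t: "triv i \<in> Sh" "tgt (triv i) = i" by simp_all
  have "tsh (triv i) v \<in> inj_leavitt_deg sp d"
    using t v by (intro tsh_deg) simp_all
  have v': "keys v \<subseteq> Admv i" using v by simp
  from End_deg[OF g \<open>tsh (triv i) v \<in> inj_leavitt_deg sp d\<close>] show ?thesis
    unfolding vcomp_eq[OF g True v'] MT_deg_iff
    using keys_ev[OF _ t(1)] t by (metis le_inf_iff)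
next
  case False
  then have "Admv i = {}" using Adm_src by (auto simp: Admv_def)
  then have "v = 0" using v by simp
  then show ?thesis by (simp add: lin_zero[OF lin_vcomp])
qed

lemma keys_acomp:
  fixes g :: "('v, 'e, 'k::field) inj_leavitt \<Rightarrow> _"
  assumes g: "g \<in> End_deg AA IM n" and a: "a \<in> arcs G" and v: "keys v \<subseteq> Admdv d (head G a)"
  shows "keys (acomp g a v) \<subseteq> Admdv (d + n) (tail G a)"
proof -
  have t: "triv (tail G a) \<in> Sh" "tgt (triv (tail G a)) = tail G a" using a by simp_all
  have v': "keys v \<subseteq> Admv (head G a)" using v by simp
  have "tsh (arr a) v \<in> inj_leavitt_deg sp d"
    using a v by (intro tsh_deg) simp_all
  from End_deg[OF g this] show ?thesis
    unfolding acomp_eq[OF g a v'] MT_deg_iff using keys_ev[OF _ t(1)] t by (metis le_inf_iff)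
qed

lemma ev_End_arr:
  fixes g :: "('v, 'e, 'k::field) inj_leavitt \<Rightarrow> _"
  assumes g: "g \<in> End_deg AA IM n" and m: "m \<in> MT" and a: "a \<in> arcs G"
  shows "evp (arr a) (g m) = vcomp g (evp (arr a) m)"
proof -
  have c: "path_class (arr a) \<in> carrier (AA :: ('k, _) dg_space)" and h: "head G a \<in> verts G"
    using a by (simp_all add: path_class_closed del: AA_simps)
  show ?thesis
    unfolding vcomp_eq[OF g h keys_ev_arr[OF m a]] lact_arr_class[OF a m, symmetric] End_lact[OF g c m]
      lact_arr_class[OF a End_MT[OF g m]]
    using h by (simp add: ev_tsh)
qed

text \<open>\<open>g\<close> commutes with the projection given by \<open>e\<^sub>i\<close>, so only
  the coordinates of \<open>i\<close> and of the arrows leaving \<open>i\<close> can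
  contribute.\<close>

lemma ev_End_triv:
  fixes g :: "('v, 'e, 'k::field) inj_leavitt \<Rightarrow> _"
  assumes g: "g \<in> End_deg AA IM n" and m: "m \<in> MT" and i: "i \<in> verts G"
  shows "evp (triv i) (g m) = vcomp g (evp (triv i) m) + (\<Sum>a\<in>out_arcs G i. acomp g a (evp (arr a) m))"
proof -
  have c: "path_class (triv i) \<in> carrier (AA :: ('k, _) dg_space)"
    using i by (simp add: path_class_closed del: AA_simps)
  note k = keys_ev_triv[OF m i] and ka = keys_ev_arr[OF m]
  have tm: "tsh (triv i) (evp (triv i) m) \<in> MT" "\<And>a. a \<in> out_arcs G i \<Longrightarrow> tsh (arr a) (evp (arr a) m) \<in> MT"
    using k ka i by (simp_all add: tsh_MT)
  have S: "(\<Sum>a\<in>out_arcs G i. tsh (arr a) (evp (arr a) m)) \<in> MT"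
    by (rule MT_sum) (rule tm(2))
  have gs: "g (\<Sum>a\<in>N. tsh (arr a) (evp (arr a) m)) = (\<Sum>a\<in>N. g (tsh (arr a) (evp (arr a) m)))"
    if "N \<subseteq> out_arcs G i" for N
    using that
  proof (induct N rule: infinite_finite_induct)
    case (insert a N)
    then show ?case using tm by (simp add: End_add[OF g] MT_sum subset_eq)
  qed (use End_scale[OF g MT_zero, of 0] in simp_all)
  have "evp (triv i) (g m) = evp (triv i) (inj_leavitt_lact (path_class (triv i)) (g m))"
    using i by (simp add: lact_triv_class[OF i End_MT[OF g m]] ev_add ev_sum ev_tsh)
  also have "\<dots> = evp (triv i) (g (inj_leavitt_lact (path_class (triv i)) m))"
    unfolding End_lact[OF g c m] ..
  also have "\<dots> = vcomp g (evp (triv i) m) + (\<Sum>a\<in>out_arcs G i. evp (triv i) (g (tsh (arr a) (evp (arr a) m))))"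
    unfolding lact_triv_class[OF i m] vcomp_eq[OF g i k] End_add[OF g tm(1) S] gs[OF order_refl] ev_add ev_sum ..
  also have "(\<Sum>a\<in>out_arcs G i. evp (triv i) (g (tsh (arr a) (evp (arr a) m)))) =
      (\<Sum>a\<in>out_arcs G i. acomp g a (evp (arr a) m))"
    using ka by (intro sum.cong refl) (auto simp: acomp_eq[OF g])
  finally show ?thesis .
qed

definition diag :: "(((('v, 'e) path \<times> ('v, 'e) path) \<Rightarrow>\<^sub>0 'k::field) \<Rightarrow> (('v, 'e) path \<times> ('v, 'e) path) \<Rightarrow>\<^sub>0 'k) \<Rightarrow>
    ('v, 'e, 'k) inj_leavitt \<Rightarrow> ('v, 'e, 'k) inj_leavitt" where
  "diag T = (\<lambda>m\<in>MT. \<Sum>s\<in>Sh. tsh s (T (evp s m)))"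

text \<open>The left action merely forms scalar combinations of coordinates, so a linear
  \<open>T\<close> used in all of them commutes with it. As \<open>T\<close> preserves starting
  vertices, the result stays in the module.\<close>

lemma
  fixes T :: "((('v, 'e) path \<times> ('v, 'e) path) \<Rightarrow>\<^sub>0 'k::field) \<Rightarrow> _"
  assumes T: "lin T" and keys_T: "\<And>d i v. keys v \<subseteq> Admdv d i \<Longrightarrow> keys (T v) \<subseteq> Admdv (d + n) i"
  shows diag_End_deg: "diag T \<in> End_deg AA IM n"
    and ev_diag: "m \<in> MT \<Longrightarrow> s \<in> Sh \<Longrightarrow> evp s (diag T m) = T (evp s m)"
proof -
  have ev: "evp s (diag T m) = T (evp s m)" if "m \<in> MT" and s: "s \<in> Sh" for s m
  proof -
    have "(\<Sum>t\<in>Sh. evp s (tsh t (T (evp t m)))) = (\<Sum>t\<in>Sh. if t = s then T (evp s m) else 0)"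
      using s by (intro sum.cong refl) (auto simp: ev_tsh)
    then show ?thesis using that by (simp add: diag_def ev_sum)
  qed
  then show "m \<in> MT \<Longrightarrow> s \<in> Sh \<Longrightarrow> evp s (diag T m) = T (evp s m)" .
  have MT: "diag T m \<in> MT" if m: "m \<in> MT" for m
  proof -
    have "keys (T (evp s m)) \<subseteq> Admv (tgt s)" if "s \<in> Sh" for s
      by (rule keys_Admv_split[OF T keys_T keys_ev[OF m that]])
    then show ?thesis
      unfolding diag_def restrict_apply'[OF m] by (intro MT_sum tsh_MT)
  qed
  show "diag T \<in> End_deg AA IM n"
  proof (rule B.End_degI)
    show "diag T \<in> extensional (carrier IM)" by (simp add: diag_def)
    show "diag T x \<in> carrier IM" if "x \<in> carrier IM" for x
      using MT that by simp
    show "diag T (x + y) = diag T x + diag T y" if "x \<in> carrier IM" "y \<in> carrier IM" for x y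
      using that by (intro M_ext) (simp_all add: MT MT_add ev ev_add lin_add[OF T])
    show "diag T (c \<odot>\<^bsub>IM\<^esub> x) = c \<odot>\<^bsub>IM\<^esub> diag T x" if "x \<in> carrier IM" for c x
      using that by (intro M_ext) (simp_all add: MT MT_scale ev ev_scale lin_scale[OF T])
    show "diag T x \<in> hcomp IM (i + n)" if "x \<in> hcomp IM i" for i x
    proof -
      have x: "x \<in> MT" and d: "\<And>s. s \<in> Sh \<Longrightarrow> keys (evp s x) \<subseteq> Admdv i (tgt s)"
        using that keys_ev[of x] by (simp_all add: MT_deg_iff)
      have "keys (T (evp s x)) \<subseteq> Admd (i + n)" if "s \<in> Sh" for s
        using keys_T[OF d[OF that]] by simp
      then show ?thesis
        using x by (simp add: MT_deg_iff MT ev)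
    qed
    show "diag T (lact IM a x) = sg (n * i) \<odot>\<^bsub>IM\<^esub> lact IM a (diag T x)"
      if a: "a \<in> hcomp AA i" and "x \<in> carrier IM" for i a x
    proof -
      have x: "x \<in> MT" using that(2) by simp
      have "diag T 0 = 0"
        by (rule M_ext) (simp_all add: MT MT_zero ev lin_zero[OF T])
      show ?thesis
      proof (cases "i = 0")
        case True
        then have "a \<in> carrier AA" using a by simp
        then show ?thesis
          using True x
          by (intro M_ext) (simp_all add: MT lact_MT ev ev_lact lin_sum[OF T] lin_scale[OF T] del: AA_simps)
      next
        case False
        then have "a = Kp 0" using a by simp
        then show ?thesis
          using lact_zero[OF x] lact_zero[OF MT[OF x]] \<open>diag T 0 = 0\<close> by simp
      qed
    qed
  qed
qed

section \<open>Cocycles and coboundaries of the endomorphism algebra\<close>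

lemma dE_eq:
  fixes g :: "('v, 'e, 'k::field) inj_leavitt \<Rightarrow> _"
  assumes "g \<in> End_deg AA IM n" "m \<in> MT"
  shows "B.dE g m = inj_leavitt_diff sp (g m) - inj_scale (sg n) (g (inj_leavitt_diff sp m))"
  using B.dE_homog[OF _ assms(1), of m] assms(2) by simp

text \<open>The maps \<open>acomp\<close> drop out: they read coordinates at arrows, which vanish
  after the differential, and write those at vertices, which the differential ignores. Thus the
  cocycle condition constrains \<open>vcomp\<close> alone.\<close>

lemma
  fixes g :: "('v, 'e, 'k::field) inj_leavitt \<Rightarrow> _"
  assumes g: "g \<in> End_deg AA IM n" and m: "m \<in> MT"
  shows ev_dE_arr: "a \<in> arcs G \<Longrightarrow> evp (arr a) (B.dE g m) = 0"
    and ev_dE_triv: "i \<in> verts G \<Longrightarrow> evp (triv i) (B.dE g m) =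
      (\<Sum>a\<in>out_arcs G i. Ract (Ghost a) (vcomp g (evp (arr a) m)) -
        scl (sg n) (vcomp g (Ract (Ghost a) (evp (arr a) m))))"
proof -
  note gm = End_MT[OF g m] and dm = diff_MT[OF m]
  show "a \<in> arcs G \<Longrightarrow> evp (arr a) (B.dE g m) = 0"
    by (simp add: dE_eq[OF g m] ev_props ev_diff_arr[OF gm] ev_End_arr[OF g dm] ev_diff_arr[OF m] lin_zero[OF lin_vcomp])
  assume i: "i \<in> verts G"
  have "(\<Sum>a\<in>out_arcs G i. Ract (Ghost a) (evp (arr a) (g m))) =
      (\<Sum>a\<in>out_arcs G i. Ract (Ghost a) (vcomp g (evp (arr a) m)))"
    by (intro sum.cong refl) (simp add: ev_End_arr[OF g m])
  moreover have "(\<Sum>a\<in>out_arcs G i. acomp g a (evp (arr a) (inj_leavitt_diff sp m))) = 0"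
    by (intro sum.neutral) (simp add: ev_diff_arr[OF m] lin_zero[OF lin_acomp])
  ultimately show "evp (triv i) (B.dE g m) =
      (\<Sum>a\<in>out_arcs G i. Ract (Ghost a) (vcomp g (evp (arr a) m)) -
        scl (sg n) (vcomp g (Ract (Ghost a) (evp (arr a) m))))"
    using i by (simp add: dE_eq[OF g m] ev_props ev_diff_triv[OF gm] ev_End_triv[OF g dm] ev_diff_triv[OF m]
        lin_sum[OF lin_vcomp] scl.scale_sum_right sum_subtractf)
qed

text \<open>The element with the single coordinate \<open>v\<close> at the arrow \<open>a\<close>
  leaves one summand of the vanishing expression in \<open>ev_dE_triv\<close>.\<close>

lemma cocycle_commutes:
  fixes z :: "('v, 'e, 'k::field) inj_leavitt \<Rightarrow> _"
  assumes z: "z \<in> End_deg AA IM n" and dz: "\<And>m. m \<in> MT \<Longrightarrow> B.dE z m = 0"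
    and a: "a \<in> arcs G" and v: "keys v \<subseteq> Admv (head G a)"
  shows "Ract (Ghost a) (vcomp z v) = scl (sg n) (vcomp z (Ract (Ghost a) v))"
proof -
  have m: "tsh (arr a) v \<in> MT" using a v by (intro tsh_MT) simp_all
  let ?f = "\<lambda>v. Ract (Ghost a) (vcomp z v) - scl (sg n) (vcomp z (Ract (Ghost a) v))"
  have "0 = (\<Sum>b\<in>out_arcs G (tail G a). Ract (Ghost b) (vcomp z (evp (arr b) (tsh (arr a) v))) -
        scl (sg n) (vcomp z (Ract (Ghost b) (evp (arr b) (tsh (arr a) v)))))"
    using ev_dE_triv[OF z m, of "tail G a"] a dz[OF m] by simp
  also have "\<dots> = (\<Sum>b\<in>out_arcs G (tail G a). if b = a then ?f v else 0)"
    using a by (intro sum.cong refl) (auto simp: ev_tsh Ract_simps lin_zero[OF lin_vcomp])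
  also have "\<dots> = ?f v"
    using a by (simp add: out_arcs_eq)
  finally show ?thesis by simp
qed

abbreviation rmult :: "(('v, 'e) leavitt_gen list \<Rightarrow>\<^sub>0 'k::field) set \<Rightarrow> _" where
  "rmult \<equiv> right_mult (op_algebra LA) (IM :: ('k, _, _, _) dg_bimod)"

lemma hcomp_op_LA: "hcomp (op_algebra LA :: ('k::field, _) dg_space) n = K ` homog n"
  by (simp add: op_algebra_simps)

lemma rmult_End_deg:
  fixes f :: "('v, 'e) leavitt_gen list \<Rightarrow>\<^sub>0 'k::field"
  shows "f \<in> homog n \<Longrightarrow> rmult (K f) \<in> End_deg AA IM n"
  by (rule B.rm_End_deg) (simp only: hcomp_op_LA imageI)

text \<open>The test elements \<open>e\<^sub>i\<^sup>\<sharp>\<zeta>\<close> at the trivial pairs: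
  in degree zero right multiplication carries no sign, and having no coordinate at an arrow they are
  killed by the differential and by coboundaries.\<close>

lemma socle_vertex:
  assumes "i \<in> verts G"
  shows "keys (single (triv i, triv i) (1::'k::field)) \<subseteq> Admdv 0 i"
    and "tsh (triv i) (single (triv i, triv i) (1::'k)) \<in> inj_leavitt_deg sp 0"
proof -
  show k: "keys (single (triv i, triv i) (1::'k)) \<subseteq> Admdv 0 i"
    using triv_Adm[OF assms] by (simp add: Admd_def Admv_def pdeg_def src_def triv_def plen_def)
  show "tsh (triv i) (single (triv i, triv i) (1::'k)) \<in> inj_leavitt_deg sp 0"
    using assms k by (intro tsh_deg) simp_all
qed

lemma ev_rmult_vertex:
  fixes f :: "('v, 'e) leavitt_gen list \<Rightarrow>\<^sub>0 'k::field"
  assumes f: "f \<in> homog n" and i: "i \<in> verts G"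
  shows "evp (triv i) (rmult (K f) (tsh (triv i) (single (triv i, triv i) 1))) = pact f (single (triv i, triv i) 1)"
proof -
  let ?m = "tsh (triv i) (single (triv i, triv i) (1::'k))"
  have m: "?m \<in> inj_leavitt_deg sp 0" by (rule socle_vertex[OF i])
  then have "?m \<in> hcomp IM 0" by simp
  moreover have "K f \<in> hcomp (op_algebra LA) n" unfolding hcomp_op_LA using f by (rule imageI)
  ultimately have "rmult (K f) ?m = inj_leavitt_ract sp ?m (K f)"
    using B.rm_homog[of "K f" n ?m 0] by simp
  then show ?thesis
    using ev_ract_K[OF homog_CF[OF f], of ?m "triv i"] m i by (simp add: MT_deg_iff ev_tsh)
qed

text \<open>At the test element of \<open>i\<close> the coboundary is zero, so \<open>f\<close>
  annihilates the trivial pair at \<open>i\<close>. Summing over the vertices, \<open>f\<close>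
  annihilates the unit, and \<open>K_injective\<close> applies.\<close>

lemma rmult_inj:
  fixes f :: "('v, 'e) leavitt_gen list \<Rightarrow>\<^sub>0 'k::field"
  assumes f: "f \<in> homog n" and h: "h \<in> End_deg AA IM (n - 1)" and eq: "rmult (K f) = B.dE h"
  shows "K f = K 0"
proof -
  have "pact f (single (triv i, triv i) 1) = 0" if i: "i \<in> verts G" for i
  proof -
    let ?m = "tsh (triv i) (single (triv i, triv i) (1::'k))"
    have "?m \<in> inj_leavitt_deg sp 0" by (rule socle_vertex(2)[OF i])
    then have m: "?m \<in> MT" by (simp add: MT_deg_iff)
    have "evp (triv i) (B.dE h ?m) = 0"
      unfolding ev_dE_triv[OF h m i] using i
      by (intro sum.neutral) (auto simp: ev_tsh Ract_simps lin_zero[OF lin_vcomp])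
    then show ?thesis
      unfolding ev_rmult_vertex[OF f i, symmetric] eq .
  qed
  then have "pact f onev = 0"
    by (simp add: onev_def pact2_simps)
  then show ?thesis
    using K_injective[OF homog_CF[OF f], of 0] by (simp add: pact1_simps)
qed

text \<open>A multiplication with the same \<open>vcomp\<close> is subtracted from the cocycle; the
  difference then consists of maps from arrow coordinates to vertex coordinates, and
  \<open>htpy_eq\<close> exhibits it as a coboundary.\<close>

lemma rmult_surj:
  fixes z :: "('v, 'e, 'k::field) inj_leavitt \<Rightarrow> _"
  assumes z: "z \<in> End_deg AA IM n" and dz: "\<And>m. m \<in> MT \<Longrightarrow> B.dE z m = 0"
  shows "\<exists>f\<in>homog n. \<exists>h\<in>End_deg AA IM (n - 1). z = (\<lambda>m\<in>MT. rmult (K f) m + B.dE h m)"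
proof -
  let ?e = "\<lambda>i. single (triv i, triv i) (1::'k)"
  \<comment> \<open>If \<open>vcomp z\<close> is a left multiplication, the multiplier is its value
    at the unit, the sum of the vertices.\<close>
  define u where "u = (\<Sum>i\<in>verts G. vcomp z (?e i))"
  have ke: "keys (vcomp z (?e i)) \<subseteq> Admdv n i" if "i \<in> verts G" for i
    using keys_vcomp[OF z socle_vertex(1)[OF that]] by simp
  have ku: "keys u \<subseteq> Admd n"
    unfolding u_def using ke by (intro keys_sum_subset) blast
  define f where "f = Th u"
  have f: "f \<in> homog n" unfolding f_def by (rule Th_homog[OF ku])
  define r where "r = rmult (K f)"
  have r: "r \<in> End_deg AA IM n" unfolding r_def by (rule rmult_End_deg[OF f])
  \<comment> \<open>\<open>rmult\<close> commutes with the differentials, and that of the Leavitt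
    path algebra is zero.\<close>
  have dr: "B.dE r m = 0" if "m \<in> MT" for m
  proof -
    have "K f \<in> carrier (op_algebra LA)"
      using homog_CF[OF f] by (simp add: op_algebra_simps)
    moreover have "\<forall>x\<in>carrier (op_algebra LA). rmult (diff (op_algebra LA) x) = B.dE (rmult x)"
      using B.dg_algebra_hom_rm unfolding dg_algebra_hom_def B.Op.opp_simps B.dgE_simps by blast
    ultimately have "rmult (diff (op_algebra LA) (K f)) = B.dE r"
      unfolding r_def by blast
    moreover have "rmult (K (0 :: _ \<Rightarrow>\<^sub>0 'k)) = (\<lambda>m\<in>MT. 0)"
    proof -
      have "K (0 :: _ \<Rightarrow>\<^sub>0 'k) \<in> carrier (op_algebra LA)" by (simp add: op_algebra_simps)
      then have "rmult ((0::'k) \<odot>\<^bsub>op_algebra LA\<^esub> K 0) = (0::'k) \<odot>\<^bsub>B.dgE\<^esub> rmult (K (0 :: _ \<Rightarrow>\<^sub>0 'k))"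
        using B.klinear_rm unfolding klinear_def by blast
      then show ?thesis
        using K_scl[of "0 :: _ \<Rightarrow>\<^sub>0 'k" "0::'k"] by (simp add: op_algebra_simps)
    qed
    ultimately have "B.dE r = (\<lambda>m\<in>MT. 0)" by (simp add: op_algebra_simps)
    then show ?thesis using that by simp
  qed
  \<comment> \<open>The vertex is the unit multiplied by it on the right. This multiplication
    commutes with the action of \<open>f\<close> and cuts the summand belonging to \<open>i\<close>
    out of \<open>u\<close>.\<close>
  have re: "vcomp r (?e i) = vcomp z (?e i)" if i: "i \<in> verts G" for i
  proof -
    have k1: "keys (?e i) \<subseteq> Admv i" using socle_vertex(1)[OF i] by blast
    have sum_V: "(\<Sum>j\<in>verts G. if j = i then T j else 0) = T i"
      for T :: "'v \<Rightarrow> (('v, 'e) path \<times> ('v, 'e) path) \<Rightarrow>\<^sub>0 'k"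
      using i by simp
    have V: "Ract (Vtx i) (\<Sum>j\<in>verts G. T j) = T i" if T: "\<And>j. j \<in> verts G \<Longrightarrow> keys (T j) \<subseteq> Admv j"
      for T :: "'v \<Rightarrow> (('v, 'e) path \<times> ('v, 'e) path) \<Rightarrow>\<^sub>0 'k"
    proof -
      have "Ract (Vtx i) (T j) = (if j = i then T j else 0)" if j: "j \<in> verts G" for j
        using Ract_vertex[OF subset_trans[OF T[OF j] Admv_Adm], of i j] Ract_Vtx_Admv[OF T[OF j]] by auto
      then show ?thesis by (simp add: Ract_simps sum_V)
    qed
    have "vcomp r (?e i) = pact f (?e i)"
      unfolding vcomp_eq[OF r i k1] unfolding r_def by (rule ev_rmult_vertex[OF f i])
    also have "\<dots> = pact f (Ract (Vtx i) onev)"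
      unfolding onev_def by (rule arg_cong[OF V[symmetric]]) (use socle_vertex(1) in blast)
    also have "\<dots> = Ract (Vtx i) (pact f onev)"
      using i by (intro pact_Ract homog_CF[OF f] keys_onev) simp
    also have "pact f onev = u"
      unfolding f_def by (rule pact_Th[OF subset_trans[OF ku Admd_Adm]])
    also have "Ract (Vtx i) u = vcomp z (?e i)"
      unfolding u_def by (rule V) (use ke in blast)
    finally show ?thesis .
  qed
  \<comment> \<open>Both operators commute with arrows up to the same sign and agree at the
    vertices, so their difference is zero.\<close>
  have zr: "vcomp z v - vcomp r v = 0" if v: "keys v \<subseteq> Adm" for v
  proof (rule ghost_commuting_zero[where T = "\<lambda>v. vcomp z v - vcomp r v" and s = "sg n", OF _ _ _ _ _ v])
    show L: "lin (\<lambda>v. vcomp z v - vcomp r v)" by (intro lin_intros lin_vcomp)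
    show "sg n * sg n = (1::'k)" by simp
    show "keys (vcomp z v - vcomp r v) \<subseteq> Admv i" if "keys v \<subseteq> Admv i" for i v
      by (rule keys_Admv_split[where n = n, OF L _ that])
        (intro keys_minus_subset keys_vcomp[OF z] keys_vcomp[OF r]; assumption)
    show "Ract (Ghost a) (vcomp z v - vcomp r v) =
        scl (sg n) (vcomp z (Ract (Ghost a) v) - vcomp r (Ract (Ghost a) v))"
      if "a \<in> arcs G" "keys v \<subseteq> Admv (head G a)" for a v
      using cocycle_commutes[OF z dz that] cocycle_commutes[OF r dr that]
      by (simp add: Ract_simps scl.scale_right_diff_distrib)
    show "vcomp z (?e i) - vcomp r (?e i) = 0" if "i \<in> verts G" for i
      using re[OF that] by simp
  qed
  define psi where "psi a v = acomp z a v - acomp r a v" for a v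
  have lin_psi: "lin (psi a)" for a
    unfolding psi_def[abs_def] by (intro lin_intros lin_acomp)
  have keys_psi: "keys (psi a v) \<subseteq> Admdv (d + n) (tail G a)" if "a \<in> arcs G" "keys v \<subseteq> Admdv d (head G a)" for a d v
    unfolding psi_def using that by (intro keys_minus_subset keys_acomp[OF z] keys_acomp[OF r])
  \<comment> \<open>The scalar is the sign in the differential of an endomorphism of degree
    \<open>n - 1\<close>; as required for the recursion, it is its own inverse.\<close>
  let ?H = "htpy (sg (n - 1)) psi"
  note H = htpy_eq[of psi n, OF keys_psi lin_psi sg_sq(1)[of "n - 1"]]
  have kH: "keys (?H v) \<subseteq> Admdv (d + (n - 1)) i" if "keys v \<subseteq> Admdv d i" for d i v
    using keys_htpy[of psi n, OF keys_psi that] by (simp add: algebra_simps)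
  define h where "h = diag ?H"
  have h: "h \<in> End_deg AA IM (n - 1)"
    unfolding h_def by (rule diag_End_deg[OF lin_htpy kH])
  have vh: "vcomp h v = ?H v" if v: "keys v \<subseteq> Adm" for v
  proof (rule lin_eqI[OF lin_vcomp lin_htpy v])
    fix b assume "b \<in> Adm"
    then have i: "src (snd b) \<in> verts G" and k: "keys (single b (1::'k)) \<subseteq> Admv (src (snd b))"
      using Adm_src by (simp_all add: Admv_def)
    show "vcomp h (single b 1) = ?H (single b 1)"
      unfolding vcomp_eq[OF h i k] unfolding h_def using i k
      by (subst ev_diag[OF lin_htpy kH]) (simp_all add: tsh_MT ev_tsh)
  qed
  have "z m = r m + B.dE h m" if m: "m \<in> MT" for m
  proof (rule M_ext)
    have dh: "B.dE h m \<in> MT"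
      unfolding dE_eq[OF h m] by (intro MT_diff MT_scale diff_MT End_MT[OF h] m)
    show "z m \<in> MT" "r m + B.dE h m \<in> MT"
      using End_MT[OF z m] MT_add[OF End_MT[OF r m] dh] .
    fix s assume "s \<in> Sh"
    then show "evp s (z m) = evp s (r m + B.dE h m)"
    proof (cases rule: Sh_cases)
      case (arrow a)
      then show ?thesis
        using zr[OF keys_ev_Adm[OF m, of "arr a"]]
        by (simp add: ev_add ev_End_arr[OF z m] ev_End_arr[OF r m] ev_dE_arr[OF h m])
    next
      case (vertex i)
      have "psi a (evp (arr a) m) = Ract (Ghost a) (vcomp h (evp (arr a) m)) -
          scl (sg (n - 1)) (vcomp h (Ract (Ghost a) (evp (arr a) m)))" if "a \<in> out_arcs G i" for a
      proof -
        have a: "a \<in> arcs G" using that by simp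
        have k: "keys (evp (arr a) m) \<subseteq> Admv (head G a)"
          using keys_ev[OF m, of "arr a"] a by simp
        have kA: "keys (evp (arr a) m) \<subseteq> Adm" using k Admv_Adm by (rule subset_trans)
        have kG: "keys (Ract (Ghost a) (evp (arr a) m)) \<subseteq> Adm"
          using a by (intro keys_Ract kA) simp
        show ?thesis
          unfolding vh[OF kA] vh[OF kG] by (rule H[OF _ _ a k])
      qed
      then have "(\<Sum>a\<in>out_arcs G i. psi a (evp (arr a) m)) = evp (triv i) (B.dE h m)"
        unfolding ev_dE_triv[OF h m vertex(1)] by (rule sum.cong[OF refl])
      then show ?thesis
        using zr[OF keys_ev_Adm[OF m, of "triv i"]] vertex
        by (simp add: ev_add ev_End_triv[OF z m] ev_End_triv[OF r m] psi_def sum_subtractf algebra_simps)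
    qed
  qed
  then have "z = (\<lambda>m\<in>MT. rmult (K f) m + B.dE h m)"
    using End_ext[OF z] unfolding r_def by (intro extensionalityI[of _ MT]) auto
  then show ?thesis using f h by blast
qed

lemma LA_diff_zero: "diff (op_algebra LA) x = \<zero>\<^bsub>op_algebra LA :: ('k::field, _) dg_space\<^esub>"
  by (simp add: op_algebra_simps)

lemma
  shows rmult_coboundary: "x \<in> hcomp LA n \<Longrightarrow> rmult x \<in> coboundaries B.dgE n \<Longrightarrow> x = \<zero>\<^bsub>LA :: ('k::field, _) dg_space\<^esub>"
    and rmult_cocycle: "z \<in> cocycles (B.dgE :: ('k, _) dg_space) n \<Longrightarrow>
      \<exists>x\<in>hcomp LA n. \<exists>h\<in>hcomp B.dgE (n - 1). z = rmult x \<oplus>\<^bsub>B.dgE\<^esub> diff B.dgE h"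
proof -
  show "x = \<zero>\<^bsub>LA :: ('k, _) dg_space\<^esub>" if x: "x \<in> hcomp LA n" "rmult x \<in> coboundaries B.dgE n"
  proof -
    obtain f where f: "f \<in> homog n" "x = K f" using x(1) by auto
    obtain h where h: "h \<in> End_deg AA IM (n - 1)" "rmult x = B.dE h"
      using x(2) by (auto simp: coboundaries_def)
    show ?thesis using rmult_inj[OF f(1) h(1)] h(2) f(2) by simp
  qed
  show "\<exists>x\<in>hcomp LA n. \<exists>h\<in>hcomp B.dgE (n - 1). z = rmult x \<oplus>\<^bsub>B.dgE\<^esub> diff B.dgE h"
    if z: "z \<in> cocycles (B.dgE :: ('k, _) dg_space) n"
  proof -
    have z1: "z \<in> End_deg AA IM n" using z by (simp add: cocycles_def)
    have z2: "B.dE z m = 0" if "m \<in> MT" for m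
      using z that by (simp add: cocycles_def)
    have "\<exists>f\<in>homog n. \<exists>h\<in>End_deg AA IM (n - 1). z = (\<lambda>m\<in>MT. rmult (K f) m + B.dE h m)"
      by (rule rmult_surj[OF z1 z2])
    then obtain f h where "f \<in> homog n" "h \<in> End_deg AA IM (n - 1)"
      "z = (\<lambda>m\<in>MT. rmult (K f) m + B.dE h m)"
      by (elim bexE)
    then show ?thesis
      by (intro bexI[of _ "K f"] bexI[of _ h]) simp_all
  qed
qed

lemma right_quasi_balanced_IM:
  "right_quasi_balanced AA (op_algebra LA) (IM :: ('k::field, _, _, _) dg_bimod)"
  unfolding right_quasi_balanced_def
proof (intro conjI dg_bimodule_IM quasi_isomorphismI[OF B.dg_algebra_hom_rm LA_diff_zero])
  show "x = \<zero>\<^bsub>op_algebra LA :: ('k, _) dg_space\<^esub>"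
    if "x \<in> hcomp (op_algebra LA) n" "rmult x \<in> coboundaries (opp_dg_algebra B.dgE) n" for n x
    using that rmult_coboundary[of x n]
    by (simp add: op_algebra_simps coboundaries_def B.Op.opp_simps)
  show "\<exists>x\<in>hcomp (op_algebra LA) n. \<exists>h\<in>hcomp (opp_dg_algebra B.dgE) (n - 1).
      z = rmult x \<oplus>\<^bsub>opp_dg_algebra B.dgE\<^esub> diff (opp_dg_algebra B.dgE) h"
    if "z \<in> cocycles (opp_dg_algebra (B.dgE :: ('k, _) dg_space)) n" for n z
    using that rmult_cocycle[of z n]
    by (simp add: op_algebra_simps cocycles_def B.Op.opp_simps)
qed

text \<open>The twisted map is a quasi-isomorphism out of the Leavitt path algebra; it serves as the
  middle step of the zigzag, traversed backwards, and both ends of the zigzag are constant.\<close>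

lemma quasi_isomorphic_End_LA: "quasi_isomorphic (dg_End AA (IM :: ('k::field, _, _, _) dg_bimod)) LA"
proof -
  have "qiso_step LA (dg_End AA (IM :: ('k, _, _, _) dg_bimod))"
    by (rule twisted_quasi_isomorphism[OF dg_algebra_LA B.dg_algebra_dgE B.dg_algebra_hom_rm _
          rmult_coboundary rmult_cocycle]) simp_all
  then show ?thesis
    unfolding quasi_isomorphic_def by (meson equivclp_refl)
qed

end

theorem theorem4p2:
  fixes Q :: "('v, 'e) pre_digraph" and sp :: "'v \<Rightarrow> 'e"
  assumes finite_quiver: "fin_digraph Q"
    and no_sinks: "\<And>i. i \<in> verts Q \<Longrightarrow> out_arcs Q i \<noteq> {}"
    and special_arrows: "\<And>i. i \<in> verts Q \<Longrightarrow> sp i \<in> out_arcs Q i"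
  shows "right_quasi_balanced
           (pre_digraph.rad_sq_zero_algebra Q :: ('k::field, (('v, 'e) path \<Rightarrow>\<^sub>0 'k) set) dg_space)
           (op_algebra (pre_digraph.leavitt_path_algebra Q))
           (pre_digraph.injective_leavitt_complex Q sp)
       \<and> quasi_isomorphic
           (dg_End (pre_digraph.rad_sq_zero_algebra Q :: ('k, (('v, 'e) path \<Rightarrow>\<^sub>0 'k) set) dg_space)
              (pre_digraph.injective_leavitt_complex Q sp))
           (pre_digraph.leavitt_path_algebra Q)"
proof -
  interpret special_quiver Q sp
    using finite_quiver special_arrows by (intro special_quiver.intro special_quiver_axioms.intro)
  show ?thesis
    using right_quasi_balanced_IM quasi_isomorphic_End_LA by blast
qed

end
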